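(* Let $\gamma>0$ and $X:=W^{2,s}(\Omega)\cap H^1_0(\Omega)$. Let $(y_\gamma,w_\gamma)\in X\times X$ be a solution to $$\begin{cases}-\nabla\cdot\left(\left(GH_\gamma(-G^*(\nabla y_\gamma\cdot\nabla w_\gamma))\right)\nabla w_\gamma\right)+y_\gamma=z,\\ -\nabla\cdot\left(\left(GH_\gamma(-G^*(\nabla y_\gamma\cdot\nabla w_\gamma))\right)\nabla y_\gamma\right)=f.\end{cases}$$ Assume that $|\partial\omega_\gamma|=0$ (Lebesgue measure), where $$\partial\omega_\gamma=\bigcup_{i=1}^{d-1}\{x\in\Omega:-[G^*(\nabla y_\gamma\cdot\nabla w_\gamma)](x)\in\partial Q_{i,i+1}^\gamma\},$$ and that the system matrix $\mathcal{M}(y_\gamma,w_\gamma)$ is continuously invertible as an operator from $X^2$ to $L^s(\Omega)^2$, where for $(y,w)\in X^2$ $$\mathcal{M}(y,w)=\begin{pmatrix}\mathrm{Id}+A_{y,w}(w,\cdot,w)&-\nabla\cdot(Gu_{y,w}\nabla\,\cdot)+A_{y,w}(y,\cdot,w)\\ -\nabla\cdot(Gu_{y,w}\nabla\,\cdot)+A_{y,w}(w,\cdot,y)&A_{y,w}(y,\cdot,y)\end{pmatrix},$$ $u_{y,w}=H_\gamma(-G^*(\nabla y\cdot\nabla w))$ and $$A_{y,w}(v_1,v_2,v_3)=\nabla\cdot\left(G\left(\tfrac1\gamma\chi(-G^*(\nabla y\cdot\nabla w))\,G^*(\nabla v_1\cdot\nabla v_2)\right)\nabla v_3\right).$$ Then,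 if $(y^0,w^0)\in X^2$ is sufficiently close in $X^2$ to $(y_\gamma,w_\gamma)$, the semismooth Newton iteration $y^{k+1}=y^k+\delta y$, $w^{k+1}=w^k+\delta w$, where $(\delta y,\delta w)\in X^2$ solves $$\mathcal{M}(y^k,w^k)\begin{pmatrix}\delta y\\ \delta w\end{pmatrix}=-\begin{pmatrix}-\nabla\cdot(Gu_{y^k,w^k}\nabla w^k)+y^k-z\\ -\nabla\cdot(Gu_{y^k,w^k}\nabla y^k)-f\end{pmatrix},$$ converges superlinearly to $(y_\gamma,w_\gamma)$ (in $X^2$).
   Context: $\Omega\subset\mathbb{R}^N$, $N\le3$, is a bounded domain and $s\in(N,\infty)$ (with $s\ge2$, so that $L^s(\Omega)\subset L^2(\Omega)$); thus $W^{1,s}(\Omega)$ embeds compactly into $C(\overline\Omega)$ and is a Banach algebra. $f,z\in L^s(\Omega)$ are given. Let $\alpha>0$, $d\ge2$, and $u_1<\dots<u_d$ be given real numbers, and for $M\ge u_1$ put $U_M=\{u\in L^2(\Omega):u_1\le u\le M\text{ a.e.}\}$. $G:L^2(\Omega)\to L^2(\Omega)$ is a local bounded linear smoothing operator (e.g. averaging over a small ball) whose restrictions satisfy $G\in\mathcal{L}(L^s(\Omega),W^{1,s}(\Omega))$ and whose adjoint $G^*$ satisfies $G^*\in\mathcal{L}(W^{1,s}(\Omega),W^{1,s}(\Omega))$, and $G(U_M)\subset U_M$. Standing assumption: $\Omega$ is sufficiently regular (and the $u_i$ are such) that for every $M$ there is $C_M$ such that for any $g\in L^s(\Omega)$ and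 $u\in U_M$ the problem $-\nabla\cdot(Gu\,\nabla y)=g$ in $\Omega$, $y=0$ on $\partial\Omega$ has a unique solution, which satisfies $y\in W^{2,s}(\Omega)\cap H_0^1(\Omega)$ and $\|y\|_{W^{2,s}(\Omega)}\le C_M\|g\|_{L^s(\Omega)}$. For $\gamma>0$ define, for a function $p$ on $\Omega$, pointwise a.e. $$[H_\gamma(p)](x)=\begin{cases}u_i & p(x)\in Q_i^\gamma,\ 1\le i\le d,\\ \tfrac1\gamma\left(p(x)-\tfrac\alpha2(u_i+u_{i+1})\right)& p(x)\in Q_{i,i+1}^\gamma,\ 1\le i<d,\end{cases}$$ where $Q_1^\gamma=\{q\in\mathbb{R}: q<\tfrac\alpha2((1+\tfrac{2\gamma}\alpha)u_1+u_2)\}$, $Q_i^\gamma=\{q: \tfrac\alpha2(u_{i-1}+(1+\tfrac{2\gamma}\alpha)u_i)<q<\tfrac\alpha2((1+\tfrac{2\gamma}\alpha)u_i+u_{i+1})\}$ for $1<i<d$, $Q_d^\gamma=\{q:\tfrac\alpha2(u_{d-1}+(1+\tfrac{2\gamma}\alpha)u_d)<q\}$, $Q_{i,i+1}^\gamma=\{q:\tfrac\alpha2((1+\tfrac{2\gamma}\alpha)u_i+u_{i+1})\le q\le\tfrac\alpha2(u_i+(1+\tfrac{2\gamma}\alpha)u_{i+1})\}$ for $1\le i<d$; $\partial Q_{i,i+1}^\gamma$ is its boundary in $\mathbb{R}$ (the two endpoints). For a function $p$ on $\Omega$, $\chi(p)$ is the characteristic function of $\bigcup_{i=1}^{d-1}\{x\in\Omega:p(x)\in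 Q_{i,i+1}^\gamma\}$. Superlinear convergence in a normed space means that the iterates are well defined, $x^k\to x^*$, and $\|x^{k+1}-x^*\|=o(\|x^k-x^*\|)$ as $k\to\infty$. *)

theory Defs
  imports "HOL-Analysis.Analysis" "HOL-Library.Landau_Symbols"
begin

text \<open>
  Elements of function spaces over a domain \<open>\<Omega>\<close> are represented by functions on the whole type;
  only their values on \<open>\<Omega>\<close> up to Lebesgue null sets matter, and equality in a function space is
  \<open>ae_eq\<close>. All operators below are only meaningful up to \<open>ae_eq\<close>.
\<close>

definition ae_eq :: "'a::euclidean_space set \<Rightarrow> ('a \<Rightarrow> real) \<Rightarrow> ('a \<Rightarrow> real) \<Rightarrow> bool" where
  "ae_eq \<Omega> v w \<longleftrightarrow> (AE x in lebesgue_on \<Omega>. v x = w x)"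

definition ae_eq2 ::
  "'a::euclidean_space set \<Rightarrow> ('a \<Rightarrow> real) \<times> ('a \<Rightarrow> real) \<Rightarrow> ('a \<Rightarrow> real) \<times> ('a \<Rightarrow> real) \<Rightarrow> bool" where
  "ae_eq2 \<Omega> v w \<longleftrightarrow> ae_eq \<Omega> (fst v) (fst w) \<and> ae_eq \<Omega> (snd v) (snd w)"


subsection \<open>Lebesgue and Sobolev spaces\<close>

definition Lp :: "'a::euclidean_space set \<Rightarrow> real \<Rightarrow> ('a \<Rightarrow> real) set" where
  "Lp \<Omega> p = {v. v \<in> borel_measurable (lebesgue_on \<Omega>) \<and>
                 integrable (lebesgue_on \<Omega>) (\<lambda>x. \<bar>v x\<bar> powr p)}"

definition Lp_norm :: "'a::euclidean_space set \<Rightarrow> real \<Rightarrow> ('a \<Rightarrow> real) \<Rightarrow> real" where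
  "Lp_norm \<Omega> p v = (LINT x|lebesgue_on \<Omega>. \<bar>v x\<bar> powr p) powr (1 / p)"

primrec C_k :: "nat \<Rightarrow> ('a::euclidean_space \<Rightarrow> real) \<Rightarrow> bool" where
  "C_k 0 \<phi> \<longleftrightarrow> continuous_on UNIV \<phi>"
| "C_k (Suc k) \<phi> \<longleftrightarrow> (\<forall>x. \<phi> differentiable (at x)) \<and>
     (\<forall>b\<in>Basis. C_k k (\<lambda>x. frechet_derivative \<phi> (at x) b))"

definition test_fun :: "'a::euclidean_space set \<Rightarrow> ('a \<Rightarrow> real) \<Rightarrow> bool" where
  "test_fun \<Omega> \<phi> \<longleftrightarrow> (\<forall>k. C_k k \<phi>) \<and> compact (closure {x. \<phi> x \<noteq> 0}) \<and> closure {x. \<phi> x \<noteq> 0} \<subseteq> \<Omega>"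

definition grad :: "('a::euclidean_space \<Rightarrow> real) \<Rightarrow> 'a \<Rightarrow> 'a" where
  "grad \<phi> x = (\<Sum>b\<in>Basis. frechet_derivative \<phi> (at x) b *\<^sub>R b)"

definition loc_integrable ::
  "'a::euclidean_space set \<Rightarrow> ('a \<Rightarrow> 'b::{banach, second_countable_topology}) \<Rightarrow> bool" where
  "loc_integrable \<Omega> v \<longleftrightarrow> (\<forall>K. compact K \<and> K \<subseteq> \<Omega> \<longrightarrow> set_integrable lebesgue K v)"

definition weak_grad :: "'a::euclidean_space set \<Rightarrow> ('a \<Rightarrow> real) \<Rightarrow> ('a \<Rightarrow> 'a) \<Rightarrow> bool" where
  "weak_grad \<Omega> v g \<longleftrightarrow> loc_integrable \<Omega> v \<and> loc_integrable \<Omega> g \<and>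
     (\<forall>\<phi>. test_fun \<Omega> \<phi> \<longrightarrow> (\<forall>b\<in>Basis.
        (LINT x|lebesgue_on \<Omega>. v x * (grad \<phi> x \<bullet> b)) = - (LINT x|lebesgue_on \<Omega>. (g x \<bullet> b) * \<phi> x)))"

definition weak_div :: "'a::euclidean_space set \<Rightarrow> ('a \<Rightarrow> 'a) \<Rightarrow> ('a \<Rightarrow> real) \<Rightarrow> bool" where
  "weak_div \<Omega> F h \<longleftrightarrow> loc_integrable \<Omega> F \<and> loc_integrable \<Omega> h \<and>
     (\<forall>\<phi>. test_fun \<Omega> \<phi> \<longrightarrow>
        (LINT x|lebesgue_on \<Omega>. F x \<bullet> grad \<phi> x) = - (LINT x|lebesgue_on \<Omega>. h x * \<phi> x))"

text \<open>
  The distributional gradient and divergence, as functions; where they exist as locally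
  integrable functions they are unique up to null sets.
\<close>

definition wgrad :: "'a::euclidean_space set \<Rightarrow> ('a \<Rightarrow> real) \<Rightarrow> 'a \<Rightarrow> 'a" where
  "wgrad \<Omega> v = (SOME g. weak_grad \<Omega> v g)"

definition wdiv :: "'a::euclidean_space set \<Rightarrow> ('a \<Rightarrow> 'a) \<Rightarrow> 'a \<Rightarrow> real" where
  "wdiv \<Omega> F = (SOME h. weak_div \<Omega> F h)"

primrec W :: "nat \<Rightarrow> 'a::euclidean_space set \<Rightarrow> real \<Rightarrow> ('a \<Rightarrow> real) set" where
  "W 0 \<Omega> p = Lp \<Omega> p"
| "W (Suc k) \<Omega> p =
     {v \<in> Lp \<Omega> p. \<exists>g. weak_grad \<Omega> v g \<and> (\<forall>b\<in>Basis. (\<lambda>x. g x \<bullet> b) \<in> W k \<Omega> p)}"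

text \<open>
  The sum of the \<open>L\<^sup>p\<close> norms of all partial derivatives up to order \<open>k\<close> (mixed ones counted with
  multiplicity); this is one of the usual equivalent norms of \<open>W\<^sup>k\<^sup>,\<^sup>p\<close>.
\<close>

primrec W_norm :: "nat \<Rightarrow> 'a::euclidean_space set \<Rightarrow> real \<Rightarrow> ('a \<Rightarrow> real) \<Rightarrow> real" where
  "W_norm 0 \<Omega> p v = Lp_norm \<Omega> p v"
| "W_norm (Suc k) \<Omega> p v = Lp_norm \<Omega> p v + (\<Sum>b\<in>Basis. W_norm k \<Omega> p (\<lambda>x. wgrad \<Omega> v x \<bullet> b))"

definition H10 :: "'a::euclidean_space set \<Rightarrow> ('a \<Rightarrow> real) set" where
  "H10 \<Omega> = {v \<in> W 1 \<Omega> 2. \<exists>\<phi>. (\<forall>n. test_fun \<Omega> (\<phi> n)) \<and>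
              (\<lambda>n. W_norm 1 \<Omega> 2 (\<lambda>x. v x - \<phi> n x)) \<longlonglongrightarrow> 0}"

definition X_space :: "'a::euclidean_space set \<Rightarrow> real \<Rightarrow> ('a \<Rightarrow> real) set" where
  "X_space \<Omega> s = W 2 \<Omega> s \<inter> H10 \<Omega>"

definition X2_norm :: "'a::euclidean_space set \<Rightarrow> real \<Rightarrow> ('a \<Rightarrow> real) \<times> ('a \<Rightarrow> real) \<Rightarrow> real" where
  "X2_norm \<Omega> s v = W_norm 2 \<Omega> s (fst v) + W_norm 2 \<Omega> s (snd v)"

definition Ls2_norm :: "'a::euclidean_space set \<Rightarrow> real \<Rightarrow> ('a \<Rightarrow> real) \<times> ('a \<Rightarrow> real) \<Rightarrow> real" where
  "Ls2_norm \<Omega> s g = Lp_norm \<Omega> s (fst g) + Lp_norm \<Omega> s (snd g)"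

definition compactly_embeds_C :: "'a::euclidean_space set \<Rightarrow> real \<Rightarrow> bool" where
  "compactly_embeds_C \<Omega> s \<longleftrightarrow>
     (\<exists>C. \<forall>v\<in>W 1 \<Omega> s. \<exists>c. continuous_on (closure \<Omega>) c \<and> ae_eq \<Omega> v c \<and>
        (\<forall>x\<in>closure \<Omega>. \<bar>c x\<bar> \<le> C * W_norm 1 \<Omega> s v)) \<and>
     (\<forall>v B. (\<forall>n. v n \<in> W 1 \<Omega> s \<and> W_norm 1 \<Omega> s (v n) \<le> B) \<longrightarrow>
        (\<exists>c l r. (\<forall>n. continuous_on (closure \<Omega>) (c n) \<and> ae_eq \<Omega> (v n) (c n)) \<and>
           strict_mono (r :: nat \<Rightarrow> nat) \<and>
           uniform_limit (closure \<Omega>) (\<lambda>n. c (r n)) l sequentially))"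


subsection \<open>Operators between function spaces\<close>

definition bounded_linear_op ::
  "'a::euclidean_space set \<Rightarrow> ('a \<Rightarrow> real) set \<Rightarrow> (('a \<Rightarrow> real) \<Rightarrow> real) \<Rightarrow>
   ('a \<Rightarrow> real) set \<Rightarrow> (('a \<Rightarrow> real) \<Rightarrow> real) \<Rightarrow> (('a \<Rightarrow> real) \<Rightarrow> ('a \<Rightarrow> real)) \<Rightarrow> bool" where
  "bounded_linear_op \<Omega> V norm_V Z norm_Z T \<longleftrightarrow>
     (\<forall>v\<in>V. T v \<in> Z) \<and>
     (\<forall>v\<in>V. \<forall>w\<in>V. \<forall>a b :: real.
        ae_eq \<Omega> (T (\<lambda>x. a * v x + b * w x)) (\<lambda>x. a * T v x + b * T w x)) \<and>
     (\<exists>C. \<forall>v\<in>V. norm_Z (T v) \<le> C * norm_V v)"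

definition L2_adjoint ::
  "'a::euclidean_space set \<Rightarrow> (('a \<Rightarrow> real) \<Rightarrow> ('a \<Rightarrow> real)) \<Rightarrow> (('a \<Rightarrow> real) \<Rightarrow> ('a \<Rightarrow> real)) \<Rightarrow> bool" where
  "L2_adjoint \<Omega> T Ts \<longleftrightarrow> (\<forall>v\<in>Lp \<Omega> 2. Ts v \<in> Lp \<Omega> 2 \<and>
     (\<forall>u\<in>Lp \<Omega> 2. (LINT x|lebesgue_on \<Omega>. T u x * v x) = (LINT x|lebesgue_on \<Omega>. u x * Ts v x)))"

definition cont_invertible ::
  "'a::euclidean_space set \<Rightarrow> real \<Rightarrow>
   (('a \<Rightarrow> real) \<times> ('a \<Rightarrow> real) \<Rightarrow> ('a \<Rightarrow> real) \<times> ('a \<Rightarrow> real)) \<Rightarrow> bool" where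
  "cont_invertible \<Omega> s T \<longleftrightarrow>
     (\<forall>v \<in> X_space \<Omega> s \<times> X_space \<Omega> s. T v \<in> Lp \<Omega> s \<times> Lp \<Omega> s) \<and>
     (\<exists>C. \<forall>g \<in> Lp \<Omega> s \<times> Lp \<Omega> s. \<exists>v \<in> X_space \<Omega> s \<times> X_space \<Omega> s.
        ae_eq2 \<Omega> (T v) g \<and> X2_norm \<Omega> s v \<le> C * Ls2_norm \<Omega> s g \<and>
        (\<forall>v' \<in> X_space \<Omega> s \<times> X_space \<Omega> s. ae_eq2 \<Omega> (T v') g \<longrightarrow> ae_eq2 \<Omega> v' v))"


subsection \<open>The admissible controls and the elliptic problem\<close>

definition U_set :: "'a::euclidean_space set \<Rightarrow> (nat \<Rightarrow> real) \<Rightarrow> real \<Rightarrow> ('a \<Rightarrow> real) set" where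
  "U_set \<Omega> u M = {v \<in> Lp \<Omega> 2. AE x in lebesgue_on \<Omega>. u 1 \<le> v x \<and> v x \<le> M}"

text \<open>
  Weak solutions in \<open>H\<^sup>1\<^sub>0\<close> of \<open>-div (a grad y) = g\<close> with homogeneous Dirichlet conditions.
\<close>

definition elliptic_sol ::
  "'a::euclidean_space set \<Rightarrow> ('a \<Rightarrow> real) \<Rightarrow> ('a \<Rightarrow> real) \<Rightarrow> ('a \<Rightarrow> real) \<Rightarrow> bool" where
  "elliptic_sol \<Omega> a g y \<longleftrightarrow> y \<in> H10 \<Omega> \<and> weak_div \<Omega> (\<lambda>x. a x *\<^sub>R wgrad \<Omega> y x) (\<lambda>x. - g x)"

definition elliptic_regularity ::
  "'a::euclidean_space set \<Rightarrow> real \<Rightarrow> (('a \<Rightarrow> real) \<Rightarrow> ('a \<Rightarrow> real)) \<Rightarrow> (nat \<Rightarrow> real) \<Rightarrow> bool" where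
  "elliptic_regularity \<Omega> s G u \<longleftrightarrow>
     (\<forall>M \<ge> u 1. \<exists>C. \<forall>g \<in> Lp \<Omega> s. \<forall>v \<in> U_set \<Omega> u M.
        \<exists>y. elliptic_sol \<Omega> (G v) g y \<and> (\<forall>y'. elliptic_sol \<Omega> (G v) g y' \<longrightarrow> ae_eq \<Omega> y' y) \<and>
            y \<in> X_space \<Omega> s \<and> W_norm 2 \<Omega> s y \<le> C * Lp_norm \<Omega> s g)"


subsection \<open>The regularized multi-bang nonlinearity\<close>

definition Q_set :: "real \<Rightarrow> real \<Rightarrow> nat \<Rightarrow> (nat \<Rightarrow> real) \<Rightarrow> nat \<Rightarrow> real set" where
  "Q_set \<alpha> \<gamma> d u i =
     {q. (1 < i \<longrightarrow> \<alpha> / 2 * (u (i - 1) + (1 + 2 * \<gamma> / \<alpha>) * u i) < q) \<and>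
         (i < d \<longrightarrow> q < \<alpha> / 2 * ((1 + 2 * \<gamma> / \<alpha>) * u i + u (i + 1)))}"

definition Q_pair :: "real \<Rightarrow> real \<Rightarrow> (nat \<Rightarrow> real) \<Rightarrow> nat \<Rightarrow> real set" where
  "Q_pair \<alpha> \<gamma> u i =
     {q. \<alpha> / 2 * ((1 + 2 * \<gamma> / \<alpha>) * u i + u (i + 1)) \<le> q \<and>
         q \<le> \<alpha> / 2 * (u i + (1 + 2 * \<gamma> / \<alpha>) * u (i + 1))}"

text \<open>
  The sets \<open>Q_set\<close> and \<open>Q_pair\<close> are pairwise disjoint and cover the line, so that exactly one
  summand is active and this is the usual definition by cases; see the lemmas below.
\<close>

definition H_reg :: "real \<Rightarrow> real \<Rightarrow> nat \<Rightarrow> (nat \<Rightarrow> real) \<Rightarrow> real \<Rightarrow> real" where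
  "H_reg \<alpha> \<gamma> d u q =
     (\<Sum>i\<in>{1..d}. if q \<in> Q_set \<alpha> \<gamma> d u i then u i else 0) +
     (\<Sum>i\<in>{1..<d}. if q \<in> Q_pair \<alpha> \<gamma> u i then 1 / \<gamma> * (q - \<alpha> / 2 * (u i + u (i + 1))) else 0)"

context
  fixes \<alpha> \<gamma> :: real and d :: nat and u :: "nat \<Rightarrow> real"
  assumes \<alpha>: "\<alpha> > 0" and \<gamma>: "\<gamma> > 0" and u: "strict_mono_on {1..d} u"
begin

lemma scale: "\<alpha> / 2 * ((1 + 2 * \<gamma> / \<alpha>) * a + b) = \<alpha> / 2 * (a + b) + \<gamma> * a"
    "\<alpha> / 2 * (a + (1 + 2 * \<gamma> / \<alpha>) * b) = \<alpha> / 2 * (a + b) + \<gamma> * b"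
  using \<alpha> by (simp_all add: field_simps)

lemma Q_set_iff: "q \<in> Q_set \<alpha> \<gamma> d u i \<longleftrightarrow>
    (1 < i \<longrightarrow> \<alpha> / 2 * (u (i - 1) + u i) + \<gamma> * u i < q) \<and>
    (i < d \<longrightarrow> q < \<alpha> / 2 * (u i + u (i + 1)) + \<gamma> * u i)"
  by (simp only: Q_set_def mem_Collect_eq scale)

lemma Q_pair_iff: "q \<in> Q_pair \<alpha> \<gamma> u i \<longleftrightarrow>
    \<alpha> / 2 * (u i + u (i + 1)) + \<gamma> * u i \<le> q \<and> q \<le> \<alpha> / 2 * (u i + u (i + 1)) + \<gamma> * u (i + 1)"
  by (simp only: Q_pair_def mem_Collect_eq scale)

lemma Q_order:
  assumes "1 \<le> i" "i < j" "j \<le> d"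
  shows "\<alpha> / 2 * (u i + u (i + 1)) + \<gamma> * u i < \<alpha> / 2 * (u i + u (i + 1)) + \<gamma> * u (i + 1)"
    and "\<alpha> / 2 * (u i + u (i + 1)) + \<gamma> * u (i + 1) \<le> \<alpha> / 2 * (u (j - 1) + u j) + \<gamma> * u j"
proof -
  have mono: "u a \<le> u b" if "1 \<le> a" "a \<le> b" "b \<le> d" for a b
    using u that by (cases "a = b") (auto simp: strict_mono_on_def intro!: less_imp_le)
  have "u i < u (i + 1)" using u assms by (auto simp: strict_mono_on_def)
  then show "\<alpha> / 2 * (u i + u (i + 1)) + \<gamma> * u i < \<alpha> / 2 * (u i + u (i + 1)) + \<gamma> * u (i + 1)"
    using \<gamma> by simp
  have 1: "u i \<le> u (j - 1)" "u (i + 1) \<le> u j"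
    using assms by (auto intro!: mono)
  show "\<alpha> / 2 * (u i + u (i + 1)) + \<gamma> * u (i + 1) \<le> \<alpha> / 2 * (u (j - 1) + u j) + \<gamma> * u j"
    using 1 \<alpha> \<gamma> by (intro add_mono mult_left_mono) auto
qed

lemma Q_midpoints:
  assumes "1 < j" "j < d"
  shows "\<alpha> / 2 * (u (j - 1) + u j) < \<alpha> / 2 * (u j + u (j + 1))"
proof -
  have "u (j - 1) < u (j + 1)" using assms by (intro strict_mono_onD[OF u]) auto
  then show ?thesis using \<alpha> by simp
qed

lemma Q_set_disjoint:
  assumes "i \<in> {1..d}" "j \<in> {1..d}" "q \<in> Q_set \<alpha> \<gamma> d u i" "q \<in> Q_set \<alpha> \<gamma> d u j"
  shows "i = j"
proof -
  have False if "1 \<le> i" "i < j" "j \<le> d" "q \<in> Q_set \<alpha> \<gamma> d u i" "q \<in> Q_set \<alpha> \<gamma> d u j" for i j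
    using Q_order[of i j] that by (auto simp: Q_set_iff)
  then show ?thesis using assms by (metis atLeastAtMost_iff linorder_neqE_nat)
qed

lemma Q_set_pair_disjoint:
  assumes "i \<in> {1..d}" "j \<in> {1..<d}" "q \<in> Q_set \<alpha> \<gamma> d u i"
  shows "q \<notin> Q_pair \<alpha> \<gamma> u j"
proof
  assume "q \<in> Q_pair \<alpha> \<gamma> u j"
  moreover have "j < i \<or> j = i \<or> i < j" by auto
  ultimately show False
    using assms Q_order[of j i] Q_order[of i j] Q_midpoints[of j]
    by (auto simp: Q_set_iff Q_pair_iff)
qed

lemma Q_pair_disjoint:
  assumes "i \<in> {1..<d}" "j \<in> {1..<d}" "q \<in> Q_pair \<alpha> \<gamma> u i" "q \<in> Q_pair \<alpha> \<gamma> u j"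
  shows "i = j"
proof -
  have False if ij: "1 \<le> i" "i < j" "j < d"
    and q: "q \<in> Q_pair \<alpha> \<gamma> u i" "q \<in> Q_pair \<alpha> \<gamma> u j" for i j
    using Q_midpoints[of j] Q_order(2)[of i j] ij q by (auto simp: Q_pair_iff)
  then show ?thesis using assms by (metis atLeastLessThan_iff linorder_neqE_nat)
qed

lemma Q_cover:
  assumes "d \<ge> 1"
  shows "(\<exists>i\<in>{1..d}. q \<in> Q_set \<alpha> \<gamma> d u i) \<or> (\<exists>i\<in>{1..<d}. q \<in> Q_pair \<alpha> \<gamma> u i)"
proof -
  let ?P = "\<lambda>i. i < d \<longrightarrow> q < \<alpha> / 2 * (u i + u (i + 1)) + \<gamma> * u i"
  define i where "i = (LEAST i. 1 \<le> i \<and> ?P i)"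
  have ex: "1 \<le> d \<and> ?P d" using assms by simp
  have i: "1 \<le> i" "?P i" "i \<le> d"
    using LeastI[of "\<lambda>i. 1 \<le> i \<and> ?P i", OF ex] Least_le[of "\<lambda>i. 1 \<le> i \<and> ?P i", OF ex]
    by (auto simp: i_def)
  show ?thesis
  proof (cases "q \<in> Q_set \<alpha> \<gamma> d u i")
    case True
    then show ?thesis using i by auto
  next
    case False
    then have i1: "1 < i" "q \<le> \<alpha> / 2 * (u (i - 1) + u i) + \<gamma> * u i"
      using i by (auto simp: Q_set_iff)
    have "\<not> (1 \<le> i - 1 \<and> ?P (i - 1))"
      using not_less_Least[of "i - 1" "\<lambda>i. 1 \<le> i \<and> ?P i"] i1 by (auto simp: i_def)
    then have "q \<in> Q_pair \<alpha> \<gamma> u (i - 1)" using i1 by (auto simp: Q_pair_iff)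
    then show ?thesis using i i1 by (intro disjI2 bexI[of _ "i - 1"]) auto
  qed
qed

lemma H_reg_Q_set:
  assumes "i \<in> {1..d}" "q \<in> Q_set \<alpha> \<gamma> d u i"
  shows "H_reg \<alpha> \<gamma> d u q = u i"
proof -
  have "(\<Sum>j\<in>{1..d}. if q \<in> Q_set \<alpha> \<gamma> d u j then u j else 0) = (\<Sum>j\<in>{1..d}. if j = i then u j else 0)"
    using assms Q_set_disjoint by (intro sum.cong) auto
  then show ?thesis
    using assms Q_set_pair_disjoint[OF assms(1) _ assms(2)] by (simp add: H_reg_def)
qed

lemma H_reg_Q_pair:
  assumes "i \<in> {1..<d}" "q \<in> Q_pair \<alpha> \<gamma> u i"
  shows "H_reg \<alpha> \<gamma> d u q = 1 / \<gamma> * (q - \<alpha> / 2 * (u i + u (i + 1)))"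
proof -
  let ?h = "\<lambda>j. 1 / \<gamma> * (q - \<alpha> / 2 * (u j + u (j + 1)))"
  have "(\<Sum>j\<in>{1..<d}. if q \<in> Q_pair \<alpha> \<gamma> u j then ?h j else 0) = (\<Sum>j\<in>{1..<d}. if j = i then ?h j else 0)"
    using assms Q_pair_disjoint by (intro sum.cong) auto
  moreover have "(\<Sum>j\<in>{1..d}. if q \<in> Q_set \<alpha> \<gamma> d u j then u j else 0) = 0"
    using assms Q_set_pair_disjoint by (intro sum.neutral) auto
  ultimately show ?thesis using assms by (simp add: H_reg_def)
qed

end

definition chi_reg ::
  "real \<Rightarrow> real \<Rightarrow> nat \<Rightarrow> (nat \<Rightarrow> real) \<Rightarrow> ('a \<Rightarrow> real) \<Rightarrow> 'a \<Rightarrow> real" where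
  "chi_reg \<alpha> \<gamma> d u p = indicat_real {x. \<exists>i\<in>{1..<d}. p x \<in> Q_pair \<alpha> \<gamma> u i}"


subsection \<open>The regularized optimality system and its Newton iteration\<close>

text \<open>In the following, \<open>G\<close> and \<open>Gs\<close> stand for the smoothing operator and its adjoint.\<close>

definition p_of ::
  "'a::euclidean_space set \<Rightarrow> (('a \<Rightarrow> real) \<Rightarrow> ('a \<Rightarrow> real)) \<Rightarrow>
   ('a \<Rightarrow> real) \<times> ('a \<Rightarrow> real) \<Rightarrow> 'a \<Rightarrow> real" where
  "p_of \<Omega> Gs = (\<lambda>(y, w) x. - Gs (\<lambda>x. wgrad \<Omega> y x \<bullet> wgrad \<Omega> w x) x)"

definition u_of ::
  "'a::euclidean_space set \<Rightarrow> (('a \<Rightarrow> real) \<Rightarrow> ('a \<Rightarrow> real)) \<Rightarrow>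
   real \<Rightarrow> real \<Rightarrow> nat \<Rightarrow> (nat \<Rightarrow> real) \<Rightarrow> ('a \<Rightarrow> real) \<times> ('a \<Rightarrow> real) \<Rightarrow> 'a \<Rightarrow> real" where
  "u_of \<Omega> Gs \<alpha> \<gamma> d u yw = (\<lambda>x. H_reg \<alpha> \<gamma> d u (p_of \<Omega> Gs yw x))"

definition div_coef ::
  "'a::euclidean_space set \<Rightarrow> ('a \<Rightarrow> real) \<Rightarrow> ('a \<Rightarrow> real) \<Rightarrow> 'a \<Rightarrow> real" where
  "div_coef \<Omega> a v = wdiv \<Omega> (\<lambda>x. a x *\<^sub>R wgrad \<Omega> v x)"

definition residual ::
  "'a::euclidean_space set \<Rightarrow> (('a \<Rightarrow> real) \<Rightarrow> ('a \<Rightarrow> real)) \<Rightarrow> (('a \<Rightarrow> real) \<Rightarrow> ('a \<Rightarrow> real)) \<Rightarrow>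
   real \<Rightarrow> real \<Rightarrow> nat \<Rightarrow> (nat \<Rightarrow> real) \<Rightarrow> ('a \<Rightarrow> real) \<Rightarrow> ('a \<Rightarrow> real) \<Rightarrow>
   ('a \<Rightarrow> real) \<times> ('a \<Rightarrow> real) \<Rightarrow> ('a \<Rightarrow> real) \<times> ('a \<Rightarrow> real)" where
  "residual \<Omega> G Gs \<alpha> \<gamma> d u f z = (\<lambda>(y, w).
     let a = G (u_of \<Omega> Gs \<alpha> \<gamma> d u (y, w)) in
     (\<lambda>x. - div_coef \<Omega> a w x + y x - z x,
      \<lambda>x. - div_coef \<Omega> a y x - f x))"

definition A_op ::
  "'a::euclidean_space set \<Rightarrow> (('a \<Rightarrow> real) \<Rightarrow> ('a \<Rightarrow> real)) \<Rightarrow> (('a \<Rightarrow> real) \<Rightarrow> ('a \<Rightarrow> real)) \<Rightarrow>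
   real \<Rightarrow> real \<Rightarrow> nat \<Rightarrow> (nat \<Rightarrow> real) \<Rightarrow> ('a \<Rightarrow> real) \<times> ('a \<Rightarrow> real) \<Rightarrow>
   ('a \<Rightarrow> real) \<Rightarrow> ('a \<Rightarrow> real) \<Rightarrow> ('a \<Rightarrow> real) \<Rightarrow> 'a \<Rightarrow> real" where
  "A_op \<Omega> G Gs \<alpha> \<gamma> d u yw v1 v2 v3 =
     div_coef \<Omega>
       (G (\<lambda>x. 1 / \<gamma> * chi_reg \<alpha> \<gamma> d u (p_of \<Omega> Gs yw) x * Gs (\<lambda>x. wgrad \<Omega> v1 x \<bullet> wgrad \<Omega> v2 x) x))
       v3"

definition M_op ::
  "'a::euclidean_space set \<Rightarrow> (('a \<Rightarrow> real) \<Rightarrow> ('a \<Rightarrow> real)) \<Rightarrow> (('a \<Rightarrow> real) \<Rightarrow> ('a \<Rightarrow> real)) \<Rightarrow>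
   real \<Rightarrow> real \<Rightarrow> nat \<Rightarrow> (nat \<Rightarrow> real) \<Rightarrow> ('a \<Rightarrow> real) \<times> ('a \<Rightarrow> real) \<Rightarrow>
   ('a \<Rightarrow> real) \<times> ('a \<Rightarrow> real) \<Rightarrow> ('a \<Rightarrow> real) \<times> ('a \<Rightarrow> real)" where
  "M_op \<Omega> G Gs \<alpha> \<gamma> d u = (\<lambda>(y, w) (\<delta>y, \<delta>w).
     let a = G (u_of \<Omega> Gs \<alpha> \<gamma> d u (y, w)); A = A_op \<Omega> G Gs \<alpha> \<gamma> d u (y, w) in
     (\<lambda>x. (\<delta>y x + A w \<delta>y w x) + (- div_coef \<Omega> a \<delta>w x + A y \<delta>w w x),
      \<lambda>x. (- div_coef \<Omega> a \<delta>y x + A w \<delta>y y x) + A y \<delta>w y x))"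

definition newton_step ::
  "'a::euclidean_space set \<Rightarrow> real \<Rightarrow> (('a \<Rightarrow> real) \<Rightarrow> ('a \<Rightarrow> real)) \<Rightarrow> (('a \<Rightarrow> real) \<Rightarrow> ('a \<Rightarrow> real)) \<Rightarrow>
   real \<Rightarrow> real \<Rightarrow> nat \<Rightarrow> (nat \<Rightarrow> real) \<Rightarrow> ('a \<Rightarrow> real) \<Rightarrow> ('a \<Rightarrow> real) \<Rightarrow>
   ('a \<Rightarrow> real) \<times> ('a \<Rightarrow> real) \<Rightarrow> ('a \<Rightarrow> real) \<times> ('a \<Rightarrow> real) \<Rightarrow> bool" where
  "newton_step \<Omega> s G Gs \<alpha> \<gamma> d u f z yw \<delta> \<longleftrightarrow>
     \<delta> \<in> X_space \<Omega> s \<times> X_space \<Omega> s \<and>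
     ae_eq2 \<Omega> (M_op \<Omega> G Gs \<alpha> \<gamma> d u yw \<delta>)
       (\<lambda>x. - fst (residual \<Omega> G Gs \<alpha> \<gamma> d u f z yw) x,
        \<lambda>x. - snd (residual \<Omega> G Gs \<alpha> \<gamma> d u f z yw) x)"

definition newton_iteration ::
  "'a::euclidean_space set \<Rightarrow> real \<Rightarrow> (('a \<Rightarrow> real) \<Rightarrow> ('a \<Rightarrow> real)) \<Rightarrow> (('a \<Rightarrow> real) \<Rightarrow> ('a \<Rightarrow> real)) \<Rightarrow>
   real \<Rightarrow> real \<Rightarrow> nat \<Rightarrow> (nat \<Rightarrow> real) \<Rightarrow> ('a \<Rightarrow> real) \<Rightarrow> ('a \<Rightarrow> real) \<Rightarrow>
   ('a \<Rightarrow> real) \<times> ('a \<Rightarrow> real) \<Rightarrow> (nat \<Rightarrow> ('a \<Rightarrow> real) \<times> ('a \<Rightarrow> real)) \<Rightarrow> bool" where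
  "newton_iteration \<Omega> s G Gs \<alpha> \<gamma> d u f z yw0 P \<longleftrightarrow>
     P 0 = yw0 \<and>
     (\<forall>k. \<exists>\<delta>. newton_step \<Omega> s G Gs \<alpha> \<gamma> d u f z (P k) \<delta> \<and>
        P (Suc k) = (\<lambda>x. fst (P k) x + fst \<delta> x, \<lambda>x. snd (P k) x + snd \<delta> x))"

definition X2_dist ::
  "'a::euclidean_space set \<Rightarrow> real \<Rightarrow>
   ('a \<Rightarrow> real) \<times> ('a \<Rightarrow> real) \<Rightarrow> ('a \<Rightarrow> real) \<times> ('a \<Rightarrow> real) \<Rightarrow> real" where
  "X2_dist \<Omega> s v v' = X2_norm \<Omega> s (\<lambda>x. fst v x - fst v' x, \<lambda>x. snd v x - snd v' x)"

definition converges_superlinearly ::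
  "'a::euclidean_space set \<Rightarrow> real \<Rightarrow>
   (nat \<Rightarrow> ('a \<Rightarrow> real) \<times> ('a \<Rightarrow> real)) \<Rightarrow> ('a \<Rightarrow> real) \<times> ('a \<Rightarrow> real) \<Rightarrow> bool" where
  "converges_superlinearly \<Omega> s P v \<longleftrightarrow>
     (\<lambda>k. X2_dist \<Omega> s (P k) v) \<longlonglongrightarrow> 0 \<and>
     (\<lambda>k. X2_dist \<Omega> s (P (Suc k)) v) \<in> o(\<lambda>k. X2_dist \<Omega> s (P k) v)"

end

theory Submission
  imports Defs "HOL-Library.Function_Algebras"
begin

text \<open>
  Put \<open>q v w = G\<^sup>*(\<nabla>v \<bullet> \<nabla>w)\<close> and \<open>T h v = div ((G h) \<nabla>v)\<close>. Both are bilinear and bounded: \<open>q\<close> maps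
  \<open>W\<^sup>2\<^sup>,\<^sup>s \<times> W\<^sup>2\<^sup>,\<^sup>s\<close> to bounded functions and \<open>T\<close> maps \<open>L\<^sup>s \<times> W\<^sup>2\<^sup>,\<^sup>s\<close> to \<open>L\<^sup>s\<close>, because \<open>W\<^sup>1\<^sup>,\<^sup>s\<close> embeds into
  the continuous functions and therefore is an algebra. In these terms the optimality system reads
  \<open>F (y, w) = (- T u w + y - z, - T u y - f) = 0\<close> with \<open>u = H (- q y w)\<close>, and its only nonsmooth
  ingredient is the scalar function \<open>H\<close>, which is piecewise affine with finitely many kinks.

  Let \<open>e = x - x\<^sup>*\<close> be the deviation of \<open>x = (y, w)\<close> from the solution. The argument \<open>- q y w\<close> of \<open>H\<close> differs
  from its value at the solution by at most \<open>P \<parallel>e\<parallel>\<close> almost everywhere. Where the value at the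
  solution keeps a distance larger than \<open>P \<parallel>e\<parallel>\<close> from the kinks, \<open>H\<close> is affine between the two values, so its
  linearization is exact and its slope does not change. The remaining points form a set whose measure
  tends to zero with \<open>\<parallel>e\<parallel>\<close>, since the kinks are attained at the solution on a null set only. As
  \<open>s < \<infinity>\<close>, a function bounded by \<open>C \<parallel>e\<parallel>\<close> that lives on this set is \<open>o(\<parallel>e\<parallel>)\<close> in \<open>L\<^sup>s\<close>. This gap between
  \<open>L\<^sup>\<infinity>\<close> and \<open>L\<^sup>s\<close> yields \<open>F x - M x e = o(\<parallel>e\<parallel>)\<close> (\<open>F_remainder\<close>) and the convergence of the system
  matrix \<open>M x\<close> to \<open>M x\<^sup>*\<close> in the operator norm (\<open>M_increment\<close>).

  A Neumann series then shows that \<open>M x\<close> is invertible, with uniformly bounded inverse, for all \<open>x\<close>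
  close to \<open>x\<^sup>*\<close> (\<open>close_op_bound\<close>, \<open>close_op_surj\<close>), and the Newton step satisfies
  \<open>M x (e + \<delta>) = M x e - F x = o(\<parallel>e\<parallel>)\<close>; this is superlinear convergence (\<open>superlinear_convergence\<close>).
  Since functions are identified up to null sets, the spaces carry seminorms and the operators are
  linear up to null sets only, and the Newton argument is carried out at that level of generality.

  The analysis of weak derivatives underneath rests on two facts: they are unique
  (\<open>fundamental_lemma\<close>), and the product rule holds for continuous functions
  (\<open>weak_deriv_mult\<close>). The latter is derived from translations and difference quotients, with
  polynomials times a test function in the place of mollifiers.
\<close>

section \<open>Smooth functions\<close>

definition smooth :: "('a::euclidean_space \<Rightarrow> real) \<Rightarrow> bool" where
  "smooth \<phi> \<longleftrightarrow> (\<forall>k. C_k k \<phi>)"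

text \<open>
  Higher derivatives are computed with explicit derivatives; this rule hides the choice of the Frechet
  derivative in the recursive definition of \<open>C_k\<close>.
\<close>

lemma C_k_SucI:
  assumes "\<And>x. (\<phi> has_derivative \<phi>' x) (at x)"
    and "\<And>b. b \<in> Basis \<Longrightarrow> C_k k (\<lambda>x. \<phi>' x b)"
  shows "C_k (Suc k) \<phi>"
proof -
  have "\<phi>' x = frechet_derivative \<phi> (at x)" for x
    using frechet_derivative_at[OF assms(1)] .
  then show ?thesis
    using assms by (auto simp: differentiable_def)
qed

lemma C_k_Suc_D: "C_k (Suc k) \<phi> \<Longrightarrow> C_k k \<phi>"
proof (induction k arbitrary: \<phi>)
  case 0
  then show ?case
    by (auto intro!: differentiable_imp_continuous_on simp: differentiable_on_def)
next
  case (Suc k)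
  then show ?case by (metis C_k.simps(2))
qed

lemma C_k_has_derivative:
  assumes "C_k (Suc k) \<phi>"
  shows "(\<phi> has_derivative frechet_derivative \<phi> (at x)) (at x)"
  using assms by (simp add: frechet_derivative_works)

lemma C_k_const: "C_k k (\<lambda>x. c)"
proof (induction k arbitrary: c)
  case (Suc k)
  show ?case by (rule C_k_SucI[where \<phi>' = "\<lambda>x h. 0"]) (auto simp: Suc)
qed simp

lemma C_k_add: "C_k k \<phi> \<Longrightarrow> C_k k \<psi> \<Longrightarrow> C_k k (\<lambda>x. \<phi> x + \<psi> x)"
proof (induction k arbitrary: \<phi> \<psi>)
  case 0
  then show ?case by (auto intro: continuous_on_add)
next
  case (Suc k)
  show ?case
  proof (rule C_k_SucI)
    show "((\<lambda>x. \<phi> x + \<psi> x) has_derivative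
        (\<lambda>h. frechet_derivative \<phi> (at x) h + frechet_derivative \<psi> (at x) h)) (at x)" for x
      using Suc.prems by (intro has_derivative_add C_k_has_derivative)
    show "C_k k (\<lambda>x. frechet_derivative \<phi> (at x) b + frechet_derivative \<psi> (at x) b)"
      if "b \<in> Basis" for b
      using Suc.prems that by (intro Suc.IH) simp_all
  qed
qed

lemma C_k_mult: "C_k k \<phi> \<Longrightarrow> C_k k \<psi> \<Longrightarrow> C_k k (\<lambda>x. \<phi> x * \<psi> x)"
proof (induction k arbitrary: \<phi> \<psi>)
  case 0
  then show ?case by (auto intro: continuous_on_mult)
next
  case (Suc k)
  show ?case
  proof (rule C_k_SucI)
    show "((\<lambda>x. \<phi> x * \<psi> x) has_derivative
        (\<lambda>h. \<phi> x * frechet_derivative \<psi> (at x) h + frechet_derivative \<phi> (at x) h * \<psi> x)) (at x)" for x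
      using Suc.prems by (intro has_derivative_mult C_k_has_derivative)
    show "C_k k (\<lambda>x. \<phi> x * frechet_derivative \<psi> (at x) b + frechet_derivative \<phi> (at x) b * \<psi> x)"
      if "b \<in> Basis" for b
      using Suc.prems[THEN C_k_Suc_D] Suc.prems that by (intro C_k_add Suc.IH) simp_all
  qed
qed

lemma C_k_bounded_linear:
  assumes "bounded_linear l"
  shows "C_k k l"
proof (cases k)
  case 0
  then show ?thesis using assms by (simp add: linear_continuous_on)
next
  case (Suc m)
  show ?thesis unfolding Suc
    by (rule C_k_SucI[where \<phi>' = "\<lambda>x. l"]) (auto simp: assms bounded_linear_imp_has_derivative C_k_const)
qed

lemma C_k_translate: "C_k k \<phi> \<Longrightarrow> C_k k (\<lambda>x. \<phi> (x + a))"
proof (induction k arbitrary: \<phi>)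
  case 0
  then show ?case
    by (auto intro!: continuous_on_compose2[of UNIV \<phi>] continuous_intros)
next
  case (Suc k)
  show ?case
  proof (rule C_k_SucI)
    have "((\<lambda>x. x + a) has_derivative (\<lambda>h. h)) (at x)" for x :: 'a
      by (auto intro!: derivative_eq_intros)
    from has_derivative_compose[OF this C_k_has_derivative[OF Suc.prems]]
    show "((\<lambda>x. \<phi> (x + a)) has_derivative frechet_derivative \<phi> (at (x + a))) (at x)" for x .
    show "C_k k (\<lambda>x. frechet_derivative \<phi> (at (x + a)) b)" if "b \<in> Basis" for b
      using Suc.IH[of "\<lambda>x. frechet_derivative \<phi> (at x) b"] Suc.prems that by simp
  qed
qed

lemma smooth_const: "smooth (\<lambda>x. c)"
  by (simp add: smooth_def C_k_const)

lemma smooth_add: "smooth \<phi> \<Longrightarrow> smooth \<psi> \<Longrightarrow> smooth (\<lambda>x. \<phi> x + \<psi> x)"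
  by (simp add: smooth_def C_k_add)

lemma smooth_mult: "smooth \<phi> \<Longrightarrow> smooth \<psi> \<Longrightarrow> smooth (\<lambda>x. \<phi> x * \<psi> x)"
  by (simp add: smooth_def C_k_mult)

lemma smooth_prod: "finite I \<Longrightarrow> (\<And>i. i \<in> I \<Longrightarrow> smooth (\<phi> i)) \<Longrightarrow> smooth (\<lambda>x. \<Prod>i\<in>I. \<phi> i x)"
  by (induction I rule: finite_induct) (auto intro: smooth_const smooth_mult)

lemma smooth_translate: "smooth \<phi> \<Longrightarrow> smooth (\<lambda>x. \<phi> (x + a))"
  by (simp add: smooth_def C_k_translate)

lemma smooth_real_polynomial_function: "real_polynomial_function \<phi> \<Longrightarrow> smooth \<phi>"
  by (induction rule: real_polynomial_function.induct)
    (simp_all add: smooth_def C_k_bounded_linear C_k_const C_k_add C_k_mult)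

lemma smooth_frechet_derivative:
  assumes "smooth \<phi>"
  shows "(\<phi> has_derivative frechet_derivative \<phi> (at x)) (at x)"
    and "b \<in> Basis \<Longrightarrow> smooth (\<lambda>x. frechet_derivative \<phi> (at x) b)"
proof -
  show "(\<phi> has_derivative frechet_derivative \<phi> (at x)) (at x)"
    using assms C_k_has_derivative[of 0] unfolding smooth_def by blast
  have "C_k (Suc k) \<phi>" for k
    using assms by (simp add: smooth_def del: C_k.simps)
  then show "smooth (\<lambda>x. frechet_derivative \<phi> (at x) b)" if "b \<in> Basis"
    using that by (auto simp: smooth_def)
qed

lemma grad_inner_Basis: "b \<in> Basis \<Longrightarrow> grad \<phi> x \<bullet> b = frechet_derivative \<phi> (at x) b"
  by (simp add: grad_def inner_sum_left_Basis)

lemma smooth_has_derivative_grad: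
  assumes "smooth \<phi>"
  shows "(\<phi> has_derivative (\<lambda>h. grad \<phi> x \<bullet> h)) (at x)"
proof -
  note * = smooth_frechet_derivative(1)[OF assms, of x]
  interpret l: bounded_linear "frechet_derivative \<phi> (at x)"
    using * by (rule has_derivative_bounded_linear)
  have "frechet_derivative \<phi> (at x) h = grad \<phi> x \<bullet> h" for h
  proof -
    have "frechet_derivative \<phi> (at x) h = frechet_derivative \<phi> (at x) (\<Sum>b\<in>Basis. (h \<bullet> b) *\<^sub>R b)"
      by (simp add: euclidean_representation)
    also have "\<dots> = grad \<phi> x \<bullet> h"
      by (simp add: l.sum l.scaleR grad_def inner_sum_left inner_commute[of h] mult.commute)
    finally show ?thesis .
  qed
  then show ?thesis using * by presburger
qed

lemma grad_unique:
  assumes "(\<phi> has_derivative (\<lambda>h. g \<bullet> h)) (at x)" "smooth \<phi>"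
  shows "grad \<phi> x = g"
proof -
  have "(\<lambda>h. g \<bullet> h) = (\<lambda>h. grad \<phi> x \<bullet> h)"
    using has_derivative_unique[OF assms(1) smooth_has_derivative_grad[OF assms(2)]] .
  then show ?thesis by (metis inner_commute vector_eq_rdot)
qed

lemma smooth_grad: "smooth \<phi> \<Longrightarrow> b \<in> Basis \<Longrightarrow> smooth (\<lambda>x. grad \<phi> x \<bullet> b)"
  using smooth_frechet_derivative(2)[of \<phi> b] by (simp add: grad_inner_Basis)

lemma smooth_imp_continuous: "smooth \<phi> \<Longrightarrow> continuous_on S \<phi>"
  unfolding smooth_def by (metis C_k.simps(1) continuous_on_subset subset_UNIV)

lemma grad_mult: "smooth \<phi> \<Longrightarrow> smooth \<psi> \<Longrightarrow>
    grad (\<lambda>x. \<phi> x * \<psi> x) x = \<phi> x *\<^sub>R grad \<psi> x + \<psi> x *\<^sub>R grad \<phi> x"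
  by (rule grad_unique)
    (auto intro!: derivative_eq_intros smooth_has_derivative_grad smooth_mult simp: inner_add_left)

section \<open>Test functions\<close>

text \<open>
  A compact set outside which the function vanishes is easier to provide, and by the next lemma
  easier to use, than the closure of its support.
\<close>

lemma test_funI:
  assumes "smooth \<phi>" "compact K" "K \<subseteq> \<Omega>" "\<And>x. x \<notin> K \<Longrightarrow> \<phi> x = 0"
  shows "test_fun \<Omega> \<phi>"
proof -
  have "closure {x. \<phi> x \<noteq> 0} \<subseteq> K"
    using assms by (intro closure_minimal) (auto intro: compact_imp_closed)
  moreover have "closure {x. \<phi> x \<noteq> 0} = K \<inter> closure {x. \<phi> x \<noteq> 0}"
    using calculation by auto
  ultimately show ?thesis
    using assms compact_Int_closed[of K "closure {x. \<phi> x \<noteq> 0}"]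
    by (auto simp: test_fun_def smooth_def)
qed

lemma test_funE:
  assumes "test_fun \<Omega> \<phi>"
  obtains K where "smooth \<phi>" "compact K" "K \<subseteq> \<Omega>" "\<And>x. x \<notin> K \<Longrightarrow> \<phi> x = 0"
    "\<And>x. x \<notin> K \<Longrightarrow> grad \<phi> x = 0"
proof -
  let ?K = "closure {x. \<phi> x \<noteq> 0}"
  have sm: "smooth \<phi>" using assms by (auto simp: test_fun_def smooth_def)
  have z: "\<phi> x = 0" if "x \<notin> ?K" for x
    using subsetD[OF closure_subset, of x "{x. \<phi> x \<noteq> 0}"] that by auto
  have g: "grad \<phi> x = 0" if "x \<notin> ?K" for x
  proof (rule grad_unique[OF _ sm])
    have "((\<lambda>x. 0::real) has_derivative (\<lambda>h. 0 \<bullet> h)) (at x)" by (simp only: inner_zero_left has_derivative_const)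
    then show "(\<phi> has_derivative (\<lambda>h. 0 \<bullet> h)) (at x)"
    proof (rule has_derivative_transform_within_open)
      show "open (- ?K)" by auto
      show "x \<in> - ?K" using that by simp
      show "0 = \<phi> y" if "y \<in> - ?K" for y using z[of y] that by simp
    qed
  qed
  show thesis
  proof (rule that[of ?K])
    show "compact ?K" "?K \<subseteq> \<Omega>" using assms by (simp_all add: test_fun_def)
  qed (fact sm z g)+
qed

lemma test_fun_smooth: "test_fun \<Omega> \<phi> \<Longrightarrow> smooth \<phi>"
  by (auto simp: test_fun_def smooth_def)

lemma test_fun_mult: 
  assumes "smooth \<psi>" "test_fun \<Omega> \<phi>"
  shows "test_fun \<Omega> (\<lambda>x. \<psi> x * \<phi> x)"
proof -
  obtain K where "smooth \<phi>" "compact K" "K \<subseteq> \<Omega>" "\<And>x. x \<notin> K \<Longrightarrow> \<phi> x = 0"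
    using test_funE[OF assms(2)] by metis
  then show ?thesis by (intro test_funI[of _ K] smooth_mult assms) auto
qed

lemma test_fun_cmult: "test_fun \<Omega> \<phi> \<Longrightarrow> test_fun \<Omega> (\<lambda>x. c * \<phi> x)"
  by (rule test_fun_mult[OF smooth_const])

lemma test_fun_add:
  assumes "test_fun \<Omega> \<phi>" "test_fun \<Omega> \<psi>"
  shows "test_fun \<Omega> (\<lambda>x. \<phi> x + \<psi> x)"
proof -
  obtain K where "smooth \<phi>" "compact K" "K \<subseteq> \<Omega>" "\<And>x. x \<notin> K \<Longrightarrow> \<phi> x = 0"
    using test_funE[OF assms(1)] by metis
  moreover obtain L where "smooth \<psi>" "compact L" "L \<subseteq> \<Omega>" "\<And>x. x \<notin> L \<Longrightarrow> \<psi> x = 0"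
    using test_funE[OF assms(2)] by metis
  ultimately show ?thesis by (intro test_funI[of _ "K \<union> L"] smooth_add) auto
qed

lemma test_fun_grad:
  assumes "test_fun \<Omega> \<phi>" "b \<in> Basis"
  shows "test_fun \<Omega> (\<lambda>x. grad \<phi> x \<bullet> b)"
proof -
  obtain K where "smooth \<phi>" "compact K" "K \<subseteq> \<Omega>" "\<And>x. x \<notin> K \<Longrightarrow> grad \<phi> x = 0"
    using test_funE[OF assms(1)] by metis
  then show ?thesis by (intro test_funI[of _ K] smooth_grad assms) auto
qed

lemma test_fun_bounded:
  assumes "test_fun \<Omega> \<phi>"
  obtains B where "B \<ge> 0" "\<And>x. \<bar>\<phi> x\<bar> \<le> B"
proof -
  obtain K where K: "smooth \<phi>" "compact K" "K \<subseteq> \<Omega>" "\<And>x. x \<notin> K \<Longrightarrow> \<phi> x = 0"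
    using test_funE[OF assms(1)] by metis
  have "bounded (\<phi> ` K)"
    using K by (intro compact_imp_bounded compact_continuous_image smooth_imp_continuous)
  then obtain B where B: "B > 0" "\<forall>x\<in>K. \<bar>\<phi> x\<bar> \<le> B"
    unfolding bounded_pos by auto
  have "\<bar>\<phi> x\<bar> \<le> B" for x using B K(4)[of x] by (cases "x \<in> K") auto
  then show thesis using that[of B] B by auto
qed

section \<open>Bump functions\<close>

text \<open>
  The functions \<open>exp (- 1 / t) / t ^ m\<close>, extended by zero. The derivative of each is a combination of two
  others, so that smoothness follows by an induction in which \<open>m\<close> is arbitrary.
\<close>

definition eta :: "nat \<Rightarrow> real \<Rightarrow> real" where
  "eta m t = (if t > 0 then exp (- (1 / t)) * (1 / t) ^ m else 0)"

lemma eta_tendsto_0: "(eta m \<longlongrightarrow> 0) (at_right 0)"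
proof -
  have "((\<lambda>x::real. x ^ m / exp x) \<longlongrightarrow> 0) at_top" by (rule tendsto_power_div_exp_0)
  from filterlim_compose[OF this filterlim_inverse_at_top_right]
  have "((\<lambda>t::real. inverse t ^ m / exp (inverse t)) \<longlongrightarrow> 0) (at_right 0)" .
  then show ?thesis
    by (rule Lim_transform_eventually)
      (auto simp: eventually_at_right_less eta_def exp_minus field_simps intro!: eventually_mono[OF eventually_at_right_less[of 0]])
qed

lemma eta_has_derivative: "(eta m has_real_derivative eta (m + 2) t - m * eta (m + 1) t) (at t)"
proof -
  consider "t > 0" | "t < 0" | "t = 0" by linarith
  then show ?thesis
  proof cases
    case 1
    have inv: "((\<lambda>t. 1 / t) has_real_derivative - ((1 / t)\<^sup>2)) (at t)"
      using 1 by (auto intro!: derivative_eq_intros simp: power2_eq_square)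
    have "((\<lambda>t. exp (- (1 / t)) * (1 / t) ^ m) has_real_derivative
        exp (- (1 / t)) * (- (- ((1 / t)\<^sup>2))) * (1 / t) ^ m +
        m * (- ((1 / t)\<^sup>2) * (1 / t) ^ (m - 1)) * exp (- (1 / t))) (at t)"
      by (rule derivative_eq_intros inv refl)+ (simp add: algebra_simps)
    also have "exp (- (1 / t)) * (- (- ((1 / t)\<^sup>2))) * (1 / t) ^ m +
        m * (- ((1 / t)\<^sup>2) * (1 / t) ^ (m - 1)) * exp (- (1 / t)) = eta (m + 2) t - m * eta (m + 1) t"
      using 1 by (cases m) (simp_all add: eta_def power2_eq_square mult_ac)
    finally have "((\<lambda>t. exp (- (1 / t)) * (1 / t) ^ m) has_real_derivative eta (m + 2) t - m * eta (m + 1) t) (at t)" .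
    then show ?thesis
      by (rule has_field_derivative_transform_within_open[where S = "{0<..}"]) (use 1 in \<open>auto simp: eta_def\<close>)
  next
    case 2
    have "((\<lambda>t. 0) has_real_derivative eta (m + 2) t - m * eta (m + 1) t) (at t)"
      using 2 by (auto simp: eta_def)
    then show ?thesis
      by (rule has_field_derivative_transform_within_open[where S = "{..<0}"]) (use 2 in \<open>auto simp: eta_def\<close>)
  next
    case 3
    have "((\<lambda>h. (eta m h - eta m 0) / h) \<longlongrightarrow> 0) (at_right 0)"
      by (rule Lim_transform_eventually[OF eta_tendsto_0[of "Suc m"]])
        (auto simp: eta_def intro!: eventually_mono[OF eventually_at_right_less[of 0]])
    moreover have "((\<lambda>h. (eta m h - eta m 0) / h) \<longlongrightarrow> 0) (at_left 0)"
      by (rule Lim_transform_eventually[OF tendsto_const])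
        (auto simp: eta_def eventually_at_filter)
    ultimately have "((\<lambda>h. (eta m h - eta m 0) / h) \<longlongrightarrow> 0) (at 0)"
      by (simp add: filterlim_at_split)
    then show ?thesis using 3 by (simp add: has_field_derivative_iff eta_def)
  qed
qed

lemma smooth_eta_affine: "smooth (\<lambda>x::'a::euclidean_space. eta m (v \<bullet> x + a))"
proof -
  have "C_k k (\<lambda>x. eta m (v \<bullet> x + a))" for k m
  proof (induction k arbitrary: m)
    case 0
    have "continuous_on UNIV (eta m)"
      using eta_has_derivative by (intro continuous_at_imp_continuous_on ballI) (rule DERIV_isCont)
    then show ?case by (auto intro!: continuous_on_compose2[of UNIV "eta m"] continuous_intros)
  next
    case (Suc k)
    let ?d = "\<lambda>x. eta (m + 2) (v \<bullet> x + a) - m * eta (m + 1) (v \<bullet> x + a)"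
    show ?case
    proof (rule C_k_SucI)
      show "((\<lambda>x. eta m (v \<bullet> x + a)) has_derivative (\<lambda>h. ?d x * (v \<bullet> h))) (at x)" for x
      proof -
        have "((\<lambda>x. v \<bullet> x + a) has_derivative (\<lambda>h. v \<bullet> h)) (at x)"
          by (auto intro!: derivative_eq_intros)
        moreover have "(eta m has_derivative (\<lambda>h. ?d x * h)) (at (v \<bullet> x + a))"
          using eta_has_derivative[of m "v \<bullet> x + a"] by (simp add: has_field_derivative_def)
        ultimately show ?thesis
          using has_derivative_compose by fast
      qed
      have eq: "?d x * (v \<bullet> b) = (v \<bullet> b) * eta (m + 2) (v \<bullet> x + a) + (- m * (v \<bullet> b)) * eta (m + 1) (v \<bullet> x + a)" for x b
        by (simp add: algebra_simps)
      show "C_k k (\<lambda>x. ?d x * (v \<bullet> b))" for b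
        unfolding eq by (intro C_k_add C_k_mult C_k_const Suc)
    qed
  qed
  then show ?thesis by (simp add: smooth_def)
qed

text \<open>
  Multiplying bumps in the distances to all faces gives a function that is positive exactly in the box.
  Stretching the argument of \<open>exp (- 1 / t)\<close> by the factor \<open>n + 1\<close> makes the limit \<open>n \<rightarrow> \<infinity>\<close> the indicator.
\<close>

lemma test_fun_box:
  fixes a b :: "'a::euclidean_space"
  assumes "cbox a b \<subseteq> \<Omega>"
  obtains \<phi> where "\<And>n. test_fun \<Omega> (\<phi> n)" "\<And>n x. \<bar>\<phi> n x\<bar> \<le> indicator (cbox a b) x"
    "\<And>x. (\<lambda>n::nat. \<phi> n x) \<longlonglongrightarrow> indicator (box a b) x"
proof -
  define \<phi> where "\<phi> n x = (\<Prod>i\<in>Basis. eta 0 (real (Suc n) * ((x - a) \<bullet> i)) * eta 0 (real (Suc n) * ((b - x) \<bullet> i)))" for n x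
  have eta0: "0 \<le> eta 0 t" "eta 0 t \<le> 1" for t by (auto simp: eta_def)
  have sm: "smooth (\<phi> n)" for n
  proof -
    have eq: "\<phi> n = (\<lambda>x. \<Prod>i\<in>Basis. eta 0 ((real (Suc n) *\<^sub>R i) \<bullet> x + real (Suc n) * (- a \<bullet> i)) *
        eta 0 ((- real (Suc n) *\<^sub>R i) \<bullet> x + real (Suc n) * (b \<bullet> i)))"
      by (auto simp: \<phi>_def fun_eq_iff algebra_simps inner_commute intro!: prod.cong)
    show ?thesis unfolding eq by (intro smooth_prod smooth_mult smooth_eta_affine) simp
  qed
  have out: "\<phi> n x = 0" if x: "x \<notin> box a b" for n x
  proof -
    obtain i where i: "i \<in> Basis" "x \<bullet> i \<le> a \<bullet> i \<or> b \<bullet> i \<le> x \<bullet> i"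
      using x unfolding mem_box by (meson not_less)
    have "real (Suc n) * ((x - a) \<bullet> i) \<le> 0 \<or> real (Suc n) * ((b - x) \<bullet> i) \<le> 0"
      using i(2) by (auto simp: inner_diff_left mult_le_0_iff)
    then have "eta 0 (real (Suc n) * ((x - a) \<bullet> i)) * eta 0 (real (Suc n) * ((b - x) \<bullet> i)) = 0"
      by (auto simp: eta_def)
    then show ?thesis unfolding \<phi>_def using i(1) by (intro prod_zero) auto
  qed
  have out': "\<phi> n x = 0" if "x \<notin> cbox a b" for n x
    by (rule out) (use that box_subset_cbox in blast)
  show thesis
  proof
    show "test_fun \<Omega> (\<phi> n)" for n
      by (rule test_funI[OF sm compact_cbox assms out'])
    have "0 \<le> \<phi> n x" "\<phi> n x \<le> 1" for n x
      unfolding \<phi>_def using eta0 by (auto intro!: prod_nonneg prod_le_1 mult_le_one)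
    then show "\<bar>\<phi> n x\<bar> \<le> indicator (cbox a b) x" for n x
      using out'[of x n] by (cases "x \<in> cbox a b") auto
    show "(\<lambda>n. \<phi> n x) \<longlonglongrightarrow> indicator (box a b) x" for x
    proof (cases "x \<in> box a b")
      case False
      then show ?thesis by (simp add: out)
    next
      case True
      have 1: "(\<lambda>n. eta 0 (real (Suc n) * t)) \<longlonglongrightarrow> 1" if "t > 0" for t
      proof -
        have "(\<lambda>n. exp (- ((1 / t) * inverse (real (Suc n))))) \<longlonglongrightarrow> exp (- (1 / t * 0))"
          by (intro tendsto_intros LIMSEQ_inverse_real_of_nat)
        moreover have "eta 0 (real (Suc n) * t) = exp (- ((1 / t) * inverse (real (Suc n))))" for n
          using that by (simp add: eta_def zero_less_mult_iff divide_simps)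
        ultimately show ?thesis by simp
      qed
      have "(\<lambda>n. \<phi> n x) \<longlonglongrightarrow> (\<Prod>i\<in>(Basis::'a set). 1 * 1)"
        unfolding \<phi>_def using True
        by (intro tendsto_prod tendsto_mult 1) (auto simp: mem_box inner_diff_left)
      then show ?thesis using True by simp
    qed
  qed
qed

section \<open>Difference quotients under the integral\<close>

lemma le_of_forall_pos_add_mult:
  fixes X Y c :: real
  assumes "\<And>\<epsilon>. \<epsilon> > 0 \<Longrightarrow> X \<le> Y + \<epsilon> * c"
  shows "X \<le> Y"
proof (rule field_le_epsilon)
  fix e :: real assume "e > 0"
  let ?\<epsilon> = "e / (\<bar>c\<bar> + 1)"
  have "X \<le> Y + ?\<epsilon> * c" using \<open>e > 0\<close> by (intro assms) auto
  also have "?\<epsilon> * c \<le> ?\<epsilon> * (\<bar>c\<bar> + 1)" using \<open>e > 0\<close> by (intro mult_left_mono) auto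
  also have "\<dots> = e" by simp
  finally show "X \<le> Y + e" by simp
qed

lemma distr_lebesgue_translate: "distr lebesgue lebesgue (\<lambda>x. x + a) = (lebesgue :: 'a::euclidean_space measure)"
  and measurable_lebesgue_translate: "(\<lambda>x. x + a) \<in> (lebesgue :: 'a measure) \<rightarrow>\<^sub>M lebesgue"
proof -
  have eq: "(\<lambda>x. a + (\<Sum>j\<in>Basis. (1 * (x \<bullet> j)) *\<^sub>R j)) = (\<lambda>x. x + a)"
    by (simp add: euclidean_representation add.commute)
  show "(\<lambda>x. x + a) \<in> (lebesgue :: 'a measure) \<rightarrow>\<^sub>M lebesgue"
    using lebesgue_affine_measurable[of "\<lambda>_. 1" a] unfolding eq by simp
  show "distr lebesgue lebesgue (\<lambda>x. x + a) = lebesgue"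
    using lebesgue_affine_euclidean[of "\<lambda>_. 1" a] unfolding eq by (simp add: density_1)
qed

lemma integral_lebesgue_translate:
  fixes f :: "'a::euclidean_space \<Rightarrow> real"
  assumes "f \<in> borel_measurable lebesgue"
  shows "(LINT x|lebesgue. f (x + a)) = (LINT x|lebesgue. f x)"
  using integral_distr[OF measurable_lebesgue_translate assms, of a] by (simp add: distr_lebesgue_translate)

lemma integrable_lebesgue_translate:
  fixes f :: "'a::euclidean_space \<Rightarrow> real"
  assumes "integrable lebesgue f"
  shows "integrable lebesgue (\<lambda>x. f (x + a))"
  using integrable_distr[OF measurable_lebesgue_translate[of a], of f] assms
  by (simp add: distr_lebesgue_translate)

lemma integrable_mult_bounded:
  fixes f g :: "'a \<Rightarrow> real"
  assumes "integrable M f" "g \<in> borel_measurable M" "\<And>x. \<bar>g x\<bar> \<le> B"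
  shows "integrable M (\<lambda>x. f x * g x)"
proof (rule Bochner_Integration.integrable_bound)
  show "integrable M (\<lambda>x. B * f x)" using assms by simp
  show "AE x in M. norm (f x * g x) \<le> norm (B * f x)"
  proof (intro AE_I2)
    fix x
    have "\<bar>g x\<bar> \<le> \<bar>B\<bar>" using assms(3)[of x] by linarith
    then show "norm (f x * g x) \<le> norm (B * f x)"
      by (simp add: abs_mult mult.commute[of "\<bar>f x\<bar>"] mult_right_mono)
  qed
qed (use assms in auto)

lemma smooth_measurable: "smooth \<phi> \<Longrightarrow> \<phi> \<in> borel_measurable lebesgue"
  by (intro measurable_completion) (simp add: borel_measurable_continuous_onI smooth_imp_continuous)

lemma smooth_measurable_translate: "smooth \<phi> \<Longrightarrow> (\<lambda>x. \<phi> (x + a)) \<in> borel_measurable lebesgue"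
  by (intro smooth_measurable smooth_translate)

lemma smooth_DERIV_line:
  assumes "smooth \<phi>"
  shows "((\<lambda>t. \<phi> (x + t *\<^sub>R b)) has_real_derivative grad \<phi> (x + t *\<^sub>R b) \<bullet> b) (at t)"
proof -
  have "((\<lambda>t. x + t *\<^sub>R b) has_derivative (\<lambda>h. h *\<^sub>R b)) (at t)"
    by (auto intro!: derivative_eq_intros)
  from has_derivative_compose[OF this smooth_has_derivative_grad[OF assms]]
  show ?thesis by (simp add: has_field_derivative_def mult.commute[of _ "_ \<bullet> b"])
qed

lemma test_fun_increment_bound:
  assumes "test_fun \<Omega> \<phi>" "b \<in> Basis"
  obtains B where "B \<ge> 0" "\<And>x h. \<bar>\<phi> (x + h *\<^sub>R b) - \<phi> x\<bar> \<le> \<bar>h\<bar> * B"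
proof -
  obtain B where B: "B \<ge> 0" "\<And>x. \<bar>grad \<phi> x \<bullet> b\<bar> \<le> B"
    using test_fun_bounded[OF test_fun_grad[OF assms]] by metis
  have "\<bar>\<phi> (x + h *\<^sub>R b) - \<phi> x\<bar> \<le> \<bar>h\<bar> * B" for x h
  proof -
    have "norm (\<phi> (x + h *\<^sub>R b) - \<phi> (x + 0 *\<^sub>R b)) \<le> B * norm (h - 0)"
      by (rule field_differentiable_bound[of UNIV _ "\<lambda>t. grad \<phi> (x + t *\<^sub>R b) \<bullet> b"])
        (use B smooth_DERIV_line[OF test_fun_smooth[OF assms(1)]] in auto)
    then show ?thesis by (simp add: mult.commute)
  qed
  then show thesis using that B by blast
qed

text \<open>
  The difference quotients of a test function are bounded by its largest slope, so that dominated
  convergence applies.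
\<close>

lemma diffquot_integral_tendsto:
  assumes u: "integrable lebesgue u" and \<phi>: "test_fun \<Omega> \<phi>" and b: "b \<in> Basis"
  shows "((\<lambda>h. (LINT x|lebesgue. u x * (\<phi> (x + h *\<^sub>R b) - \<phi> x)) / h) \<longlongrightarrow>
    (LINT x|lebesgue. u x * (grad \<phi> x \<bullet> b))) (at 0)"
proof -
  obtain B where B: "B \<ge> 0" "\<And>x h. \<bar>\<phi> (x + h *\<^sub>R b) - \<phi> x\<bar> \<le> \<bar>h\<bar> * B"
    using test_fun_increment_bound[OF \<phi> b] by metis
  note sm = test_fun_smooth[OF \<phi>]
  note [measurable] = smooth_measurable[OF sm] smooth_measurable_translate[OF sm]
    smooth_measurable[OF smooth_grad[OF sm b]] borel_measurable_integrable[OF u]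
  have "(\<lambda>n. (LINT x|lebesgue. u x * (\<phi> (x + H n *\<^sub>R b) - \<phi> x)) / H n) \<longlonglongrightarrow>
    (LINT x|lebesgue. u x * (grad \<phi> x \<bullet> b))" if H: "\<And>n. H n \<noteq> 0" "H \<longlonglongrightarrow> 0" for H :: "nat \<Rightarrow> real"
  proof -
    have "(\<lambda>n. (LINT x|lebesgue. u x * ((\<phi> (x + H n *\<^sub>R b) - \<phi> x) / H n))) \<longlonglongrightarrow>
      (LINT x|lebesgue. u x * (grad \<phi> x \<bullet> b))"
    proof (rule integral_dominated_convergence)
      show "integrable lebesgue (\<lambda>x. B * \<bar>u x\<bar>)" using u by simp
      show "AE x in lebesgue. (\<lambda>n. u x * ((\<phi> (x + H n *\<^sub>R b) - \<phi> x) / H n)) \<longlonglongrightarrow> u x * (grad \<phi> x \<bullet> b)"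
      proof (intro AE_I2 tendsto_mult tendsto_const)
        fix x
        have "((\<lambda>h. (\<phi> (x + h *\<^sub>R b) - \<phi> x) / h) \<longlongrightarrow> grad \<phi> x \<bullet> b) (at 0)"
          using smooth_DERIV_line[OF sm, of x b 0] by (simp add: has_field_derivative_iff)
        then show "(\<lambda>n. (\<phi> (x + H n *\<^sub>R b) - \<phi> x) / H n) \<longlonglongrightarrow> grad \<phi> x \<bullet> b"
          using H by (auto simp: tendsto_at_iff_sequentially o_def)
      qed
      show "AE x in lebesgue. norm (u x * ((\<phi> (x + H n *\<^sub>R b) - \<phi> x) / H n)) \<le> B * \<bar>u x\<bar>" for n
      proof (intro AE_I2)
        fix x
        have "\<bar>(\<phi> (x + H n *\<^sub>R b) - \<phi> x) / H n\<bar> \<le> B"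
          using B(2)[of x "H n"] H(1)[of n] by (simp add: divide_le_eq mult.commute)
        then show "norm (u x * ((\<phi> (x + H n *\<^sub>R b) - \<phi> x) / H n)) \<le> B * \<bar>u x\<bar>"
          unfolding real_norm_def abs_mult by (simp only: mult.commute[of B] mult_left_mono abs_ge_zero)
      qed
    qed measurable
    then show ?thesis by simp
  qed
  then show ?thesis by (auto simp: tendsto_at_iff_sequentially o_def)
qed

text \<open>
  The map \<open>t \<mapsto> \<integral> u(x) \<psi>(x + t b) dx\<close> has the derivative \<open>- \<integral> g(x) \<psi>(x + t b) dx\<close>, because the translates of
  \<open>\<psi>\<close> by at most \<open>\<delta>\<close> are still test functions in \<open>N\<close>. The mean value theorem gives the bound. Its point is
  that only the supremum of \<open>\<psi>\<close> enters, not its derivatives.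
\<close>

lemma weak_increment_bound:
  assumes u: "integrable lebesgue u" and g: "integrable lebesgue g" and b: "b \<in> Basis"
    and wd: "\<And>\<psi>. test_fun N \<psi> \<Longrightarrow> (LINT x|lebesgue. u x * (grad \<psi> x \<bullet> b)) = - (LINT x|lebesgue. g x * \<psi> x)"
    and K: "compact K" "\<And>x. x \<in> K \<Longrightarrow> cball x \<delta> \<subseteq> N"
    and \<psi>: "smooth \<psi>" "\<And>x. x \<notin> K \<Longrightarrow> \<psi> x = 0" "\<And>x. \<bar>\<psi> x\<bar> \<le> S"
    and h: "\<bar>h\<bar> \<le> \<delta>"
  shows "\<bar>LINT x|lebesgue. u x * (\<psi> (x + h *\<^sub>R b) - \<psi> x)\<bar> \<le> \<bar>h\<bar> * (S * (LINT x|lebesgue. \<bar>g x\<bar>))"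
proof -
  have \<psi>U: "test_fun UNIV (\<lambda>x. \<psi> (x + t *\<^sub>R b))" for t
  proof (rule test_funI)
    show "compact ((\<lambda>x. x - t *\<^sub>R b) ` K)"
      using K by (intro compact_continuous_image continuous_intros)
    show "\<psi> (x + t *\<^sub>R b) = 0" if "x \<notin> (\<lambda>x. x - t *\<^sub>R b) ` K" for x
      using \<psi>(2)[of "x + t *\<^sub>R b"] that by (force simp: image_iff)
  qed (auto intro: smooth_translate \<psi>)
  have \<psi>N: "test_fun N (\<lambda>x. \<psi> (x + t *\<^sub>R b))" if t: "\<bar>t\<bar> \<le> \<delta>" for t
  proof (rule test_funI)
    show "compact ((\<lambda>x. x - t *\<^sub>R b) ` K)"
      using K by (intro compact_continuous_image continuous_intros)
    show "\<psi> (x + t *\<^sub>R b) = 0" if "x \<notin> (\<lambda>x. x - t *\<^sub>R b) ` K" for x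
      using \<psi>(2)[of "x + t *\<^sub>R b"] that by (force simp: image_iff)
    show "(\<lambda>x. x - t *\<^sub>R b) ` K \<subseteq> N"
    proof (rule image_subsetI)
      fix x assume "x \<in> K"
      moreover have "x - t *\<^sub>R b \<in> cball x \<delta>" using t b by (simp add: dist_norm)
      ultimately show "x - t *\<^sub>R b \<in> N" using K by blast
    qed
  qed (auto intro: smooth_translate \<psi>)
  define m where "m t = (LINT x|lebesgue. u x * \<psi> (x + t *\<^sub>R b))" for t
  have int: "integrable lebesgue (\<lambda>x. u x * \<psi> (x + t *\<^sub>R b))" for t
    using \<psi> by (intro integrable_mult_bounded[OF u _, of _ S] smooth_measurable_translate) auto
  have "(m has_real_derivative - (LINT x|lebesgue. g x * \<psi> (x + t *\<^sub>R b))) (at t)" if t: "\<bar>t\<bar> \<le> \<delta>" for t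
  proof -
    have "((\<lambda>h. (LINT x|lebesgue. u x * (\<psi> (x + h *\<^sub>R b + t *\<^sub>R b) - \<psi> (x + t *\<^sub>R b))) / h) \<longlongrightarrow>
       (LINT x|lebesgue. u x * (grad (\<lambda>x. \<psi> (x + t *\<^sub>R b)) x \<bullet> b))) (at 0)"
      by (rule diffquot_integral_tendsto[OF u \<psi>U b])
    also have "(LINT x|lebesgue. u x * (grad (\<lambda>x. \<psi> (x + t *\<^sub>R b)) x \<bullet> b)) =
        - (LINT x|lebesgue. g x * \<psi> (x + t *\<^sub>R b))"
      by (rule wd[OF \<psi>N[OF t]])
    also have "(\<lambda>h. (LINT x|lebesgue. u x * (\<psi> (x + h *\<^sub>R b + t *\<^sub>R b) - \<psi> (x + t *\<^sub>R b))) / h) =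
        (\<lambda>h. (m (t + h) - m t) / h)"
    proof
      fix h
      have "(LINT x|lebesgue. u x * (\<psi> (x + h *\<^sub>R b + t *\<^sub>R b) - \<psi> (x + t *\<^sub>R b))) = m (t + h) - m t"
        unfolding m_def using int[of "t + h"] int[of t]
        by (subst Bochner_Integration.integral_diff[symmetric])
          (auto simp: algebra_simps intro!: Bochner_Integration.integral_cong)
      then show "(LINT x|lebesgue. u x * (\<psi> (x + h *\<^sub>R b + t *\<^sub>R b) - \<psi> (x + t *\<^sub>R b))) / h = (m (t + h) - m t) / h"
        by simp
    qed
    finally show ?thesis by (simp add: DERIV_def)
  qed
  note deriv = this
  have bd: "norm (- (LINT x|lebesgue. g x * \<psi> (x + t *\<^sub>R b))) \<le> S * (LINT x|lebesgue. \<bar>g x\<bar>)" for t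
  proof -
    have "\<bar>LINT x|lebesgue. g x * \<psi> (x + t *\<^sub>R b)\<bar> \<le> (LINT x|lebesgue. \<bar>g x * \<psi> (x + t *\<^sub>R b)\<bar>)"
      by (rule integral_abs_bound)
    also have "\<dots> \<le> (LINT x|lebesgue. S * \<bar>g x\<bar>)"
    proof (rule integral_mono)
      show "integrable lebesgue (\<lambda>x. \<bar>g x * \<psi> (x + t *\<^sub>R b)\<bar>)"
        using \<psi> by (intro integrable_abs integrable_mult_bounded[OF g _, of _ S] smooth_measurable_translate) auto
      show "\<bar>g x * \<psi> (x + t *\<^sub>R b)\<bar> \<le> S * \<bar>g x\<bar>" for x
        unfolding abs_mult mult.commute[of S] using \<psi>(3) by (intro mult_left_mono) auto
    qed (use g in auto)
    finally show ?thesis by simp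
  qed
  have "norm (m h - m 0) \<le> (S * (LINT x|lebesgue. \<bar>g x\<bar>)) * norm (h - 0)"
    by (rule field_differentiable_bound[of "{-\<delta>..\<delta>}" m "\<lambda>t. - (LINT x|lebesgue. g x * \<psi> (x + t *\<^sub>R b))"])
      (use h in \<open>auto intro!: has_field_derivative_at_within deriv bd[unfolded real_norm_def abs_minus_cancel]\<close>)
  moreover have "m h - m 0 = (LINT x|lebesgue. u x * (\<psi> (x + h *\<^sub>R b) - \<psi> x))"
    unfolding m_def using int[of h] int[of 0]
    by (subst Bochner_Integration.integral_diff[symmetric])
      (auto simp: algebra_simps intro!: Bochner_Integration.integral_cong)
  ultimately show ?thesis by (simp add: mult.commute)
qed

text \<open>
  As the bound involves only the supremum, it passes to uniform limits: \<open>\<theta>\<close> is approximated by polynomials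
  \<open>Q\<close>, and \<open>Q \<phi>\<close> is smooth and supported in \<open>K\<close>.
\<close>

lemma weak_increment_bound_continuous:
  assumes u: "integrable lebesgue u" and g: "integrable lebesgue g" and b: "b \<in> Basis"
    and wd: "\<And>\<psi>. test_fun N \<psi> \<Longrightarrow> (LINT x|lebesgue. u x * (grad \<psi> x \<bullet> b)) = - (LINT x|lebesgue. g x * \<psi> x)"
    and K: "compact K" "\<And>x. x \<in> K \<Longrightarrow> cball x \<delta> \<subseteq> N"
    and \<phi>: "smooth \<phi>" "\<And>x. x \<notin> K \<Longrightarrow> \<phi> x = 0"
    and \<theta>: "continuous_on K \<theta>" "\<And>x. x \<in> K \<Longrightarrow> \<bar>\<theta> x * \<phi> x\<bar> \<le> S"
    and h: "\<bar>h\<bar> \<le> \<delta>" and S: "S \<ge> 0"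
  shows "integrable lebesgue (\<lambda>x. u x * (\<theta> (x + a) * \<phi> (x + a)))"
    and "\<bar>LINT x|lebesgue. u x * (\<theta> (x + h *\<^sub>R b) * \<phi> (x + h *\<^sub>R b) - \<theta> x * \<phi> x)\<bar> \<le>
      \<bar>h\<bar> * (S * (LINT x|lebesgue. \<bar>g x\<bar>))"
proof -
  define f where "f x = \<theta> x * \<phi> x" for x
  have fS: "\<bar>f x\<bar> \<le> S" for x using \<theta>(2)[of x] \<phi>(2)[of x] S by (cases "x \<in> K") (auto simp: f_def)
  have f_eq: "f = (\<lambda>x. (indicator K x *\<^sub>R \<theta> x) * \<phi> x)"
    using \<phi>(2) by (auto simp: f_def fun_eq_iff indicator_def)
  have f_borel: "f \<in> borel_measurable borel"
    unfolding f_eq using K \<phi>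
    by (intro borel_measurable_times borel_measurable_continuous_on_indicator[OF _ \<theta>(1)]
        borel_measurable_continuous_onI[of \<phi>] smooth_imp_continuous borel_compact)
  have ft: "(\<lambda>x. f (x + a)) \<in> borel_measurable lebesgue" for a
    using f_borel by (intro measurable_completion) (measurable, simp)
  have intf: "integrable lebesgue (\<lambda>x. u x * f (x + a))" for a
    by (rule integrable_mult_bounded[OF u ft fS])
  then show "integrable lebesgue (\<lambda>x. u x * (\<theta> (x + a) * \<phi> (x + a)))" by (simp add: f_def)
  have \<phi>T: "test_fun UNIV \<phi>" using \<phi> K by (intro test_funI[of _ K]) auto
  obtain B where B: "B \<ge> 0" "\<And>x. \<bar>\<phi> x\<bar> \<le> B" using test_fun_bounded[OF \<phi>T] by metis
  let ?G = "LINT x|lebesgue. \<bar>g x\<bar>" and ?U = "LINT x|lebesgue. \<bar>u x\<bar>"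
  have "\<bar>LINT x|lebesgue. u x * (f (x + h *\<^sub>R b) - f x)\<bar> \<le> \<bar>h\<bar> * (S * ?G) + \<epsilon> * (\<bar>h\<bar> * (B * ?G) + 2 * B * ?U)"
    if \<epsilon>: "\<epsilon> > 0" for \<epsilon>
  proof -
    obtain Q where Q: "real_polynomial_function Q" "\<And>x. x \<in> K \<Longrightarrow> \<bar>\<theta> x - Q x\<bar> < \<epsilon>"
      using Stone_Weierstrass_real_polynomial_function[OF K(1) \<theta>(1) \<epsilon>] by metis
    define q where "q x = Q x * \<phi> x" for x
    have fq: "\<bar>f x - q x\<bar> \<le> \<epsilon> * B" for x
    proof (cases "x \<in> K")
      case True
      have "\<bar>f x - q x\<bar> = \<bar>\<theta> x - Q x\<bar> * \<bar>\<phi> x\<bar>" by (simp add: f_def q_def abs_mult[symmetric] algebra_simps)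
      also have "\<dots> \<le> \<epsilon> * B" using Q(2)[OF True] B(2)[of x] \<epsilon> by (intro mult_mono) auto
      finally show ?thesis .
    next
      case False
      then show ?thesis using \<phi>(2) \<epsilon> B by (simp add: f_def q_def)
    qed
    have q: "smooth q" "q x = 0" if "x \<notin> K" for x
      using that \<phi> Q unfolding q_def by (auto intro: smooth_mult smooth_real_polynomial_function)
    have sq: "smooth q"
      using \<phi> Q unfolding q_def by (auto intro: smooth_mult smooth_real_polynomial_function)
    have qb: "\<bar>q x\<bar> \<le> S + \<epsilon> * B" for x using fq[of x] fS[of x] by linarith
    have intq: "integrable lebesgue (\<lambda>x. u x * q (x + a))" for a
      by (rule integrable_mult_bounded[OF u smooth_measurable_translate[OF sq] qb])
    have 1: "\<bar>LINT x|lebesgue. u x * (q (x + h *\<^sub>R b) - q x)\<bar> \<le> \<bar>h\<bar> * ((S + \<epsilon> * B) * ?G)"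
      by (rule weak_increment_bound[OF u g b wd K sq _ qb h]) (use q in auto)
    have i1: "integrable lebesgue (\<lambda>x. u x * (f (x + h *\<^sub>R b) - f x))"
      using intf[of "h *\<^sub>R b"] intf[of 0] by (simp add: right_diff_distrib)
    have i2: "integrable lebesgue (\<lambda>x. u x * (q (x + h *\<^sub>R b) - q x))"
      using intq[of "h *\<^sub>R b"] intq[of 0] by (simp add: right_diff_distrib)
    have "\<bar>(LINT x|lebesgue. u x * (f (x + h *\<^sub>R b) - f x)) - (LINT x|lebesgue. u x * (q (x + h *\<^sub>R b) - q x))\<bar>
      \<le> (LINT x|lebesgue. \<bar>u x * (f (x + h *\<^sub>R b) - f x) - u x * (q (x + h *\<^sub>R b) - q x)\<bar>)"
      unfolding Bochner_Integration.integral_diff[OF i1 i2, symmetric] by (rule integral_abs_bound)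
    also have "\<dots> \<le> (LINT x|lebesgue. (2 * (\<epsilon> * B)) * \<bar>u x\<bar>)"
    proof (rule integral_mono)
      show "integrable lebesgue (\<lambda>x. \<bar>u x * (f (x + h *\<^sub>R b) - f x) - u x * (q (x + h *\<^sub>R b) - q x)\<bar>)"
        using i1 i2 by auto
      show "\<bar>u x * (f (x + h *\<^sub>R b) - f x) - u x * (q (x + h *\<^sub>R b) - q x)\<bar> \<le> 2 * (\<epsilon> * B) * \<bar>u x\<bar>" for x
      proof -
        have "\<bar>u x * (f (x + h *\<^sub>R b) - f x) - u x * (q (x + h *\<^sub>R b) - q x)\<bar> =
          \<bar>u x\<bar> * \<bar>(f (x + h *\<^sub>R b) - q (x + h *\<^sub>R b)) - (f x - q x)\<bar>"
          by (simp add: abs_mult[symmetric] algebra_simps)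
        also have "\<dots> \<le> \<bar>u x\<bar> * (2 * (\<epsilon> * B))"
          using fq[of x] fq[of "x + h *\<^sub>R b"] by (intro mult_left_mono) linarith+
        finally show ?thesis by (simp add: mult.commute)
      qed
    qed (use u in auto)
    also have "\<dots> = 2 * (\<epsilon> * B) * ?U" by simp
    finally show ?thesis using 1 by (simp add: algebra_simps)
  qed
  then have "\<bar>LINT x|lebesgue. u x * (f (x + h *\<^sub>R b) - f x)\<bar> \<le> \<bar>h\<bar> * (S * ?G)"
    by (rule le_of_forall_pos_add_mult)
  then show "\<bar>LINT x|lebesgue. u x * (\<theta> (x + h *\<^sub>R b) * \<phi> (x + h *\<^sub>R b) - \<theta> x * \<phi> x)\<bar> \<le>
      \<bar>h\<bar> * (S * (LINT x|lebesgue. \<bar>g x\<bar>))"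
    by (simp add: f_def)
qed


text \<open>
  The discrete product rule: up to a translation, \<open>u\<^sup>2\<close> tested with an increment of \<open>\<phi>\<close> equals \<open>u\<close> tested with
  the increment of \<open>\<theta> \<phi>\<close>, where \<open>\<theta>(x) = u(x - h b) + u(x)\<close>. For small \<open>h\<close> this \<open>\<theta>\<close> is uniformly close to
  \<open>2 v\<close> and hence to a polynomial \<open>Q\<close>. The difference is controlled by the preceding lemma, and for the
  test function \<open>Q \<phi>\<close> the definition of the weak derivative applies.
\<close>

lemma weak_derivative_square:
  assumes N: "compact N" and v: "continuous_on N v" and g: "integrable lebesgue g" and b: "b \<in> Basis"
    and u_def: "u = (\<lambda>x. indicator N x *\<^sub>R v x)"
    and wd: "\<And>\<psi>. test_fun N \<psi> \<Longrightarrow> (LINT x|lebesgue. u x * (grad \<psi> x \<bullet> b)) = - (LINT x|lebesgue. g x * \<psi> x)"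
    and K: "compact K" "\<And>x. x \<in> K \<Longrightarrow> cball x \<delta> \<subseteq> N" and \<delta>: "\<delta> > 0"
    and \<phi>: "smooth \<phi>" "\<And>x. x \<notin> K \<Longrightarrow> \<phi> x = 0"
  shows "(LINT x|lebesgue. (u x)\<^sup>2 * (grad \<phi> x \<bullet> b)) = - (LINT x|lebesgue. 2 * u x * g x * \<phi> x)"
proof -
  have KN: "K \<subseteq> N" using K(2) \<delta> by (meson centre_in_cball less_imp_le subset_iff)
  have uN: "u x = v x" if "x \<in> N" for x using that by (simp add: u_def)
  have u_borel: "u \<in> borel_measurable borel"
    unfolding u_def by (rule borel_measurable_continuous_on_indicator[OF borel_compact[OF N] v])
  have ut: "(\<lambda>x. u (x + a)) \<in> borel_measurable lebesgue" for a
    using u_borel by (intro measurable_completion) (measurable, simp)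
  have "bounded (v ` N)" using N v by (intro compact_imp_bounded compact_continuous_image)
  then obtain B where B: "B > 0" "\<And>x. x \<in> N \<Longrightarrow> \<bar>v x\<bar> \<le> B" unfolding bounded_pos by auto
  have uB: "\<bar>u x\<bar> \<le> B" for x using B by (simp add: u_def indicator_def)
  have u: "integrable lebesgue u"
  proof -
    have "integrable lborel u" unfolding u_def by (rule borel_integrable_compact[OF N v])
    then show ?thesis by (rule integrable_completion[THEN iffD2, rotated]) (use u_borel in simp)
  qed
  have \<phi>T: "test_fun UNIV \<phi>" using \<phi> K by (intro test_funI[of _ K]) auto
  obtain C where C: "C \<ge> 0" "\<And>x. \<bar>\<phi> x\<bar> \<le> C" using test_fun_bounded[OF \<phi>T] by metis
  let ?G = "LINT x|lebesgue. \<bar>g x\<bar>"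
  define L where "L = (LINT x|lebesgue. (u x)\<^sup>2 * (grad \<phi> x \<bullet> b)) + (LINT x|lebesgue. 2 * u x * g x * \<phi> x)"
  have u2: "integrable lebesgue (\<lambda>x. (u x)\<^sup>2)"
    unfolding power2_eq_square using ut[of 0] uB by (intro integrable_mult_bounded[OF u, of _ B]) auto
  have "\<bar>L\<bar> \<le> 0 + \<epsilon> * (3 * C * ?G)" if \<epsilon>: "\<epsilon> > 0" for \<epsilon>
  proof -
    obtain Q where Q: "real_polynomial_function Q" "\<And>x. x \<in> N \<Longrightarrow> \<bar>2 * v x - Q x\<bar> < \<epsilon>"
      using Stone_Weierstrass_real_polynomial_function[OF N _ \<epsilon>, of "\<lambda>x. 2 * v x"] v
      by (metis continuous_on_mult_left)
    define q where "q x = Q x * \<phi> x" for x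
    have sq: "smooth q" and q0: "\<And>x. x \<notin> K \<Longrightarrow> q x = 0"
      using \<phi> Q unfolding q_def by (auto intro: smooth_mult smooth_real_polynomial_function)
    have qT: "test_fun N q" using sq q0 K KN by (intro test_funI[of _ K]) auto
    obtain Bq where Bq: "\<And>x. \<bar>q x\<bar> \<le> Bq" using test_fun_bounded[OF qT] by metis
    have "uniformly_continuous_on N v" using N v by (rule compact_uniformly_continuous[rotated])
    then obtain \<eta> where \<eta>: "\<eta> > 0" "\<And>x y. x \<in> N \<Longrightarrow> y \<in> N \<Longrightarrow> dist y x < \<eta> \<Longrightarrow> dist (v y) (v x) < \<epsilon>"
      unfolding uniformly_continuous_on_def using \<epsilon> by metis
    have main: "\<bar>(LINT x|lebesgue. (u x)\<^sup>2 * (\<phi> (x + h *\<^sub>R b) - \<phi> x)) - (LINT x|lebesgue. u x * (q (x + h *\<^sub>R b) - q x))\<bar>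
        \<le> \<bar>h\<bar> * ((2 * \<epsilon> * C) * ?G)" if h: "\<bar>h\<bar> \<le> \<delta>" "\<bar>h\<bar> < \<eta>" for h
    proof -
      define \<theta> where "\<theta> x = u (x - h *\<^sub>R b) + u x - Q x" for x
      have xN: "x - h *\<^sub>R b \<in> N" if "x \<in> K" for x
      proof -
        have "x - h *\<^sub>R b \<in> cball x \<delta>" using h b by (simp add: dist_norm)
        then show ?thesis using K(2) that by blast
      qed
      have \<theta>c: "continuous_on K \<theta>"
      proof -
        have "continuous_on K (\<lambda>x. v (x - h *\<^sub>R b) + v x - Q x)"
          using xN KN Q
          by (intro continuous_intros continuous_on_compose2[OF v] smooth_imp_continuous smooth_real_polynomial_function) auto
        then show ?thesis
          by (rule continuous_on_cong[THEN iffD1, rotated -1]) (use xN KN uN in \<open>auto simp: \<theta>_def\<close>)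
      qed
      have \<theta>b: "\<bar>\<theta> x * \<phi> x\<bar> \<le> 2 * \<epsilon> * C" if x: "x \<in> K" for x
      proof -
        have "dist (v (x - h *\<^sub>R b)) (v x) < \<epsilon>"
          using x xN KN h b by (intro \<eta>) (auto simp: dist_norm)
        then have "\<bar>\<theta> x\<bar> \<le> 2 * \<epsilon>"
          using Q(2)[of x] x xN[OF x] KN uN by (auto simp: \<theta>_def dist_real_def subset_iff)
        then show ?thesis unfolding abs_mult using C \<epsilon> by (intro mult_mono) auto
      qed
      have nn: "0 \<le> 2 * \<epsilon> * C" using \<epsilon> C by simp
      have wib: "\<bar>LINT x|lebesgue. u x * (\<theta> (x + h *\<^sub>R b) * \<phi> (x + h *\<^sub>R b) - \<theta> x * \<phi> x)\<bar> \<le>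
          \<bar>h\<bar> * ((2 * \<epsilon> * C) * ?G)"
        by (rule weak_increment_bound_continuous(2)[OF u g b wd K \<phi> \<theta>c \<theta>b h(1) nn])
      have i\<theta>: "integrable lebesgue (\<lambda>x. u x * (\<theta> (x + a) * \<phi> (x + a)))" for a
        by (rule weak_increment_bound_continuous(1)[OF u g b wd K \<phi> \<theta>c \<theta>b h(1) nn])
      have iq: "integrable lebesgue (\<lambda>x. u x * q (x + a))" for a
        by (rule integrable_mult_bounded[OF u smooth_measurable_translate[OF sq] Bq])
      have i\<phi>: "integrable lebesgue (\<lambda>x. (u x)\<^sup>2 * \<phi> (x + a))" for a
        by (rule integrable_mult_bounded[OF u2 smooth_measurable_translate[OF \<phi>(1)] C(2)])
      \<comment> \<open>The two tested increments differ by \<open>r(x + h b) - r(x)\<close>, whose integral vanishes.\<close>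
      define r where "r x = u x * u (x - h *\<^sub>R b) * \<phi> x" for x
      have ir: "integrable lebesgue r"
      proof -
        have "integrable lebesgue (\<lambda>x. u x * u (x + (- h *\<^sub>R b)))"
          by (rule integrable_mult_bounded[OF u ut uB])
        from integrable_mult_bounded[OF this smooth_measurable_translate[OF \<phi>(1), of 0], of C]
        show ?thesis using C by (simp add: r_def[abs_def])
      qed
      have irt: "integrable lebesgue (\<lambda>x. r (x + h *\<^sub>R b))"
        by (rule integrable_lebesgue_translate[OF ir])
      have eqr: "(LINT x|lebesgue. r (x + h *\<^sub>R b) - r x) = 0"
        using integral_lebesgue_translate[of r "h *\<^sub>R b"] ir irt by simp
      have pw: "(u x)\<^sup>2 * (\<phi> (x + h *\<^sub>R b) - \<phi> x) - u x * (q (x + h *\<^sub>R b) - q x) =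
         u x * (\<theta> (x + h *\<^sub>R b) * \<phi> (x + h *\<^sub>R b) - \<theta> x * \<phi> x) - (r (x + h *\<^sub>R b) - r x)" for x
        by (simp add: \<theta>_def r_def q_def power2_eq_square algebra_simps)
      have j1: "integrable lebesgue (\<lambda>x. (u x)\<^sup>2 * (\<phi> (x + h *\<^sub>R b) - \<phi> x))"
        using i\<phi>[of "h *\<^sub>R b"] i\<phi>[of 0] by (simp add: right_diff_distrib)
      have j2: "integrable lebesgue (\<lambda>x. u x * (q (x + h *\<^sub>R b) - q x))"
        using iq[of "h *\<^sub>R b"] iq[of 0] by (simp add: right_diff_distrib)
      have j3: "integrable lebesgue (\<lambda>x. u x * (\<theta> (x + h *\<^sub>R b) * \<phi> (x + h *\<^sub>R b) - \<theta> x * \<phi> x))"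
        using i\<theta>[of "h *\<^sub>R b"] i\<theta>[of 0] by (simp add: right_diff_distrib)
      have "(LINT x|lebesgue. (u x)\<^sup>2 * (\<phi> (x + h *\<^sub>R b) - \<phi> x)) - (LINT x|lebesgue. u x * (q (x + h *\<^sub>R b) - q x))
        = (LINT x|lebesgue. u x * (\<theta> (x + h *\<^sub>R b) * \<phi> (x + h *\<^sub>R b) - \<theta> x * \<phi> x))"
        unfolding Bochner_Integration.integral_diff[OF j1 j2, symmetric] pw
        using j3 ir irt eqr by simp
      then show ?thesis using wib by simp
    qed
    have lim1: "((\<lambda>h. \<bar>((LINT x|lebesgue. (u x)\<^sup>2 * (\<phi> (x + h *\<^sub>R b) - \<phi> x)) / h -
        (LINT x|lebesgue. u x * (q (x + h *\<^sub>R b) - q x)) / h)\<bar>) \<longlongrightarrow>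
        \<bar>(LINT x|lebesgue. (u x)\<^sup>2 * (grad \<phi> x \<bullet> b)) - (LINT x|lebesgue. u x * (grad q x \<bullet> b))\<bar>) (at 0)"
      by (intro tendsto_intros diffquot_integral_tendsto[OF u2 \<phi>T b] diffquot_integral_tendsto[OF u qT b])
    have "\<bar>(LINT x|lebesgue. (u x)\<^sup>2 * (grad \<phi> x \<bullet> b)) - (LINT x|lebesgue. u x * (grad q x \<bullet> b))\<bar> \<le> 2 * \<epsilon> * C * ?G"
    proof (rule tendsto_upperbound[OF lim1])
      have ev: "\<forall>\<^sub>F h in at 0. \<bar>h\<bar> \<le> \<delta> \<and> \<bar>h\<bar> < \<eta> \<and> h \<noteq> 0" for h :: real
        unfolding eventually_at using \<delta> \<eta>(1) by (intro exI[of _ "min \<delta> \<eta>"]) (auto simp: dist_real_def)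
      show "\<forall>\<^sub>F h in at 0. \<bar>(LINT x|lebesgue. (u x)\<^sup>2 * (\<phi> (x + h *\<^sub>R b) - \<phi> x)) / h -
        (LINT x|lebesgue. u x * (q (x + h *\<^sub>R b) - q x)) / h\<bar> \<le> 2 * \<epsilon> * C * ?G"
        using ev
      proof eventually_elim
        case (elim h)
        then show ?case using main[of h]
          by (simp add: diff_divide_distrib[symmetric] divide_le_eq mult.commute)
      qed
    qed simp
    moreover have "(LINT x|lebesgue. u x * (grad q x \<bullet> b)) = - (LINT x|lebesgue. g x * q x)"
      by (rule wd[OF qT])
    moreover have "\<bar>(LINT x|lebesgue. 2 * u x * g x * \<phi> x) - (LINT x|lebesgue. g x * q x)\<bar> \<le> \<epsilon> * C * ?G"
    proof -
      have 1: "integrable lebesgue (\<lambda>x. g x * q x)"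
        by (rule integrable_mult_bounded[OF g smooth_measurable[OF sq] Bq])
      have "\<bar>2 * u x * \<phi> x\<bar> \<le> 2 * B * C" for x
        unfolding abs_mult using uB[of x] C B by (intro mult_mono) auto
      moreover have "(\<lambda>x. 2 * u x * \<phi> x) \<in> borel_measurable lebesgue"
        using ut[of 0] smooth_measurable[OF \<phi>(1)] by simp
      ultimately have "integrable lebesgue (\<lambda>x. g x * (2 * u x * \<phi> x))"
        by (intro integrable_mult_bounded[OF g])
      then have 2: "integrable lebesgue (\<lambda>x. 2 * u x * g x * \<phi> x)" by (simp add: mult_ac)
      have "\<bar>(LINT x|lebesgue. 2 * u x * g x * \<phi> x) - (LINT x|lebesgue. g x * q x)\<bar> \<le>
        (LINT x|lebesgue. \<bar>2 * u x * g x * \<phi> x - g x * q x\<bar>)"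
        unfolding Bochner_Integration.integral_diff[OF 2 1, symmetric] by (rule integral_abs_bound)
      also have "\<dots> \<le> (LINT x|lebesgue. (\<epsilon> * C) * \<bar>g x\<bar>)"
      proof (rule integral_mono)
        show "\<bar>2 * u x * g x * \<phi> x - g x * q x\<bar> \<le> \<epsilon> * C * \<bar>g x\<bar>" for x
        proof (cases "x \<in> K")
          case True
          then have "x \<in> N" using KN by auto
          then have "\<bar>2 * u x - Q x\<bar> * \<bar>\<phi> x\<bar> * \<bar>g x\<bar> \<le> \<epsilon> * C * \<bar>g x\<bar>"
            using Q(2)[of x] C(2)[of x] \<epsilon> uN by (intro mult_right_mono mult_mono) auto
          then show ?thesis by (simp add: abs_mult[symmetric] q_def algebra_simps)
        next
          case False
          then show ?thesis using \<epsilon> C by (simp add: \<phi> q_def)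
        qed
      qed (use 1 2 g in auto)
      finally show ?thesis by simp
    qed
    ultimately show ?thesis unfolding L_def by (simp add: algebra_simps)
  qed
  then have "\<bar>L\<bar> \<le> 0" by (rule le_of_forall_pos_add_mult)
  then show ?thesis by (simp add: L_def)
qed

section \<open>Local integrability\<close>

lemma AE_lebesgue_on_iff_negligible:
  assumes "\<Omega> \<in> sets lebesgue"
  shows "(AE x in lebesgue_on \<Omega>. P x) \<longleftrightarrow> negligible {x \<in> \<Omega>. \<not> P x}"
proof -
  have "(AE x in lebesgue_on \<Omega>. P x) \<longleftrightarrow> (AE x in lebesgue. x \<in> \<Omega> \<longrightarrow> P x)"
    using assms by (intro AE_restrict_space_iff) simp
  also have "\<dots> \<longleftrightarrow> negligible {x \<in> \<Omega>. \<not> P x}"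
  proof
    assume "AE x in lebesgue. x \<in> \<Omega> \<longrightarrow> P x"
    then obtain N where N: "{x \<in> space lebesgue. \<not> (x \<in> \<Omega> \<longrightarrow> P x)} \<subseteq> N" "emeasure lebesgue N = 0" "N \<in> sets lebesgue"
      by (rule AE_E)
    then have "negligible N" by (auto simp: negligible_iff_null_sets)
    then show "negligible {x \<in> \<Omega>. \<not> P x}" by (rule negligible_subset) (use N in auto)
  next
    assume "negligible {x \<in> \<Omega>. \<not> P x}"
    then show "AE x in lebesgue. x \<in> \<Omega> \<longrightarrow> P x"
      by (intro AE_I'[of "{x \<in> \<Omega>. \<not> P x}"]) (auto simp: negligible_iff_null_sets)
  qed
  finally show ?thesis .
qed

lemma loc_integrable_cong_AE:
  fixes v w :: "'a::euclidean_space \<Rightarrow> 'b::euclidean_space"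
  assumes \<Omega>: "\<Omega> \<in> sets lebesgue" and v: "loc_integrable \<Omega> v" and eq: "AE x in lebesgue_on \<Omega>. v x = w x"
  shows "loc_integrable \<Omega> w"
  unfolding loc_integrable_def
proof (intro allI impI)
  fix K assume K: "compact K \<and> K \<subseteq> \<Omega>"
  show "set_integrable lebesgue K w"
    by (rule absolutely_integrable_spike[where f = v and S = "{x \<in> \<Omega>. v x \<noteq> w x}"])
      (use v K eq in \<open>auto simp: loc_integrable_def AE_lebesgue_on_iff_negligible[OF \<Omega>]\<close>)
qed

lemma loc_integrable_add: "loc_integrable \<Omega> v \<Longrightarrow> loc_integrable \<Omega> w \<Longrightarrow> loc_integrable \<Omega> (\<lambda>x. v x + w x)"
  by (auto simp: loc_integrable_def intro!: set_integral_add)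

lemma loc_integrable_cmult:
  fixes v :: "'a::euclidean_space \<Rightarrow> real"
  shows "loc_integrable \<Omega> v \<Longrightarrow> loc_integrable \<Omega> (\<lambda>x. c * v x)"
  by (auto simp: loc_integrable_def intro!: set_integrable_mult_right)

lemma loc_integrable_sum:
  "finite I \<Longrightarrow> (\<And>i. i \<in> I \<Longrightarrow> loc_integrable \<Omega> (v i)) \<Longrightarrow> loc_integrable \<Omega> (\<lambda>x. \<Sum>i\<in>I. v i x)"
proof (induction I rule: finite_induct)
  case empty
  show ?case by (simp add: loc_integrable_def set_integrable_def)
next
  case (insert i I)
  then show ?case using loc_integrable_add[of \<Omega> "v i" "\<lambda>x. \<Sum>i\<in>I. v i x"] by simp
qed

lemma loc_integrable_inner:
  fixes v :: "'a::euclidean_space \<Rightarrow> 'b::euclidean_space"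
  shows "loc_integrable \<Omega> v \<Longrightarrow> loc_integrable \<Omega> (\<lambda>x. v x \<bullet> b)"
  unfolding loc_integrable_def set_integrable_def
  by (auto dest!: spec mp intro: integrable_inner_left simp flip: inner_scaleR_left)

lemma loc_integrable_vector:
  fixes v :: "'a::euclidean_space \<Rightarrow> 'b::euclidean_space"
  assumes "\<And>b. b \<in> Basis \<Longrightarrow> loc_integrable \<Omega> (\<lambda>x. v x \<bullet> b)"
  shows "loc_integrable \<Omega> v"
  unfolding loc_integrable_def
proof (intro allI impI)
  fix K assume "compact K \<and> K \<subseteq> \<Omega>"
  then show "set_integrable lebesgue K v"
    using assms by (subst absolutely_integrable_componentwise_iff) (auto simp: loc_integrable_def)
qed

lemma loc_integrable_mult_continuous:
  fixes v w :: "'a::euclidean_space \<Rightarrow> real"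
  assumes "continuous_on \<Omega> v" "loc_integrable \<Omega> w"
  shows "loc_integrable \<Omega> (\<lambda>x. v x * w x)"
  unfolding loc_integrable_def
proof (intro allI impI)
  fix K assume K: "compact K \<and> K \<subseteq> \<Omega>"
  have v: "continuous_on K v" using assms K continuous_on_subset by blast
  show "set_integrable lebesgue K (\<lambda>x. v x * w x)"
  proof (rule absolutely_integrable_bounded_measurable_product[OF bilinear_times])
    show "K \<in> sets lebesgue" using K lmeasurable_compact by blast
    then show "v \<in> borel_measurable (lebesgue_on K)"
      by (rule continuous_imp_measurable_on_sets_lebesgue[OF v])
    show "bounded (v ` K)" using v K by (auto intro: compact_imp_bounded compact_continuous_image)
    show "set_integrable lebesgue K w" using assms K by (auto simp: loc_integrable_def)
  qed
qed

lemma continuous_imp_loc_integrable: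
  fixes v :: "'a::euclidean_space \<Rightarrow> real"
  assumes "continuous_on \<Omega> v"
  shows "loc_integrable \<Omega> v"
proof -
  have "loc_integrable \<Omega> (\<lambda>x. 1::real)"
    unfolding loc_integrable_def
    by (auto intro!: absolutely_integrable_on_const lmeasurable_compact)
  from loc_integrable_mult_continuous[OF assms this] show ?thesis by simp
qed

lemma loc_integral_compact_support:
  fixes v \<phi> :: "'a::euclidean_space \<Rightarrow> real"
  assumes "open \<Omega>" "K \<subseteq> \<Omega>" "\<And>x. x \<notin> K \<Longrightarrow> \<phi> x = 0"
  shows "(LINT x|lebesgue_on \<Omega>. v x * \<phi> x) = (LINT x|lebesgue. (indicator K x * v x) * \<phi> x)"
proof -
  have "\<Omega> \<in> sets lebesgue" using assms by auto
  then have "(LINT x|lebesgue_on \<Omega>. v x * \<phi> x) = (LINT x|lebesgue. indicator \<Omega> x *\<^sub>R (v x * \<phi> x))"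
    by (intro integral_restrict_space) simp
  also have "\<dots> = (LINT x|lebesgue. (indicator K x * v x) * \<phi> x)"
    using assms(2,3) by (intro Bochner_Integration.integral_cong) (auto simp: indicator_def)
  finally show ?thesis .
qed

lemma integrable_loc_integrable_mult:
  fixes v \<phi> :: "'a::euclidean_space \<Rightarrow> real"
  assumes \<Omega>: "open \<Omega>" and v: "loc_integrable \<Omega> v" and \<phi>: "test_fun \<Omega> \<phi>"
  shows "integrable (lebesgue_on \<Omega>) (\<lambda>x. v x * \<phi> x)"
proof -
  obtain K where K: "smooth \<phi>" "compact K" "K \<subseteq> \<Omega>" "\<And>x. x \<notin> K \<Longrightarrow> \<phi> x = 0"
    using test_funE[OF \<phi>] by metis
  obtain B where B: "\<And>x. \<bar>\<phi> x\<bar> \<le> B" using test_fun_bounded[OF \<phi>] by metis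
  have "integrable lebesgue (\<lambda>x. indicator K x * v x)"
    using v K by (auto simp: loc_integrable_def set_integrable_def)
  from integrable_mult_bounded[OF this smooth_measurable[OF K(1)] B]
  have "integrable lebesgue (\<lambda>x. (indicator K x * v x) * \<phi> x)" .
  also have "(\<lambda>x. (indicator K x * v x) * \<phi> x) = (\<lambda>x. indicator \<Omega> x *\<^sub>R (v x * \<phi> x))"
    using K(3,4) by (auto simp: fun_eq_iff indicator_def)
  finally show ?thesis using \<Omega> by (subst integrable_restrict_space) auto
qed

text \<open>
  Testing with the bumps of \<open>test_fun_box\<close> shows that \<open>h\<close> has integral zero over every box in \<open>\<Omega>\<close>. By
  Lebesgue differentiation over small cubes, \<open>h\<close> vanishes almost everywhere.
\<close>

lemma fundamental_lemma:
  fixes h :: "'a::euclidean_space \<Rightarrow> real"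
  assumes \<Omega>: "open \<Omega>" and h: "loc_integrable \<Omega> h"
    and z: "\<And>\<phi>. test_fun \<Omega> \<phi> \<Longrightarrow> (LINT x|lebesgue_on \<Omega>. h x * \<phi> x) = 0"
  shows "AE x in lebesgue_on \<Omega>. h x = 0"
proof -
  have box0: "integral (cbox a b) h = 0" if ab: "cbox a b \<subseteq> \<Omega>" for a b
  proof -
    have hK: "integrable lebesgue (\<lambda>x. indicator (cbox a b) x * h x)"
      using h ab by (auto simp: loc_integrable_def set_integrable_def)
    have hB: "set_integrable lebesgue (box a b) h"
      using h ab box_subset_cbox[of a b] set_integrable_subset[of lebesgue "cbox a b" h "box a b"]
      by (auto simp: loc_integrable_def)
    obtain \<phi> where \<phi>: "\<And>n. test_fun \<Omega> (\<phi> n)" "\<And>n x. \<bar>\<phi> n x\<bar> \<le> indicator (cbox a b) x"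
      "\<And>x. (\<lambda>n::nat. \<phi> n x) \<longlonglongrightarrow> indicator (box a b) x"
      using test_fun_box[OF ab] by metis
    have 0: "(LINT x|lebesgue. (indicator (cbox a b) x * h x) * \<phi> n x) = 0" for n
    proof -
      have "\<phi> n x = 0" if "x \<notin> cbox a b" for x using \<phi>(2)[of n x] that by simp
      from loc_integral_compact_support[OF \<Omega> ab this, of "\<lambda>x. x" h] z[OF \<phi>(1)[of n]] show ?thesis by simp
    qed
    have "(\<lambda>n. LINT x|lebesgue. (indicator (cbox a b) x * h x) * \<phi> n x) \<longlonglongrightarrow>
      (LINT x|lebesgue. (indicator (cbox a b) x * h x) * indicator (box a b) x)"
    proof (rule integral_dominated_convergence[where w = "\<lambda>x. \<bar>indicator (cbox a b) x * h x\<bar>"])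
      show "AE x in lebesgue. norm (indicator (cbox a b) x * h x * \<phi> n x) \<le> \<bar>indicator (cbox a b) x * h x\<bar>" for n
      proof (intro AE_I2)
        fix x
        have "\<bar>\<phi> n x\<bar> \<le> 1" using \<phi>(2)[of n x] by (cases "x \<in> cbox a b") auto
        then show "norm (indicator (cbox a b) x * h x * \<phi> n x) \<le> \<bar>indicator (cbox a b) x * h x\<bar>"
          unfolding real_norm_def abs_mult by (simp add: mult_left_le)
      qed
      show "(\<lambda>x. (indicator (cbox a b) x * h x) * indicator (box a b) x) \<in> borel_measurable lebesgue"
        by (intro borel_measurable_times[OF borel_measurable_integrable[OF hK]] borel_measurable_indicator) simp
      show "(\<lambda>x. (indicator (cbox a b) x * h x) * \<phi> n x) \<in> borel_measurable lebesgue" for n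
        by (intro borel_measurable_times[OF borel_measurable_integrable[OF hK]]
            smooth_measurable[OF test_fun_smooth[OF \<phi>(1)]])
      show "integrable lebesgue (\<lambda>x. \<bar>indicator (cbox a b) x * h x\<bar>)"
        using hK by (rule integrable_abs)
      show "AE x in lebesgue. (\<lambda>n. (indicator (cbox a b) x * h x) * \<phi> n x) \<longlonglongrightarrow>
          (indicator (cbox a b) x * h x) * indicator (box a b) x"
        by (intro AE_I2 tendsto_mult tendsto_const \<phi>(3))
    qed
    then have "(LINT x|lebesgue. (indicator (cbox a b) x * h x) * indicator (box a b) x) = 0"
      by (simp only: 0 LIMSEQ_const_iff)
    also have "(LINT x|lebesgue. (indicator (cbox a b) x * h x) * indicator (box a b) x) = (LINT x:box a b|lebesgue. h x)"
      unfolding set_lebesgue_integral_def using box_subset_cbox[of a b]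
      by (intro Bochner_Integration.integral_cong) (auto simp: indicator_def)
    also have "\<dots> = integral (box a b) h" by (rule set_lebesgue_integral_eq_integral(2)[OF hB])
    also have "\<dots> = integral (cbox a b) h" by (rule integral_open_interval)
    finally show ?thesis .
  qed
  have neg: "negligible {x \<in> cbox c d. h x \<noteq> 0}" if cd: "cbox c d \<subseteq> \<Omega>" for c d
  proof -
    let ?f = "\<lambda>x. if x \<in> cbox c d then h x else 0"
    have "h integrable_on cbox c d"
      using h cd by (auto simp: loc_integrable_def absolutely_integrable_on_def)
    then have "?f integrable_on UNIV" by (simp add: integrable_restrict_UNIV)
    then have f: "?f integrable_on cbox a b" for a b by (rule integrable_on_subcbox) simp
    obtain N where N: "negligible N" "\<And>x e. x \<notin> N \<Longrightarrow> 0 < e \<Longrightarrow>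
      \<exists>\<delta>>0. \<forall>t. 0 < t \<and> t < \<delta> \<longrightarrow> norm (integral (cbox x (x + t *\<^sub>R One)) ?f /\<^sub>R t ^ DIM('a) - ?f x) < e"
      by (rule integrable_ccontinuous_explicit[of ?f, OF f]) (rule that)
    have "{x \<in> cbox c d. h x \<noteq> 0} \<subseteq> N \<union> (cbox c d - box c d)"
    proof (rule subsetI, rule ccontr)
      fix x assume "x \<in> {x \<in> cbox c d. h x \<noteq> 0}" "x \<notin> N \<union> (cbox c d - box c d)"
      then have x: "x \<in> cbox c d" "h x \<noteq> 0" "x \<notin> N" and xb: "x \<in> box c d" by auto
      obtain \<delta> where \<delta>: "\<delta> > 0" "\<forall>t. 0 < t \<and> t < \<delta> \<longrightarrow>
        norm (integral (cbox x (x + t *\<^sub>R One)) ?f /\<^sub>R t ^ DIM('a) - ?f x) < \<bar>h x\<bar>"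
        using N(2)[OF \<open>x \<notin> N\<close>, of "\<bar>h x\<bar>"] x by auto
      \<comment> \<open>Cubes at \<open>x\<close> with an edge below \<open>m\<close> stay inside the box.\<close>
      define m where "m = Min ((\<lambda>i. d \<bullet> i - x \<bullet> i) ` Basis)"
      have m: "m > 0" unfolding m_def using xb by (subst Min_gr_iff) (auto simp: mem_box)
      have mi: "m \<le> d \<bullet> i - x \<bullet> i" if "i \<in> Basis" for i
        unfolding m_def using that by (intro Min_le) auto
      define t where "t = min m \<delta> / 2"
      have t: "0 < t" "t < \<delta>" "t \<le> m" using m \<delta> by (auto simp: t_def)
      have sub: "cbox x (x + t *\<^sub>R One) \<subseteq> cbox c d"
      proof
        fix y assume y: "y \<in> cbox x (x + t *\<^sub>R One)"
        show "y \<in> cbox c d" unfolding mem_box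
        proof (intro ballI conjI)
          fix i :: 'a assume i: "i \<in> Basis"
          have "x \<bullet> i \<le> y \<bullet> i" "y \<bullet> i \<le> x \<bullet> i + t" "c \<bullet> i \<le> x \<bullet> i"
            using x(1) y i by (auto simp: mem_box inner_add_left)
          then show "c \<bullet> i \<le> y \<bullet> i" "y \<bullet> i \<le> d \<bullet> i" using mi[OF i] t by linarith+
        qed
      qed
      have "integral (cbox x (x + t *\<^sub>R One)) ?f = integral (cbox x (x + t *\<^sub>R One)) h"
        using sub by (intro integral_cong) auto
      also have "\<dots> = 0" using sub cd by (intro box0) auto
      finally show False using \<delta>(2)[rule_format, of t] t x by simp
    qed
    moreover have "negligible (N \<union> (cbox c d - box c d))"
      by (intro negligible_Un N(1) negligible_frontier_interval)
    ultimately show ?thesis by (metis negligible_subset)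
  qed
  obtain \<D> where \<D>: "countable \<D>" "\<D> \<subseteq> Pow \<Omega>" "\<And>X. X \<in> \<D> \<Longrightarrow> \<exists>a b. X = cbox a b" "\<Union>\<D> = \<Omega>"
    using open_countable_Union_open_cbox[OF \<Omega>] by metis
  have "negligible (\<Union>X\<in>\<D>. {x \<in> X. h x \<noteq> 0})"
  proof (intro negligible_countable_Union countable_image \<D>(1))
    fix S assume "S \<in> (\<lambda>X. {x \<in> X. h x \<noteq> 0}) ` \<D>"
    then obtain X where X: "X \<in> \<D>" "S = {x \<in> X. h x \<noteq> 0}" by auto
    obtain a b where "X = cbox a b" using \<D>(3)[OF X(1)] by auto
    then show "negligible S" using X \<D>(2) neg[of a b] by auto
  qed
  moreover have "(\<Union>X\<in>\<D>. {x \<in> X. h x \<noteq> 0}) = {x \<in> \<Omega>. h x \<noteq> 0}" using \<D>(4) by auto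
  ultimately show ?thesis using \<Omega> by (simp add: AE_lebesgue_on_iff_negligible)
qed

section \<open>Weak partial derivatives\<close>

text \<open>
  One component of \<open>weak_grad\<close>: linearity, uniqueness and the product rule are proved for a single
  direction and only then assembled into gradients.
\<close>

definition weak_deriv :: "'a::euclidean_space set \<Rightarrow> 'a \<Rightarrow> ('a \<Rightarrow> real) \<Rightarrow> ('a \<Rightarrow> real) \<Rightarrow> bool" where
  "weak_deriv \<Omega> b v g \<longleftrightarrow> loc_integrable \<Omega> v \<and> loc_integrable \<Omega> g \<and>
     (\<forall>\<phi>. test_fun \<Omega> \<phi> \<longrightarrow>
        (LINT x|lebesgue_on \<Omega>. v x * (grad \<phi> x \<bullet> b)) = - (LINT x|lebesgue_on \<Omega>. g x * \<phi> x))"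

lemma weak_grad_iff:
  "weak_grad \<Omega> v g \<longleftrightarrow> (\<forall>b\<in>Basis. weak_deriv \<Omega> b v (\<lambda>x. g x \<bullet> b))"
proof -
  obtain b0 :: 'a where "b0 \<in> Basis" using nonempty_Basis by blast
  moreover have "loc_integrable \<Omega> g \<longleftrightarrow> (\<forall>b\<in>Basis. loc_integrable \<Omega> (\<lambda>x. g x \<bullet> b))"
    using loc_integrable_vector loc_integrable_inner by blast
  ultimately show ?thesis unfolding weak_grad_def weak_deriv_def by blast
qed

lemma weak_deriv_add:
  assumes "open \<Omega>" "b \<in> Basis" "weak_deriv \<Omega> b v gv" "weak_deriv \<Omega> b w gw"
  shows "weak_deriv \<Omega> b (\<lambda>x. v x + w x) (\<lambda>x. gv x + gw x)"
  using assms integrable_loc_integrable_mult[OF assms(1)]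
  by (auto simp: weak_deriv_def distrib_right test_fun_grad intro!: loc_integrable_add)

lemma weak_deriv_cmult:
  assumes "open \<Omega>" "b \<in> Basis" "weak_deriv \<Omega> b v g"
  shows "weak_deriv \<Omega> b (\<lambda>x. c * v x) (\<lambda>x. c * g x)"
  using assms by (auto simp: weak_deriv_def mult.assoc loc_integrable_cmult)

lemma weak_deriv_cong_AE:
  assumes \<Omega>: "open \<Omega>" and d: "weak_deriv \<Omega> b v g"
    and eq: "ae_eq \<Omega> v v'" "ae_eq \<Omega> g g'"
    and b: "b \<in> Basis"
  shows "weak_deriv \<Omega> b v' g'"
proof -
  have S: "\<Omega> \<in> sets lebesgue" using \<Omega> by auto
  have l: "loc_integrable \<Omega> v'" "loc_integrable \<Omega> g'"
    using d eq loc_integrable_cong_AE[OF S] by (auto simp: weak_deriv_def ae_eq_def)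
  have c: "(LINT x|lebesgue_on \<Omega>. f x * \<phi> x) = (LINT x|lebesgue_on \<Omega>. f' x * \<phi> x)"
    if "ae_eq \<Omega> f f'" "test_fun \<Omega> \<phi>" "loc_integrable \<Omega> f" "loc_integrable \<Omega> f'" for f f' \<phi>
  proof (rule integral_cong_AE)
    show "AE x in lebesgue_on \<Omega>. f x * \<phi> x = f' x * \<phi> x" using that by (auto simp: ae_eq_def)
    show "(\<lambda>x. f x * \<phi> x) \<in> borel_measurable (lebesgue_on \<Omega>)" "(\<lambda>x. f' x * \<phi> x) \<in> borel_measurable (lebesgue_on \<Omega>)"
      using integrable_loc_integrable_mult[OF \<Omega> that(3,2)] integrable_loc_integrable_mult[OF \<Omega> that(4,2)]
      by (auto dest: borel_measurable_integrable)
  qed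
  have "(LINT x|lebesgue_on \<Omega>. v' x * (grad \<phi> x \<bullet> b)) = - (LINT x|lebesgue_on \<Omega>. g' x * \<phi> x)"
    if \<phi>: "test_fun \<Omega> \<phi>" for \<phi>
  proof -
    have "(LINT x|lebesgue_on \<Omega>. v x * (grad \<phi> x \<bullet> b)) = (LINT x|lebesgue_on \<Omega>. v' x * (grad \<phi> x \<bullet> b))"
      using d by (intro c[OF eq(1) test_fun_grad[OF \<phi> b] _ l(1)]) (simp add: weak_deriv_def)
    moreover have "(LINT x|lebesgue_on \<Omega>. g x * \<phi> x) = (LINT x|lebesgue_on \<Omega>. g' x * \<phi> x)"
      using d by (intro c[OF eq(2) \<phi> _ l(2)]) (simp add: weak_deriv_def)
    ultimately show ?thesis using d \<phi> by (simp add: weak_deriv_def)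
  qed
  then show ?thesis using l by (simp add: weak_deriv_def)
qed

lemma weak_deriv_unique:
  assumes \<Omega>: "open \<Omega>" and b: "b \<in> Basis" and "weak_deriv \<Omega> b v g" "weak_deriv \<Omega> b v g'"
  shows "ae_eq \<Omega> g g'"
proof -
  have "AE x in lebesgue_on \<Omega>. g x + (-1) * g' x = 0"
  proof (rule fundamental_lemma[OF \<Omega>])
    show "loc_integrable \<Omega> (\<lambda>x. g x + (-1) * g' x)"
      using assms by (intro loc_integrable_add loc_integrable_cmult) (auto simp: weak_deriv_def)
    show "(LINT x|lebesgue_on \<Omega>. (g x + (-1) * g' x) * \<phi> x) = 0" if "test_fun \<Omega> \<phi>" for \<phi>
      using assms that integrable_loc_integrable_mult[OF \<Omega>]
      by (simp add: weak_deriv_def left_diff_distrib)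
  qed
  then show ?thesis by (simp add: ae_eq_def)
qed

text \<open>
  The global statement reduces to \<open>weak_derivative_square\<close> on a compact neighbourhood \<open>N\<close> of the support of the
  test function.
\<close>

lemma weak_deriv_square:
  assumes \<Omega>: "open \<Omega>" and b: "b \<in> Basis" and v: "continuous_on \<Omega> v" and d: "weak_deriv \<Omega> b v g"
  shows "weak_deriv \<Omega> b (\<lambda>x. v x * v x) (\<lambda>x. 2 * (v x * g x))"
proof -
  have gl: "loc_integrable \<Omega> g" using d by (simp add: weak_deriv_def)
  have main: "(LINT x|lebesgue_on \<Omega>. (v x * v x) * (grad \<phi> x \<bullet> b)) = - (LINT x|lebesgue_on \<Omega>. (2 * (v x * g x)) * \<phi> x)"
    if \<phi>: "test_fun \<Omega> \<phi>" for \<phi>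
  proof -
    obtain K where K: "smooth \<phi>" "compact K" "K \<subseteq> \<Omega>" "\<And>x. x \<notin> K \<Longrightarrow> \<phi> x = 0"
      "\<And>x. x \<notin> K \<Longrightarrow> grad \<phi> x = 0"
      using test_funE[OF \<phi>] by metis
    obtain \<delta> where \<delta>: "\<delta> > 0" "(\<Union>x\<in>K. cball x \<delta>) \<subseteq> \<Omega>"
      using compact_subset_open_imp_cball_epsilon_subset[OF K(2) \<Omega> K(3)] by metis
    define N where "N = {x + y |x y. x \<in> K \<and> y \<in> cball 0 \<delta>}"
    have N: "compact N" unfolding N_def using K by (intro compact_sums) auto
    have KN: "cball x \<delta> \<subseteq> N" if "x \<in> K" for x
    proof
      fix y assume "y \<in> cball x \<delta>"
      then have "y = x + (y - x)" "y - x \<in> cball 0 \<delta>" by (auto simp: dist_norm norm_minus_commute)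
      then show "y \<in> N" unfolding N_def using that by blast
    qed
    have N\<Omega>: "N \<subseteq> \<Omega>"
    proof
      fix z assume "z \<in> N"
      then obtain x y where "x \<in> K" "y \<in> cball 0 \<delta>" "z = x + y" by (auto simp: N_def)
      then have "z \<in> cball x \<delta>" by (simp add: dist_norm)
      then show "z \<in> \<Omega>" using \<delta> \<open>x \<in> K\<close> by blast
    qed
    have KN': "x \<in> N" if "x \<in> K" for x using KN[OF that] \<delta>(1) by (meson centre_in_cball less_imp_le subsetD)
    have K0: "\<phi> x = 0" "grad \<phi> x \<bullet> b = 0" if "x \<notin> N" for x
      using K(4,5)[of x] KN'[of x] that by (cases "x \<in> K"; simp)+
    define u where "u = (\<lambda>x. indicator N x *\<^sub>R v x)"
    define g' where "g' x = indicator N x * g x" for x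
    have g': "integrable lebesgue g'"
      using gl N N\<Omega> unfolding g'_def[abs_def] by (auto simp: loc_integrable_def set_integrable_def)
    have wd: "(LINT x|lebesgue. u x * (grad \<psi> x \<bullet> b)) = - (LINT x|lebesgue. g' x * \<psi> x)" if \<psi>: "test_fun N \<psi>" for \<psi>
    proof -
      obtain L where L: "smooth \<psi>" "compact L" "L \<subseteq> N" "\<And>x. x \<notin> L \<Longrightarrow> \<psi> x = 0"
        "\<And>x. x \<notin> L \<Longrightarrow> grad \<psi> x = 0"
        using test_funE[OF \<psi>] by metis
      have L0: "\<psi> x = 0" "grad \<psi> x \<bullet> b = 0" if "x \<notin> N" for x
        using that L(3) L(4,5)[of x] by (cases "x \<in> L"; auto)+
      have "test_fun \<Omega> \<psi>" using L N\<Omega> by (intro test_funI[of _ L]) auto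
      then have "(LINT x|lebesgue_on \<Omega>. v x * (grad \<psi> x \<bullet> b)) = - (LINT x|lebesgue_on \<Omega>. g x * \<psi> x)"
        using d by (simp add: weak_deriv_def)
      moreover have "(LINT x|lebesgue_on \<Omega>. v x * (grad \<psi> x \<bullet> b)) = (LINT x|lebesgue. u x * (grad \<psi> x \<bullet> b))"
        using loc_integral_compact_support[where v = v and \<phi> = "\<lambda>x. grad \<psi> x \<bullet> b", OF \<Omega> N\<Omega> L0(2)] by (simp add: u_def)
      moreover have "(LINT x|lebesgue_on \<Omega>. g x * \<psi> x) = (LINT x|lebesgue. g' x * \<psi> x)"
        using loc_integral_compact_support[where v = g and \<phi> = \<psi>, OF \<Omega> N\<Omega> L0(1)] by (simp add: g'_def)
      ultimately show ?thesis by simp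
    qed
    have cN: "continuous_on N v" using v N\<Omega> continuous_on_subset by blast
    have "(LINT x|lebesgue. (u x)\<^sup>2 * (grad \<phi> x \<bullet> b)) = - (LINT x|lebesgue. 2 * u x * g' x * \<phi> x)"
      by (rule weak_derivative_square[OF N cN g' b u_def wd K(2) KN \<delta>(1) K(1) K(4)])
    moreover have "(LINT x|lebesgue_on \<Omega>. (v x * v x) * (grad \<phi> x \<bullet> b)) = (LINT x|lebesgue. (u x)\<^sup>2 * (grad \<phi> x \<bullet> b))"
      by (rule trans[OF loc_integral_compact_support[where v = "\<lambda>x. v x * v x" and \<phi> = "\<lambda>x. grad \<phi> x \<bullet> b", OF \<Omega> N\<Omega> K0(2)]], assumption,
          intro Bochner_Integration.integral_cong refl) (auto simp: u_def power2_eq_square indicator_def)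
    moreover have "(LINT x|lebesgue_on \<Omega>. (2 * (v x * g x)) * \<phi> x) = (LINT x|lebesgue. 2 * u x * g' x * \<phi> x)"
      by (rule trans[OF loc_integral_compact_support[where v = "\<lambda>x. 2 * (v x * g x)" and \<phi> = \<phi>, OF \<Omega> N\<Omega> K0(1)]], assumption,
          intro Bochner_Integration.integral_cong refl) (auto simp: u_def g'_def indicator_def)
    ultimately show ?thesis by simp
  qed
  have "loc_integrable \<Omega> (\<lambda>x. v x * v x)"
    using v by (intro continuous_imp_loc_integrable continuous_intros)
  moreover have "loc_integrable \<Omega> (\<lambda>x. 2 * (v x * g x))"
    by (intro loc_integrable_cmult loc_integrable_mult_continuous v gl)
  ultimately show ?thesis using main by (simp add: weak_deriv_def)
qed

text \<open>
  Polarization of \<open>weak_deriv_square\<close>: \<open>2 v w = (v + w)\<^sup>2 - v\<^sup>2 - w\<^sup>2\<close>.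
\<close>

lemma weak_deriv_mult:
  assumes \<Omega>: "open \<Omega>" and b: "b \<in> Basis" and v: "continuous_on \<Omega> v" "weak_deriv \<Omega> b v gv"
    and w: "continuous_on \<Omega> w" "weak_deriv \<Omega> b w gw"
  shows "weak_deriv \<Omega> b (\<lambda>x. v x * w x) (\<lambda>x. v x * gw x + w x * gv x)"
proof -
  have 1: "weak_deriv \<Omega> b (\<lambda>x. (v x + w x) * (v x + w x)) (\<lambda>x. 2 * ((v x + w x) * (gv x + gw x)))"
    by (rule weak_deriv_square[OF \<Omega> b _ weak_deriv_add[OF \<Omega> b v(2) w(2)]]) (use v w in \<open>intro continuous_intros\<close>)
  note 2 = weak_deriv_cmult[OF \<Omega> b weak_deriv_square[OF \<Omega> b v], of "-1"]
  note 3 = weak_deriv_cmult[OF \<Omega> b weak_deriv_square[OF \<Omega> b w], of "-1"]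
  note weak_deriv_cmult[OF \<Omega> b weak_deriv_add[OF \<Omega> b 1 weak_deriv_add[OF \<Omega> b 2 3]], of "1/2"]
  then show ?thesis by (simp add: algebra_simps)
qed

text \<open>
  The increments of \<open>\<phi>\<close> have integral zero by translation invariance, and so have their quotients in the limit.
\<close>

lemma integral_grad_eq_0:
  assumes \<phi>: "test_fun UNIV \<phi>" and b: "b \<in> Basis"
  shows "(LINT x|lebesgue. grad \<phi> x \<bullet> b) = 0"
proof -
  obtain K where K: "smooth \<phi>" "compact K" "\<And>x. x \<notin> K \<Longrightarrow> \<phi> x = 0" "\<And>x. x \<notin> K \<Longrightarrow> grad \<phi> x = 0"
    using test_funE[OF \<phi>] by metis
  define N where "N = {x + y |x y. x \<in> K \<and> y \<in> cball 0 (1::real)}"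
  have N: "compact N" unfolding N_def using K by (intro compact_sums) auto
  have KN: "x - y \<in> N" if "x \<in> K" "norm y \<le> 1" for x y
  proof -
    have "x - y = x + (- y)" "- y \<in> cball 0 1" using that by auto
    then show ?thesis unfolding N_def using that(1) by blast
  qed
  have N0: "x \<in> N" if "x \<in> K" for x using KN[OF that, of 0] by simp
  let ?u = "indicator N :: 'a \<Rightarrow> real"
  have u: "integrable lebesgue ?u"
    using lmeasurable_compact[OF N] by (auto simp: fmeasurable_def)
  obtain B where B: "\<And>x. \<bar>\<phi> x\<bar> \<le> B" using test_fun_bounded[OF \<phi>] by metis
  have \<phi>i: "integrable lebesgue \<phi>"
  proof -
    have "integrable lebesgue (\<lambda>x. ?u x * \<phi> x)"
      by (rule integrable_mult_bounded[OF u smooth_measurable[OF K(1)] B])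
    also have "(\<lambda>x. ?u x * \<phi> x) = \<phi>" using K(3) N0 by (auto simp: fun_eq_iff indicator_def)
    finally show ?thesis .
  qed
  have "((\<lambda>h. (LINT x|lebesgue. ?u x * (\<phi> (x + h *\<^sub>R b) - \<phi> x)) / h) \<longlongrightarrow>
    (LINT x|lebesgue. ?u x * (grad \<phi> x \<bullet> b))) (at 0)"
    by (rule diffquot_integral_tendsto[OF u \<phi> b])
  moreover have "\<forall>\<^sub>F h in at 0. (LINT x|lebesgue. ?u x * (\<phi> (x + h *\<^sub>R b) - \<phi> x)) / h = 0"
  proof -
    have "(LINT x|lebesgue. ?u x * (\<phi> (x + h *\<^sub>R b) - \<phi> x)) = 0" if h: "\<bar>h\<bar> < 1" for h
    proof -
      have hN: "x \<in> N" if "x + h *\<^sub>R b \<in> K" for x using KN[OF that, of "h *\<^sub>R b"] h b by simp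
      have "?u x * (\<phi> (x + h *\<^sub>R b) - \<phi> x) = \<phi> (x + h *\<^sub>R b) - \<phi> x" for x
      proof (cases "x \<in> N")
        case False
        then have "x \<notin> K" "x + h *\<^sub>R b \<notin> K" using N0 hN by blast+
        then show ?thesis by (simp add: K(3))
      qed simp
      then have "(LINT x|lebesgue. ?u x * (\<phi> (x + h *\<^sub>R b) - \<phi> x)) = (LINT x|lebesgue. \<phi> (x + h *\<^sub>R b) - \<phi> x)"
        by (simp only:)
      also have "\<dots> = 0"
        using integral_lebesgue_translate[of \<phi> "h *\<^sub>R b"] \<phi>i integrable_lebesgue_translate[OF \<phi>i] by simp
      finally show ?thesis .
    qed
    then show ?thesis unfolding eventually_at by (intro exI[of _ 1]) (auto simp: dist_real_def)
  qed
  ultimately have "((\<lambda>h. 0) \<longlongrightarrow> (LINT x|lebesgue. ?u x * (grad \<phi> x \<bullet> b))) (at (0::real))"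
    by (rule Lim_transform_eventually)
  then have "(LINT x|lebesgue. ?u x * (grad \<phi> x \<bullet> b)) = 0" by (simp add: tendsto_const_iff)
  moreover have "(\<lambda>x. ?u x * (grad \<phi> x \<bullet> b)) = (\<lambda>x. grad \<phi> x \<bullet> b)"
  proof
    show "?u x * (grad \<phi> x \<bullet> b) = grad \<phi> x \<bullet> b" for x
      using K(4)[of x] N0[of x] by (cases "x \<in> K") auto
  qed
  ultimately show ?thesis by simp
qed

lemma weak_deriv_test_fun:
  assumes \<Omega>: "open \<Omega>" and b: "b \<in> Basis" and \<phi>: "test_fun \<Omega> \<phi>"
  shows "weak_deriv \<Omega> b \<phi> (\<lambda>x. grad \<phi> x \<bullet> b)"
proof -
  have sm: "smooth \<phi>" "smooth (\<lambda>x. grad \<phi> x \<bullet> b)"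
    using test_fun_smooth[OF \<phi>] smooth_grad[OF _ b] by auto
  then have l: "loc_integrable \<Omega> \<phi>" "loc_integrable \<Omega> (\<lambda>x. grad \<phi> x \<bullet> b)"
    by (auto intro: continuous_imp_loc_integrable smooth_imp_continuous)
  have "(LINT x|lebesgue_on \<Omega>. \<phi> x * (grad \<psi> x \<bullet> b)) = - (LINT x|lebesgue_on \<Omega>. (grad \<phi> x \<bullet> b) * \<psi> x)"
    if \<psi>: "test_fun \<Omega> \<psi>" for \<psi>
  proof -
    obtain K where K: "smooth \<psi>" "compact K" "K \<subseteq> \<Omega>" "\<And>x. x \<notin> K \<Longrightarrow> \<psi> x = 0" "\<And>x. x \<notin> K \<Longrightarrow> grad \<psi> x = 0"
      using test_funE[OF \<psi>] by metis
    have p: "test_fun UNIV (\<lambda>x. \<phi> x * \<psi> x)"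
      using K sm by (intro test_funI[of _ K] smooth_mult) auto
    have i1: "integrable (lebesgue_on \<Omega>) (\<lambda>x. \<phi> x * (grad \<psi> x \<bullet> b))"
      by (rule integrable_loc_integrable_mult[OF \<Omega> l(1) test_fun_grad[OF \<psi> b]])
    have i2: "integrable (lebesgue_on \<Omega>) (\<lambda>x. (grad \<phi> x \<bullet> b) * \<psi> x)"
      by (rule integrable_loc_integrable_mult[OF \<Omega> l(2) \<psi>])
    have "(LINT x|lebesgue_on \<Omega>. \<phi> x * (grad \<psi> x \<bullet> b)) + (LINT x|lebesgue_on \<Omega>. (grad \<phi> x \<bullet> b) * \<psi> x) =
      (LINT x|lebesgue_on \<Omega>. 1 * (grad (\<lambda>x. \<phi> x * \<psi> x) x \<bullet> b))"
      using i1 i2 by (simp add: grad_mult[OF sm(1) K(1)] inner_add_left mult.commute)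
    also have "\<dots> = (LINT x|lebesgue. grad (\<lambda>x. \<phi> x * \<psi> x) x \<bullet> b)"
    proof -
      have 0: "grad (\<lambda>x. \<phi> x * \<psi> x) x \<bullet> b = 0" if "x \<notin> K" for x
        using K(4,5)[OF that] by (simp add: grad_mult[OF sm(1) K(1)])
      show ?thesis
        by (rule trans[OF loc_integral_compact_support[where v = "\<lambda>x. 1" and \<phi> = "\<lambda>x. grad (\<lambda>x. \<phi> x * \<psi> x) x \<bullet> b", OF \<Omega> K(3) 0]], assumption,
          intro Bochner_Integration.integral_cong refl) (use 0 in \<open>auto simp: indicator_def\<close>)
    qed
    also have "\<dots> = 0" by (rule integral_grad_eq_0[OF p b])
    finally show ?thesis by simp
  qed
  then show ?thesis using l by (simp add: weak_deriv_def)
qed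

section \<open>Lebesgue spaces\<close>

lemma powr_convex_combination:
  fixes x y t p :: real
  assumes "p \<ge> 1" "0 \<le> x" "0 \<le> y" "0 \<le> t" "t \<le> 1"
  shows "(t * x + (1 - t) * y) powr p \<le> t * x powr p + (1 - t) * y powr p"
proof -
  have small: "(c * r) powr p \<le> c * r powr p" if "0 \<le> c" "c \<le> 1" "0 \<le> r" for c r :: real
  proof -
    have "c powr p \<le> c powr 1" using that assms by (intro powr_mono') auto
    then have "c powr p \<le> c" using that by simp
    then show ?thesis using that by (simp add: powr_mult mult_right_mono)
  qed
  consider "x = 0" | "y = 0" | "x > 0" "y > 0" using assms by fastforce
  then show ?thesis
  proof cases
    case 1
    then show ?thesis using small[of "1 - t" y] assms by simp
  next
    case 2
    then show ?thesis using small[of t x] assms by simp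
  next
    case 3
    then show ?thesis
      using convex_onD[OF powr_convex[OF assms(1)], of "1 - t" x y] assms by simp
  qed
qed

text \<open>
  Convexity with free positive weights. Integrated with \<open>a\<close> and \<open>b\<close> slightly larger than the two norms it
  gives the triangle inequality, with no special treatment of vanishing norms.
\<close>

lemma powr_add_le_weighted:
  fixes x y a b p :: real
  assumes "p \<ge> 1" "0 \<le> x" "0 \<le> y" "0 < a" "0 < b"
  shows "(x + y) powr p \<le> (a + b) powr p * (a / (a + b) * (x powr p / a powr p) + b / (a + b) * (y powr p / b powr p))"
proof -
  define t where "t = a / (a + b)"
  have t: "0 \<le> t" "t \<le> 1" "1 - t = b / (a + b)" using assms by (auto simp: t_def field_simps)
  have "x + y = (a + b) * (t * (x / a) + (1 - t) * (y / b))"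
  proof -
    have "t * (x / a) = x / (a + b)" "(1 - t) * (y / b) = y / (a + b)"
      using assms unfolding t(3) by (simp_all add: t_def)
    then show ?thesis using assms by (simp add: add_divide_distrib[symmetric])
  qed
  then have "(x + y) powr p = (a + b) powr p * (t * (x / a) + (1 - t) * (y / b)) powr p"
    using assms t by (simp add: powr_mult)
  also have "\<dots> \<le> (a + b) powr p * (t * (x / a) powr p + (1 - t) * (y / b) powr p)"
    using assms t by (intro mult_left_mono powr_convex_combination) auto
  finally show ?thesis using assms unfolding t(3) by (simp add: t_def powr_divide)
qed

lemma borel_measurable_lebesgue_on_cong_AE:
  fixes v w :: "'a::euclidean_space \<Rightarrow> real"
  assumes \<Omega>: "\<Omega> \<in> sets lebesgue" and v: "v \<in> borel_measurable (lebesgue_on \<Omega>)" and eq: "ae_eq \<Omega> v w"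
  shows "w \<in> borel_measurable (lebesgue_on \<Omega>)"
proof -
  have "AE x in lebesgue. x \<in> \<Omega> \<longrightarrow> v x = w x"
    using eq \<Omega> unfolding ae_eq_def by (subst (asm) AE_restrict_space_iff) auto
  then have "AE x in lebesgue. (if x \<in> \<Omega> then v x else 0) = (if x \<in> \<Omega> then w x else 0)"
    by (rule AE_mp) auto
  then have "(\<lambda>x. if x \<in> \<Omega> then w x else 0) \<in> borel_measurable lebesgue"
    by (rule borel_measurable_AE[rotated]) (simp add: borel_measurable_if[OF \<Omega>] v)
  then show ?thesis by (simp add: borel_measurable_if[OF \<Omega>])
qed

lemma Lp_measurable: "v \<in> Lp \<Omega> p \<Longrightarrow> v \<in> borel_measurable (lebesgue_on \<Omega>)"
  by (simp add: Lp_def)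

lemma Lp_integrable: "v \<in> Lp \<Omega> p \<Longrightarrow> integrable (lebesgue_on \<Omega>) (\<lambda>x. \<bar>v x\<bar> powr p)"
  by (simp add: Lp_def)

lemma Lp_norm_nonneg: "Lp_norm \<Omega> p v \<ge> 0"
  by (simp add: Lp_norm_def)

lemma Lp_norm_powr:
  assumes "p \<ge> 1"
  shows "Lp_norm \<Omega> p v powr p = (LINT x|lebesgue_on \<Omega>. \<bar>v x\<bar> powr p)"
  using assms by (simp add: Lp_norm_def powr_powr)

lemma Lp_norm_leI:
  assumes "p \<ge> 1" "c \<ge> 0" "(LINT x|lebesgue_on \<Omega>. \<bar>v x\<bar> powr p) \<le> c powr p"
  shows "Lp_norm \<Omega> p v \<le> c"
proof -
  have "Lp_norm \<Omega> p v \<le> (c powr p) powr (1 / p)"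
    unfolding Lp_norm_def using assms by (intro powr_mono2) auto
  then show ?thesis using assms by (simp add: powr_powr)
qed

lemma Lp_dominated:
  assumes p: "p \<ge> 1" and v: "v \<in> Lp \<Omega> p" and w: "w \<in> borel_measurable (lebesgue_on \<Omega>)"
    and le: "AE x in lebesgue_on \<Omega>. \<bar>w x\<bar> \<le> \<bar>v x\<bar>"
  shows "w \<in> Lp \<Omega> p" "Lp_norm \<Omega> p w \<le> Lp_norm \<Omega> p v"
proof -
  have le': "AE x in lebesgue_on \<Omega>. \<bar>w x\<bar> powr p \<le> \<bar>v x\<bar> powr p"
    using le by (rule AE_mp) (use p in \<open>auto intro!: AE_I2 powr_mono2\<close>)
  have int: "integrable (lebesgue_on \<Omega>) (\<lambda>x. \<bar>w x\<bar> powr p)"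
    by (rule Bochner_Integration.integrable_bound[OF Lp_integrable[OF v]])
      (use w le' in auto)
  then show "w \<in> Lp \<Omega> p" using w by (simp add: Lp_def)
  have "(LINT x|lebesgue_on \<Omega>. \<bar>w x\<bar> powr p) \<le> (LINT x|lebesgue_on \<Omega>. \<bar>v x\<bar> powr p)"
    by (rule integral_mono_AE[OF int Lp_integrable[OF v] le'])
  then show "Lp_norm \<Omega> p w \<le> Lp_norm \<Omega> p v"
    unfolding Lp_norm_def using p by (intro powr_mono2) auto
qed

lemma Lp_cong_AE:
  assumes \<Omega>: "\<Omega> \<in> sets lebesgue" and p: "p \<ge> 1" and v: "v \<in> Lp \<Omega> p" and eq: "ae_eq \<Omega> v w"
  shows "w \<in> Lp \<Omega> p" "Lp_norm \<Omega> p w = Lp_norm \<Omega> p v"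
proof -
  have w: "w \<in> borel_measurable (lebesgue_on \<Omega>)"
    using borel_measurable_lebesgue_on_cong_AE[OF \<Omega> Lp_measurable[OF v] eq] .
  have 1: "AE x in lebesgue_on \<Omega>. \<bar>w x\<bar> \<le> \<bar>v x\<bar>" "AE x in lebesgue_on \<Omega>. \<bar>v x\<bar> \<le> \<bar>w x\<bar>"
    using eq by (auto simp: ae_eq_def elim!: eventually_mono)
  show wp: "w \<in> Lp \<Omega> p" by (rule Lp_dominated(1)[OF p v w 1(1)])
  show "Lp_norm \<Omega> p w = Lp_norm \<Omega> p v"
    using Lp_dominated(2)[OF p v w 1(1)] Lp_dominated(2)[OF p wp Lp_measurable[OF v] 1(2)] by simp
qed

lemma Lp_cmult:
  assumes p: "p \<ge> 1" and v: "v \<in> Lp \<Omega> p"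
  shows "(\<lambda>x. c * v x) \<in> Lp \<Omega> p" "Lp_norm \<Omega> p (\<lambda>x. c * v x) = \<bar>c\<bar> * Lp_norm \<Omega> p v"
proof -
  have eq: "\<bar>c * v x\<bar> powr p = \<bar>c\<bar> powr p * \<bar>v x\<bar> powr p" for x by (simp add: abs_mult powr_mult)
  show "(\<lambda>x. c * v x) \<in> Lp \<Omega> p" using v by (auto simp: Lp_def eq)
  show "Lp_norm \<Omega> p (\<lambda>x. c * v x) = \<bar>c\<bar> * Lp_norm \<Omega> p v"
    unfolding Lp_norm_def eq using p by (simp add: powr_mult powr_powr)
qed

lemma Lp_add:
  assumes p: "p \<ge> 1" and v: "v \<in> Lp \<Omega> p" and w: "w \<in> Lp \<Omega> p"
  shows "(\<lambda>x. v x + w x) \<in> Lp \<Omega> p"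
    and "Lp_norm \<Omega> p (\<lambda>x. v x + w x) \<le> Lp_norm \<Omega> p v + Lp_norm \<Omega> p w"
proof -
  note [measurable] = Lp_measurable[OF v] Lp_measurable[OF w]
  let ?A = "Lp_norm \<Omega> p v" and ?B = "Lp_norm \<Omega> p w"
  define F where "F a b x = (a + b) powr p * (a / (a + b) * (\<bar>v x\<bar> powr p / a powr p) + b / (a + b) * (\<bar>w x\<bar> powr p / b powr p))"
    for a b x
  have le: "\<bar>v x + w x\<bar> powr p \<le> F a b x" if "a > 0" "b > 0" for a b x
  proof -
    have "\<bar>v x + w x\<bar> powr p \<le> (\<bar>v x\<bar> + \<bar>w x\<bar>) powr p" using p by (intro powr_mono2) auto
    also have "\<dots> \<le> F a b x" unfolding F_def using p that by (intro powr_add_le_weighted) auto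
    finally show ?thesis .
  qed
  have F: "integrable (lebesgue_on \<Omega>) (F a b)" for a b
    unfolding F_def using Lp_integrable[OF v] Lp_integrable[OF w] by auto
  have int: "integrable (lebesgue_on \<Omega>) (\<lambda>x. \<bar>v x + w x\<bar> powr p)"
    by (rule Bochner_Integration.integrable_bound[OF F[of 1 1]])
      (use le[of 1 1] in \<open>auto intro!: AE_I2 order_trans[OF _ abs_ge_self]\<close>)
  then show "(\<lambda>x. v x + w x) \<in> Lp \<Omega> p" by (simp add: Lp_def)
  \<comment> \<open>The weights are the norms, shifted by \<open>\<epsilon>\<close> to make them positive.\<close>
  have "Lp_norm \<Omega> p (\<lambda>x. v x + w x) \<le> (?A + ?B) + \<epsilon> * 2" if \<epsilon>: "\<epsilon> > 0" for \<epsilon>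
  proof -
    let ?a = "?A + \<epsilon>" and ?b = "?B + \<epsilon>"
    have pos: "?a > 0" "?b > 0" using Lp_norm_nonneg[of \<Omega> p v] Lp_norm_nonneg[of \<Omega> p w] \<epsilon> by linarith+
    have q: "?A powr p / ?a powr p \<le> 1" "?B powr p / ?b powr p \<le> 1"
      using pos p \<epsilon> Lp_norm_nonneg by (auto simp: divide_le_eq intro!: powr_mono2)
    have "(LINT x|lebesgue_on \<Omega>. \<bar>v x + w x\<bar> powr p) \<le> (LINT x|lebesgue_on \<Omega>. F ?a ?b x)"
      by (rule integral_mono[OF int F le[OF pos]])
    also have "\<dots> = (?a + ?b) powr p * (?a / (?a + ?b) * (?A powr p / ?a powr p) + ?b / (?a + ?b) * (?B powr p / ?b powr p))"
      unfolding F_def Lp_norm_powr[OF p] using Lp_integrable[OF v] Lp_integrable[OF w] by simp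
    also have "\<dots> \<le> (?a + ?b) powr p * (?a / (?a + ?b) * 1 + ?b / (?a + ?b) * 1)"
      using pos q by (intro mult_left_mono add_mono) auto
    also have "?a / (?a + ?b) * 1 + ?b / (?a + ?b) * 1 = 1"
      using pos by (simp add: add_divide_distrib[symmetric])
    finally have "(LINT x|lebesgue_on \<Omega>. \<bar>v x + w x\<bar> powr p) \<le> (?a + ?b) powr p" by simp
    then show ?thesis using Lp_norm_leI[OF p, of "?a + ?b"] pos by fastforce
  qed
  then show "Lp_norm \<Omega> p (\<lambda>x. v x + w x) \<le> ?A + ?B" by (rule le_of_forall_pos_add_mult)
qed

lemma Lp_zero: "(\<lambda>x. 0) \<in> Lp \<Omega> p" and Lp_norm_zero: "p \<ge> 1 \<Longrightarrow> Lp_norm \<Omega> p (\<lambda>x. 0) = 0"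
  by (simp_all add: Lp_def Lp_norm_def)

lemma Lp_norm_eq_0_iff:
  assumes p: "p \<ge> 1" and v: "v \<in> Lp \<Omega> p"
  shows "Lp_norm \<Omega> p v = 0 \<longleftrightarrow> ae_eq \<Omega> v (\<lambda>x. 0)"
proof -
  have "Lp_norm \<Omega> p v = 0 \<longleftrightarrow> (LINT x|lebesgue_on \<Omega>. \<bar>v x\<bar> powr p) = 0"
    using p by (auto simp: Lp_norm_def)
  also have "\<dots> \<longleftrightarrow> (AE x in lebesgue_on \<Omega>. \<bar>v x\<bar> powr p = 0)"
    by (rule integral_nonneg_eq_0_iff_AE[OF Lp_integrable[OF v]]) simp
  finally show ?thesis by (simp add: ae_eq_def)
qed

lemma Lp_sum:
  assumes p: "p \<ge> 1" and I: "finite I" and v: "\<And>i. i \<in> I \<Longrightarrow> v i \<in> Lp \<Omega> p"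
  shows "(\<lambda>x. \<Sum>i\<in>I. v i x) \<in> Lp \<Omega> p \<and> Lp_norm \<Omega> p (\<lambda>x. \<Sum>i\<in>I. v i x) \<le> (\<Sum>i\<in>I. Lp_norm \<Omega> p (v i))"
  using I v
proof (induction I rule: finite_induct)
  case empty
  then show ?case using p by (simp add: Lp_zero Lp_norm_zero)
next
  case (insert i I)
  have IH: "(\<lambda>x. \<Sum>i\<in>I. v i x) \<in> Lp \<Omega> p" "Lp_norm \<Omega> p (\<lambda>x. \<Sum>i\<in>I. v i x) \<le> (\<Sum>i\<in>I. Lp_norm \<Omega> p (v i))"
    using insert by auto
  have i: "v i \<in> Lp \<Omega> p" using insert by auto
  show ?case using Lp_add[OF p i IH(1)] IH(2) insert(1,2) by simp
qed

lemma Lp_mult_bounded: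
  assumes p: "p \<ge> 1" and v: "v \<in> Lp \<Omega> p" and g: "g \<in> borel_measurable (lebesgue_on \<Omega>)"
    and B: "AE x in lebesgue_on \<Omega>. \<bar>g x\<bar> \<le> B" "B \<ge> 0"
  shows "(\<lambda>x. g x * v x) \<in> Lp \<Omega> p" "Lp_norm \<Omega> p (\<lambda>x. g x * v x) \<le> B * Lp_norm \<Omega> p v"
proof -
  have m: "(\<lambda>x. g x * v x) \<in> borel_measurable (lebesgue_on \<Omega>)"
    using g Lp_measurable[OF v] by auto
  have le: "AE x in lebesgue_on \<Omega>. \<bar>g x * v x\<bar> \<le> \<bar>B * v x\<bar>"
    using B(1) by (rule AE_mp) (use B(2) in \<open>auto simp: abs_mult intro!: AE_I2 mult_right_mono\<close>)
  show "(\<lambda>x. g x * v x) \<in> Lp \<Omega> p" by (rule Lp_dominated(1)[OF p Lp_cmult(1)[OF p v] m le])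
  show "Lp_norm \<Omega> p (\<lambda>x. g x * v x) \<le> B * Lp_norm \<Omega> p v"
    using Lp_dominated(2)[OF p Lp_cmult(1)[OF p v] m le] Lp_cmult(2)[OF p v, of B] B(2) by simp
qed

lemma finite_lebesgue_on: 
  assumes "open \<Omega>" "bounded \<Omega>"
  shows "finite_measure (lebesgue_on \<Omega>)"
proof -
  have "\<Omega> \<in> lmeasurable" using assms by (intro lmeasurable_open)
  then show ?thesis by (rule finite_measure_lebesgue_on)
qed

text \<open>
  A series in \<open>L\<^sup>p\<close> whose norms decay geometrically converges. The series of absolute values has partial
  sums bounded in \<open>L\<^sup>p\<close>, so by monotone convergence its limit \<open>R\<close> is in \<open>L\<^sup>p\<close>; it dominates all remainders.
\<close>

lemma Lp_complete:
  assumes p: "p \<ge> 1" and h: "\<And>n. h n \<in> Lp \<Omega> p" and le: "\<And>n::nat. Lp_norm \<Omega> p (h n) \<le> C * (1 / 2) ^ n"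
  obtains l where "l \<in> Lp \<Omega> p" "(\<lambda>N. Lp_norm \<Omega> p (\<lambda>x. l x - (\<Sum>i<N. h i x))) \<longlonglongrightarrow> 0"
proof -
  let ?M = "lebesgue_on \<Omega>"
  have C: "C \<ge> 0" using le[of 0] Lp_norm_nonneg[of \<Omega> p "h 0"] by simp
  note [measurable] = Lp_measurable[OF h]
  define S where "S N x = (\<Sum>i<N. \<bar>h i x\<bar>)" for N x
  have S0: "S N x \<ge> 0" for N x by (simp add: S_def sum_nonneg)
  have [measurable]: "S N \<in> borel_measurable ?M" for N unfolding S_def by measurable
  have habs: "(\<lambda>x. \<bar>h i x\<bar>) \<in> Lp \<Omega> p" "Lp_norm \<Omega> p (\<lambda>x. \<bar>h i x\<bar>) \<le> Lp_norm \<Omega> p (h i)" for i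
    using Lp_dominated[OF p h[of i], of "\<lambda>x. \<bar>h i x\<bar>"] Lp_measurable[OF h[of i]] by simp_all
  have SL: "S N \<in> Lp \<Omega> p" "Lp_norm \<Omega> p (S N) \<le> 2 * C" for N
  proof -
    have *: "S N \<in> Lp \<Omega> p \<and> Lp_norm \<Omega> p (S N) \<le> (\<Sum>i<N. Lp_norm \<Omega> p (\<lambda>x. \<bar>h i x\<bar>))"
      unfolding S_def by (rule Lp_sum[OF p]) (auto intro: habs)
    then show "S N \<in> Lp \<Omega> p" by simp
    have "(\<Sum>i<N. Lp_norm \<Omega> p (\<lambda>x. \<bar>h i x\<bar>)) \<le> (\<Sum>i<N. C * (1 / 2) ^ i)"
    proof (rule sum_mono)
      show "Lp_norm \<Omega> p (\<lambda>x. \<bar>h i x\<bar>) \<le> C * (1 / 2) ^ i" for i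
        using habs(2)[of i] le[of i] by linarith
    qed
    also have "\<dots> = C * (\<Sum>i<N. (1 / 2) ^ i)" by (simp add: sum_distrib_left)
    also have "\<dots> \<le> C * 2" using C
    proof (intro mult_left_mono)
      show "(\<Sum>i<N. (1 / 2) ^ i) \<le> (2 :: real)" unfolding sum_gp_strict by simp
    qed
    finally show "Lp_norm \<Omega> p (S N) \<le> 2 * C" using * by simp
  qed
  have Sp: "(\<integral>\<^sup>+ x. ennreal (S N x powr p) \<partial>?M) \<le> ennreal ((2 * C) powr p)" for N
  proof -
    have "integrable ?M (\<lambda>x. S N x powr p)" using Lp_integrable[OF SL(1)[of N]] S0 by simp
    then have "(\<integral>\<^sup>+ x. ennreal (S N x powr p) \<partial>?M) = ennreal (LINT x|?M. S N x powr p)"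
      by (rule nn_integral_eq_integral) auto
    also have "(LINT x|?M. S N x powr p) = Lp_norm \<Omega> p (S N) powr p"
      using S0 by (simp add: Lp_norm_powr[OF p])
    also have "\<dots> \<le> (2 * C) powr p" using SL p Lp_norm_nonneg by (intro powr_mono2) auto
    finally show ?thesis by (simp add: ennreal_leI)
  qed
  let ?T = "\<lambda>x. SUP N. ennreal (S N x powr p)"
  have "incseq (\<lambda>N x. ennreal (S N x powr p))"
    using p S0 by (intro incseq_SucI le_funI ennreal_leI powr_mono2) (auto simp: S_def)
  then have "(\<integral>\<^sup>+ x. ?T x \<partial>?M) = (SUP N. \<integral>\<^sup>+ x. ennreal (S N x powr p) \<partial>?M)"
    by (intro nn_integral_monotone_convergence_SUP) auto
  also have "\<dots> \<le> ennreal ((2 * C) powr p)" using Sp by (intro SUP_least)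
  finally have T: "(\<integral>\<^sup>+ x. ?T x \<partial>?M) \<le> ennreal ((2 * C) powr p)" .
  have Tlt: "(\<integral>\<^sup>+ x. ?T x \<partial>?M) < \<infinity>"
    using le_less_trans[OF T ennreal_less_top] by simp
  have "?T \<in> borel_measurable ?M" by measurable
  then have "AE x in ?M. ?T x \<noteq> \<infinity>" by (rule nn_integral_PInf_AE) (use Tlt in simp)
  then have summ: "AE x in ?M. summable (\<lambda>i. \<bar>h i x\<bar>)"
  proof (rule AE_mp, intro AE_I2 impI)
    fix x assume "?T x \<noteq> \<infinity>"
    then obtain r where r: "r \<ge> 0" "?T x = ennreal r" by (cases "?T x") auto
    have "S N x \<le> r powr (1 / p)" for N
    proof -
      have "ennreal (S N x powr p) \<le> ?T x" by (rule SUP_upper) simp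
      then have "S N x powr p \<le> r" using r by simp
      then have "(S N x powr p) powr (1 / p) \<le> r powr (1 / p)" using p by (intro powr_mono2) auto
      then show ?thesis using p S0 by (simp add: powr_powr)
    qed
    then show "summable (\<lambda>i. \<bar>h i x\<bar>)"
      by (intro summableI_nonneg_bounded[of _ "r powr (1 / p)"]) (auto simp: S_def)
  qed
  define R where "R x = (\<Sum>i. \<bar>h i x\<bar>)" for x
  define l where "l x = (\<Sum>i. h i x)" for x
  have [measurable]: "R \<in> borel_measurable ?M" "l \<in> borel_measurable ?M"
    unfolding R_def l_def by measurable
  have R_int: "integrable ?M (\<lambda>x. \<bar>R x\<bar> powr p)"
  proof (rule integrableI_bounded)
    have "AE x in ?M. ennreal (norm (\<bar>R x\<bar> powr p)) \<le> ?T x"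
      using summ
    proof (rule AE_mp, intro AE_I2 impI)
      fix x assume s: "summable (\<lambda>i. \<bar>h i x\<bar>)"
      have "(\<lambda>N. S N x) \<longlonglongrightarrow> R x" unfolding S_def R_def using s by (rule summable_LIMSEQ)
      moreover have R0: "R x \<ge> 0" unfolding R_def using s by (intro suminf_nonneg) auto
      ultimately have "(\<lambda>N. S N x powr p) \<longlonglongrightarrow> R x powr p"
        using p S0 by (intro tendsto_powr') (auto intro!: always_eventually)
      then have "(\<lambda>N. ennreal (S N x powr p)) \<longlonglongrightarrow> ennreal (R x powr p)" by (intro tendsto_ennrealI)
      then have "ennreal (R x powr p) \<le> ?T x"
        by (rule LIMSEQ_le_const2) (auto intro!: SUP_upper)
      then show "ennreal (norm (\<bar>R x\<bar> powr p)) \<le> ?T x" using R0 by simp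
    qed
    then have "(\<integral>\<^sup>+ x. ennreal (norm (\<bar>R x\<bar> powr p)) \<partial>?M) \<le> (\<integral>\<^sup>+ x. ?T x \<partial>?M)"
      by (rule nn_integral_mono_AE)
    then show "(\<integral>\<^sup>+ x. ennreal (norm (\<bar>R x\<bar> powr p)) \<partial>?M) < \<infinity>"
      using Tlt by (rule le_less_trans)
  qed measurable
  have R: "R \<in> Lp \<Omega> p" using R_int by (simp add: Lp_def)
  show thesis
  proof
    show "l \<in> Lp \<Omega> p"
    proof (rule Lp_dominated(1)[OF p R])
      show "AE x in ?M. \<bar>l x\<bar> \<le> \<bar>R x\<bar>" using summ
        by (rule AE_mp) (auto simp: l_def R_def intro!: AE_I2 order_trans[OF summable_rabs abs_ge_self])
    qed measurable
    have "(\<lambda>N. LINT x|?M. \<bar>l x - (\<Sum>i<N. h i x)\<bar> powr p) \<longlonglongrightarrow> (LINT x|?M. 0)"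
    proof (rule integral_dominated_convergence[OF _ _ R_int])
      show "AE x in ?M. (\<lambda>N. \<bar>l x - (\<Sum>i<N. h i x)\<bar> powr p) \<longlonglongrightarrow> 0" using summ
      proof (rule AE_mp, intro AE_I2 impI)
        fix x assume "summable (\<lambda>i. \<bar>h i x\<bar>)"
        then have "(\<lambda>N. \<Sum>i<N. h i x) \<longlonglongrightarrow> l x"
          unfolding l_def by (intro summable_LIMSEQ) (rule summable_rabs_cancel)
        then have "(\<lambda>N. \<bar>l x - (\<Sum>i<N. h i x)\<bar>) \<longlonglongrightarrow> \<bar>l x - l x\<bar>" by (intro tendsto_intros)
        then have "(\<lambda>N. \<bar>l x - (\<Sum>i<N. h i x)\<bar> powr p) \<longlonglongrightarrow> 0 powr p"
          using p by (intro tendsto_powr') auto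
        then show "(\<lambda>N. \<bar>l x - (\<Sum>i<N. h i x)\<bar> powr p) \<longlonglongrightarrow> 0" using p by simp
      qed
      show "AE x in ?M. norm (\<bar>l x - (\<Sum>i<N. h i x)\<bar> powr p) \<le> \<bar>R x\<bar> powr p" for N using summ
      proof (rule AE_mp, intro AE_I2 impI)
        fix x assume s: "summable (\<lambda>i. \<bar>h i x\<bar>)"
        have s': "summable (\<lambda>i. h i x)" using s by (rule summable_rabs_cancel)
        have sN: "summable (\<lambda>i. \<bar>h (i + N) x\<bar>)" using s summable_iff_shift[of "\<lambda>i. \<bar>h i x\<bar>" N] by simp
        have "l x - (\<Sum>i<N. h i x) = (\<Sum>i. h (i + N) x)"
          unfolding l_def using suminf_minus_initial_segment[OF s', of N] by simp
        also have "\<bar>\<dots>\<bar> \<le> (\<Sum>i. \<bar>h (i + N) x\<bar>)" by (rule summable_rabs[OF sN])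
        also have "\<dots> = R x - (\<Sum>i<N. \<bar>h i x\<bar>)"
          unfolding R_def using suminf_minus_initial_segment[OF s, of N] by simp
        also have "\<dots> \<le> \<bar>R x\<bar>"
        proof -
          have "0 \<le> (\<Sum>i<N. \<bar>h i x\<bar>)" by (rule sum_nonneg) simp
          then show ?thesis by linarith
        qed
        finally show "norm (\<bar>l x - (\<Sum>i<N. h i x)\<bar> powr p) \<le> \<bar>R x\<bar> powr p"
          using p by (simp add: powr_mono2)
      qed
    qed measurable
    then have "(\<lambda>N. (LINT x|?M. \<bar>l x - (\<Sum>i<N. h i x)\<bar> powr p) powr (1 / p)) \<longlonglongrightarrow> 0 powr (1 / p)"
      using p by (intro tendsto_powr') (auto intro!: always_eventually)
    then show "(\<lambda>N. Lp_norm \<Omega> p (\<lambda>x. l x - (\<Sum>i<N. h i x))) \<longlonglongrightarrow> 0"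
      using p by (simp add: Lp_norm_def)
  qed
qed

section \<open>Weak gradients\<close>

lemma ae_eq_refl: "ae_eq \<Omega> v v"
  by (simp add: ae_eq_def)

lemma ae_eq_sym: "ae_eq \<Omega> v w \<Longrightarrow> ae_eq \<Omega> w v"
  by (auto simp: ae_eq_def elim!: eventually_mono)

lemma weak_grad_wgrad: "weak_grad \<Omega> v g \<Longrightarrow> weak_grad \<Omega> v (wgrad \<Omega> v)"
  unfolding wgrad_def by (rule someI[of "weak_grad \<Omega> v" g])

context
  fixes \<Omega> :: "'a::euclidean_space set"
  assumes \<Omega>: "open \<Omega>"
begin

lemma domain_sets: "\<Omega> \<in> sets lebesgue"
  using \<Omega> by auto

lemma weak_grad_cong_AE:
  assumes "ae_eq \<Omega> v w"
  shows "weak_grad \<Omega> v g \<longleftrightarrow> weak_grad \<Omega> w g"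
  using weak_deriv_cong_AE[OF \<Omega> _ assms ae_eq_refl] weak_deriv_cong_AE[OF \<Omega> _ ae_eq_sym[OF assms] ae_eq_refl]
  unfolding weak_grad_iff by blast

text \<open>
  The chosen gradient depends on \<open>v\<close> only through the predicate \<open>weak_grad \<Omega> v\<close>, so it is literally the same
  function for both, not merely almost everywhere.
\<close>

lemma wgrad_cong_AE:
  assumes "ae_eq \<Omega> v w"
  shows "wgrad \<Omega> v = wgrad \<Omega> w"
proof -
  have "weak_grad \<Omega> v = weak_grad \<Omega> w" by (rule ext) (rule weak_grad_cong_AE[OF assms])
  then show ?thesis by (simp add: wgrad_def)
qed

lemma weak_grad_unique:
  assumes "weak_grad \<Omega> v g" "weak_grad \<Omega> v g'"
  shows "AE x in lebesgue_on \<Omega>. g x = g' x"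
proof -
  have "AE x in lebesgue_on \<Omega>. \<forall>b\<in>Basis. g x \<bullet> b = g' x \<bullet> b"
  proof (rule AE_finite_allI)
    fix b :: 'a assume b: "b \<in> Basis"
    have "weak_deriv \<Omega> b v (\<lambda>x. g x \<bullet> b)" "weak_deriv \<Omega> b v (\<lambda>x. g' x \<bullet> b)"
      using assms b unfolding weak_grad_iff by blast+
    from weak_deriv_unique[OF \<Omega> b this]
    show "AE x in lebesgue_on \<Omega>. g x \<bullet> b = g' x \<bullet> b" by (simp only: ae_eq_def)
  qed simp
  then show ?thesis by eventually_elim (rule euclidean_eqI, blast)
qed

lemma weak_grad_lincomb:
  assumes "weak_grad \<Omega> v gv" "weak_grad \<Omega> w gw"
  shows "weak_grad \<Omega> (\<lambda>x. a * v x + c * w x) (\<lambda>x. a *\<^sub>R gv x + c *\<^sub>R gw x)"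
  unfolding weak_grad_iff
proof
  fix b :: 'a assume b: "b \<in> Basis"
  show "weak_deriv \<Omega> b (\<lambda>x. a * v x + c * w x) (\<lambda>x. (a *\<^sub>R gv x + c *\<^sub>R gw x) \<bullet> b)"
  proof -
    have "weak_deriv \<Omega> b v (\<lambda>x. gv x \<bullet> b)" "weak_deriv \<Omega> b w (\<lambda>x. gw x \<bullet> b)"
      using assms b unfolding weak_grad_iff by blast+
    from weak_deriv_add[OF \<Omega> b weak_deriv_cmult[OF \<Omega> b this(1), of a] weak_deriv_cmult[OF \<Omega> b this(2), of c]]
    show ?thesis by (simp add: inner_add_left)
  qed
qed

lemma wgrad_lincomb_AE:
  assumes "weak_grad \<Omega> v gv" "weak_grad \<Omega> w gw" "ae_eq \<Omega> z (\<lambda>x. a * v x + c * w x)"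
  shows "AE x in lebesgue_on \<Omega>. wgrad \<Omega> z x = a *\<^sub>R wgrad \<Omega> v x + c *\<^sub>R wgrad \<Omega> w x"
proof -
  have "weak_grad \<Omega> (\<lambda>x. a * v x + c * w x) (\<lambda>x. a *\<^sub>R wgrad \<Omega> v x + c *\<^sub>R wgrad \<Omega> w x)"
    using assms by (intro weak_grad_lincomb weak_grad_wgrad)
  then have "weak_grad \<Omega> z (\<lambda>x. a *\<^sub>R wgrad \<Omega> v x + c *\<^sub>R wgrad \<Omega> w x)"
    by (simp add: weak_grad_cong_AE[OF assms(3)])
  then show ?thesis using weak_grad_unique[OF weak_grad_wgrad] by blast
qed

lemma wgrad_inner_AE:
  assumes "weak_grad \<Omega> v g"
  shows "ae_eq \<Omega> (\<lambda>x. g x \<bullet> b) (\<lambda>x. wgrad \<Omega> v x \<bullet> b)"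
  using weak_grad_unique[OF assms weak_grad_wgrad[OF assms]] unfolding ae_eq_def by eventually_elim simp

end

section \<open>Sobolev spaces\<close>

context
  fixes \<Omega> :: "'a::euclidean_space set" and p :: real
  assumes \<Omega>: "open \<Omega>" and p: "p \<ge> 1"
begin

lemma W_cong_AE:
  assumes "v \<in> W k \<Omega> p" "ae_eq \<Omega> v w"
  shows "w \<in> W k \<Omega> p" "W_norm k \<Omega> p w = W_norm k \<Omega> p v"
proof -
  have v: "v \<in> Lp \<Omega> p" using assms(1) by (cases k) auto
  note L = Lp_cong_AE[OF domain_sets[OF \<Omega>] p v assms(2)]
  show "w \<in> W k \<Omega> p" using assms L by (cases k) (auto simp: weak_grad_cong_AE[OF \<Omega>])
  show "W_norm k \<Omega> p w = W_norm k \<Omega> p v"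
    using L wgrad_cong_AE[OF \<Omega> assms(2)] by (cases k) auto
qed

lemma W_imp_Lp: "v \<in> W k \<Omega> p \<Longrightarrow> v \<in> Lp \<Omega> p"
  by (cases k) auto

lemma W_SucD:
  assumes "v \<in> W (Suc k) \<Omega> p"
  shows "weak_grad \<Omega> v (wgrad \<Omega> v)" "b \<in> Basis \<Longrightarrow> (\<lambda>x. wgrad \<Omega> v x \<bullet> b) \<in> W k \<Omega> p"
proof -
  obtain g where g: "weak_grad \<Omega> v g" "\<forall>b\<in>Basis. (\<lambda>x. g x \<bullet> b) \<in> W k \<Omega> p" using assms by auto
  show "weak_grad \<Omega> v (wgrad \<Omega> v)" by (rule weak_grad_wgrad[OF g(1)])
  show "(\<lambda>x. wgrad \<Omega> v x \<bullet> b) \<in> W k \<Omega> p" if "b \<in> Basis"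
    using W_cong_AE(1)[OF _ wgrad_inner_AE[OF \<Omega> g(1)]] g(2) that by blast
qed

lemma W_norm_nonneg: "W_norm k \<Omega> p v \<ge> 0"
  by (induction k arbitrary: v) (auto simp: Lp_norm_nonneg intro!: add_nonneg_nonneg sum_nonneg)

lemma Lp_norm_le_W_norm: "Lp_norm \<Omega> p v \<le> W_norm k \<Omega> p v"
  by (cases k) (auto intro!: sum_nonneg W_norm_nonneg)

lemma W_norm_wgrad_le:
  assumes "b \<in> Basis"
  shows "W_norm k \<Omega> p (\<lambda>x. wgrad \<Omega> v x \<bullet> b) \<le> W_norm (Suc k) \<Omega> p v"
proof -
  have "W_norm k \<Omega> p (\<lambda>x. wgrad \<Omega> v x \<bullet> b) \<le> (\<Sum>b\<in>Basis. W_norm k \<Omega> p (\<lambda>x. wgrad \<Omega> v x \<bullet> b))"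
    using assms by (intro member_le_sum) (auto intro: W_norm_nonneg)
  then show ?thesis using Lp_norm_nonneg[of \<Omega> p v] by simp
qed

lemma W_cmult:
  "v \<in> W k \<Omega> p \<Longrightarrow> (\<lambda>x. c * v x) \<in> W k \<Omega> p \<and> W_norm k \<Omega> p (\<lambda>x. c * v x) = \<bar>c\<bar> * W_norm k \<Omega> p v"
proof (induction k arbitrary: v)
  case 0
  then show ?case using Lp_cmult[OF p, of v \<Omega> c] by simp
next
  case (Suc k)
  note D = W_SucD[OF Suc.prems]
  note L = Lp_cmult[OF p W_imp_Lp[OF Suc.prems], of c]
  have wg: "weak_grad \<Omega> (\<lambda>x. c * v x) (\<lambda>x. c *\<^sub>R wgrad \<Omega> v x)"
    using weak_grad_lincomb[OF \<Omega> D(1) D(1), of c 0] by simp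
  have 1: "(\<lambda>x. (c *\<^sub>R wgrad \<Omega> v x) \<bullet> b) \<in> W k \<Omega> p" 
    and 2: "W_norm k \<Omega> p (\<lambda>x. (c *\<^sub>R wgrad \<Omega> v x) \<bullet> b) = \<bar>c\<bar> * W_norm k \<Omega> p (\<lambda>x. wgrad \<Omega> v x \<bullet> b)" if "b \<in> Basis" for b
    using Suc.IH[OF D(2)[OF that]] by auto
  have 3: "W_norm k \<Omega> p (\<lambda>x. wgrad \<Omega> (\<lambda>x. c * v x) x \<bullet> b) = \<bar>c\<bar> * W_norm k \<Omega> p (\<lambda>x. wgrad \<Omega> v x \<bullet> b)" if "b \<in> Basis" for b
    using W_cong_AE(2)[OF 1[OF that] wgrad_inner_AE[OF \<Omega> wg]] 2[OF that] by simp
  show ?case using L wg 1 3 by (auto simp: sum_distrib_left distrib_left)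
qed

lemma W_add:
  "v \<in> W k \<Omega> p \<Longrightarrow> w \<in> W k \<Omega> p \<Longrightarrow> (\<lambda>x. v x + w x) \<in> W k \<Omega> p \<and>
    W_norm k \<Omega> p (\<lambda>x. v x + w x) \<le> W_norm k \<Omega> p v + W_norm k \<Omega> p w"
proof (induction k arbitrary: v w)
  case 0
  then show ?case using Lp_add[OF p, of v \<Omega> w] by simp
next
  case (Suc k)
  note D = W_SucD[OF Suc.prems(1)] and E = W_SucD[OF Suc.prems(2)]
  note L = Lp_add[OF p W_imp_Lp[OF Suc.prems(1)] W_imp_Lp[OF Suc.prems(2)]]
  have wg: "weak_grad \<Omega> (\<lambda>x. v x + w x) (\<lambda>x. wgrad \<Omega> v x + wgrad \<Omega> w x)"
    using weak_grad_lincomb[OF \<Omega> D(1) E(1), of 1 1] by simp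
  have 1: "(\<lambda>x. (wgrad \<Omega> v x + wgrad \<Omega> w x) \<bullet> b) \<in> W k \<Omega> p" 
    and 2: "W_norm k \<Omega> p (\<lambda>x. (wgrad \<Omega> v x + wgrad \<Omega> w x) \<bullet> b) \<le>
      W_norm k \<Omega> p (\<lambda>x. wgrad \<Omega> v x \<bullet> b) + W_norm k \<Omega> p (\<lambda>x. wgrad \<Omega> w x \<bullet> b)" if "b \<in> Basis" for b
    using Suc.IH[OF D(2)[OF that] E(2)[OF that]] by (auto simp: inner_add_left)
  have 3: "W_norm k \<Omega> p (\<lambda>x. wgrad \<Omega> (\<lambda>x. v x + w x) x \<bullet> b) \<le>
      W_norm k \<Omega> p (\<lambda>x. wgrad \<Omega> v x \<bullet> b) + W_norm k \<Omega> p (\<lambda>x. wgrad \<Omega> w x \<bullet> b)" if "b \<in> Basis" for b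
    using W_cong_AE(2)[OF 1[OF that] wgrad_inner_AE[OF \<Omega> wg]] 2[OF that] by simp
  have "(\<Sum>b\<in>Basis. W_norm k \<Omega> p (\<lambda>x. wgrad \<Omega> (\<lambda>x. v x + w x) x \<bullet> b)) \<le>
    (\<Sum>b\<in>Basis. W_norm k \<Omega> p (\<lambda>x. wgrad \<Omega> v x \<bullet> b) + W_norm k \<Omega> p (\<lambda>x. wgrad \<Omega> w x \<bullet> b))"
    by (rule sum_mono) (rule 3)
  then show ?case using L wg 1 by (auto simp: sum.distrib)
qed

lemma W_sum:
  assumes "finite I" "I \<noteq> {}" "\<And>i. i \<in> I \<Longrightarrow> v i \<in> W k \<Omega> p"
  shows "(\<lambda>x. \<Sum>i\<in>I. v i x) \<in> W k \<Omega> p \<and> W_norm k \<Omega> p (\<lambda>x. \<Sum>i\<in>I. v i x) \<le> (\<Sum>i\<in>I. W_norm k \<Omega> p (v i))"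
  using assms
proof (induction I rule: finite_ne_induct)
  case (singleton i)
  then show ?case by simp
next
  case (insert i I)
  have IH: "(\<lambda>x. \<Sum>i\<in>I. v i x) \<in> W k \<Omega> p" "W_norm k \<Omega> p (\<lambda>x. \<Sum>i\<in>I. v i x) \<le> (\<Sum>i\<in>I. W_norm k \<Omega> p (v i))"
    using insert by auto
  have i: "v i \<in> W k \<Omega> p" using insert by auto
  show ?case using W_add[OF i IH(1)] IH(2) insert(1,3) by simp
qed

lemma W_norm_eq_0_iff:
  assumes "v \<in> W k \<Omega> p"
  shows "W_norm k \<Omega> p v = 0 \<longleftrightarrow> ae_eq \<Omega> v (\<lambda>x. 0)"
proof
  assume "W_norm k \<Omega> p v = 0"
  then have "Lp_norm \<Omega> p v = 0"
    using Lp_norm_le_W_norm[of v k] Lp_norm_nonneg[of \<Omega> p v] by simp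
  then show "ae_eq \<Omega> v (\<lambda>x. 0)" using Lp_norm_eq_0_iff[OF p W_imp_Lp[OF assms]] by simp
next
  assume "ae_eq \<Omega> v (\<lambda>x. 0)"
  then have "ae_eq \<Omega> v (\<lambda>x. 0 * v x)" by simp
  from W_cong_AE(2)[OF assms this] W_cmult[OF assms, of 0] show "W_norm k \<Omega> p v = 0" by simp
qed

end

lemma test_fun_W1:
  assumes \<Omega>: "open \<Omega>" and p: "p \<ge> 1" and \<phi>: "test_fun \<Omega> \<phi>"
  shows "\<phi> \<in> W 1 \<Omega> p"
proof -
  have L: "\<psi> \<in> Lp \<Omega> p" if \<psi>: "test_fun \<Omega> \<psi>" for \<psi>
  proof -
    obtain K where K: "smooth \<psi>" "compact K" "K \<subseteq> \<Omega>" "\<And>x. x \<notin> K \<Longrightarrow> \<psi> x = 0"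
      using test_funE[OF \<psi>] by metis
    obtain B where B: "B \<ge> 0" "\<And>x. \<bar>\<psi> x\<bar> \<le> B" using test_fun_bounded[OF \<psi>] by metis
    have m: "\<psi> \<in> borel_measurable (lebesgue_on \<Omega>)"
      using smooth_measurable[OF K(1)] by (rule measurable_restrict_space1)
    have "integrable lebesgue (indicator K :: 'a \<Rightarrow> real)"
      using lmeasurable_compact[OF K(2)] by (auto simp: fmeasurable_def)
    moreover have "(\<lambda>x. indicator \<Omega> x *\<^sub>R indicator K x) = (indicator K :: 'a \<Rightarrow> real)"
      using K(3) by (auto simp: fun_eq_iff indicator_def)
    ultimately have i: "integrable (lebesgue_on \<Omega>) (indicator K :: 'a \<Rightarrow> real)"
      using \<Omega> by (subst integrable_restrict_space) auto
    have "integrable (lebesgue_on \<Omega>) (\<lambda>x. \<bar>\<psi> x\<bar> powr p)"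
    proof (rule Bochner_Integration.integrable_bound)
      show "integrable (lebesgue_on \<Omega>) (\<lambda>x. B powr p * indicator K x)" using i by simp
      show "AE x in lebesgue_on \<Omega>. norm (\<bar>\<psi> x\<bar> powr p) \<le> norm (B powr p * indicator K x)"
      proof (intro AE_I2)
        show "norm (\<bar>\<psi> x\<bar> powr p) \<le> norm (B powr p * indicator K x)" for x
          using B(2)[of x] K(4)[of x] p by (cases "x \<in> K") (auto intro: powr_mono2)
      qed
    qed (use m in auto)
    then show ?thesis using m by (simp add: Lp_def)
  qed
  have "weak_grad \<Omega> \<phi> (grad \<phi>)"
    unfolding weak_grad_iff using weak_deriv_test_fun[OF \<Omega> _ \<phi>] by blast
  then show ?thesis using L[OF \<phi>] L[OF test_fun_grad[OF \<phi>]] by auto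
qed

text \<open>
  Test functions lie in \<open>W\<^sup>1\<^sup>,\<^sup>2\<close>, so that the norms of the differences to the approximating sequences obey the
  triangle inequality.
\<close>

lemma H10_lincomb:
  assumes \<Omega>: "open \<Omega>" and v: "v \<in> H10 \<Omega>" and w: "w \<in> H10 \<Omega>"
  shows "(\<lambda>x. a * v x + c * w x) \<in> H10 \<Omega>"
proof -
  have p: "(2::real) \<ge> 1" by simp
  obtain \<phi> where \<phi>: "\<And>n. test_fun \<Omega> (\<phi> n)" "(\<lambda>n. W_norm 1 \<Omega> 2 (\<lambda>x. v x - \<phi> n x)) \<longlonglongrightarrow> 0"
    using v by (auto simp: H10_def)
  obtain \<psi> where \<psi>: "\<And>n. test_fun \<Omega> (\<psi> n)" "(\<lambda>n. W_norm 1 \<Omega> 2 (\<lambda>x. w x - \<psi> n x)) \<longlonglongrightarrow> 0"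
    using w by (auto simp: H10_def)
  have vW: "v \<in> W 1 \<Omega> 2" and wW: "w \<in> W 1 \<Omega> 2" using v w by (auto simp: H10_def)
  note cm = W_cmult[OF \<Omega> p, of _ 1] and ad = W_add[OF \<Omega> p, of _ 1] and t = test_fun_W1[OF \<Omega> p]
  have d: "(\<lambda>x. v' x - \<phi>' x) \<in> W 1 \<Omega> 2" if "v' \<in> W 1 \<Omega> 2" "test_fun \<Omega> \<phi>'" for v' \<phi>'
    using ad[of v' "\<lambda>x. -1 * \<phi>' x"] cm[OF t[OF that(2)], of "-1"] that by simp
  define \<theta> where "\<theta> n x = a * \<phi> n x + c * \<psi> n x" for n x
  have \<theta>: "test_fun \<Omega> (\<theta> n)" for n
    unfolding \<theta>_def by (intro test_fun_add test_fun_cmult \<phi> \<psi>)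
  have le: "W_norm 1 \<Omega> 2 (\<lambda>x. (a * v x + c * w x) - \<theta> n x) \<le>
    \<bar>a\<bar> * W_norm 1 \<Omega> 2 (\<lambda>x. v x - \<phi> n x) + \<bar>c\<bar> * W_norm 1 \<Omega> 2 (\<lambda>x. w x - \<psi> n x)" for n
  proof -
    have eq: "(\<lambda>x. (a * v x + c * w x) - \<theta> n x) = (\<lambda>x. a * (v x - \<phi> n x) + c * (w x - \<psi> n x))"
      by (simp add: \<theta>_def fun_eq_iff algebra_simps)
    show ?thesis unfolding eq
      using ad[OF conjunct1[OF cm[OF d[OF vW \<phi>(1)]]] conjunct1[OF cm[OF d[OF wW \<psi>(1)]]], of a n c n]
        cm[OF d[OF vW \<phi>(1)], of a n] cm[OF d[OF wW \<psi>(1)], of c n] by simp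
  qed
  have "(\<lambda>n. \<bar>a\<bar> * W_norm 1 \<Omega> 2 (\<lambda>x. v x - \<phi> n x) + \<bar>c\<bar> * W_norm 1 \<Omega> 2 (\<lambda>x. w x - \<psi> n x)) \<longlonglongrightarrow> \<bar>a\<bar> * 0 + \<bar>c\<bar> * 0"
    by (intro tendsto_intros \<phi>(2) \<psi>(2))
  then have lim: "(\<lambda>n. \<bar>a\<bar> * W_norm 1 \<Omega> 2 (\<lambda>x. v x - \<phi> n x) + \<bar>c\<bar> * W_norm 1 \<Omega> 2 (\<lambda>x. w x - \<psi> n x)) \<longlonglongrightarrow> 0"
    by simp
  have "(\<lambda>n. W_norm 1 \<Omega> 2 (\<lambda>x. (a * v x + c * w x) - \<theta> n x)) \<longlonglongrightarrow> 0"
    by (rule tendsto_sandwich[OF _ _ tendsto_const lim]; intro always_eventually allI le W_norm_nonneg[OF \<Omega> p])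
  moreover have "(\<lambda>x. a * v x + c * w x) \<in> W 1 \<Omega> 2"
    using ad[OF conjunct1[OF cm[OF vW]] conjunct1[OF cm[OF wW]]] by blast
  ultimately show ?thesis using \<theta> unfolding H10_def by blast
qed

lemma X_space_lincomb:
  assumes \<Omega>: "open \<Omega>" and s: "s \<ge> 1" and "v \<in> X_space \<Omega> s" "w \<in> X_space \<Omega> s"
  shows "(\<lambda>x. a * v x + c * w x) \<in> X_space \<Omega> s"
  using assms H10_lincomb[OF \<Omega>, of v w a c] W_cmult[OF \<Omega> s, of v 2 a] W_cmult[OF \<Omega> s, of w 2 c]
    W_add[OF \<Omega> s, of "\<lambda>x. a * v x" 2 "\<lambda>x. c * w x"]
  by (simp add: X_space_def del: W.simps)

section \<open>Weak divergence\<close>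

lemma weak_div_unique:
  assumes \<Omega>: "open \<Omega>" and "weak_div \<Omega> F h" "weak_div \<Omega> F h'"
  shows "ae_eq \<Omega> h h'"
proof -
  have "AE x in lebesgue_on \<Omega>. h x + (-1) * h' x = 0"
  proof (rule fundamental_lemma[OF \<Omega>])
    show "loc_integrable \<Omega> (\<lambda>x. h x + (-1) * h' x)"
      using assms by (intro loc_integrable_add loc_integrable_cmult) (auto simp: weak_div_def)
    show "(LINT x|lebesgue_on \<Omega>. (h x + (-1) * h' x) * \<phi> x) = 0" if "test_fun \<Omega> \<phi>" for \<phi>
      using assms that integrable_loc_integrable_mult[OF \<Omega>]
      by (simp add: weak_div_def left_diff_distrib)
  qed
  then show ?thesis by (simp add: ae_eq_def)
qed

lemma integral_inner_grad:
  assumes \<Omega>: "open \<Omega>" and F: "loc_integrable \<Omega> F" and \<phi>: "test_fun \<Omega> \<phi>"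
  shows "(LINT x|lebesgue_on \<Omega>. F x \<bullet> grad \<phi> x) = (\<Sum>b\<in>Basis. LINT x|lebesgue_on \<Omega>. (F x \<bullet> b) * (grad \<phi> x \<bullet> b))"
    and "integrable (lebesgue_on \<Omega>) (\<lambda>x. F x \<bullet> grad \<phi> x)"
proof -
  have i: "integrable (lebesgue_on \<Omega>) (\<lambda>x. (F x \<bullet> b) * (grad \<phi> x \<bullet> b))" if "b \<in> Basis" for b
    by (rule integrable_loc_integrable_mult[OF \<Omega> loc_integrable_inner[OF F] test_fun_grad[OF \<phi> that]])
  have eq: "(\<lambda>x. F x \<bullet> grad \<phi> x) = (\<lambda>x. \<Sum>b\<in>Basis. (F x \<bullet> b) * (grad \<phi> x \<bullet> b))"
    by (rule ext) (rule euclidean_inner)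
  show "integrable (lebesgue_on \<Omega>) (\<lambda>x. F x \<bullet> grad \<phi> x)"
    unfolding eq using i by (rule Bochner_Integration.integrable_sum)
  show "(LINT x|lebesgue_on \<Omega>. F x \<bullet> grad \<phi> x) = (\<Sum>b\<in>Basis. LINT x|lebesgue_on \<Omega>. (F x \<bullet> b) * (grad \<phi> x \<bullet> b))"
    unfolding eq using i by (rule Bochner_Integration.integral_sum)
qed

text \<open>
  The flux \<open>F\<close> is compared almost everywhere only, because weak gradients are additive only in this sense.
\<close>

lemma weak_div_lincomb:
  assumes \<Omega>: "open \<Omega>" and 1: "weak_div \<Omega> F1 h1" and 2: "weak_div \<Omega> F2 h2"
    and F: "AE x in lebesgue_on \<Omega>. F x = c1 *\<^sub>R F1 x + c2 *\<^sub>R F2 x"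
  shows "weak_div \<Omega> F (\<lambda>x. c1 * h1 x + c2 * h2 x)"
proof -
  have S: "\<Omega> \<in> sets lebesgue" using \<Omega> by auto
  have lF: "loc_integrable \<Omega> F1" "loc_integrable \<Omega> F2" "loc_integrable \<Omega> h1" "loc_integrable \<Omega> h2"
    using 1 2 by (auto simp: weak_div_def)
  have "loc_integrable \<Omega> (\<lambda>x. c1 *\<^sub>R F1 x + c2 *\<^sub>R F2 x)"
    by (rule loc_integrable_vector)
      (simp add: inner_add_left loc_integrable_add loc_integrable_cmult loc_integrable_inner lF)
  moreover have "AE x in lebesgue_on \<Omega>. c1 *\<^sub>R F1 x + c2 *\<^sub>R F2 x = F x"
    using F by eventually_elim simp
  ultimately have l: "loc_integrable \<Omega> F" by (rule loc_integrable_cong_AE[OF S])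
  have lh: "loc_integrable \<Omega> (\<lambda>x. c1 * h1 x + c2 * h2 x)"
    by (intro loc_integrable_add loc_integrable_cmult lF)
  have "(LINT x|lebesgue_on \<Omega>. F x \<bullet> grad \<phi> x) = - (LINT x|lebesgue_on \<Omega>. (c1 * h1 x + c2 * h2 x) * \<phi> x)"
    if \<phi>: "test_fun \<Omega> \<phi>" for \<phi>
  proof -
    note i1 = integral_inner_grad(2)[OF \<Omega> lF(1) \<phi>] and i2 = integral_inner_grad(2)[OF \<Omega> lF(2) \<phi>]
    note j1 = integrable_loc_integrable_mult[OF \<Omega> lF(3) \<phi>] and j2 = integrable_loc_integrable_mult[OF \<Omega> lF(4) \<phi>]
    have "(LINT x|lebesgue_on \<Omega>. F x \<bullet> grad \<phi> x) = (LINT x|lebesgue_on \<Omega>. c1 * (F1 x \<bullet> grad \<phi> x) + c2 * (F2 x \<bullet> grad \<phi> x))"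
    proof (rule integral_cong_AE)
      show "(\<lambda>x. F x \<bullet> grad \<phi> x) \<in> borel_measurable (lebesgue_on \<Omega>)"
        by (rule borel_measurable_integrable[OF integral_inner_grad(2)[OF \<Omega> l \<phi>]])
      show "(\<lambda>x. c1 * (F1 x \<bullet> grad \<phi> x) + c2 * (F2 x \<bullet> grad \<phi> x)) \<in> borel_measurable (lebesgue_on \<Omega>)"
        using i1 i2 by (intro borel_measurable_integrable) auto
      show "AE x in lebesgue_on \<Omega>. F x \<bullet> grad \<phi> x = c1 * (F1 x \<bullet> grad \<phi> x) + c2 * (F2 x \<bullet> grad \<phi> x)"
        using F by eventually_elim (simp add: inner_add_left)
    qed
    also have "\<dots> = c1 * (LINT x|lebesgue_on \<Omega>. F1 x \<bullet> grad \<phi> x) + c2 * (LINT x|lebesgue_on \<Omega>. F2 x \<bullet> grad \<phi> x)"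
      using i1 i2 by simp
    also have "\<dots> = - (c1 * (LINT x|lebesgue_on \<Omega>. h1 x * \<phi> x) + c2 * (LINT x|lebesgue_on \<Omega>. h2 x * \<phi> x))"
      using 1 2 \<phi> by (simp add: weak_div_def)
    also have "c1 * (LINT x|lebesgue_on \<Omega>. h1 x * \<phi> x) + c2 * (LINT x|lebesgue_on \<Omega>. h2 x * \<phi> x) =
        (LINT x|lebesgue_on \<Omega>. (c1 * h1 x + c2 * h2 x) * \<phi> x)"
      using j1 j2 by (simp add: distrib_right mult.assoc)
    finally show ?thesis .
  qed
  then show ?thesis using l lh by (simp add: weak_div_def)
qed

lemma weak_div_wdiv: "weak_div \<Omega> F h \<Longrightarrow> weak_div \<Omega> F (wdiv \<Omega> F)"
  unfolding wdiv_def by (rule someI[of "weak_div \<Omega> F" h])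

lemma weak_div_components:
  assumes \<Omega>: "open \<Omega>" and F: "\<And>b. b \<in> Basis \<Longrightarrow> weak_deriv \<Omega> b (\<lambda>x. F x \<bullet> b) (h b)"
  shows "weak_div \<Omega> F (\<lambda>x. \<Sum>b\<in>Basis. h b x)"
proof -
  have l: "loc_integrable \<Omega> (\<lambda>x. F x \<bullet> b)" "loc_integrable \<Omega> (h b)" if "b \<in> Basis" for b
    using F[OF that] unfolding weak_deriv_def by blast+
  have lF: "loc_integrable \<Omega> F" by (rule loc_integrable_vector) (rule l(1))
  have lh: "loc_integrable \<Omega> (\<lambda>x. \<Sum>b\<in>Basis. h b x)"
    by (rule loc_integrable_sum[OF finite_Basis]) (rule l(2))
  have "(LINT x|lebesgue_on \<Omega>. F x \<bullet> grad \<phi> x) = - (LINT x|lebesgue_on \<Omega>. (\<Sum>b\<in>Basis. h b x) * \<phi> x)"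
    if \<phi>: "test_fun \<Omega> \<phi>" for \<phi>
  proof -
    have "(LINT x|lebesgue_on \<Omega>. F x \<bullet> grad \<phi> x) = (\<Sum>b\<in>Basis. - (LINT x|lebesgue_on \<Omega>. h b x * \<phi> x))"
      unfolding integral_inner_grad(1)[OF \<Omega> lF \<phi>]
    proof (rule sum.cong[OF refl])
      show "(LINT x|lebesgue_on \<Omega>. (F x \<bullet> b) * (grad \<phi> x \<bullet> b)) = - (LINT x|lebesgue_on \<Omega>. h b x * \<phi> x)"
        if "b \<in> Basis" for b
        using F[OF that] \<phi> unfolding weak_deriv_def by blast
    qed
    also have "\<dots> = - (\<Sum>b\<in>Basis. (LINT x|lebesgue_on \<Omega>. h b x * \<phi> x))" by (rule sum_negf)
    also have "(\<Sum>b\<in>Basis. (LINT x|lebesgue_on \<Omega>. h b x * \<phi> x)) = (LINT x|lebesgue_on \<Omega>. (\<Sum>b\<in>Basis. h b x * \<phi> x))"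
      using integrable_loc_integrable_mult[OF \<Omega> l(2) \<phi>] by (intro Bochner_Integration.integral_sum[symmetric])
    finally show ?thesis by (simp add: sum_distrib_right)
  qed
  then show ?thesis using lF lh unfolding weak_div_def by blast
qed

section \<open>Products of Sobolev functions\<close>

lemma compactly_embeds_C_bound:
  assumes "compactly_embeds_C \<Omega> s" "open \<Omega>" "s \<ge> 1"
  obtains C where "C \<ge> 0" "\<And>v. v \<in> W 1 \<Omega> s \<Longrightarrow> \<exists>c. continuous_on \<Omega> c \<and> ae_eq \<Omega> v c"
    "\<And>v. v \<in> W 1 \<Omega> s \<Longrightarrow> AE x in lebesgue_on \<Omega>. \<bar>v x\<bar> \<le> C * W_norm 1 \<Omega> s v"
proof -
  obtain C where C: "\<forall>v\<in>W 1 \<Omega> s. \<exists>c. continuous_on (closure \<Omega>) c \<and> ae_eq \<Omega> v c \<and>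
        (\<forall>x\<in>closure \<Omega>. \<bar>c x\<bar> \<le> C * W_norm 1 \<Omega> s v)"
    using assms(1) unfolding compactly_embeds_C_def by blast
  show thesis
  proof (rule that[of "max C 0"])
    fix v assume v: "v \<in> W 1 \<Omega> s"
    obtain c where c: "continuous_on (closure \<Omega>) c" "ae_eq \<Omega> v c" "\<forall>x\<in>closure \<Omega>. \<bar>c x\<bar> \<le> C * W_norm 1 \<Omega> s v"
      using C v by blast
    show "\<exists>c. continuous_on \<Omega> c \<and> ae_eq \<Omega> v c"
      using c continuous_on_subset closure_subset by blast
    have "AE x in lebesgue_on \<Omega>. x \<in> \<Omega>" using AE_space[of "lebesgue_on \<Omega>"] by simp
    then show "AE x in lebesgue_on \<Omega>. \<bar>v x\<bar> \<le> max C 0 * W_norm 1 \<Omega> s v"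
      using c(2) unfolding ae_eq_def
    proof eventually_elim
      case (elim x)
      then have "\<bar>v x\<bar> \<le> C * W_norm 1 \<Omega> s v" using c(3) closure_subset by fastforce
      also have "\<dots> \<le> max C 0 * W_norm 1 \<Omega> s v"
        by (rule mult_right_mono[OF max.cobounded1 W_norm_nonneg[OF assms(2,3)]])
      finally show ?case .
    qed
  qed simp
qed

text \<open>
  \<open>W\<^sup>1\<^sup>,\<^sup>s\<close> is an algebra. The embedding supplies continuous representatives, to which the product rule applies,
  and bounds on them, so that each term of \<open>v \<nabla>w + w \<nabla>v\<close> is a bounded function times one in \<open>L\<^sup>s\<close>.
\<close>

lemma W1_mult:
  assumes \<Omega>: "open \<Omega>" and s: "s \<ge> 1" and emb: "compactly_embeds_C \<Omega> s"
  obtains C where "C \<ge> 0" "\<And>v w. v \<in> W 1 \<Omega> s \<Longrightarrow> w \<in> W 1 \<Omega> s \<Longrightarrow>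
    (\<lambda>x. v x * w x) \<in> W 1 \<Omega> s \<and> W_norm 1 \<Omega> s (\<lambda>x. v x * w x) \<le> C * W_norm 1 \<Omega> s v * W_norm 1 \<Omega> s w"
proof -
  obtain C where C: "C \<ge> 0" "\<And>v. v \<in> W 1 \<Omega> s \<Longrightarrow> \<exists>c. continuous_on \<Omega> c \<and> ae_eq \<Omega> v c"
    "\<And>v. v \<in> W 1 \<Omega> s \<Longrightarrow> AE x in lebesgue_on \<Omega>. \<bar>v x\<bar> \<le> C * W_norm 1 \<Omega> s v"
    by (rule compactly_embeds_C_bound[OF emb \<Omega> s]) (rule that)
  let ?N = "W_norm 1 \<Omega> s"
  have nn: "?N v \<ge> 0" for v by (rule W_norm_nonneg[OF \<Omega> s])
  have main: "(\<lambda>x. v x * w x) \<in> W 1 \<Omega> s \<and> ?N (\<lambda>x. v x * w x) \<le> (2 * C) * ?N v * ?N w"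
    if v: "v \<in> W 1 \<Omega> s" and w: "w \<in> W 1 \<Omega> s" for v w
  proof -
    obtain cv where cv: "continuous_on \<Omega> cv" "ae_eq \<Omega> v cv" using C(2)[OF v] by auto
    obtain cw where cw: "continuous_on \<Omega> cw" "ae_eq \<Omega> w cw" using C(2)[OF w] by auto
    have vL: "v \<in> Lp \<Omega> s" and wL: "w \<in> Lp \<Omega> s" using W_imp_Lp[OF \<Omega> s] v w by auto
    let ?gv = "wgrad \<Omega> v" and ?gw = "wgrad \<Omega> w"
    have gv: "weak_grad \<Omega> v ?gv" "\<And>b. b \<in> Basis \<Longrightarrow> (\<lambda>x. ?gv x \<bullet> b) \<in> Lp \<Omega> s"
      using W_SucD[OF \<Omega> s, of v 0] v by auto
    have gw: "weak_grad \<Omega> w ?gw" "\<And>b. b \<in> Basis \<Longrightarrow> (\<lambda>x. ?gw x \<bullet> b) \<in> Lp \<Omega> s"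
      using W_SucD[OF \<Omega> s, of w 0] w by auto
    define g where "g x = v x *\<^sub>R ?gw x + w x *\<^sub>R ?gv x" for x
    have gb: "g x \<bullet> b = v x * (?gw x \<bullet> b) + w x * (?gv x \<bullet> b)" for x b by (simp add: g_def inner_add_left)
    have wg: "weak_grad \<Omega> (\<lambda>x. v x * w x) g"
      unfolding weak_grad_iff
    proof
      fix b :: 'a assume b: "b \<in> Basis"
      have "weak_deriv \<Omega> b v (\<lambda>x. ?gv x \<bullet> b)" "weak_deriv \<Omega> b w (\<lambda>x. ?gw x \<bullet> b)"
        using gv(1) gw(1) b by (auto simp: weak_grad_iff)
      then have "weak_deriv \<Omega> b cv (\<lambda>x. ?gv x \<bullet> b)" "weak_deriv \<Omega> b cw (\<lambda>x. ?gw x \<bullet> b)"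
        using weak_deriv_cong_AE[OF \<Omega> _ _ ae_eq_refl b] cv(2) cw(2) by blast+
      from weak_deriv_mult[OF \<Omega> b cv(1) this(1) cw(1) this(2)]
      show "weak_deriv \<Omega> b (\<lambda>x. v x * w x) (\<lambda>x. g x \<bullet> b)"
      proof (rule weak_deriv_cong_AE[OF \<Omega> _ _ _ b])
        show "ae_eq \<Omega> (\<lambda>x. cv x * cw x) (\<lambda>x. v x * w x)"
          using cv(2) cw(2) unfolding ae_eq_def by eventually_elim simp
        show "ae_eq \<Omega> (\<lambda>x. cv x * (?gw x \<bullet> b) + cw x * (?gv x \<bullet> b)) (\<lambda>x. g x \<bullet> b)"
          using cv(2) cw(2) unfolding ae_eq_def gb by eventually_elim simp
      qed
    qed
    note vm = Lp_mult_bounded[OF s _ Lp_measurable[OF vL] C(3)[OF v]]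
    note wm = Lp_mult_bounded[OF s _ Lp_measurable[OF wL] C(3)[OF w]]
    have c0: "0 \<le> C * ?N v" "0 \<le> C * ?N w" using C(1) nn by auto
    have 1: "(\<lambda>x. v x * w x) \<in> Lp \<Omega> s" "Lp_norm \<Omega> s (\<lambda>x. v x * w x) \<le> C * ?N v * Lp_norm \<Omega> s w"
      using vm[OF wL c0(1)] by auto
    have 2: "(\<lambda>x. g x \<bullet> b) \<in> Lp \<Omega> s" and
      3: "Lp_norm \<Omega> s (\<lambda>x. g x \<bullet> b) \<le> C * ?N v * Lp_norm \<Omega> s (\<lambda>x. ?gw x \<bullet> b) + C * ?N w * Lp_norm \<Omega> s (\<lambda>x. ?gv x \<bullet> b)"
      if b: "b \<in> Basis" for b
      unfolding gb using Lp_add[OF s vm(1)[OF gw(2)[OF b] c0(1)] wm(1)[OF gv(2)[OF b] c0(2)]]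
        vm(2)[OF gw(2)[OF b] c0(1)] wm(2)[OF gv(2)[OF b] c0(2)] by auto
    have 4: "Lp_norm \<Omega> s (\<lambda>x. wgrad \<Omega> (\<lambda>x. v x * w x) x \<bullet> b) = Lp_norm \<Omega> s (\<lambda>x. g x \<bullet> b)" if b: "b \<in> Basis" for b
      using Lp_cong_AE(2)[OF domain_sets[OF \<Omega>] s 2[OF b] wgrad_inner_AE[OF \<Omega> wg]] .
    have in1: "(\<lambda>x. v x * w x) \<in> W 1 \<Omega> s" using 1 wg 2 by auto
    have "?N (\<lambda>x. v x * w x) = Lp_norm \<Omega> s (\<lambda>x. v x * w x) + (\<Sum>b\<in>Basis. Lp_norm \<Omega> s (\<lambda>x. g x \<bullet> b))"
      using 4 by simp
    also have "\<dots> \<le> C * ?N v * Lp_norm \<Omega> s w +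
        (\<Sum>b\<in>Basis. C * ?N v * Lp_norm \<Omega> s (\<lambda>x. ?gw x \<bullet> b) + C * ?N w * Lp_norm \<Omega> s (\<lambda>x. ?gv x \<bullet> b))"
      by (intro add_mono 1 sum_mono 3)
    also have "\<dots> = C * ?N v * ?N w + C * ?N w * (\<Sum>b\<in>Basis. Lp_norm \<Omega> s (\<lambda>x. ?gv x \<bullet> b))"
      by (simp add: sum.distrib sum_distrib_left algebra_simps)
    also have "\<dots> \<le> C * ?N v * ?N w + C * ?N w * ?N v"
      using c0(2) by (intro add_left_mono mult_left_mono) (auto simp: Lp_norm_nonneg)
    also have "\<dots> = (2 * C) * ?N v * ?N w" by (simp only: mult_2 distrib_right distrib_left mult_ac)
    finally show ?thesis using in1 by blast
  qed
  show thesis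
  proof (rule that[of "2 * C"])
    show "0 \<le> 2 * C" using C(1) by simp
  qed (rule main)
qed

lemma inner_wgrad_W1:
  assumes \<Omega>: "open \<Omega>" and s: "s \<ge> 1" and emb: "compactly_embeds_C \<Omega> s"
  obtains C where "C \<ge> 0" "\<And>v w. v \<in> W 2 \<Omega> s \<Longrightarrow> w \<in> W 2 \<Omega> s \<Longrightarrow>
    (\<lambda>x. wgrad \<Omega> v x \<bullet> wgrad \<Omega> w x) \<in> W 1 \<Omega> s \<and>
    W_norm 1 \<Omega> s (\<lambda>x. wgrad \<Omega> v x \<bullet> wgrad \<Omega> w x) \<le> C * W_norm 2 \<Omega> s v * W_norm 2 \<Omega> s w"
proof -
  obtain C where C: "C \<ge> 0" "\<And>v w. v \<in> W 1 \<Omega> s \<Longrightarrow> w \<in> W 1 \<Omega> s \<Longrightarrow>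
    (\<lambda>x. v x * w x) \<in> W 1 \<Omega> s \<and> W_norm 1 \<Omega> s (\<lambda>x. v x * w x) \<le> C * W_norm 1 \<Omega> s v * W_norm 1 \<Omega> s w"
    by (rule W1_mult[OF \<Omega> s emb]) (rule that)
  have two: "2 = Suc 1" by simp
  have main: "(\<lambda>x. wgrad \<Omega> v x \<bullet> wgrad \<Omega> w x) \<in> W 1 \<Omega> s \<and>
    W_norm 1 \<Omega> s (\<lambda>x. wgrad \<Omega> v x \<bullet> wgrad \<Omega> w x) \<le> (DIM('a) * C) * W_norm 2 \<Omega> s v * W_norm 2 \<Omega> s w"
    if v: "v \<in> W 2 \<Omega> s" and w: "w \<in> W 2 \<Omega> s" for v w
  proof -
    let ?v = "\<lambda>b x. wgrad \<Omega> v x \<bullet> b" and ?w = "\<lambda>b x. wgrad \<Omega> w x \<bullet> b"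
    have v': "v \<in> W (Suc 1) \<Omega> s" and w': "w \<in> W (Suc 1) \<Omega> s"
      using v w unfolding two by this+
    note vb = W_SucD(2)[OF \<Omega> s v'] and wb = W_SucD(2)[OF \<Omega> s w']
    have prod: "(\<lambda>x. ?v b x * ?w b x) \<in> W 1 \<Omega> s"
        "W_norm 1 \<Omega> s (\<lambda>x. ?v b x * ?w b x) \<le> C * W_norm 2 \<Omega> s v * W_norm 2 \<Omega> s w" if b: "b \<in> Basis" for b
    proof -
      show "(\<lambda>x. ?v b x * ?w b x) \<in> W 1 \<Omega> s" using C(2)[OF vb[OF b] wb[OF b]] by (rule conjunct1)
      have "W_norm 1 \<Omega> s (\<lambda>x. ?v b x * ?w b x) \<le> C * W_norm 1 \<Omega> s (?v b) * W_norm 1 \<Omega> s (?w b)"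
        using C(2)[OF vb[OF b] wb[OF b]] by (rule conjunct2)
      also have "\<dots> \<le> C * W_norm 2 \<Omega> s v * W_norm 2 \<Omega> s w"
        unfolding two
        by (intro mult_mono order_refl mult_nonneg_nonneg W_norm_nonneg[OF \<Omega> s] W_norm_wgrad_le[OF \<Omega> s b] C(1))
      finally show "W_norm 1 \<Omega> s (\<lambda>x. ?v b x * ?w b x) \<le> C * W_norm 2 \<Omega> s v * W_norm 2 \<Omega> s w" .
    qed
    have S: "(\<lambda>x. \<Sum>b\<in>Basis. ?v b x * ?w b x) \<in> W 1 \<Omega> s \<and>
        W_norm 1 \<Omega> s (\<lambda>x. \<Sum>b\<in>Basis. ?v b x * ?w b x) \<le> (\<Sum>b\<in>Basis. W_norm 1 \<Omega> s (\<lambda>x. ?v b x * ?w b x))"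
      by (rule W_sum[OF \<Omega> s finite_Basis nonempty_Basis]) (rule prod(1))
    have "(\<Sum>b\<in>Basis. W_norm 1 \<Omega> s (\<lambda>x. ?v b x * ?w b x)) \<le> (\<Sum>b\<in>(Basis::'a set). C * W_norm 2 \<Omega> s v * W_norm 2 \<Omega> s w)"
      by (rule sum_mono) (rule prod(2))
    also have "\<dots> = (DIM('a) * C) * W_norm 2 \<Omega> s v * W_norm 2 \<Omega> s w" by simp
    finally have "(\<Sum>b\<in>Basis. W_norm 1 \<Omega> s (\<lambda>x. ?v b x * ?w b x)) \<le> (DIM('a) * C) * W_norm 2 \<Omega> s v * W_norm 2 \<Omega> s w" .
    moreover have "(\<lambda>x. wgrad \<Omega> v x \<bullet> wgrad \<Omega> w x) = (\<lambda>x. \<Sum>b\<in>Basis. ?v b x * ?w b x)"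
      by (rule ext) (rule euclidean_inner)
    ultimately show ?thesis using S by (metis (no_types, lifting) order_trans)
  qed
  show thesis
  proof (rule that[of "DIM('a) * C"])
    show "0 \<le> DIM('a) * C" using C(1) by simp
  qed (rule main)
qed

text \<open>
  Each component of \<open>a \<nabla>v\<close> is a product of two functions in \<open>W\<^sup>1\<^sup>,\<^sup>s\<close>, and the divergence is the sum of their
  partial derivatives.
\<close>

lemma div_coef_Lp:
  assumes \<Omega>: "open \<Omega>" and s: "s \<ge> 1" and emb: "compactly_embeds_C \<Omega> s"
  obtains C where "C \<ge> 0"
    "\<And>a v. a \<in> W 1 \<Omega> s \<Longrightarrow> v \<in> W 2 \<Omega> s \<Longrightarrow> weak_div \<Omega> (\<lambda>x. a x *\<^sub>R wgrad \<Omega> v x) (div_coef \<Omega> a v)"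
    "\<And>a v. a \<in> W 1 \<Omega> s \<Longrightarrow> v \<in> W 2 \<Omega> s \<Longrightarrow> div_coef \<Omega> a v \<in> Lp \<Omega> s"
    "\<And>a v. a \<in> W 1 \<Omega> s \<Longrightarrow> v \<in> W 2 \<Omega> s \<Longrightarrow>
       Lp_norm \<Omega> s (div_coef \<Omega> a v) \<le> C * W_norm 1 \<Omega> s a * W_norm 2 \<Omega> s v"
proof -
  obtain C where C: "C \<ge> 0" "\<And>v w. v \<in> W 1 \<Omega> s \<Longrightarrow> w \<in> W 1 \<Omega> s \<Longrightarrow>
    (\<lambda>x. v x * w x) \<in> W 1 \<Omega> s \<and> W_norm 1 \<Omega> s (\<lambda>x. v x * w x) \<le> C * W_norm 1 \<Omega> s v * W_norm 1 \<Omega> s w"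
    by (rule W1_mult[OF \<Omega> s emb]) (rule that)
  have two: "2 = Suc 1" by simp
  have main: "weak_div \<Omega> (\<lambda>x. a x *\<^sub>R wgrad \<Omega> v x) (div_coef \<Omega> a v) \<and> div_coef \<Omega> a v \<in> Lp \<Omega> s \<and>
    Lp_norm \<Omega> s (div_coef \<Omega> a v) \<le> (DIM('a) * C) * W_norm 1 \<Omega> s a * W_norm 2 \<Omega> s v"
    if a: "a \<in> W 1 \<Omega> s" and v: "v \<in> W 2 \<Omega> s" for a v
  proof -
    let ?F = "\<lambda>b x. a x * (wgrad \<Omega> v x \<bullet> b)"
    define h where "h b x = wgrad \<Omega> (?F b) x \<bullet> b" for b x
    have v': "v \<in> W (Suc 1) \<Omega> s" using v unfolding two .
    note vb = W_SucD(2)[OF \<Omega> s v']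
    have F: "?F b \<in> W 1 \<Omega> s" "W_norm 1 \<Omega> s (?F b) \<le> C * W_norm 1 \<Omega> s a * W_norm 2 \<Omega> s v" if b: "b \<in> Basis" for b
    proof -
      show "?F b \<in> W 1 \<Omega> s" using C(2)[OF a vb[OF b]] by (rule conjunct1)
      have "W_norm 1 \<Omega> s (?F b) \<le> C * W_norm 1 \<Omega> s a * W_norm 1 \<Omega> s (\<lambda>x. wgrad \<Omega> v x \<bullet> b)"
        using C(2)[OF a vb[OF b]] by (rule conjunct2)
      also have "\<dots> \<le> C * W_norm 1 \<Omega> s a * W_norm 2 \<Omega> s v"
        unfolding two
        by (intro mult_left_mono mult_nonneg_nonneg W_norm_nonneg[OF \<Omega> s] W_norm_wgrad_le[OF \<Omega> s b] C(1))
      finally show "W_norm 1 \<Omega> s (?F b) \<le> C * W_norm 1 \<Omega> s a * W_norm 2 \<Omega> s v" .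
    qed
    have hb: "weak_deriv \<Omega> b (?F b) (h b)" "h b \<in> Lp \<Omega> s"
        "Lp_norm \<Omega> s (h b) \<le> C * W_norm 1 \<Omega> s a * W_norm 2 \<Omega> s v" if b: "b \<in> Basis" for b
    proof -
      have F0: "?F b \<in> W (Suc 0) \<Omega> s" using F(1)[OF b] by simp
      show "weak_deriv \<Omega> b (?F b) (h b)"
        using W_SucD(1)[OF \<Omega> s F0] b unfolding weak_grad_iff h_def by blast
      show "h b \<in> Lp \<Omega> s" using W_SucD(2)[OF \<Omega> s F0 b] unfolding h_def by simp
      show "Lp_norm \<Omega> s (h b) \<le> C * W_norm 1 \<Omega> s a * W_norm 2 \<Omega> s v"
        using W_norm_wgrad_le[OF \<Omega> s b, of 0 "?F b"] F(2)[OF b] unfolding h_def by simp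
    qed
    have wd: "weak_div \<Omega> (\<lambda>x. a x *\<^sub>R wgrad \<Omega> v x) (\<lambda>x. \<Sum>b\<in>Basis. h b x)"
      using hb(1) by (intro weak_div_components[OF \<Omega>]) simp
    have wd': "weak_div \<Omega> (\<lambda>x. a x *\<^sub>R wgrad \<Omega> v x) (div_coef \<Omega> a v)"
      unfolding div_coef_def by (rule weak_div_wdiv[OF wd])
    have S: "(\<lambda>x. \<Sum>b\<in>Basis. h b x) \<in> Lp \<Omega> s \<and> Lp_norm \<Omega> s (\<lambda>x. \<Sum>b\<in>Basis. h b x) \<le> (\<Sum>b\<in>Basis. Lp_norm \<Omega> s (h b))"
      by (rule Lp_sum[OF s finite_Basis hb(2)])
    have "(\<Sum>b\<in>Basis. Lp_norm \<Omega> s (h b)) \<le> (\<Sum>b\<in>(Basis::'a set). C * W_norm 1 \<Omega> s a * W_norm 2 \<Omega> s v)"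
      by (rule sum_mono) (rule hb(3))
    also have "\<dots> = (DIM('a) * C) * W_norm 1 \<Omega> s a * W_norm 2 \<Omega> s v" by simp
    finally have "Lp_norm \<Omega> s (\<lambda>x. \<Sum>b\<in>Basis. h b x) \<le> (DIM('a) * C) * W_norm 1 \<Omega> s a * W_norm 2 \<Omega> s v"
      using S by linarith
    then show ?thesis
      using wd' S Lp_cong_AE[OF domain_sets[OF \<Omega>] s _ weak_div_unique[OF \<Omega> wd wd']] by auto
  qed
  show thesis
    by (rule that[of "DIM('a) * C"]) (use main C(1) in auto)
qed

section \<open>Newton iterations in seminormed spaces\<close>

text \<open>
  Pointwise operations; with them pairs of functions form a real vector space, and Newton iterates can be
  added and subtracted as vectors.
\<close>

instantiation "fun" :: (type, real_vector) real_vector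
begin

definition scaleR_fun :: "real \<Rightarrow> ('a \<Rightarrow> 'b) \<Rightarrow> 'a \<Rightarrow> 'b" where
  "scaleR_fun c f = (\<lambda>x. c *\<^sub>R f x)"

instance
  by standard (simp_all add: scaleR_fun_def plus_fun_def scaleR_add_left scaleR_add_right)

end

text \<open>
  Functions that vanish almost everywhere have norm zero without being zero, so norms are replaced by
  seminorms on a subspace.
\<close>

locale seminormed =
  fixes V :: "'v::real_vector set" and n :: "'v \<Rightarrow> real"
  assumes subspace: "subspace V"
    and norm_scaleR: "v \<in> V \<Longrightarrow> n (c *\<^sub>R v) = \<bar>c\<bar> * n v"
    and norm_add: "v \<in> V \<Longrightarrow> w \<in> V \<Longrightarrow> n (v + w) \<le> n v + n w"
begin

lemma mem: "0 \<in> V" "v \<in> V \<Longrightarrow> w \<in> V \<Longrightarrow> v + w \<in> V" "v \<in> V \<Longrightarrow> w \<in> V \<Longrightarrow> v - w \<in> V"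
    "v \<in> V \<Longrightarrow> - v \<in> V" "v \<in> V \<Longrightarrow> c *\<^sub>R v \<in> V"
  using subspace by (auto intro: subspace_0 subspace_add subspace_diff subspace_neg subspace_scale)

lemma mem_sum: "(\<And>i. i \<in> I \<Longrightarrow> v i \<in> V) \<Longrightarrow> (\<Sum>i\<in>I. v i) \<in> V"
  using subspace by (rule subspace_sum)

lemma norm_0: "n 0 = 0"
  using norm_scaleR[OF mem(1), of 0] by simp

lemma norm_minus: "v \<in> V \<Longrightarrow> n (- v) = n v"
  using norm_scaleR[of v "-1"] by simp

lemma norm_diff_commute: "v \<in> V \<Longrightarrow> w \<in> V \<Longrightarrow> n (v - w) = n (w - v)"
  using norm_minus[of "v - w"] mem(3) by simp

lemma norm_diff: "v \<in> V \<Longrightarrow> w \<in> V \<Longrightarrow> n (v - w) \<le> n v + n w"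
  using norm_add[of v "- w"] norm_minus[of w] mem(4)[of w] by simp

lemma norm_nonneg: "v \<in> V \<Longrightarrow> n v \<ge> 0"
  using norm_diff[of v v] norm_0 by simp

lemma norm_triangle: "u \<in> V \<Longrightarrow> v \<in> V \<Longrightarrow> w \<in> V \<Longrightarrow> n (u - w) \<le> n (u - v) + n (v - w)"
  using norm_add[of "u - v" "v - w"] mem(3) by simp

lemma norm_eq_of_diff_0:
  assumes "v \<in> V" "w \<in> V" "n (v - w) = 0"
  shows "n v = n w"
proof (rule antisym)
  show "n v \<le> n w" using norm_add[of "v - w" w] assms mem by simp
  show "n w \<le> n v" using norm_diff[of v "v - w"] assms mem by simp
qed

end

text \<open>
  The ingredients of the Newton iteration \<open>M x \<delta> = - F x\<close> near a zero \<open>xs\<close>. Equality in the target space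
  means that the difference has seminorm zero, and \<open>M x\<close> is additive in this sense. The continuity of \<open>M\<close>
  and the approximation property of \<open>F\<close> refer to the point \<open>xs\<close>; the latter contains \<open>F xs = 0\<close>, by taking
  \<open>x = xs\<close>.
\<close>

locale semismooth_newton = X: seminormed X nX + Z: seminormed Z nZ
  for X :: "'x::real_vector set" and nX and Z :: "'z::real_vector set" and nZ +
  fixes M :: "'x \<Rightarrow> 'x \<Rightarrow> 'z" and F :: "'x \<Rightarrow> 'z" and xs :: 'x
  assumes complete: "\<And>h C. (\<And>n::nat. h n \<in> Z) \<Longrightarrow> (\<And>n. nZ (h n) \<le> C * (1 / 2) ^ n) \<Longrightarrow>
      \<exists>l\<in>Z. (\<lambda>N. nZ (l - (\<Sum>i<N. h i))) \<longlonglongrightarrow> 0"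
    and M_in: "x \<in> X \<Longrightarrow> v \<in> X \<Longrightarrow> M x v \<in> Z"
    and M_diff: "x \<in> X \<Longrightarrow> v \<in> X \<Longrightarrow> w \<in> X \<Longrightarrow> nZ (M x (v - w) - (M x v - M x w)) = 0"
    and M_bounded: "x \<in> X \<Longrightarrow> \<exists>C. \<forall>v\<in>X. nZ (M x v) \<le> C * nX v"
    and F_in: "x \<in> X \<Longrightarrow> F x \<in> Z"
    and xs: "xs \<in> X"
    and M_inverse_bounded: "\<exists>C. \<forall>v\<in>X. nX v \<le> C * nZ (M xs v)"
    and M_surj: "g \<in> Z \<Longrightarrow> \<exists>v\<in>X. nZ (M xs v - g) = 0"
    and M_continuous: "\<kappa> > 0 \<Longrightarrow> \<exists>\<epsilon>>0. \<forall>x\<in>X. nX (x - xs) < \<epsilon> \<longrightarrow>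
      (\<forall>v\<in>X. nZ (M x v - M xs v) \<le> \<kappa> * nX v)"
    and F_approx: "\<kappa> > 0 \<Longrightarrow> \<exists>\<epsilon>>0. \<forall>x\<in>X. nX (x - xs) < \<epsilon> \<longrightarrow>
      nZ (F x - M x (x - xs)) \<le> \<kappa> * nX (x - xs)"
begin

lemma norm_M_diff: "x \<in> X \<Longrightarrow> v \<in> X \<Longrightarrow> w \<in> X \<Longrightarrow> nZ (M x (v - w)) = nZ (M x v - M x w)"
  by (intro Z.norm_eq_of_diff_0 M_diff Z.mem X.mem M_in)

lemma M_add: 
  assumes "x \<in> X" "v \<in> X" "w \<in> X"
  shows "nZ (M x (v + w) - (M x v + M x w)) = 0"
proof -
  have "nZ (M x ((v + w) - w) - (M x (v + w) - M x w)) = 0"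
    using assms by (intro M_diff X.mem)
  then have "nZ (M x v - (M x (v + w) - M x w)) = 0" by simp
  then have "nZ (- (M x v - (M x (v + w) - M x w))) = 0"
    using assms by (subst Z.norm_minus) (auto intro!: Z.mem X.mem M_in)
  then show ?thesis by (simp add: algebra_simps)
qed

definition "Cinv = (SOME C. C > 0 \<and> (\<forall>v\<in>X. nX v \<le> C * nZ (M xs v)))"

lemma Cinv: "Cinv > 0" "v \<in> X \<Longrightarrow> nX v \<le> Cinv * nZ (M xs v)"
proof -
  obtain C where C: "\<forall>v\<in>X. nX v \<le> C * nZ (M xs v)" using M_inverse_bounded by blast
  have "max C 1 > 0 \<and> (\<forall>v\<in>X. nX v \<le> max C 1 * nZ (M xs v))"
  proof (intro conjI ballI)
    fix v assume v: "v \<in> X"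
    have "nX v \<le> C * nZ (M xs v)" using C v by blast
    also have "\<dots> \<le> max C 1 * nZ (M xs v)"
      using M_in[OF xs v] by (intro mult_right_mono Z.norm_nonneg) auto
    finally show "nX v \<le> max C 1 * nZ (M xs v)" .
  qed simp
  then have "Cinv > 0 \<and> (\<forall>v\<in>X. nX v \<le> Cinv * nZ (M xs v))" unfolding Cinv_def by (rule someI)
  then show "Cinv > 0" "v \<in> X \<Longrightarrow> nX v \<le> Cinv * nZ (M xs v)" by auto
qed

text \<open>
  The points at which \<open>M x\<close> differs from \<open>M xs\<close> by so little that a perturbation argument halves the error.
\<close>

definition "close_op x \<longleftrightarrow> x \<in> X \<and> (\<forall>v\<in>X. nZ (M x v - M xs v) \<le> (1 / (2 * Cinv)) * nX v)"

lemma close_op_bound: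
  assumes x: "close_op x" and v: "v \<in> X"
  shows "nX v \<le> 2 * Cinv * nZ (M x v)"
proof -
  have xX: "x \<in> X" using x by (simp add: close_op_def)
  have "nZ (M xs v) \<le> nZ (M x v) + nZ (M x v - M xs v)"
    using Z.norm_diff[of "M x v" "M x v - M xs v"] M_in xX xs v Z.mem by simp
  also have "\<dots> \<le> nZ (M x v) + (1 / (2 * Cinv)) * nX v"
    using x v by (simp add: close_op_def)
  finally have "Cinv * nZ (M xs v) \<le> Cinv * (nZ (M x v) + (1 / (2 * Cinv)) * nX v)"
    using Cinv(1) by (intro mult_left_mono) auto
  also have "\<dots> = Cinv * nZ (M x v) + nX v / 2" using Cinv(1) by (simp add: field_simps)
  finally show ?thesis using Cinv(2)[OF v] by simp
qed

text \<open>
  The Neumann series, arranged in the target space: solving with \<open>M xs\<close> instead of \<open>M x\<close> leaves a residual of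
  at most half the size, and the residuals \<open>r i\<close> have a sum \<open>l\<close> because the target is complete. The element
  that \<open>M xs\<close> maps to \<open>l\<close> solves the equation for \<open>M x\<close>.
\<close>

lemma close_op_surj:
  assumes x: "close_op x" and g: "g \<in> Z"
  shows "\<exists>v\<in>X. nZ (M x v - g) = 0"
proof -
  have xX: "x \<in> X" using x by (simp add: close_op_def)
  define S where "S h = (SOME v. v \<in> X \<and> nZ (M xs v - h) = 0)" for h
  have S: "S h \<in> X" "nZ (M xs (S h) - h) = 0" if "h \<in> Z" for h
  proof -
    have "S h \<in> X \<and> nZ (M xs (S h) - h) = 0"
      unfolding S_def by (rule someI_ex[of "\<lambda>v. v \<in> X \<and> nZ (M xs v - h) = 0"]) (use M_surj[OF that] in blast)
    then show "S h \<in> X" "nZ (M xs (S h) - h) = 0" by auto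
  qed
  have Sb: "nX (S h) \<le> Cinv * nZ h" if "h \<in> Z" for h
    using Cinv(2)[OF S(1)[OF that]] Z.norm_eq_of_diff_0[OF M_in[OF xs S(1)[OF that]] that S(2)[OF that]] by simp
  define r where "r = rec_nat g (\<lambda>n h. h - M x (S h))"
  have r_Suc: "r (Suc n) = r n - M x (S (r n))" and r0: "r 0 = g" for n by (simp_all add: r_def)
  have r: "r n \<in> Z" for n
    by (induction n) (simp_all add: r0 r_Suc g Z.mem M_in xX S)
  have half: "nZ (r (Suc n)) \<le> nZ (r n) * (1 / 2)" for n
  proof -
    let ?v = "S (r n)"
    have v: "?v \<in> X" by (rule S[OF r])
    have "nZ (M x ?v - r n) \<le> nZ (M x ?v - M xs ?v) + nZ (M xs ?v - r n)"
      using v xX xs r by (intro Z.norm_triangle M_in)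
    also have "\<dots> \<le> (1 / (2 * Cinv)) * nX ?v + 0"
      using x v S(2)[OF r] by (intro add_mono) (auto simp: close_op_def)
    also have "\<dots> \<le> (1 / (2 * Cinv)) * (Cinv * nZ (r n)) + 0"
      using Cinv(1) Sb[OF r] by (intro add_mono mult_left_mono) auto
    finally have "nZ (M x ?v - r n) \<le> nZ (r n) * (1 / 2)" using Cinv(1) by simp
    then show ?thesis unfolding r_Suc using v xX r by (subst Z.norm_diff_commute) (auto intro: M_in)
  qed
  have rb: "nZ (r n) \<le> nZ g * (1 / 2) ^ n" for n
  proof (induction n)
    case (Suc n)
    have "nZ (r (Suc n)) \<le> nZ (r n) * (1 / 2)" by (rule half)
    also have "\<dots> \<le> (nZ g * (1 / 2) ^ n) * (1 / 2)" using Suc by (intro mult_right_mono) auto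
    finally show ?case by simp
  qed (simp add: r0)
  obtain l where l: "l \<in> Z" "(\<lambda>N. nZ (l - (\<Sum>i<N. r i))) \<longlonglongrightarrow> 0"
    using complete[of r, OF r rb] by blast
  define v where "v = S l"
  \<comment> \<open>The partial sums \<open>W N\<close> satisfy \<open>M x (W N) = g - r N\<close> and \<open>M xs (W N) = r 0 + \<dots> + r (N - 1)\<close>.\<close>
  define W where "W N = (\<Sum>i<N. S (r i))" for N
  have v: "v \<in> X" and W: "W N \<in> X" for N
    unfolding v_def W_def by (auto intro!: S l X.mem_sum r)
  have sumr: "(\<Sum>i<N. r i) \<in> Z" for N by (intro Z.mem_sum r)
  have M0: "nZ (M y 0) = 0" if "y \<in> X" for y
    using norm_M_diff[OF that xs xs] Z.norm_0 by simp
  have W_eq1: "nZ (M xs (W N) - (\<Sum>i<N. r i)) = 0" for N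
  proof (induction N)
    case 0
    then show ?case using M0[OF xs] by (simp add: W_def)
  next
    case (Suc N)
    let ?s = "S (r N)"
    have s: "?s \<in> X" by (rule S[OF r])
    have "nZ (M xs (W N + ?s) - ((\<Sum>i<N. r i) + r N)) \<le>
       nZ (M xs (W N + ?s) - (M xs (W N) + M xs ?s)) + nZ ((M xs (W N) + M xs ?s) - ((\<Sum>i<N. r i) + r N))"
      by (intro Z.norm_triangle M_in Z.mem X.mem W s xs r sumr)
    also have "(M xs (W N) + M xs ?s) - ((\<Sum>i<N. r i) + r N) = (M xs (W N) - (\<Sum>i<N. r i)) + (M xs ?s - r N)"
      by (simp add: algebra_simps)
    also have "nZ \<dots> \<le> nZ (M xs (W N) - (\<Sum>i<N. r i)) + nZ (M xs ?s - r N)"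
      by (intro Z.norm_add M_in Z.mem X.mem W s xs r sumr)
    also have "nZ (M xs (W N + ?s) - (M xs (W N) + M xs ?s)) = 0" by (rule M_add[OF xs W s])
    finally have "nZ (M xs (W N + ?s) - ((\<Sum>i<N. r i) + r N)) \<le> 0" using Suc S(2)[OF r, of N] by simp
    moreover have "0 \<le> nZ (M xs (W N + ?s) - ((\<Sum>i<N. r i) + r N))"
      by (intro Z.norm_nonneg Z.mem M_in X.mem W s xs r sumr)
    ultimately have "nZ (M xs (W N + ?s) - ((\<Sum>i<N. r i) + r N)) = 0" by linarith
    then show ?case by (simp add: W_def)
  qed
  have W_eq2: "nZ (M x (W N) - (g - r N)) = 0" for N
  proof (induction N)
    case 0
    then show ?case using M0[OF xX] by (simp add: W_def r0)
  next
    case (Suc N)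
    let ?s = "S (r N)"
    have s: "?s \<in> X" by (rule S[OF r])
    have "nZ (M x (W N + ?s) - (g - r N + M x ?s)) \<le>
       nZ (M x (W N + ?s) - (M x (W N) + M x ?s)) + nZ ((M x (W N) + M x ?s) - (g - r N + M x ?s))"
      by (intro Z.norm_triangle M_in Z.mem X.mem W s xX r g)
    also have "(M x (W N) + M x ?s) - (g - r N + M x ?s) = M x (W N) - (g - r N)" by simp
    also have "nZ (M x (W N + ?s) - (M x (W N) + M x ?s)) = 0" by (rule M_add[OF xX W s])
    finally have "nZ (M x (W N + ?s) - (g - r N + M x ?s)) \<le> 0" using Suc by simp
    moreover have "0 \<le> nZ (M x (W N + ?s) - (g - r N + M x ?s))"
      by (intro Z.norm_nonneg Z.mem M_in X.mem W s xX r g)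
    moreover have "g - r N + M x ?s = g - r (Suc N)" by (simp add: r_Suc)
    ultimately have "nZ (M x (W N + ?s) - (g - r (Suc N))) = 0" by simp
    then show ?case by (simp add: W_def)
  qed
  obtain B where B: "\<forall>v\<in>X. nZ (M x v) \<le> B * nX v" using M_bounded[OF xX] by blast
  have vW: "nX (v - W N) \<le> Cinv * nZ (l - (\<Sum>i<N. r i))" for N
  proof -
    have "nX (v - W N) \<le> Cinv * nZ (M xs (v - W N))" by (intro Cinv(2) X.mem v W)
    also have "nZ (M xs (v - W N)) = nZ (M xs v - M xs (W N))" by (intro norm_M_diff xs v W)
    also have "nZ (M xs v - M xs (W N)) = nZ (l - (\<Sum>i<N. r i))"
    proof (rule Z.norm_eq_of_diff_0)
      have "nZ ((M xs v - l) - (M xs (W N) - (\<Sum>i<N. r i))) \<le> nZ (M xs v - l) + nZ (M xs (W N) - (\<Sum>i<N. r i))"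
        by (intro Z.norm_diff Z.mem M_in xs v W l sumr)
      also have "\<dots> = 0" using S(2)[OF l(1)] W_eq1 by (simp add: v_def)
      finally have "nZ ((M xs v - l) - (M xs (W N) - (\<Sum>i<N. r i))) \<le> 0" .
      moreover have "0 \<le> nZ ((M xs v - l) - (M xs (W N) - (\<Sum>i<N. r i)))"
        by (intro Z.norm_nonneg Z.mem M_in xs v W l sumr)
      moreover have "(M xs v - l) - (M xs (W N) - (\<Sum>i<N. r i)) = (M xs v - M xs (W N)) - (l - (\<Sum>i<N. r i))"
        by (simp add: algebra_simps)
      ultimately show "nZ ((M xs v - M xs (W N)) - (l - (\<Sum>i<N. r i))) = 0" by simp
    qed (intro Z.mem M_in xs v W l sumr)+
    finally show ?thesis .
  qed
  have "nZ (M x v - g) \<le> \<bar>B\<bar> * (Cinv * nZ (l - (\<Sum>i<N. r i))) + nZ g * (1 / 2) ^ N" for N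
  proof -
    have "nZ (M x v - g) \<le> nZ (M x v - M x (W N)) + nZ (M x (W N) - g)"
      by (intro Z.norm_triangle M_in xX v W g)
    moreover have "nZ (M x v - M x (W N)) \<le> \<bar>B\<bar> * (Cinv * nZ (l - (\<Sum>i<N. r i)))"
    proof -
      have "nZ (M x v - M x (W N)) = nZ (M x (v - W N))" by (intro norm_M_diff[symmetric] xX v W)
      also have "\<dots> \<le> B * nX (v - W N)" using B X.mem(3)[OF v W] by blast
      also have "\<dots> \<le> \<bar>B\<bar> * nX (v - W N)" by (intro mult_right_mono X.norm_nonneg X.mem v W) auto
      also have "\<dots> \<le> \<bar>B\<bar> * (Cinv * nZ (l - (\<Sum>i<N. r i)))" by (intro mult_left_mono vW) auto
      finally show ?thesis .
    qed
    moreover have "nZ (M x (W N) - g) \<le> nZ g * (1 / 2) ^ N"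
    proof -
      have "nZ (M x (W N) - g) \<le> nZ (M x (W N) - (g - r N)) + nZ ((g - r N) - g)"
        by (intro Z.norm_triangle M_in xX W g Z.mem r)
      also have "nZ ((g - r N) - g) = nZ (r N)" using Z.norm_minus[OF r] by simp
      finally show ?thesis using W_eq2[of N] rb[of N] by simp
    qed
    ultimately show ?thesis by linarith
  qed
  note bound = this
  have lim: "(\<lambda>N. \<bar>B\<bar> * (Cinv * nZ (l - (\<Sum>i<N. r i))) + nZ g * (1 / 2) ^ N) \<longlonglongrightarrow> \<bar>B\<bar> * (Cinv * 0) + nZ g * 0"
    by (intro tendsto_intros l(2) LIMSEQ_power_zero) simp
  have "nZ (M x v - g) \<le> \<bar>B\<bar> * (Cinv * 0) + nZ g * 0"
    by (rule LIMSEQ_le_const[OF lim]) (use bound in blast)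
  moreover have "0 \<le> nZ (M x v - g)" by (intro Z.norm_nonneg Z.mem M_in xX v g)
  ultimately show ?thesis using v by (intro bexI[of _ v]) auto
qed

definition step :: "'x \<Rightarrow> 'x \<Rightarrow> bool" where
  "step x \<delta> \<longleftrightarrow> \<delta> \<in> X \<and> nZ (M x \<delta> + F x) = 0"

lemma step_exists:
  assumes "close_op x"
  shows "\<exists>\<delta>. step x \<delta>"
proof -
  have xX: "x \<in> X" using assms by (simp add: close_op_def)
  show ?thesis using close_op_surj[OF assms Z.mem(4)[OF F_in[OF xX]]] by (auto simp: step_def)
qed

lemma step_unique:
  assumes x: "close_op x" and \<delta>: "step x \<delta>" "step x \<delta>'"
  shows "nX (\<delta> - \<delta>') = 0"
proof -
  have X: "x \<in> X" "\<delta> \<in> X" "\<delta>' \<in> X" using assms by (auto simp: close_op_def step_def)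
  have "nZ (M x \<delta> - M x \<delta>') \<le> nZ (M x \<delta> - (- F x)) + nZ (- F x - M x \<delta>')"
    by (intro Z.norm_triangle M_in X Z.mem F_in)
  also have "nZ (- F x - M x \<delta>') = nZ (M x \<delta>' - (- F x))"
    by (intro Z.norm_diff_commute M_in X Z.mem F_in)
  finally have "nZ (M x (\<delta> - \<delta>')) \<le> 0" using \<delta> norm_M_diff[OF X] by (simp add: step_def)
  then have "2 * Cinv * nZ (M x (\<delta> - \<delta>')) \<le> 0" using Cinv(1) by (simp add: mult_le_0_iff)
  then have "nX (\<delta> - \<delta>') \<le> 0" using close_op_bound[OF x X.mem(3)[OF X(2,3)]] by linarith
  then show ?thesis using X.norm_nonneg[OF X.mem(3)[OF X(2,3)]] by simp
qed

text \<open>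
  With \<open>e = x - xs\<close>, the new error \<open>e + \<delta>\<close> satisfies \<open>M x (e + \<delta>) = M x e - F x\<close>, up to seminorm zero.
\<close>

lemma step_contraction:
  assumes x: "close_op x" and \<delta>: "step x \<delta>"
  shows "nX (x + \<delta> - xs) \<le> 2 * Cinv * nZ (F x - M x (x - xs))"
proof -
  have X: "x \<in> X" "\<delta> \<in> X" using assms by (auto simp: close_op_def step_def)
  let ?e = "x - xs"
  have e: "?e \<in> X" by (intro X.mem X xs)
  have "nX (?e + \<delta>) \<le> 2 * Cinv * nZ (M x (?e + \<delta>))" by (intro close_op_bound x X.mem e X)
  also have "nZ (M x (?e + \<delta>)) = nZ (M x ?e + M x \<delta>)"
    by (intro Z.norm_eq_of_diff_0 M_add X.mem Z.mem M_in X e)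
  also have "\<dots> = nZ (M x ?e - F x)"
  proof (rule Z.norm_eq_of_diff_0)
    show "nZ ((M x ?e + M x \<delta>) - (M x ?e - F x)) = 0" using \<delta> by (simp add: step_def)
  qed (intro Z.mem M_in X e F_in)+
  also have "\<dots> = nZ (F x - M x ?e)" by (intro Z.norm_diff_commute M_in X e F_in)
  finally show ?thesis by (simp add: algebra_simps)
qed

theorem superlinear_convergence:
  "\<exists>\<epsilon>>0. \<forall>x0\<in>X. nX (x0 - xs) < \<epsilon> \<longrightarrow>
     (\<exists>P. P 0 = x0 \<and> (\<forall>k. \<exists>\<delta>. step (P k) \<delta> \<and> P (Suc k) = P k + \<delta>)) \<and>
     (\<forall>P. P 0 = x0 \<longrightarrow> (\<forall>k. \<exists>\<delta>. step (P k) \<delta> \<and> P (Suc k) = P k + \<delta>) \<longrightarrow>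
        (\<forall>k. P k \<in> X) \<and>
        (\<forall>k \<delta> \<delta>'. step (P k) \<delta> \<longrightarrow> step (P k) \<delta>' \<longrightarrow> nX (\<delta> - \<delta>') = 0) \<and>
        (\<lambda>k. nX (P k - xs)) \<longlonglongrightarrow> 0 \<and>
        (\<lambda>k. nX (P (Suc k) - xs)) \<in> o(\<lambda>k. nX (P k - xs)))"
proof -
  have C: "Cinv > 0" by (rule Cinv)
  obtain \<epsilon>1 where \<epsilon>1: "\<epsilon>1 > 0" "\<forall>x\<in>X. nX (x - xs) < \<epsilon>1 \<longrightarrow> (\<forall>v\<in>X. nZ (M x v - M xs v) \<le> (1 / (2 * Cinv)) * nX v)"
    using M_continuous[of "1 / (2 * Cinv)"] C by auto
  have close: "close_op x" if "x \<in> X" "nX (x - xs) < \<epsilon>1" for x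
    using \<epsilon>1(2) that by (simp add: close_op_def)
  have contr: "\<exists>\<epsilon>>0. \<forall>x \<delta>. x \<in> X \<longrightarrow> nX (x - xs) < \<epsilon> \<longrightarrow> step x \<delta> \<longrightarrow> nX (x + \<delta> - xs) \<le> \<kappa> * nX (x - xs)"
    if \<kappa>: "\<kappa> > 0" for \<kappa>
  proof -
    obtain \<epsilon> where \<epsilon>: "\<epsilon> > 0" "\<forall>x\<in>X. nX (x - xs) < \<epsilon> \<longrightarrow> nZ (F x - M x (x - xs)) \<le> (\<kappa> / (2 * Cinv)) * nX (x - xs)"
      using F_approx[of "\<kappa> / (2 * Cinv)"] C \<kappa> by auto
    have "nX (x + \<delta> - xs) \<le> \<kappa> * nX (x - xs)" if x: "x \<in> X" "nX (x - xs) < min \<epsilon> \<epsilon>1" "step x \<delta>" for x \<delta>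
    proof -
      have "nX (x + \<delta> - xs) \<le> 2 * Cinv * nZ (F x - M x (x - xs))"
        using x by (intro step_contraction close) auto
      also have "\<dots> \<le> 2 * Cinv * ((\<kappa> / (2 * Cinv)) * nX (x - xs))"
        using \<epsilon>(2) x C by (intro mult_left_mono) auto
      finally show ?thesis using C by simp
    qed
    then show ?thesis using \<epsilon>(1) \<epsilon>1(1) by (intro exI[of _ "min \<epsilon> \<epsilon>1"]) auto
  qed
  obtain \<epsilon>2 where \<epsilon>2: "\<epsilon>2 > 0" "\<And>x \<delta>. x \<in> X \<Longrightarrow> nX (x - xs) < \<epsilon>2 \<Longrightarrow> step x \<delta> \<Longrightarrow> nX (x + \<delta> - xs) \<le> (1 / 2) * nX (x - xs)"
    using contr[of "1 / 2"] by auto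
  define \<epsilon> where "\<epsilon> = min \<epsilon>1 \<epsilon>2"
  have \<epsilon>: "\<epsilon> > 0" using \<epsilon>1 \<epsilon>2 by (simp add: \<epsilon>_def)
  have next_in: "x + \<delta> \<in> X \<and> nX (x + \<delta> - xs) < \<epsilon>" if x: "x \<in> X" "nX (x - xs) < \<epsilon>" "step x \<delta>" for x \<delta>
  proof
    show "x + \<delta> \<in> X" using x by (intro X.mem) (auto simp: step_def)
    have "nX (x + \<delta> - xs) \<le> (1 / 2) * nX (x - xs)" using x by (intro \<epsilon>2(2)) (auto simp: \<epsilon>_def)
    also have "\<dots> < \<epsilon>" using x(2) \<epsilon> by simp
    finally show "nX (x + \<delta> - xs) < \<epsilon>" .
  qed
  show ?thesis
  proof (intro exI[of _ \<epsilon>] conjI ballI impI allI)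
    show "\<epsilon> > 0" by fact
  next
    fix x0 assume x0: "x0 \<in> X" "nX (x0 - xs) < \<epsilon>"
    let ?Q = "\<lambda>x. x \<in> X \<and> nX (x - xs) < \<epsilon>"
    define P where "P = rec_nat x0 (\<lambda>n x. x + (SOME \<delta>. step x \<delta>))"
    have st: "step x (SOME \<delta>. step x \<delta>)" if "?Q x" for x
      using step_exists[OF close, of x] that by (intro someI_ex[of "step x"]) (auto simp: \<epsilon>_def)
    have PQ: "?Q (P k)" for k
    proof (induction k)
      case (Suc k)
      then show ?case using next_in[of "P k"] st[of "P k"] by (simp add: P_def)
    qed (use x0 in \<open>simp add: P_def\<close>)
    have "P 0 = x0 \<and> (\<forall>k. \<exists>\<delta>. step (P k) \<delta> \<and> P (Suc k) = P k + \<delta>)"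
      using st[OF PQ] by (auto simp: P_def)
    then show "\<exists>P. P 0 = x0 \<and> (\<forall>k. \<exists>\<delta>. step (P k) \<delta> \<and> P (Suc k) = P k + \<delta>)" by blast
  next
    fix x0 P assume x0: "x0 \<in> X" "nX (x0 - xs) < \<epsilon>"
      and P0: "P 0 = x0" and P: "\<forall>k. \<exists>\<delta>. step (P k) \<delta> \<and> P (Suc k) = P k + \<delta>"
    have PQ: "P k \<in> X \<and> nX (P k - xs) < \<epsilon>" for k
    proof (induction k)
      case (Suc k)
      obtain \<delta> where "step (P k) \<delta>" "P (Suc k) = P k + \<delta>" using P by blast
      then show ?case using next_in Suc by auto
    qed (use x0 P0 in simp)
    have nn: "nX (P k - xs) \<ge> 0" for k using PQ[of k] by (intro X.norm_nonneg X.mem xs) auto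
    show "P k \<in> X" for k using PQ by simp
    show "nX (\<delta> - \<delta>') = 0" if "step (P k) \<delta>" "step (P k) \<delta>'" for k \<delta> \<delta>'
      using PQ[of k] that by (intro step_unique[of "P k"] close) (auto simp: \<epsilon>_def)
    have half: "nX (P k - xs) \<le> \<epsilon> * (1 / 2) ^ k" for k
    proof (induction k)
      case (Suc k)
      obtain \<delta> where "step (P k) \<delta>" "P (Suc k) = P k + \<delta>" using P by blast
      then have "nX (P (Suc k) - xs) \<le> (1 / 2) * nX (P k - xs)"
        using \<epsilon>2(2)[of "P k" \<delta>] PQ[of k] by (simp add: \<epsilon>_def)
      also have "\<dots> \<le> (1 / 2) * (\<epsilon> * (1 / 2) ^ k)" using Suc by (intro mult_left_mono) auto
      finally show ?case by simp
    qed (use x0 P0 in simp)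
    have "(\<lambda>k. \<epsilon> * (1 / 2) ^ k) \<longlonglongrightarrow> \<epsilon> * 0" by (intro tendsto_intros LIMSEQ_power_zero) simp
    then have lim0: "(\<lambda>k. \<epsilon> * (1 / 2) ^ k) \<longlonglongrightarrow> 0" by simp
    show lim: "(\<lambda>k. nX (P k - xs)) \<longlonglongrightarrow> 0"
      by (rule tendsto_sandwich[OF _ _ tendsto_const lim0]; intro always_eventually allI nn half)
    show "(\<lambda>k. nX (P (Suc k) - xs)) \<in> o(\<lambda>k. nX (P k - xs))"
    proof (rule landau_o.smallI)
      fix c :: real assume c: "c > 0"
      obtain \<eta> where \<eta>: "\<eta> > 0" "\<And>x \<delta>. x \<in> X \<Longrightarrow> nX (x - xs) < \<eta> \<Longrightarrow> step x \<delta> \<Longrightarrow> nX (x + \<delta> - xs) \<le> c * nX (x - xs)"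
        using contr[OF c] by auto
      have "\<forall>\<^sub>F k in sequentially. nX (P k - xs) < \<eta>" using lim \<eta>(1) by (rule order_tendstoD)
      then show "\<forall>\<^sub>F k in sequentially. norm (nX (P (Suc k) - xs)) \<le> c * norm (nX (P k - xs))"
      proof eventually_elim
        case (elim k)
        obtain \<delta> where "step (P k) \<delta>" "P (Suc k) = P k + \<delta>" using P by blast
        then have "nX (P (Suc k) - xs) \<le> c * nX (P k - xs)" using \<eta>(2)[of "P k" \<delta>] PQ[of k] elim by simp
        then show ?case using nn by simp
      qed
    qed
  qed
qed

end

section \<open>The regularized multi-bang nonlinearity\<close>

definition clamp :: "real \<Rightarrow> real \<Rightarrow> real \<Rightarrow> real \<Rightarrow> real" where
  "clamp \<gamma> a w q = max 0 (min ((q - a) / \<gamma>) w)"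

lemma clamp_lipschitz:
  assumes "\<gamma> > 0"
  shows "\<bar>clamp \<gamma> a w q - clamp \<gamma> a w q'\<bar> \<le> (1 / \<gamma>) * \<bar>q - q'\<bar>"
proof -
  have "\<bar>clamp \<gamma> a w q - clamp \<gamma> a w q'\<bar> \<le> \<bar>(q - a) / \<gamma> - (q' - a) / \<gamma>\<bar>"
    unfolding clamp_def by linarith
  also have "\<dots> = (1 / \<gamma>) * \<bar>q - q'\<bar>" using assms by (simp add: diff_divide_distrib[symmetric] abs_divide)
  finally show ?thesis .
qed

text \<open>
  The two points lie on the same side of each of the kinks \<open>a\<close> and \<open>a + \<gamma> w\<close>.
\<close>

lemma clamp_off_kinks:
  assumes \<gamma>: "\<gamma> > 0" and w: "w > 0" and "\<bar>q - q'\<bar> < \<bar>q' - a\<bar>" "\<bar>q - q'\<bar> < \<bar>q' - (a + \<gamma> * w)\<bar>"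
  shows "clamp \<gamma> a w q - clamp \<gamma> a w q' = (if a \<le> q \<and> q \<le> a + \<gamma> * w then 1 / \<gamma> else 0) * (q - q')"
    and "a \<le> q \<and> q \<le> a + \<gamma> * w \<longleftrightarrow> a \<le> q' \<and> q' \<le> a + \<gamma> * w"
proof -
  have v: "clamp \<gamma> a w r = (if r \<le> a then 0 else if r \<le> a + \<gamma> * w then (r - a) / \<gamma> else w)" for r
  proof -
    have "(r - a) / \<gamma> \<le> 0 \<longleftrightarrow> r \<le> a" "(r - a) / \<gamma> \<le> w \<longleftrightarrow> r \<le> a + \<gamma> * w"
      using \<gamma> by (auto simp: divide_le_eq mult.commute algebra_simps)
    then show ?thesis using w by (auto simp: clamp_def max_def min_def)
  qed
  have ab: "a < a + \<gamma> * w" using \<gamma> w by simp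
  consider "q' < a" "q < a" | "a < q'" "a < q" "q' < a + \<gamma> * w" "q < a + \<gamma> * w" | "q' > a + \<gamma> * w" "q > a + \<gamma> * w"
    using assms(3,4) ab by linarith
  note cases = this
  show "clamp \<gamma> a w q - clamp \<gamma> a w q' = (if a \<le> q \<and> q \<le> a + \<gamma> * w then 1 / \<gamma> else 0) * (q - q')"
    by (cases rule: cases) (use ab in \<open>auto simp: v diff_divide_distrib[symmetric]\<close>)
  show "a \<le> q \<and> q \<le> a + \<gamma> * w \<longleftrightarrow> a \<le> q' \<and> q' \<le> a + \<gamma> * w"
    by (cases rule: cases) (use ab in auto)
qed

text \<open>
  The union of the intervals on which the nonlinearity is increasing: \<open>1 / \<gamma>\<close> times its indicator is the
  Newton derivative.
\<close>

definition active :: "real \<Rightarrow> real \<Rightarrow> nat \<Rightarrow> (nat \<Rightarrow> real) \<Rightarrow> real set" where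
  "active \<alpha> \<gamma> d u = (\<Union>i\<in>{1..<d}. Q_pair \<alpha> \<gamma> u i)"

definition kinks :: "real \<Rightarrow> real \<Rightarrow> nat \<Rightarrow> (nat \<Rightarrow> real) \<Rightarrow> real set" where
  "kinks \<alpha> \<gamma> d u = (\<Union>i\<in>{1..<d}. frontier (Q_pair \<alpha> \<gamma> u i))"

lemma chi_reg_active: "chi_reg \<alpha> \<gamma> d u p x = indicator (active \<alpha> \<gamma> d u) (p x)"
  by (simp add: chi_reg_def active_def indicator_def)

context
  fixes \<alpha> \<gamma> :: real and d :: nat and u :: "nat \<Rightarrow> real"
  assumes \<alpha>: "\<alpha> > 0" and \<gamma>: "\<gamma> > 0" and u: "strict_mono_on {1..d} u" and d: "d \<ge> 2"
begin

definition left_kink :: "nat \<Rightarrow> real" where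
  "left_kink i = \<alpha> / 2 * (u i + u (i + 1)) + \<gamma> * u i"

lemma jump_pos: "i \<in> {1..<d} \<Longrightarrow> u (i + 1) - u i > 0"
  using strict_mono_onD[OF u, of i "i + 1"] by auto

lemma Q_pair_interval: "Q_pair \<alpha> \<gamma> u i = {left_kink i .. left_kink i + \<gamma> * (u (i + 1) - u i)}"
  using Q_pair_iff[OF \<alpha> \<gamma> u] by (auto simp: left_kink_def algebra_simps)

lemma active_closed: "closed (active \<alpha> \<gamma> d u)"
  unfolding active_def Q_pair_interval by auto

lemma frontier_Q_pair: "i \<in> {1..<d} \<Longrightarrow> frontier (Q_pair \<alpha> \<gamma> u i) = {left_kink i, left_kink i + \<gamma> * (u (i + 1) - u i)}"
  unfolding Q_pair_interval using jump_pos[of i] \<gamma> by (subst frontier_cbox[of "left_kink i", unfolded cbox_interval]) auto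

lemma kinks_finite: "finite (kinks \<alpha> \<gamma> d u)" and kinks_nonempty: "kinks \<alpha> \<gamma> d u \<noteq> {}"
proof -
  have eq: "kinks \<alpha> \<gamma> d u = (\<Union>i\<in>{1..<d}. {left_kink i, left_kink i + \<gamma> * (u (i + 1) - u i)})"
    unfolding kinks_def using frontier_Q_pair by (intro SUP_cong) auto
  show "finite (kinks \<alpha> \<gamma> d u)" unfolding eq by simp
  have "1 \<in> {1..<d}" using d by simp
  then show "kinks \<alpha> \<gamma> d u \<noteq> {}" unfolding eq by blast
qed

lemma u_mono: "1 \<le> a \<Longrightarrow> a \<le> b \<Longrightarrow> b \<le> d \<Longrightarrow> u a \<le> u b"
  using u by (cases "a = b") (auto simp: strict_mono_on_def intro!: less_imp_le)

lemma upper_le_lower: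
  assumes "1 \<le> i" "i < j" "j < d"
  shows "left_kink i + \<gamma> * (u (i + 1) - u i) \<le> left_kink j"
proof -
  have "u i \<le> u j" "u (i + 1) \<le> u (j + 1)" "u (i + 1) \<le> u j" using assms by (auto intro!: u_mono)
  then have "\<alpha> / 2 * (u i + u (i + 1)) + \<gamma> * u (i + 1) \<le> \<alpha> / 2 * (u j + u (j + 1)) + \<gamma> * u j"
    using \<alpha> \<gamma> by (intro add_mono mult_left_mono) auto
  then show ?thesis by (simp add: left_kink_def algebra_simps)
qed

abbreviation "piece i \<equiv> clamp \<gamma> (left_kink i) (u (i + 1) - u i)"

lemma piece_below:
  assumes "q \<le> left_kink i"
  shows "piece i q = 0"
proof -
  have "(q - left_kink i) / \<gamma> \<le> 0" using assms \<gamma> by (simp add: divide_nonpos_pos)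
  then show ?thesis unfolding clamp_def by linarith
qed

lemma piece_above:
  assumes "i \<in> {1..<d}" "left_kink i + \<gamma> * (u (i + 1) - u i) \<le> q"
  shows "piece i q = u (i + 1) - u i"
proof -
  have "u (i + 1) - u i \<le> (q - left_kink i) / \<gamma>" using assms \<gamma> by (simp add: le_divide_eq mult.commute)
  then show ?thesis using jump_pos[OF assms(1)] by (simp add: clamp_def)
qed

text \<open>
  The nonlinearity climbs from \<open>u 1\<close> to \<open>u d\<close> by one ramp per index. The ramps below the current index are
  complete and add up to \<open>u i - u 1\<close>, those above have not started. Lipschitz continuity, boundedness and
  local linearity can now be checked ramp by ramp.
\<close>

lemma H_reg_eq_sum: "H_reg \<alpha> \<gamma> d u q = u 1 + (\<Sum>i\<in>{1..<d}. piece i q)"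
proof -
  have split: "(\<Sum>j\<in>{1..<d}. piece j q) = (u i - u 1) + (if i < d then piece i q else 0)"
    if i: "1 \<le> i" "i \<le> d" and lo: "\<And>j. 1 \<le> j \<Longrightarrow> j < i \<Longrightarrow> left_kink j + \<gamma> * (u (j + 1) - u j) \<le> q"
      and hi: "\<And>j. i < j \<Longrightarrow> j < d \<Longrightarrow> q \<le> left_kink j" for i
  proof -
    have "(\<Sum>j\<in>{1..<d}. piece j q) = (\<Sum>j\<in>{1..<i}. piece j q) + (\<Sum>j\<in>{i..<d}. piece j q)"
      using i by (simp add: sum.atLeastLessThan_concat)
    also have "(\<Sum>j\<in>{1..<i}. piece j q) = (\<Sum>j\<in>{1..<i}. u (Suc j) - u j)"
    proof (rule sum.cong[OF refl])
      fix j assume "j \<in> {1..<i}"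
      then show "piece j q = u (Suc j) - u j" using piece_above[of j q] lo[of j] i by simp
    qed
    also have "\<dots> = u i - u 1" by (rule sum_Suc_diff'[OF i(1)])
    also have "(\<Sum>j\<in>{i..<d}. piece j q) = (if i < d then piece i q else 0)"
    proof (cases "i < d")
      case True
      have "(\<Sum>j\<in>{i..<d}. piece j q) = piece i q + (\<Sum>j\<in>{Suc i..<d}. piece j q)"
        using True by (simp add: sum.atLeast_Suc_lessThan)
      also have "(\<Sum>j\<in>{Suc i..<d}. piece j q) = 0"
      proof (rule sum.neutral, rule ballI)
        fix j assume "j \<in> {Suc i..<d}"
        then show "piece j q = 0" by (intro piece_below hi) auto
      qed
      finally show ?thesis using True by simp
    qed simp
    finally show ?thesis .
  qed
  consider (s) i where "i \<in> {1..d}" "q \<in> Q_set \<alpha> \<gamma> d u i" | (p) i where "i \<in> {1..<d}" "q \<in> Q_pair \<alpha> \<gamma> u i"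
    using Q_cover[OF \<alpha> \<gamma> u, of q] d by auto
  then show ?thesis
  proof cases
    case s
    note Q = s(2)[unfolded Q_set_iff[OF \<alpha> \<gamma> u]]
    have "(\<Sum>j\<in>{1..<d}. piece j q) = (u i - u 1) + (if i < d then piece i q else 0)"
    proof (rule split)
      fix j assume j: "1 \<le> j" "j < i"
      have "\<alpha> / 2 * (u j + u (j + 1)) + \<gamma> * u (j + 1) \<le> \<alpha> / 2 * (u (i - 1) + u i) + \<gamma> * u i"
        using Q_order(2)[OF \<alpha> \<gamma> u j] s(1) by auto
      then show "left_kink j + \<gamma> * (u (j + 1) - u j) \<le> q"
        using Q j by (simp add: left_kink_def algebra_simps)
    next
      fix j assume j: "i < j" "j < d"
      have "q < left_kink i" using Q j by (simp add: left_kink_def)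
      also have "left_kink i \<le> left_kink i + \<gamma> * (u (i + 1) - u i)" using jump_pos[of i] \<gamma> s(1) j by simp
      also have "\<dots> \<le> left_kink j" using s(1) j by (intro upper_le_lower) auto
      finally show "q \<le> left_kink j" by simp
    qed (use s in auto)
    moreover have "(if i < d then piece i q else 0) = 0"
    proof (cases "i < d")
      case True
      then have "q \<le> left_kink i" using Q by (simp add: left_kink_def)
      then show ?thesis by (simp only: piece_below if_cancel)
    qed simp
    ultimately show ?thesis using H_reg_Q_set[OF \<alpha> \<gamma> u s] by simp
  next
    case p
    have Q: "left_kink i \<le> q" "q \<le> left_kink i + \<gamma> * (u (i + 1) - u i)" using p(2) unfolding Q_pair_interval by auto
    have "(\<Sum>j\<in>{1..<d}. piece j q) = (u i - u 1) + (if i < d then piece i q else 0)"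
    proof (rule split)
      fix j assume j: "1 \<le> j" "j < i"
      then show "left_kink j + \<gamma> * (u (j + 1) - u j) \<le> q" using upper_le_lower[of j i] Q p(1) by auto
    next
      fix j assume j: "i < j" "j < d"
      then show "q \<le> left_kink j" using upper_le_lower[of i j] Q p(1) by auto
    qed (use p in auto)
    moreover have "piece i q = (q - left_kink i) / \<gamma>"
    proof -
      have "0 \<le> (q - left_kink i) / \<gamma>" "(q - left_kink i) / \<gamma> \<le> u (i + 1) - u i"
        using Q \<gamma> by (auto simp: divide_le_eq mult.commute)
      then show ?thesis by (simp add: clamp_def)
    qed
    moreover have "(q - left_kink i) / \<gamma> = 1 / \<gamma> * (q - \<alpha> / 2 * (u i + u (i + 1))) - u i"
      using \<gamma> by (simp add: left_kink_def field_simps)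
    ultimately show ?thesis using H_reg_Q_pair[OF \<alpha> \<gamma> u p] p(1) by simp
  qed
qed

lemma H_reg_lipschitz: "\<bar>H_reg \<alpha> \<gamma> d u q - H_reg \<alpha> \<gamma> d u q'\<bar> \<le> (d / \<gamma>) * \<bar>q - q'\<bar>"
proof -
  have "\<bar>H_reg \<alpha> \<gamma> d u q - H_reg \<alpha> \<gamma> d u q'\<bar> = \<bar>\<Sum>i\<in>{1..<d}. piece i q - piece i q'\<bar>"
    by (simp add: H_reg_eq_sum sum_subtractf)
  also have "\<dots> \<le> (\<Sum>i\<in>{1..<d}. \<bar>piece i q - piece i q'\<bar>)" by (rule sum_abs)
  also have "\<dots> \<le> (\<Sum>i\<in>{1..<d}. (1 / \<gamma>) * \<bar>q - q'\<bar>)"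
    by (intro sum_mono clamp_lipschitz \<gamma>)
  also have "\<dots> \<le> d * ((1 / \<gamma>) * \<bar>q - q'\<bar>)"
    using \<gamma> by (simp add: mult_right_mono divide_right_mono)
  finally show ?thesis by simp
qed

lemma H_reg_continuous: "continuous_on UNIV (H_reg \<alpha> \<gamma> d u)"
proof -
  have "H_reg \<alpha> \<gamma> d u = (\<lambda>q. u 1 + (\<Sum>i\<in>{1..<d}. piece i q))" by (rule ext) (rule H_reg_eq_sum)
  then show ?thesis unfolding clamp_def using \<gamma> by (auto intro!: continuous_intros)
qed

lemma H_reg_bounded: "\<bar>H_reg \<alpha> \<gamma> d u q\<bar> \<le> \<bar>u 1\<bar> + (\<Sum>i\<in>{1..<d}. u (i + 1) - u i)"
proof -
  have "0 \<le> piece i q \<and> piece i q \<le> u (i + 1) - u i" if "i \<in> {1..<d}" for i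
    using jump_pos[OF that] by (auto simp: clamp_def)
  then have "0 \<le> (\<Sum>i\<in>{1..<d}. piece i q)" "(\<Sum>i\<in>{1..<d}. piece i q) \<le> (\<Sum>i\<in>{1..<d}. u (i + 1) - u i)"
    by (auto intro!: sum_nonneg sum_mono)
  then show ?thesis unfolding H_reg_eq_sum by linarith
qed

lemma indicator_active: "indicator (active \<alpha> \<gamma> d u) q = (\<Sum>i\<in>{1..<d}. if q \<in> Q_pair \<alpha> \<gamma> u i then 1 else 0 :: real)"
proof (cases "q \<in> active \<alpha> \<gamma> d u")
  case True
  then obtain i where i: "i \<in> {1..<d}" "q \<in> Q_pair \<alpha> \<gamma> u i" by (auto simp: active_def)
  have "(\<Sum>j\<in>{1..<d}. if q \<in> Q_pair \<alpha> \<gamma> u j then 1 else 0 :: real) = (\<Sum>j\<in>{1..<d}. if j = i then 1 else 0)"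
    using i Q_pair_disjoint[OF \<alpha> \<gamma> u] by (intro sum.cong) auto
  then show ?thesis using i True by simp
next
  case False
  then show ?thesis by (auto simp: active_def intro!: sum.neutral[symmetric])
qed

text \<open>
  If \<open>q\<close> is closer to \<open>q'\<close> than every kink is, then the linearization at \<open>q\<close> is exact at \<open>q'\<close> and the slopes at
  both points agree.
\<close>

lemma H_reg_off_kinks:
  assumes "\<bar>q - q'\<bar> < infdist q' (kinks \<alpha> \<gamma> d u)"
  shows "H_reg \<alpha> \<gamma> d u q - H_reg \<alpha> \<gamma> d u q' = (1 / \<gamma>) * indicator (active \<alpha> \<gamma> d u) q * (q - q')"
    and "indicator (active \<alpha> \<gamma> d u) q = (indicator (active \<alpha> \<gamma> d u) q' :: real)"
proof -
  have k: "\<bar>q - q'\<bar> < \<bar>q' - left_kink i\<bar>" "\<bar>q - q'\<bar> < \<bar>q' - (left_kink i + \<gamma> * (u (i + 1) - u i))\<bar>"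
    if i: "i \<in> {1..<d}" for i
  proof -
    have "left_kink i \<in> kinks \<alpha> \<gamma> d u" "left_kink i + \<gamma> * (u (i + 1) - u i) \<in> kinks \<alpha> \<gamma> d u"
      using i frontier_Q_pair[OF i] unfolding kinks_def by blast+
    then show "\<bar>q - q'\<bar> < \<bar>q' - left_kink i\<bar>" "\<bar>q - q'\<bar> < \<bar>q' - (left_kink i + \<gamma> * (u (i + 1) - u i))\<bar>"
      using assms infdist_le[of _ "kinks \<alpha> \<gamma> d u" q'] by (fastforce simp: dist_real_def)+
  qed
  have Q: "r \<in> Q_pair \<alpha> \<gamma> u i \<longleftrightarrow> left_kink i \<le> r \<and> r \<le> left_kink i + \<gamma> * (u (i + 1) - u i)" for r i
    unfolding Q_pair_interval by auto
  have "H_reg \<alpha> \<gamma> d u q - H_reg \<alpha> \<gamma> d u q' = (\<Sum>i\<in>{1..<d}. piece i q - piece i q')"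
    by (simp add: H_reg_eq_sum sum_subtractf)
  also have "\<dots> = (\<Sum>i\<in>{1..<d}. (1 / \<gamma>) * (if q \<in> Q_pair \<alpha> \<gamma> u i then 1 else 0) * (q - q'))"
  proof (rule sum.cong[OF refl])
    fix i assume i: "i \<in> {1..<d}"
    show "piece i q - piece i q' = (1 / \<gamma>) * (if q \<in> Q_pair \<alpha> \<gamma> u i then 1 else 0) * (q - q')"
      using clamp_off_kinks(1)[OF \<gamma> jump_pos[OF i] k[OF i]] unfolding Q by simp
  qed
  also have "\<dots> = (1 / \<gamma>) * indicator (active \<alpha> \<gamma> d u) q * (q - q')"
    unfolding indicator_active by (simp add: sum_distrib_left sum_distrib_right)
  finally show "H_reg \<alpha> \<gamma> d u q - H_reg \<alpha> \<gamma> d u q' = (1 / \<gamma>) * indicator (active \<alpha> \<gamma> d u) q * (q - q')" .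
  show "indicator (active \<alpha> \<gamma> d u) q = (indicator (active \<alpha> \<gamma> d u) q' :: real)"
    unfolding indicator_active
  proof (rule sum.cong[OF refl])
    fix i assume i: "i \<in> {1..<d}"
    show "(if q \<in> Q_pair \<alpha> \<gamma> u i then 1 else 0 :: real) = (if q' \<in> Q_pair \<alpha> \<gamma> u i then 1 else 0)"
      using clamp_off_kinks(2)[OF \<gamma> jump_pos[OF i] k[OF i]] unfolding Q by simp
  qed
qed

end

section \<open>Estimates for the optimality system\<close>

text \<open>
  All remainders below are bounded by a constant, plus a constant on a small set.
\<close>

lemma Lp_indicator_bound:
  assumes p: "p \<ge> 1" and \<Omega>: "open \<Omega>" "bounded \<Omega>"
    and r: "r \<in> borel_measurable (lebesgue_on \<Omega>)" and A: "A \<in> sets (lebesgue_on \<Omega>)"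
    and c: "c1 \<ge> 0" "c2 \<ge> 0"
    and le: "AE x in lebesgue_on \<Omega>. \<bar>r x\<bar> \<le> c1 + c2 * indicator A x"
  shows "r \<in> Lp \<Omega> p"
    and "Lp_norm \<Omega> p r \<le> c1 * measure (lebesgue_on \<Omega>) \<Omega> powr (1 / p) + c2 * measure (lebesgue_on \<Omega>) A powr (1 / p)"
proof -
  interpret finite_measure "lebesgue_on \<Omega>" using \<Omega> by (rule finite_lebesgue_on)
  have ind: "(indicator B :: 'a \<Rightarrow> real) \<in> Lp \<Omega> p \<and> Lp_norm \<Omega> p (indicator B) = measure (lebesgue_on \<Omega>) B powr (1 / p)"
    if B: "B \<in> sets (lebesgue_on \<Omega>)" for B
  proof -
    have eq: "(\<lambda>x. (indicator B x :: real) powr p) = indicator B"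
      using p by (auto simp: fun_eq_iff indicator_def)
    have "integrable (lebesgue_on \<Omega>) (indicator B :: 'a \<Rightarrow> real)"
      using B by (intro integrable_real_indicator) (auto simp: emeasure_eq_measure)
    moreover have "(LINT x|lebesgue_on \<Omega>. indicator B x) = measure (lebesgue_on \<Omega>) B"
      using sets.sets_into_space[OF B] by (simp add: Int_absorb2)
    ultimately show ?thesis using B by (simp add: Lp_def Lp_norm_def eq)
  qed
  have sp: "\<Omega> \<in> sets (lebesgue_on \<Omega>)" using sets.top[of "lebesgue_on \<Omega>"] by simp
  let ?f = "\<lambda>x. c1 * indicator \<Omega> x + c2 * indicator A x :: real"
  note i1 = ind[OF sp] and i2 = ind[OF A]
  have f: "?f \<in> Lp \<Omega> p" and fn: "Lp_norm \<Omega> p ?f \<le> c1 * measure (lebesgue_on \<Omega>) \<Omega> powr (1 / p) + c2 * measure (lebesgue_on \<Omega>) A powr (1 / p)"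
    using Lp_add[OF p Lp_cmult(1)[OF p, of "indicator \<Omega>" \<Omega> c1] Lp_cmult(1)[OF p, of "indicator A" \<Omega> c2]]
      Lp_cmult(2)[OF p, of "indicator \<Omega>" \<Omega> c1] Lp_cmult(2)[OF p, of "indicator A" \<Omega> c2] i1 i2 c by simp_all
  have "AE x in lebesgue_on \<Omega>. x \<in> \<Omega>" using AE_space[of "lebesgue_on \<Omega>"] by simp
  with le have "AE x in lebesgue_on \<Omega>. \<bar>r x\<bar> \<le> \<bar>?f x\<bar>"
    by eventually_elim (use c in auto)
  note D = Lp_dominated[OF p f r this]
  show "r \<in> Lp \<Omega> p" by (rule D)
  show "Lp_norm \<Omega> p r \<le> c1 * measure (lebesgue_on \<Omega>) \<Omega> powr (1 / p) + c2 * measure (lebesgue_on \<Omega>) A powr (1 / p)"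
    using D(2) fn by (rule order_trans)
qed

lemma Lp_lincomb3_AE:
  assumes p: "p \<ge> 1" and \<Omega>: "\<Omega> \<in> sets lebesgue"
    and L: "v1 \<in> Lp \<Omega> p" "v2 \<in> Lp \<Omega> p" "v3 \<in> Lp \<Omega> p"
    and eq: "ae_eq \<Omega> (\<lambda>x. c1 * v1 x + c2 * v2 x + c3 * v3 x) g"
  shows "g \<in> Lp \<Omega> p"
    and "Lp_norm \<Omega> p g \<le> \<bar>c1\<bar> * Lp_norm \<Omega> p v1 + \<bar>c2\<bar> * Lp_norm \<Omega> p v2 + \<bar>c3\<bar> * Lp_norm \<Omega> p v3"
proof -
  note c = Lp_cmult[OF p L(1), of c1] Lp_cmult[OF p L(2), of c2] Lp_cmult[OF p L(3), of c3]
  note a = Lp_add[OF p c(1) c(3)]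
  note b = Lp_add[OF p a(1) c(5)]
  note e = Lp_cong_AE[OF \<Omega> p b(1) eq]
  show "g \<in> Lp \<Omega> p" by (rule e)
  show "Lp_norm \<Omega> p g \<le> \<bar>c1\<bar> * Lp_norm \<Omega> p v1 + \<bar>c2\<bar> * Lp_norm \<Omega> p v2 + \<bar>c3\<bar> * Lp_norm \<Omega> p v3"
    using e(2) a(2) b(2) c(2,4,6) by linarith
qed

lemma add_le_double:
  fixes x x' a1 a2 b1 b2 c1 c2 A B C :: real
  assumes "x \<le> a1 + b1 + c1" "x' \<le> a2 + b2 + c2" "a1 \<le> A" "a2 \<le> A" "b1 \<le> B" "b2 \<le> B" "c1 \<le> C" "c2 \<le> C"
  shows "x + x' \<le> 2 * (A + B + C)"
proof -
  have "x \<le> A + B + C" using assms(1,3,5,7) by linarith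
  moreover have "x' \<le> A + B + C" using assms(2,4,6,8) by linarith
  ultimately show ?thesis by (simp only: mult_2 add_mono)
qed

text \<open>
  The optimality system in terms of \<open>q v w = G\<^sup>*(\<nabla>v \<bullet> \<nabla>w)\<close> and \<open>T h v = div ((G h) \<nabla>v)\<close>; the
  assumptions collect the bounds and the bilinearity almost everywhere of these two maps. The pair
  \<open>(ys, ws)\<close> is the point around which the system is linearized.
\<close>

locale regularized_system =
  fixes \<Omega> :: "'a::euclidean_space set" and s \<alpha> \<gamma> :: real and d :: nat and u :: "nat \<Rightarrow> real"
    and XX :: "('a \<Rightarrow> real) set" and nX :: "('a \<Rightarrow> real) \<Rightarrow> real"
    and q T :: "('a \<Rightarrow> real) \<Rightarrow> ('a \<Rightarrow> real) \<Rightarrow> 'a \<Rightarrow> real" and Cq CT :: real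
    and f z ys ws :: "'a \<Rightarrow> real"
  assumes \<Omega>: "open \<Omega>" "bounded \<Omega>" and s: "s \<ge> 1"
    and \<alpha>: "\<alpha> > 0" and \<gamma>: "\<gamma> > 0" and d: "d \<ge> 2" and u: "strict_mono_on {1..d} u"
    and XX_lincomb: "\<And>v w a c. v \<in> XX \<Longrightarrow> w \<in> XX \<Longrightarrow> (\<lambda>t. a * v t + c * w t) \<in> XX"
    and nX_cmult: "\<And>v a. v \<in> XX \<Longrightarrow> nX (\<lambda>t. a * v t) = \<bar>a\<bar> * nX v"
    and nX_add: "\<And>v w. v \<in> XX \<Longrightarrow> w \<in> XX \<Longrightarrow> nX (\<lambda>t. v t + w t) \<le> nX v + nX w"
    and XX_Lp: "\<And>v. v \<in> XX \<Longrightarrow> v \<in> Lp \<Omega> s"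
    and Lp_le_nX: "\<And>v. v \<in> XX \<Longrightarrow> Lp_norm \<Omega> s v \<le> nX v"
    and Cq: "Cq \<ge> 0" and CT: "CT \<ge> 0"
    and q_measurable: "\<And>v w. v \<in> XX \<Longrightarrow> w \<in> XX \<Longrightarrow> q v w \<in> borel_measurable (lebesgue_on \<Omega>)"
    and q_bound: "\<And>v w. v \<in> XX \<Longrightarrow> w \<in> XX \<Longrightarrow> AE t in lebesgue_on \<Omega>. \<bar>q v w t\<bar> \<le> Cq * nX v * nX w"
    and q_lincomb: "\<And>v1 v2 w a c. v1 \<in> XX \<Longrightarrow> v2 \<in> XX \<Longrightarrow> w \<in> XX \<Longrightarrow>
      AE t in lebesgue_on \<Omega>. q (\<lambda>t. a * v1 t + c * v2 t) w t = a * q v1 w t + c * q v2 w t"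
    and q_sym: "\<And>v w. q v w = q w v"
    and T_Lp: "\<And>h v. h \<in> Lp \<Omega> s \<Longrightarrow> v \<in> XX \<Longrightarrow> T h v \<in> Lp \<Omega> s"
    and T_bound: "\<And>h v. h \<in> Lp \<Omega> s \<Longrightarrow> v \<in> XX \<Longrightarrow> Lp_norm \<Omega> s (T h v) \<le> CT * Lp_norm \<Omega> s h * nX v"
    and T_lincomb1: "\<And>h h1 h2 v a c. h1 \<in> Lp \<Omega> s \<Longrightarrow> h2 \<in> Lp \<Omega> s \<Longrightarrow> h \<in> Lp \<Omega> s \<Longrightarrow> v \<in> XX \<Longrightarrow>
      AE t in lebesgue_on \<Omega>. h t = a * h1 t + c * h2 t \<Longrightarrow>
      AE t in lebesgue_on \<Omega>. T h v t = a * T h1 v t + c * T h2 v t"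
    and T_lincomb2: "\<And>h v1 v2 a c. h \<in> Lp \<Omega> s \<Longrightarrow> v1 \<in> XX \<Longrightarrow> v2 \<in> XX \<Longrightarrow>
      AE t in lebesgue_on \<Omega>. T h (\<lambda>t. a * v1 t + c * v2 t) t = a * T h v1 t + c * T h v2 t"
    and f: "f \<in> Lp \<Omega> s" and z: "z \<in> Lp \<Omega> s" and ys: "ys \<in> XX" and ws: "ws \<in> XX"
begin

abbreviation "L \<equiv> lebesgue_on \<Omega>"
abbreviation "N \<equiv> Lp_norm \<Omega> s"
abbreviation "H \<equiv> H_reg \<alpha> \<gamma> d u"
abbreviation "act \<equiv> active \<alpha> \<gamma> d u"
abbreviation "kk \<equiv> kinks \<alpha> \<gamma> d u"

definition "U y w = (\<lambda>t. H (- q y w t))"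
definition "slope y w = (\<lambda>t. 1 / \<gamma> * indicator act (- q y w t) :: real)"
text \<open>
  As \<open>U\<close> is the nonlinearity at \<open>- q y w\<close>, this is the negative of its Newton derivative in the direction
  \<open>(a, b)\<close>.
\<close>

definition "K y w a b = (\<lambda>t. slope y w t * (q w a t + q y b t))"
text \<open>
  The \<open>L\<^sup>s\<close> norm of the constant function 1.
\<close>

definition "m = measure L \<Omega> powr (1 / s)"
text \<open>
  The points at which the solution is within \<open>\<delta>\<close> of a kink. The \<open>L\<^sup>s\<close> norm \<open>\<mu> \<delta>\<close> of the indicator of this set
  measures the loss of differentiability.
\<close>

definition "bad \<delta> = {t \<in> \<Omega>. infdist (- q ys ws t) kk \<le> \<delta>}"
definition "\<mu> \<delta> = measure L (bad \<delta>) powr (1 / s)"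
definition "\<rho> = nX ys + nX ws"
text \<open>
  Within distance 1 of \<open>(ys, ws)\<close> the value of \<open>q\<close> changes by at most \<open>P\<close> times the distance.
\<close>

definition "P = Cq * (2 * \<rho> + 1)"

lemma \<Omega>_sets: "\<Omega> \<in> sets lebesgue" using \<Omega> by auto

lemma AE_\<Omega>: "AE t in L. t \<in> \<Omega>"
  using AE_space[of L] by simp

lemma nX_nonneg: "v \<in> XX \<Longrightarrow> nX v \<ge> 0"
  using Lp_le_nX Lp_norm_nonneg order_trans by blast

lemma XX_add: "v \<in> XX \<Longrightarrow> w \<in> XX \<Longrightarrow> (\<lambda>t. v t + w t) \<in> XX"
  using XX_lincomb[of v w 1 1] by simp

lemma XX_diff: "v \<in> XX \<Longrightarrow> w \<in> XX \<Longrightarrow> (\<lambda>t. v t - w t) \<in> XX"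
  using XX_lincomb[of v w 1 "-1"] by simp

lemma q_diff1:
  assumes "v \<in> XX" "v' \<in> XX" "w \<in> XX"
  shows "AE t in L. q (\<lambda>t. v t - v' t) w t = q v w t - q v' w t"
  using q_lincomb[OF assms, of 1 "-1"] by simp

lemma q_diff2:
  assumes "v \<in> XX" "v' \<in> XX" "w \<in> XX"
  shows "AE t in L. q w (\<lambda>t. v t - v' t) t = q w v t - q w v' t"
  using q_diff1[OF assms] unfolding q_sym[of _ w] .

lemma T_diff1:
  assumes "h1 \<in> Lp \<Omega> s" "h2 \<in> Lp \<Omega> s" "h \<in> Lp \<Omega> s" "v \<in> XX" "AE t in L. h t = h1 t - h2 t"
  shows "AE t in L. T h v t = T h1 v t - T h2 v t"
  using T_lincomb1[OF assms(1-4), of 1 "-1"] assms(5) by simp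

lemma T_add1:
  assumes "h1 \<in> Lp \<Omega> s" "h2 \<in> Lp \<Omega> s" "h \<in> Lp \<Omega> s" "v \<in> XX" "AE t in L. h t = h1 t + h2 t"
  shows "AE t in L. T h v t = T h1 v t + T h2 v t"
  using T_lincomb1[OF assms(1-4), of 1 1] assms(5) by simp

lemma T_diff2:
  assumes "h \<in> Lp \<Omega> s" "v \<in> XX" "v' \<in> XX"
  shows "AE t in L. T h (\<lambda>t. v t - v' t) t = T h v t - T h v' t"
  using T_lincomb2[OF assms, of 1 "-1"] by simp

lemma slope_bound: "\<bar>slope y w t\<bar> \<le> 1 / \<gamma>"
  using \<gamma> by (auto simp: slope_def indicator_def)

lemma indicator_active_measurable: "(indicator act :: real \<Rightarrow> real) \<in> borel_measurable borel"
  using active_closed[OF \<alpha> \<gamma> u d] by auto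

lemma slope_measurable: "y \<in> XX \<Longrightarrow> w \<in> XX \<Longrightarrow> slope y w \<in> borel_measurable L"
  unfolding slope_def
  by (intro borel_measurable_times borel_measurable_const
      measurable_compose[OF borel_measurable_uminus indicator_active_measurable] q_measurable)

lemma U_measurable: "y \<in> XX \<Longrightarrow> w \<in> XX \<Longrightarrow> U y w \<in> borel_measurable L"
  unfolding U_def
  by (intro measurable_compose[OF borel_measurable_uminus
      borel_measurable_continuous_onI[OF H_reg_continuous[OF \<alpha> \<gamma> u d]]] q_measurable)

lemma K_measurable: "y \<in> XX \<Longrightarrow> w \<in> XX \<Longrightarrow> a \<in> XX \<Longrightarrow> b \<in> XX \<Longrightarrow> K y w a b \<in> borel_measurable L"
  unfolding K_def by (intro borel_measurable_times borel_measurable_add slope_measurable q_measurable)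

lemma Lp_boundI:
  assumes "r \<in> borel_measurable L" "c \<ge> 0" "AE t in L. \<bar>r t\<bar> \<le> c"
  shows "r \<in> Lp \<Omega> s" "N r \<le> c * m"
  using Lp_indicator_bound[OF s \<Omega> assms(1) sets.empty_sets assms(2), of 0] assms(3) by (simp_all add: m_def)

lemma U_Lp:
  assumes "y \<in> XX" "w \<in> XX"
  shows "U y w \<in> Lp \<Omega> s"
proof (rule Lp_boundI(1)[OF U_measurable[OF assms]])
  let ?c = "\<bar>u 1\<bar> + (\<Sum>i\<in>{1..<d}. u (i + 1) - u i)"
  show "AE t in L. \<bar>U y w t\<bar> \<le> ?c"
    unfolding U_def by (intro AE_I2 H_reg_bounded[OF \<alpha> \<gamma> u d])
  show "0 \<le> ?c" using H_reg_bounded[OF \<alpha> \<gamma> u d, of 0] by linarith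
qed

lemma K_parts_Lp:
  assumes X: "y \<in> XX" "w \<in> XX" "v \<in> XX" "b \<in> XX"
  shows "(\<lambda>t. slope y w t * q v b t) \<in> Lp \<Omega> s" "N (\<lambda>t. slope y w t * q v b t) \<le> Cq / \<gamma> * nX v * nX b * m"
proof -
  have me: "(\<lambda>t. slope y w t * q v b t) \<in> borel_measurable L"
    using X by (intro borel_measurable_times slope_measurable q_measurable)
  have c: "0 \<le> Cq / \<gamma> * nX v * nX b" using Cq \<gamma> X nX_nonneg by simp
  have le: "AE t in L. \<bar>slope y w t * q v b t\<bar> \<le> Cq / \<gamma> * nX v * nX b"
    using q_bound[OF X(3,4)]
  proof eventually_elim
    case (elim t)
    have "\<bar>slope y w t * q v b t\<bar> \<le> 1 / \<gamma> * (Cq * nX v * nX b)"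
      unfolding abs_mult using slope_bound elim \<gamma> by (intro mult_mono) auto
    then show ?case by simp
  qed
  show "(\<lambda>t. slope y w t * q v b t) \<in> Lp \<Omega> s" "N (\<lambda>t. slope y w t * q v b t) \<le> Cq / \<gamma> * nX v * nX b * m"
    by (rule Lp_boundI[OF me c le])+
qed

lemma K_Lp:
  assumes X: "y \<in> XX" "w \<in> XX" "a \<in> XX" "b \<in> XX"
  shows "K y w a b \<in> Lp \<Omega> s" "N (K y w a b) \<le> Cq / \<gamma> * (nX y + nX w) * (nX a + nX b) * m"
proof -
  have eq: "K y w a b = (\<lambda>t. slope y w t * q w a t + slope y w t * q y b t)"
    by (simp add: K_def distrib_left)
  note 1 = K_parts_Lp[OF X(1,2,2,3)] and 2 = K_parts_Lp[OF X(1,2,1,4)]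
  show "K y w a b \<in> Lp \<Omega> s" unfolding eq by (rule Lp_add(1)[OF s 1(1) 2(1)])
  have "N (K y w a b) \<le> Cq / \<gamma> * nX w * nX a * m + Cq / \<gamma> * nX y * nX b * m"
    unfolding eq using Lp_add(2)[OF s 1(1) 2(1)] 1(2) 2(2) by linarith
  also have "\<dots> = Cq / \<gamma> * (nX w * nX a + nX y * nX b) * m" by (simp add: algebra_simps)
  also have "\<dots> \<le> Cq / \<gamma> * ((nX y + nX w) * (nX a + nX b)) * m"
  proof (intro mult_right_mono mult_left_mono)
    show "nX w * nX a + nX y * nX b \<le> (nX y + nX w) * (nX a + nX b)"
      using X nX_nonneg by (simp add: algebra_simps)
  qed (use Cq \<gamma> in \<open>auto simp: m_def\<close>)
  finally show "N (K y w a b) \<le> Cq / \<gamma> * (nX y + nX w) * (nX a + nX b) * m" by (simp add: mult.assoc)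
qed

definition M :: "('a \<Rightarrow> real) \<times> ('a \<Rightarrow> real) \<Rightarrow> ('a \<Rightarrow> real) \<times> ('a \<Rightarrow> real) \<Rightarrow> ('a \<Rightarrow> real) \<times> ('a \<Rightarrow> real)" where
  "M = (\<lambda>(y, w) (a, b).
     (\<lambda>t. (a t + T (\<lambda>t. slope y w t * q w a t) w t) + (- T (U y w) b t + T (\<lambda>t. slope y w t * q y b t) w t),
      \<lambda>t. (- T (U y w) a t + T (\<lambda>t. slope y w t * q w a t) y t) + T (\<lambda>t. slope y w t * q y b t) y t))"

definition F :: "('a \<Rightarrow> real) \<times> ('a \<Rightarrow> real) \<Rightarrow> ('a \<Rightarrow> real) \<times> ('a \<Rightarrow> real)" where
  "F = (\<lambda>(y, w). (\<lambda>t. - T (U y w) w t + y t - z t, \<lambda>t. - T (U y w) y t - f t))"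

lemma M_AE:
  assumes X: "y \<in> XX" "w \<in> XX" "a \<in> XX" "b \<in> XX"
  shows "AE t in L. fst (M (y, w) (a, b)) t = a t - T (U y w) b t + T (K y w a b) w t"
    and "AE t in L. snd (M (y, w) (a, b)) t = - T (U y w) a t + T (K y w a b) y t"
proof -
  have eq: "AE t in L. K y w a b t = slope y w t * q w a t + slope y w t * q y b t"
    by (simp add: K_def distrib_left)
  note TK = T_add1[OF K_parts_Lp(1)[OF X(1,2,2,3)] K_parts_Lp(1)[OF X(1,2,1,4)] K_Lp(1)[OF X] _ eq]
  show "AE t in L. fst (M (y, w) (a, b)) t = a t - T (U y w) b t + T (K y w a b) w t"
    using TK[OF X(2)] by eventually_elim (simp add: M_def)
  show "AE t in L. snd (M (y, w) (a, b)) t = - T (U y w) a t + T (K y w a b) y t"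
    using TK[OF X(1)] by eventually_elim (simp add: M_def)
qed

lemma M_Lp:
  assumes X: "y \<in> XX" "w \<in> XX" "a \<in> XX" "b \<in> XX"
  shows "fst (M (y, w) (a, b)) \<in> Lp \<Omega> s" "snd (M (y, w) (a, b)) \<in> Lp \<Omega> s"
    and "N (fst (M (y, w) (a, b))) + N (snd (M (y, w) (a, b))) \<le>
      (1 + CT * N (U y w) + CT * (Cq / \<gamma>) * m * (nX y + nX w)^2) * (nX a + nX b)"
proof -
  have 1: "ae_eq \<Omega> (\<lambda>t. 1 * a t + (-1) * T (U y w) b t + 1 * T (K y w a b) w t) (fst (M (y, w) (a, b)))"
    using M_AE(1)[OF X] unfolding ae_eq_def by eventually_elim simp
  have 2: "ae_eq \<Omega> (\<lambda>t. 0 * a t + (-1) * T (U y w) a t + 1 * T (K y w a b) y t) (snd (M (y, w) (a, b)))"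
    using M_AE(2)[OF X] unfolding ae_eq_def by eventually_elim simp
  note UL = U_Lp[OF X(1,2)] and KL = K_Lp[OF X]
  note A = Lp_lincomb3_AE[OF s \<Omega>_sets XX_Lp[OF X(3)] T_Lp[OF UL X(4)] T_Lp[OF KL(1) X(2)] 1]
  note B = Lp_lincomb3_AE[OF s \<Omega>_sets XX_Lp[OF X(3)] T_Lp[OF UL X(3)] T_Lp[OF KL(1) X(1)] 2]
  show "fst (M (y, w) (a, b)) \<in> Lp \<Omega> s" "snd (M (y, w) (a, b)) \<in> Lp \<Omega> s" by (rule A B)+
  have "CT * N (K y w a b) * nX w + CT * N (K y w a b) * nX y = CT * (N (K y w a b) * (nX y + nX w))"
    by (simp add: algebra_simps)
  also have "\<dots> \<le> CT * ((Cq / \<gamma> * (nX y + nX w) * (nX a + nX b) * m) * (nX y + nX w))"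
    using CT KL(2) X nX_nonneg by (intro mult_left_mono mult_right_mono) auto
  finally have 3: "CT * N (K y w a b) * nX w + CT * N (K y w a b) * nX y \<le>
      CT * ((Cq / \<gamma> * (nX y + nX w) * (nX a + nX b) * m) * (nX y + nX w))" .
  have "N (fst (M (y, w) (a, b))) + N (snd (M (y, w) (a, b))) \<le>
    (nX a + CT * N (U y w) * nX b + CT * N (K y w a b) * nX w) + (CT * N (U y w) * nX a + CT * N (K y w a b) * nX y)"
    using A(2) B(2) Lp_le_nX[OF X(3)] T_bound[OF UL X(4)] T_bound[OF KL(1) X(2)] T_bound[OF UL X(3)] T_bound[OF KL(1) X(1)]
    by simp
  also have "\<dots> \<le> nX a + CT * N (U y w) * (nX a + nX b) + CT * ((Cq / \<gamma> * (nX y + nX w) * (nX a + nX b) * m) * (nX y + nX w))"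
    using 3 by (simp add: algebra_simps)
  also have "\<dots> \<le> (nX a + nX b) + CT * N (U y w) * (nX a + nX b) + CT * ((Cq / \<gamma> * (nX y + nX w) * (nX a + nX b) * m) * (nX y + nX w))"
    using nX_nonneg[OF X(4)] by simp
  also have "\<dots> = (1 + CT * N (U y w) + CT * (Cq / \<gamma>) * m * (nX y + nX w)^2) * (nX a + nX b)"
    by (simp only: power2_eq_square distrib_left distrib_right mult_ac add_ac mult_1_left mult_1_right)
  finally show "N (fst (M (y, w) (a, b))) + N (snd (M (y, w) (a, b))) \<le>
      (1 + CT * N (U y w) + CT * (Cq / \<gamma>) * m * (nX y + nX w)^2) * (nX a + nX b)" .
qed

lemma M_diff_AE:
  assumes X: "y \<in> XX" "w \<in> XX" "a \<in> XX" "b \<in> XX" "a' \<in> XX" "b' \<in> XX"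
  shows "AE t in L. fst (M (y, w) (\<lambda>t. a t - a' t, \<lambda>t. b t - b' t)) t = fst (M (y, w) (a, b)) t - fst (M (y, w) (a', b')) t"
    and "AE t in L. snd (M (y, w) (\<lambda>t. a t - a' t, \<lambda>t. b t - b' t)) t = snd (M (y, w) (a, b)) t - snd (M (y, w) (a', b')) t"
proof -
  let ?a = "\<lambda>t. a t - a' t" and ?b = "\<lambda>t. b t - b' t"
  note D = XX_diff[OF X(3,5)] XX_diff[OF X(4,6)]
  have K: "AE t in L. K y w ?a ?b t = K y w a b t - K y w a' b' t"
    using q_diff2[OF X(3,5,2)] q_diff2[OF X(4,6,1)]
  proof eventually_elim
    case (elim t)
    show ?case unfolding K_def elim by (simp add: algebra_simps)
  qed
  note TK = T_diff1[OF K_Lp(1)[OF X(1-4)] K_Lp(1)[OF X(1,2,5,6)] K_Lp(1)[OF X(1,2) D] _ K]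
  show "AE t in L. fst (M (y, w) (?a, ?b)) t = fst (M (y, w) (a, b)) t - fst (M (y, w) (a', b')) t"
    using M_AE(1)[OF X(1-4)] M_AE(1)[OF X(1,2,5,6)] M_AE(1)[OF X(1,2) D] TK[OF X(2)] T_diff2[OF U_Lp[OF X(1,2)] X(4,6)]
    by eventually_elim simp
  show "AE t in L. snd (M (y, w) (?a, ?b)) t = snd (M (y, w) (a, b)) t - snd (M (y, w) (a', b')) t"
    using M_AE(2)[OF X(1-4)] M_AE(2)[OF X(1,2,5,6)] M_AE(2)[OF X(1,2) D] TK[OF X(1)] T_diff2[OF U_Lp[OF X(1,2)] X(3,5)]
    by eventually_elim simp
qed

lemma F_Lp:
  assumes X: "y \<in> XX" "w \<in> XX"
  shows "fst (F (y, w)) \<in> Lp \<Omega> s" "snd (F (y, w)) \<in> Lp \<Omega> s"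
proof -
  note UL = U_Lp[OF X]
  have 1: "ae_eq \<Omega> (\<lambda>t. (-1) * T (U y w) w t + 1 * y t + (-1) * z t) (fst (F (y, w)))"
    by (simp add: ae_eq_def F_def)
  have 2: "ae_eq \<Omega> (\<lambda>t. (-1) * T (U y w) y t + (-1) * f t + 0 * f t) (snd (F (y, w)))"
    by (simp add: ae_eq_def F_def)
  show "fst (F (y, w)) \<in> Lp \<Omega> s" by (rule Lp_lincomb3_AE(1)[OF s \<Omega>_sets T_Lp[OF UL X(2)] XX_Lp[OF X(1)] z 1])
  show "snd (F (y, w)) \<in> Lp \<Omega> s" by (rule Lp_lincomb3_AE(1)[OF s \<Omega>_sets T_Lp[OF UL X(1)] f f 2])
qed

lemma bad_sets: "bad \<delta> \<in> sets L"
proof -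
  have "(\<lambda>t. infdist (- q ys ws t) kk) \<in> borel_measurable L"
    by (intro measurable_compose[OF borel_measurable_uminus[OF q_measurable[OF ys ws]]]
        borel_measurable_continuous_onI continuous_on_infdist continuous_on_id)
  then have "{t \<in> space L. infdist (- q ys ws t) kk \<le> \<delta>} \<in> sets L" by (rule borel_measurable_le) simp
  then show ?thesis by (simp add: bad_def)
qed

lemma \<rho>_nonneg: "\<rho> \<ge> 0" using nX_nonneg[OF ys] nX_nonneg[OF ws] by (simp add: \<rho>_def)
lemma P_nonneg: "P \<ge> 0" using \<rho>_nonneg Cq by (simp add: P_def)
lemma m_nonneg: "m \<ge> 0" by (simp add: m_def)
lemma \<mu>_nonneg: "\<mu> \<delta> \<ge> 0" by (simp add: \<mu>_def)

context
  fixes y w :: "'a \<Rightarrow> real" and e1 e2 :: "'a \<Rightarrow> real" and E :: real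
  assumes y: "y \<in> XX" and w: "w \<in> XX"
    and e1_def: "e1 = (\<lambda>t. y t - ys t)" and e2_def: "e2 = (\<lambda>t. w t - ws t)"
    and E_def: "E = nX e1 + nX e2" and E1: "E \<le> 1"
begin

lemma e: "e1 \<in> XX" "e2 \<in> XX"
  unfolding e1_def e2_def by (intro XX_diff y w ys ws)+

lemma E_nonneg: "E \<ge> 0" "nX e1 \<le> E" "nX e2 \<le> E"
  using nX_nonneg[OF e(1)] nX_nonneg[OF e(2)] by (simp_all add: E_def)

lemma yw_bound: "nX y + nX w \<le> \<rho> + 1"
proof -
  have "nX y \<le> nX ys + nX e1" using nX_add[OF ys e(1)] by (simp add: e1_def)
  moreover have "nX w \<le> nX ws + nX e2" using nX_add[OF ws e(2)] by (simp add: e2_def)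
  ultimately show ?thesis using E1 by (simp add: E_def \<rho>_def)
qed

lemma yw_single: "nX y \<le> \<rho> + 1" "nX w \<le> \<rho> + 1" "nX ys \<le> \<rho>" "nX ws \<le> \<rho>"
  using yw_bound nX_nonneg[OF y] nX_nonneg[OF w] nX_nonneg[OF ys] nX_nonneg[OF ws] by (simp_all add: \<rho>_def)

lemma q_increment: "AE t in L. q y w t - q ys ws t = q ys e2 t + q e1 w t"
  using q_diff1[OF y ys w] q_diff2[OF w ws ys] unfolding e1_def[symmetric] e2_def[symmetric]
  by eventually_elim simp

lemma q_close: "AE t in L. \<bar>(- q y w t) - (- q ys ws t)\<bar> \<le> P * E"
  using q_increment q_bound[OF ys e(2)] q_bound[OF e(1) w]
proof eventually_elim
  case (elim t)
  have "\<bar>(- q y w t) - (- q ys ws t)\<bar> \<le> Cq * nX ys * nX e2 + Cq * nX e1 * nX w" using elim by linarith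
  also have "\<dots> \<le> Cq * \<rho> * E + Cq * E * (\<rho> + 1)"
    using Cq \<rho>_nonneg E_nonneg yw_single nX_nonneg y w ys ws e by (intro add_mono mult_mono) auto
  also have "\<dots> = P * E" by (simp add: P_def algebra_simps)
  finally show ?case .
qed

lemma U_increment:
  shows "(\<lambda>t. U y w t - U ys ws t) \<in> Lp \<Omega> s" "N (\<lambda>t. U y w t - U ys ws t) \<le> (d / \<gamma>) * (P * E) * m"
proof -
  have le: "AE t in L. \<bar>U y w t - U ys ws t\<bar> \<le> (d / \<gamma>) * (P * E)"
    using q_close
  proof eventually_elim
    case (elim t)
    have "\<bar>U y w t - U ys ws t\<bar> \<le> (d / \<gamma>) * \<bar>(- q y w t) - (- q ys ws t)\<bar>"
      unfolding U_def by (rule H_reg_lipschitz[OF \<alpha> \<gamma> u d])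
    also have "\<dots> \<le> (d / \<gamma>) * (P * E)" using elim \<gamma> by (intro mult_left_mono) auto
    finally show ?case .
  qed
  have "(\<lambda>t. U y w t - U ys ws t) \<in> borel_measurable L"
    by (intro borel_measurable_diff U_measurable y w ys ws)
  from Lp_boundI[OF this _ le] show "(\<lambda>t. U y w t - U ys ws t) \<in> Lp \<Omega> s" "N (\<lambda>t. U y w t - U ys ws t) \<le> (d / \<gamma>) * (P * E) * m"
    using \<gamma> P_nonneg E_nonneg by auto
qed

lemma slope_increment: "AE t in L. \<bar>slope y w t - slope ys ws t\<bar> \<le> 1 / \<gamma> * indicator (bad (P * E)) t"
  using q_close AE_\<Omega>
proof eventually_elim
  case (elim t)
  show ?case
  proof (cases "t \<in> bad (P * E)")
    case True
    then show ?thesis using \<gamma> by (auto simp: slope_def indicator_def)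
  next
    case False
    then have "\<bar>(- q y w t) - (- q ys ws t)\<bar> < infdist (- q ys ws t) kk" using elim by (simp add: bad_def)
    from H_reg_off_kinks(2)[OF \<alpha> \<gamma> u d this] show ?thesis using False by (simp add: slope_def)
  qed
qed

text \<open>
  The increment of a product: where the slope stays the same, only the bilinear factor changes, which costs
  \<open>E\<close>; the slope itself changes only on the set \<open>bad (P * E)\<close>.
\<close>

lemma K_increment:
  assumes a: "a \<in> XX" and b: "b \<in> XX"
  shows "(\<lambda>t. K y w a b t - K ys ws a b t) \<in> Lp \<Omega> s"
    and "N (\<lambda>t. K y w a b t - K ys ws a b t) \<le> Cq / \<gamma> * (nX a + nX b) * (E * m + \<rho> * \<mu> (P * E))"
proof -
  let ?D = "nX a + nX b"
  have D: "?D \<ge> 0" using nX_nonneg[OF a] nX_nonneg[OF b] by simp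
  have le: "AE t in L. \<bar>K y w a b t - K ys ws a b t\<bar> \<le> Cq / \<gamma> * E * ?D + Cq / \<gamma> * \<rho> * ?D * indicator (bad (P * E)) t"
    using slope_increment q_diff1[OF w ws a] q_diff1[OF y ys b] q_bound[OF e(2) a] q_bound[OF e(1) b] q_bound[OF ws a] q_bound[OF ys b]
    unfolding e1_def[symmetric] e2_def[symmetric]
  proof eventually_elim
    case (elim t)
    have 1: "\<bar>q e2 a t + q e1 b t\<bar> \<le> Cq * E * ?D"
    proof -
      have "\<bar>q e2 a t + q e1 b t\<bar> \<le> Cq * nX e2 * nX a + Cq * nX e1 * nX b" using elim by linarith
      also have "\<dots> \<le> Cq * E * nX a + Cq * E * nX b"
        using Cq E_nonneg nX_nonneg a b e by (intro add_mono mult_mono) auto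
      finally show ?thesis by (simp add: algebra_simps)
    qed
    have 2: "\<bar>q ws a t + q ys b t\<bar> \<le> Cq * \<rho> * ?D"
    proof -
      have "\<bar>q ws a t + q ys b t\<bar> \<le> Cq * nX ws * nX a + Cq * nX ys * nX b" using elim by linarith
      also have "\<dots> \<le> Cq * \<rho> * nX a + Cq * \<rho> * nX b"
        using Cq \<rho>_nonneg yw_single nX_nonneg a b ws ys by (intro add_mono mult_mono) auto
      finally show ?thesis by (simp add: algebra_simps)
    qed
    have eq: "K y w a b t - K ys ws a b t =
        slope y w t * (q e2 a t + q e1 b t) + (slope y w t - slope ys ws t) * (q ws a t + q ys b t)"
    proof -
      have qa: "q w a t = q e2 a t + q ws a t" "q y b t = q e1 b t + q ys b t" using elim by auto
      show ?thesis unfolding K_def qa by (simp add: algebra_simps)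
    qed
    have "\<bar>K y w a b t - K ys ws a b t\<bar> \<le>
        \<bar>slope y w t\<bar> * \<bar>q e2 a t + q e1 b t\<bar> + \<bar>slope y w t - slope ys ws t\<bar> * \<bar>q ws a t + q ys b t\<bar>"
      unfolding eq abs_mult[symmetric] by (rule abs_triangle_ineq)
    also have "\<dots> \<le> 1 / \<gamma> * (Cq * E * ?D) + (1 / \<gamma> * indicator (bad (P * E)) t) * (Cq * \<rho> * ?D)"
      using 1 2 slope_bound elim(1) \<gamma> by (intro add_mono mult_mono) auto
    finally show ?case by (simp add: algebra_simps add_divide_distrib)
  qed
  have me: "(\<lambda>t. K y w a b t - K ys ws a b t) \<in> borel_measurable L"
    by (intro borel_measurable_diff K_measurable y w ys ws a b)
  have c: "0 \<le> Cq / \<gamma> * E * ?D" "0 \<le> Cq / \<gamma> * \<rho> * ?D"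
    using Cq \<gamma> E_nonneg D \<rho>_nonneg by simp_all
  note I = Lp_indicator_bound[OF s \<Omega> me bad_sets c le]
  show "(\<lambda>t. K y w a b t - K ys ws a b t) \<in> Lp \<Omega> s" by (rule I)
  show "N (\<lambda>t. K y w a b t - K ys ws a b t) \<le> Cq / \<gamma> * (nX a + nX b) * (E * m + \<rho> * \<mu> (P * E))"
    using I(2) unfolding m_def[symmetric] \<mu>_def[symmetric] by (simp add: algebra_simps add_divide_distrib)
qed

text \<open>
  The linearization error of the control. Outside of \<open>bad (P * E)\<close> the nonlinearity is affine between the two
  arguments, and only the quadratic remainder \<open>q e1 e2\<close> of the inner map is left. On \<open>bad (P * E)\<close>
  Lipschitz continuity gives a multiple of \<open>E\<close>.
\<close>

lemma U_remainder:
  shows "(\<lambda>t. U y w t - U ys ws t + K y w e1 e2 t) \<in> Lp \<Omega> s"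
    and "N (\<lambda>t. U y w t - U ys ws t + K y w e1 e2 t) \<le> E * (Cq / \<gamma> * E * m + (d + 1) / \<gamma> * P * \<mu> (P * E))"
proof -
  have le: "AE t in L. \<bar>U y w t - U ys ws t + K y w e1 e2 t\<bar> \<le>
      Cq / \<gamma> * E * E + (d + 1) / \<gamma> * P * E * indicator (bad (P * E)) t"
    using q_close AE_\<Omega> q_increment q_diff1[OF y ys e(2)] q_bound[OF e]
    unfolding e1_def[symmetric]
  proof eventually_elim
    case (elim t)
    let ?\<Delta> = "(- q y w t) - (- q ys ws t)"
    have kd: "?\<Delta> + (q w e1 t + q y e2 t) = q e1 e2 t" using elim q_sym[of w e1] by simp
    have eq: "U y w t - U ys ws t + K y w e1 e2 t = (H (- q y w t) - H (- q ys ws t) - slope y w t * ?\<Delta>) + slope y w t * q e1 e2 t"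
      unfolding kd[symmetric] by (simp add: U_def K_def algebra_simps)
    have "\<bar>q e1 e2 t\<bar> \<le> Cq * E * E"
    proof -
      have "Cq * nX e1 * nX e2 \<le> Cq * E * E" using Cq E_nonneg nX_nonneg e by (intro mult_mono) auto
      then show ?thesis using elim by linarith
    qed
    then have 1: "\<bar>slope y w t * q e1 e2 t\<bar> \<le> 1 / \<gamma> * (Cq * E * E)"
      unfolding abs_mult using slope_bound \<gamma> by (intro mult_mono) auto
    have 2: "\<bar>H (- q y w t) - H (- q ys ws t) - slope y w t * ?\<Delta>\<bar> \<le> (d + 1) / \<gamma> * P * E * indicator (bad (P * E)) t"
    proof (cases "t \<in> bad (P * E)")
      case True
      have "\<bar>H (- q y w t) - H (- q ys ws t)\<bar> \<le> (d / \<gamma>) * \<bar>?\<Delta>\<bar>" by (rule H_reg_lipschitz[OF \<alpha> \<gamma> u d])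
      moreover have "\<bar>slope y w t * ?\<Delta>\<bar> \<le> 1 / \<gamma> * \<bar>?\<Delta>\<bar>"
        unfolding abs_mult using slope_bound by (intro mult_right_mono) auto
      ultimately have "\<bar>H (- q y w t) - H (- q ys ws t) - slope y w t * ?\<Delta>\<bar> \<le> (d / \<gamma>) * \<bar>?\<Delta>\<bar> + 1 / \<gamma> * \<bar>?\<Delta>\<bar>"
        by linarith
      also have "\<dots> = (d + 1) / \<gamma> * \<bar>?\<Delta>\<bar>" by (simp add: add_divide_distrib distrib_right)
      also have "\<dots> \<le> (d + 1) / \<gamma> * (P * E)" using elim \<gamma> by (intro mult_left_mono) auto
      finally show ?thesis using True by simp
    next
      case False
      then have "\<bar>?\<Delta>\<bar> < infdist (- q ys ws t) kk" using elim by (simp add: bad_def)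
      from H_reg_off_kinks(1)[OF \<alpha> \<gamma> u d this] show ?thesis using False by (simp add: slope_def)
    qed
    have "\<bar>U y w t - U ys ws t + K y w e1 e2 t\<bar> \<le> 1 / \<gamma> * (Cq * E * E) + (d + 1) / \<gamma> * P * E * indicator (bad (P * E)) t"
      unfolding eq using 1 2 by linarith
    then show ?case by simp
  qed
  have me: "(\<lambda>t. U y w t - U ys ws t + K y w e1 e2 t) \<in> borel_measurable L"
    by (intro borel_measurable_diff borel_measurable_add K_measurable U_measurable y w ys ws e)
  have c: "0 \<le> Cq / \<gamma> * E * E" "0 \<le> (d + 1) / \<gamma> * P * E"
    using Cq \<gamma> E_nonneg P_nonneg by simp_all
  note I = Lp_indicator_bound[OF s \<Omega> me bad_sets c le]
  show "(\<lambda>t. U y w t - U ys ws t + K y w e1 e2 t) \<in> Lp \<Omega> s" by (rule I)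
  show "N (\<lambda>t. U y w t - U ys ws t + K y w e1 e2 t) \<le> E * (Cq / \<gamma> * E * m + (d + 1) / \<gamma> * P * \<mu> (P * E))"
    using I(2) unfolding m_def[symmetric] \<mu>_def[symmetric] by (simp add: algebra_simps add_divide_distrib)
qed

text \<open>
  The operators at \<open>(y, w)\<close> and \<open>(ys, ws)\<close> differ, in the first component, by
  \<open>- T (U - U\<^sub>s) b + T (K - K\<^sub>s) w + T K\<^sub>s e2\<close>, where the index \<open>s\<close> refers to \<open>(ys, ws)\<close>; the second component is
  analogous.
\<close>

lemma M_increment:
  assumes a: "a \<in> XX" and b: "b \<in> XX"
  shows "N (\<lambda>t. fst (M (y, w) (a, b)) t - fst (M (ys, ws) (a, b)) t) + N (\<lambda>t. snd (M (y, w) (a, b)) t - snd (M (ys, ws) (a, b)) t)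
    \<le> 2 * CT * ((d / \<gamma>) * P * m + Cq / \<gamma> * (m + \<rho>) * (\<rho> + 1) + Cq / \<gamma> * \<rho> * m) * (E + \<mu> (P * E)) * (nX a + nX b)"
proof -
  let ?D = "nX a + nX b"
  have D: "?D \<ge> 0" "nX a \<le> ?D" "nX b \<le> ?D" using nX_nonneg[OF a] nX_nonneg[OF b] by simp_all
  let ?dU = "\<lambda>t. U y w t - U ys ws t" and ?dK = "\<lambda>t. K y w a b t - K ys ws a b t"
  note dU = U_increment and dK = K_increment[OF a b]
  note UL = U_Lp[OF y w] and UsL = U_Lp[OF ys ws] and KL = K_Lp(1)[OF y w a b] and KsL = K_Lp(1)[OF ys ws a b]
  have TU: "AE t in L. T ?dU v t = T (U y w) v t - T (U ys ws) v t" if "v \<in> XX" for v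
    by (rule T_diff1[OF UL UsL dU(1) that]) simp
  have TK: "AE t in L. T ?dK v t = T (K y w a b) v t - T (K ys ws a b) v t" if "v \<in> XX" for v
    by (rule T_diff1[OF KL KsL dK(1) that]) simp
  have 1: "ae_eq \<Omega> (\<lambda>t. (-1) * T ?dU b t + 1 * T ?dK w t + 1 * T (K ys ws a b) e2 t)
      (\<lambda>t. fst (M (y, w) (a, b)) t - fst (M (ys, ws) (a, b)) t)"
    unfolding ae_eq_def
    using M_AE(1)[OF y w a b] M_AE(1)[OF ys ws a b] TU[OF b] TK[OF w] T_diff2[OF KsL w ws] unfolding e2_def[symmetric]
    by eventually_elim simp
  have 2: "ae_eq \<Omega> (\<lambda>t. (-1) * T ?dU a t + 1 * T ?dK y t + 1 * T (K ys ws a b) e1 t)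
      (\<lambda>t. snd (M (y, w) (a, b)) t - snd (M (ys, ws) (a, b)) t)"
    unfolding ae_eq_def
    using M_AE(2)[OF y w a b] M_AE(2)[OF ys ws a b] TU[OF a] TK[OF y] T_diff2[OF KsL y ys] unfolding e1_def[symmetric]
    by eventually_elim simp
  note A = Lp_lincomb3_AE(2)[OF s \<Omega>_sets T_Lp[OF dU(1) b] T_Lp[OF dK(1) w] T_Lp[OF KsL e(2)] 1]
  note B = Lp_lincomb3_AE(2)[OF s \<Omega>_sets T_Lp[OF dU(1) a] T_Lp[OF dK(1) y] T_Lp[OF KsL e(1)] 2]
  let ?\<epsilon> = "E + \<mu> (P * E)"
  have nn: "0 \<le> N h" for h by (rule Lp_norm_nonneg)
  have \<epsilon>: "0 \<le> ?\<epsilon>" using E_nonneg \<mu>_nonneg by simp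
  have tU: "N (T ?dU v) \<le> CT * ((d / \<gamma>) * P * m) * ?\<epsilon> * ?D" if v: "v \<in> XX" "nX v \<le> ?D" for v
  proof -
    have "N (T ?dU v) \<le> CT * N ?dU * nX v" by (rule T_bound[OF dU(1) v(1)])
    also have "\<dots> \<le> CT * ((d / \<gamma>) * (P * E) * m) * ?D"
      using CT nn v nX_nonneg[OF v(1)] dU(2) D \<gamma> P_nonneg E_nonneg m_nonneg by (intro mult_mono mult_nonneg_nonneg) auto
    also have "\<dots> = CT * ((d / \<gamma>) * P * m) * E * ?D" by simp
    also have "\<dots> \<le> CT * ((d / \<gamma>) * P * m) * ?\<epsilon> * ?D"
      using CT \<gamma> P_nonneg E_nonneg m_nonneg \<mu>_nonneg[of "P * E"] D by (intro mult_right_mono mult_left_mono mult_nonneg_nonneg) auto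
    finally show ?thesis .
  qed
  have tK: "N (T ?dK v) \<le> CT * (Cq / \<gamma> * (m + \<rho>) * (\<rho> + 1)) * ?\<epsilon> * ?D" if v: "v \<in> XX" "nX v \<le> \<rho> + 1" for v
  proof -
    have c: "0 \<le> Cq / \<gamma>" using Cq \<gamma> by simp
    have mix: "E * m + \<rho> * \<mu> (P * E) \<le> (m + \<rho>) * ?\<epsilon>"
      using m_nonneg \<rho>_nonneg E_nonneg \<mu>_nonneg[of "P * E"] by (simp add: algebra_simps)
    have dK': "N ?dK \<le> Cq / \<gamma> * ?D * ((m + \<rho>) * ?\<epsilon>)"
      using dK(2) mult_left_mono[OF mix mult_nonneg_nonneg[OF c D(1)]] by linarith
    have "N (T ?dK v) \<le> CT * N ?dK * nX v" by (rule T_bound[OF dK(1) v(1)])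
    also have "\<dots> \<le> CT * (Cq / \<gamma> * ?D * ((m + \<rho>) * ?\<epsilon>)) * (\<rho> + 1)"
      using CT nn v nX_nonneg[OF v(1)] dK' c D m_nonneg \<rho>_nonneg \<epsilon>
      by (intro mult_mono mult_nonneg_nonneg) auto
    finally show ?thesis by (simp add: mult_ac)
  qed
  have tKs: "N (T (K ys ws a b) v) \<le> CT * (Cq / \<gamma> * \<rho> * m) * ?\<epsilon> * ?D" if v: "v \<in> XX" "nX v \<le> E" for v
  proof -
    have c: "0 \<le> Cq / \<gamma>" using Cq \<gamma> by simp
    have "N (T (K ys ws a b) v) \<le> CT * N (K ys ws a b) * nX v" by (rule T_bound[OF KsL v(1)])
    also have "\<dots> \<le> CT * (Cq / \<gamma> * \<rho> * ?D * m) * ?\<epsilon>"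
      using CT nn v nX_nonneg[OF v(1)] K_Lp(2)[OF ys ws a b, folded \<rho>_def] c D m_nonneg \<rho>_nonneg \<epsilon> \<mu>_nonneg[of "P * E"]
      by (intro mult_mono mult_nonneg_nonneg) auto
    finally show ?thesis by (simp add: mult_ac)
  qed
  have "N (\<lambda>t. fst (M (y, w) (a, b)) t - fst (M (ys, ws) (a, b)) t) + N (\<lambda>t. snd (M (y, w) (a, b)) t - snd (M (ys, ws) (a, b)) t)
    \<le> 2 * (CT * ((d / \<gamma>) * P * m) * ?\<epsilon> * ?D + CT * (Cq / \<gamma> * (m + \<rho>) * (\<rho> + 1)) * ?\<epsilon> * ?D + CT * (Cq / \<gamma> * \<rho> * m) * ?\<epsilon> * ?D)"
    by (rule add_le_double[OF A[unfolded abs_minus_cancel abs_one mult_1_left] B[unfolded abs_minus_cancel abs_one mult_1_left]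
        tU[OF b D(3)] tU[OF a D(2)] tK[OF w yw_single(2)] tK[OF y yw_single(1)] tKs[OF e(2) E_nonneg(3)] tKs[OF e(1) E_nonneg(2)]])
  also have "\<dots> = 2 * CT * ((d / \<gamma>) * P * m + Cq / \<gamma> * (m + \<rho>) * (\<rho> + 1) + Cq / \<gamma> * \<rho> * m) * ?\<epsilon> * ?D"
    by (simp only: distrib_left distrib_right mult_ac)
  finally show ?thesis .
qed

text \<open>
  All terms that are linear in \<open>(e1, e2)\<close> cancel: with the linearization error \<open>r\<close> of \<open>U_remainder\<close>, the first
  component of \<open>F - M e\<close> is \<open>- T r ws - T K e2\<close> and the second one \<open>- T r ys - T K e1\<close>.
\<close>

lemma F_remainder:
  assumes sol: "AE t in L. fst (F (ys, ws)) t = 0" "AE t in L. snd (F (ys, ws)) t = 0"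
  shows "N (\<lambda>t. fst (F (y, w)) t - fst (M (y, w) (e1, e2)) t) + N (\<lambda>t. snd (F (y, w)) t - snd (M (y, w) (e1, e2)) t)
    \<le> 2 * CT * ((Cq / \<gamma> * m + (d + 1) / \<gamma> * P) * \<rho> + Cq / \<gamma> * (\<rho> + 1) * m) * (E + \<mu> (P * E)) * E"
proof -
  let ?r = "\<lambda>t. U y w t - U ys ws t + K y w e1 e2 t"
  note r = U_remainder
  note UL = U_Lp[OF y w] and UsL = U_Lp[OF ys ws] and KL = K_Lp(1)[OF y w e]
  have Tr: "AE t in L. T ?r v t = T (U y w) v t - T (U ys ws) v t + T (K y w e1 e2) v t" if v: "v \<in> XX" for v
  proof -
    have 1: "AE t in L. T (\<lambda>t. U y w t - U ys ws t) v t = T (U y w) v t - T (U ys ws) v t"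
      by (rule T_diff1[OF UL UsL U_increment(1) v]) simp
    have "AE t in L. T ?r v t = T (\<lambda>t. U y w t - U ys ws t) v t + T (K y w e1 e2) v t"
      by (rule T_add1[OF U_increment(1) KL r(1) v]) simp
    with 1 show ?thesis by eventually_elim simp
  qed
  have 1: "ae_eq \<Omega> (\<lambda>t. (-1) * T ?r ws t + (-1) * T (K y w e1 e2) e2 t + 0 * T (K y w e1 e2) e2 t)
      (\<lambda>t. fst (F (y, w)) t - fst (M (y, w) (e1, e2)) t)"
    unfolding ae_eq_def
    using M_AE(1)[OF y w e] sol(1) Tr[OF ws] T_diff2[OF KL w ws] T_diff2[OF UL w ws]
    unfolding e2_def[symmetric]
    by eventually_elim (simp add: F_def e1_def)
  have 2: "ae_eq \<Omega> (\<lambda>t. (-1) * T ?r ys t + (-1) * T (K y w e1 e2) e1 t + 0 * T (K y w e1 e2) e1 t)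
      (\<lambda>t. snd (F (y, w)) t - snd (M (y, w) (e1, e2)) t)"
    unfolding ae_eq_def
    using M_AE(2)[OF y w e] sol(2) Tr[OF ys] T_diff2[OF KL y ys] T_diff2[OF UL y ys]
    unfolding e1_def[symmetric]
    by eventually_elim (simp add: F_def)
  note A = Lp_lincomb3_AE(2)[OF s \<Omega>_sets T_Lp[OF r(1) ws] T_Lp[OF KL e(2)] T_Lp[OF KL e(2)] 1]
  note B = Lp_lincomb3_AE(2)[OF s \<Omega>_sets T_Lp[OF r(1) ys] T_Lp[OF KL e(1)] T_Lp[OF KL e(1)] 2]
  let ?\<epsilon> = "E + \<mu> (P * E)"
  have nn: "0 \<le> N h" for h by (rule Lp_norm_nonneg)
  have \<epsilon>: "0 \<le> ?\<epsilon>" using E_nonneg \<mu>_nonneg by simp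
  have c: "0 \<le> Cq / \<gamma>" "0 \<le> (d + 1) / \<gamma>" using Cq \<gamma> by simp_all
  have tr: "N (T ?r v) \<le> CT * ((Cq / \<gamma> * m + (d + 1) / \<gamma> * P) * \<rho>) * ?\<epsilon> * E" if v: "v \<in> XX" "nX v \<le> \<rho>" for v
  proof -
    have "Cq / \<gamma> * E * m + (d + 1) / \<gamma> * P * \<mu> (P * E) \<le> (Cq / \<gamma> * m + (d + 1) / \<gamma> * P) * ?\<epsilon>"
    proof -
      have "0 \<le> (Cq / \<gamma> * m) * \<mu> (P * E)" "0 \<le> ((d + 1) / \<gamma> * P) * E"
        using c m_nonneg P_nonneg E_nonneg \<mu>_nonneg by (intro mult_nonneg_nonneg; simp)+
      then show ?thesis by (simp add: algebra_simps)
    qed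
    from mult_left_mono[OF this E_nonneg(1)] r(2)
    have r': "N ?r \<le> E * ((Cq / \<gamma> * m + (d + 1) / \<gamma> * P) * ?\<epsilon>)" by linarith
    have "N (T ?r v) \<le> CT * N ?r * nX v" by (rule T_bound[OF r(1) v(1)])
    also have "\<dots> \<le> CT * (E * ((Cq / \<gamma> * m + (d + 1) / \<gamma> * P) * ?\<epsilon>)) * \<rho>"
      using CT nn v nX_nonneg[OF v(1)] r' c m_nonneg \<rho>_nonneg E_nonneg P_nonneg \<mu>_nonneg[of "P * E"]
      by (intro mult_mono mult_nonneg_nonneg add_nonneg_nonneg) auto
    finally show ?thesis by (simp only: mult_ac)
  qed
  have tK: "N (T (K y w e1 e2) v) \<le> CT * (Cq / \<gamma> * (\<rho> + 1) * m) * ?\<epsilon> * E" if v: "v \<in> XX" "nX v \<le> E" for v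
  proof -
    have "N (K y w e1 e2) \<le> Cq / \<gamma> * (nX y + nX w) * E * m" using K_Lp(2)[OF y w e] by (simp add: E_def)
    also have "\<dots> \<le> Cq / \<gamma> * (\<rho> + 1) * E * m"
      using c yw_bound E_nonneg m_nonneg by (intro mult_right_mono mult_left_mono) auto
    finally have k: "N (K y w e1 e2) \<le> Cq / \<gamma> * (\<rho> + 1) * E * m" .
    have "N (T (K y w e1 e2) v) \<le> CT * N (K y w e1 e2) * nX v" by (rule T_bound[OF KL v(1)])
    also have "\<dots> \<le> CT * (Cq / \<gamma> * (\<rho> + 1) * E * m) * ?\<epsilon>"
      using CT nn v nX_nonneg[OF v(1)] k c m_nonneg \<rho>_nonneg E_nonneg \<mu>_nonneg[of "P * E"]
      by (intro mult_mono mult_nonneg_nonneg) auto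
    finally show ?thesis by (simp only: mult_ac)
  qed
  have "N (\<lambda>t. fst (F (y, w)) t - fst (M (y, w) (e1, e2)) t) + N (\<lambda>t. snd (F (y, w)) t - snd (M (y, w) (e1, e2)) t)
    \<le> 2 * (CT * ((Cq / \<gamma> * m + (d + 1) / \<gamma> * P) * \<rho>) * ?\<epsilon> * E + CT * (Cq / \<gamma> * (\<rho> + 1) * m) * ?\<epsilon> * E)"
    using add_le_double[OF A[unfolded abs_minus_cancel abs_one abs_zero mult_1_left mult_zero_left]
        B[unfolded abs_minus_cancel abs_one abs_zero mult_1_left mult_zero_left]
        tr[OF ws yw_single(4)] tr[OF ys yw_single(3)] tK[OF e(2) E_nonneg(3)] tK[OF e(1) E_nonneg(2)] order_refl order_refl]
    by (simp only: add_0_right)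
  also have "\<dots> = 2 * CT * ((Cq / \<gamma> * m + (d + 1) / \<gamma> * P) * \<rho> + Cq / \<gamma> * (\<rho> + 1) * m) * ?\<epsilon> * E"
    by (simp only: distrib_left distrib_right mult_ac)
  finally show ?thesis .
qed

end

lemma \<mu>_mono: "\<delta> \<le> \<delta>' \<Longrightarrow> \<mu> \<delta> \<le> \<mu> \<delta>'"
proof -
  assume "\<delta> \<le> \<delta>'"
  interpret finite_measure L using \<Omega> by (rule finite_lebesgue_on)
  have "measure L (bad \<delta>) \<le> measure L (bad \<delta>')"
    using \<open>\<delta> \<le> \<delta>'\<close> bad_sets by (intro finite_measure_mono) (auto simp: bad_def)
  then show ?thesis unfolding \<mu>_def using s by (intro powr_mono2) auto
qed

text \<open>
  Continuity of the measure from above: the sets \<open>bad \<delta>\<close> decrease to the set on which a kink is attained.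
\<close>

lemma \<mu>_small:
  assumes neg: "negligible {t \<in> \<Omega>. - q ys ws t \<in> kk}" and \<kappa>: "\<kappa> > 0"
  shows "\<exists>\<delta>>0. \<mu> \<delta> < \<kappa>"
proof -
  interpret finite_measure L using \<Omega> by (rule finite_lebesgue_on)
  let ?A = "\<lambda>n. bad (inverse (real (Suc n)))"
  have "decseq ?A" unfolding decseq_Suc_iff bad_def by (auto intro: order_trans le_imp_inverse_le)
  then have lim: "(\<lambda>n. measure L (?A n)) \<longlonglongrightarrow> measure L (\<Inter>n. ?A n)"
    using bad_sets by (intro finite_Lim_measure_decseq) auto
  have "(\<Inter>n. ?A n) = {t \<in> \<Omega>. - q ys ws t \<in> kk}"
  proof (intro equalityI subsetI)
    fix t assume t: "t \<in> (\<Inter>n. ?A n)"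
    have "infdist (- q ys ws t) kk \<le> 0"
      by (rule LIMSEQ_le_const[OF LIMSEQ_inverse_real_of_nat]) (use t in \<open>auto simp: bad_def\<close>)
    then have "infdist (- q ys ws t) kk = 0" using infdist_nonneg[of "- q ys ws t" kk] by simp
    moreover have "closed kk" using kinks_finite[OF \<alpha> \<gamma> u d] by (rule finite_imp_closed)
    ultimately have "- q ys ws t \<in> kk" using in_closed_iff_infdist_zero kinks_nonempty[OF \<alpha> \<gamma> u d] by blast
    then show "t \<in> {t \<in> \<Omega>. - q ys ws t \<in> kk}" using t by (auto simp: bad_def)
  qed (auto simp: bad_def)
  moreover have "measure L {t \<in> \<Omega>. - q ys ws t \<in> kk} = 0"
    using neg \<Omega>_sets by (subst measure_restrict_space) (auto simp: negligible_iff_null_sets measure_eq_0_null_sets)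
  ultimately have "(\<lambda>n. measure L (?A n)) \<longlonglongrightarrow> 0" using lim by simp
  then have "(\<lambda>n. measure L (?A n) powr (1 / s)) \<longlonglongrightarrow> 0 powr (1 / s)"
    using s by (intro tendsto_powr') auto
  then have "(\<lambda>n. \<mu> (inverse (real (Suc n)))) \<longlonglongrightarrow> 0" using s by (simp add: \<mu>_def)
  from order_tendstoD(2)[OF this \<kappa>] obtain n where "\<mu> (inverse (real (Suc n))) < \<kappa>"
    by (auto simp: eventually_sequentially)
  then show ?thesis by (intro exI[of _ "inverse (real (Suc n))"]) auto
qed

lemma modulus_small:
  assumes neg: "negligible {t \<in> \<Omega>. - q ys ws t \<in> kk}" and \<kappa>: "\<kappa> > 0" and C: "C \<ge> 0"
  shows "\<exists>\<epsilon>>0. \<epsilon> \<le> 1 \<and> (\<forall>E. 0 \<le> E \<longrightarrow> E < \<epsilon> \<longrightarrow> C * (E + \<mu> (P * E)) \<le> \<kappa>)"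
proof -
  let ?k = "\<kappa> / (2 * (C + 1))"
  have k: "?k > 0" using \<kappa> C by simp
  obtain \<delta> where \<delta>: "\<delta> > 0" "\<mu> \<delta> < ?k" using \<mu>_small[OF neg k] by blast
  define \<epsilon> where "\<epsilon> = min 1 (min ?k (\<delta> / (P + 1)))"
  have P: "P \<ge> 0" by (rule P_nonneg)
  have "C * (E + \<mu> (P * E)) \<le> \<kappa>" if E: "0 \<le> E" "E < \<epsilon>" for E
  proof -
    have "P * E \<le> (P + 1) * (\<delta> / (P + 1))" using E P by (intro mult_mono) (auto simp: \<epsilon>_def)
    then have "P * E \<le> \<delta>" using P by simp
    then have "\<mu> (P * E) \<le> ?k" using \<mu>_mono \<delta>(2) by fastforce
    moreover have "E \<le> ?k" using E by (simp add: \<epsilon>_def)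
    ultimately have "C * (E + \<mu> (P * E)) \<le> (C + 1) * (?k + ?k)"
      using C E \<mu>_nonneg by (intro mult_mono) auto
    also have "(C + 1) * (?k + ?k) = \<kappa>"
    proof -
      have "c * (\<kappa> / (2 * c) + \<kappa> / (2 * c)) = \<kappa>" if "c > 0" for c :: real
        using that by (simp add: field_simps)
      from this[of "C + 1"] C show ?thesis by simp
    qed
    finally show ?thesis .
  qed
  moreover have "\<epsilon> > 0" "\<epsilon> \<le> 1" using k \<delta> P by (auto simp: \<epsilon>_def)
  ultimately show ?thesis by blast
qed

end

section \<open>The hypotheses of the Newton theorem\<close>

context regularized_system
begin

definition "X2 = XX \<times> XX"
definition "nX2 v = nX (fst v) + nX (snd v)"
definition "Z2 = Lp \<Omega> s \<times> Lp \<Omega> s"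
definition "nZ2 g = N (fst g) + N (snd g)"

lemma XX_subspace: "subspace XX"
proof (rule subspaceI)
  show "0 \<in> XX" using XX_lincomb[OF ys ys, of 0 0] by (simp add: zero_fun_def)
  show "v + w \<in> XX" if "v \<in> XX" "w \<in> XX" for v w using XX_add[OF that] by (simp add: plus_fun_def)
  show "c *\<^sub>R v \<in> XX" if "v \<in> XX" for c v using XX_lincomb[OF that that, of c 0] by (simp add: scaleR_fun_def)
qed

lemma Lp_subspace: "subspace (Lp \<Omega> s)"
proof (rule subspaceI)
  show "0 \<in> Lp \<Omega> s" using Lp_zero[of \<Omega> s] by (simp add: zero_fun_def)
  show "v + w \<in> Lp \<Omega> s" if "v \<in> Lp \<Omega> s" "w \<in> Lp \<Omega> s" for v w
    using Lp_add(1)[OF s that] by (simp add: plus_fun_def)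
  show "c *\<^sub>R v \<in> Lp \<Omega> s" if "v \<in> Lp \<Omega> s" for c v using Lp_cmult(1)[OF s that] by (simp add: scaleR_fun_def)
qed

lemma seminormed_X2: "seminormed X2 nX2"
proof
  show "subspace X2" unfolding X2_def by (intro subspace_Times XX_subspace)
  show "nX2 (c *\<^sub>R v) = \<bar>c\<bar> * nX2 v" if "v \<in> X2" for c v
    using that nX_cmult[of "fst v" c] nX_cmult[of "snd v" c] by (auto simp: X2_def nX2_def scaleR_fun_def distrib_left)
  show "nX2 (v + w) \<le> nX2 v + nX2 w" if "v \<in> X2" "w \<in> X2" for v w
    using that nX_add[of "fst v" "fst w"] nX_add[of "snd v" "snd w"] by (auto simp: X2_def nX2_def plus_fun_def)
qed

lemma seminormed_Z2: "seminormed Z2 nZ2"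
proof
  show "subspace Z2" unfolding Z2_def by (intro subspace_Times Lp_subspace)
  show "nZ2 (c *\<^sub>R v) = \<bar>c\<bar> * nZ2 v" if "v \<in> Z2" for c v
    using that Lp_cmult(2)[OF s, of "fst v" \<Omega> c] Lp_cmult(2)[OF s, of "snd v" \<Omega> c]
    by (auto simp: Z2_def nZ2_def scaleR_fun_def distrib_left)
  show "nZ2 (v + w) \<le> nZ2 v + nZ2 w" if "v \<in> Z2" "w \<in> Z2" for v w
    using that Lp_add(2)[OF s, of "fst v" \<Omega> "fst w"] Lp_add(2)[OF s, of "snd v" \<Omega> "snd w"]
    by (auto simp: Z2_def nZ2_def plus_fun_def)
qed

lemma nZ2_eq_0_iff:
  assumes "g \<in> Z2"
  shows "nZ2 g = 0 \<longleftrightarrow> ae_eq \<Omega> (fst g) (\<lambda>x. 0) \<and> ae_eq \<Omega> (snd g) (\<lambda>x. 0)"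
  using assms Lp_norm_eq_0_iff[OF s, of "fst g" \<Omega>] Lp_norm_eq_0_iff[OF s, of "snd g" \<Omega>]
    Lp_norm_nonneg[of \<Omega> s "fst g"] Lp_norm_nonneg[of \<Omega> s "snd g"]
  by (auto simp: Z2_def nZ2_def)

lemma ae_eq2_iff_nZ2:
  assumes "g \<in> Z2" "h \<in> Z2"
  shows "ae_eq2 \<Omega> g h \<longleftrightarrow> nZ2 (g - h) = 0"
proof -
  have "g - h \<in> Z2"
    using seminormed.mem(3)[OF seminormed_Z2] assms by blast
  from nZ2_eq_0_iff[OF this] show ?thesis by (simp add: ae_eq2_def ae_eq_def)
qed

lemma ae_eq2_of_nX2:
  assumes v: "v \<in> X2" "w \<in> X2" and "nX2 (v - w) = 0"
  shows "ae_eq2 \<Omega> v w"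
proof -
  have d: "v - w \<in> X2" using seminormed.mem(3)[OF seminormed_X2] assms by blast
  have X: "X2 \<subseteq> Z2" using XX_Lp by (auto simp: X2_def Z2_def)
  have "fst (v - w) \<in> XX" "snd (v - w) \<in> XX" using d unfolding X2_def mem_Times_iff by blast+
  then have "nZ2 (v - w) \<le> nX2 (v - w)" unfolding nX2_def nZ2_def by (intro add_mono Lp_le_nX)
  moreover have "nZ2 (v - w) \<ge> 0" by (simp add: nZ2_def Lp_norm_nonneg)
  ultimately have "nZ2 (v - w) = 0" using assms by simp
  then show ?thesis using ae_eq2_iff_nZ2[of v w] v X by auto
qed

lemma sum_fun_apply: "(\<Sum>i\<in>I. h i) t = (\<Sum>i\<in>I. h i t)" for h :: "nat \<Rightarrow> 'a \<Rightarrow> real"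
  by (induction I rule: infinite_finite_induct) auto

lemma Z2_complete:
  assumes h: "\<And>n::nat. h n \<in> Z2" and le: "\<And>n. nZ2 (h n) \<le> C * (1 / 2) ^ n"
  shows "\<exists>l\<in>Z2. (\<lambda>N. nZ2 (l - (\<Sum>i<N. h i))) \<longlonglongrightarrow> 0"
proof -
  have 1: "fst (h n) \<in> Lp \<Omega> s" "snd (h n) \<in> Lp \<Omega> s" for n using h[of n] by (auto simp: Z2_def)
  have 2: "N (fst (h n)) \<le> C * (1 / 2) ^ n" "N (snd (h n)) \<le> C * (1 / 2) ^ n" for n
    using le[of n] Lp_norm_nonneg[of \<Omega> s "fst (h n)"] Lp_norm_nonneg[of \<Omega> s "snd (h n)"] unfolding nZ2_def by linarith+
  obtain l1 where l1: "l1 \<in> Lp \<Omega> s" "(\<lambda>n. N (\<lambda>x. l1 x - (\<Sum>i<n. fst (h i) x))) \<longlonglongrightarrow> 0"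
    by (rule Lp_complete[OF s 1(1) 2(1)]) (rule that)
  obtain l2 where l2: "l2 \<in> Lp \<Omega> s" "(\<lambda>n. N (\<lambda>x. l2 x - (\<Sum>i<n. snd (h i) x))) \<longlonglongrightarrow> 0"
    by (rule Lp_complete[OF s 1(2) 2(2)]) (rule that)
  have eq: "nZ2 ((l1, l2) - (\<Sum>i<n. h i)) = N (\<lambda>x. l1 x - (\<Sum>i<n. fst (h i) x)) + N (\<lambda>x. l2 x - (\<Sum>i<n. snd (h i) x))" for n
    by (simp add: nZ2_def fun_diff_def fst_sum snd_sum sum_fun_apply)
  have "(\<lambda>n. nZ2 ((l1, l2) - (\<Sum>i<n. h i))) \<longlonglongrightarrow> 0 + 0"
    unfolding eq by (intro tendsto_add l1 l2)
  moreover have "(l1, l2) \<in> Z2" using l1 l2 by (simp add: Z2_def)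
  ultimately show ?thesis by auto
qed

lemma M_in_Z2: "x \<in> X2 \<Longrightarrow> v \<in> X2 \<Longrightarrow> M x v \<in> Z2"
  using M_Lp(1,2) by (cases x; cases v) (simp add: X2_def Z2_def mem_Times_iff)

lemma F_in_Z2: "x \<in> X2 \<Longrightarrow> F x \<in> Z2"
  using F_Lp by (cases x) (simp add: X2_def Z2_def mem_Times_iff)

theorem semismooth_newton_axioms_hold:
  assumes nX_cong: "\<And>v w. v \<in> XX \<Longrightarrow> w \<in> XX \<Longrightarrow> ae_eq \<Omega> v w \<Longrightarrow> nX v = nX w"
    and sol: "AE t in L. fst (F (ys, ws)) t = 0" "AE t in L. snd (F (ys, ws)) t = 0"
    and neg: "negligible {t \<in> \<Omega>. - q ys ws t \<in> kk}"
    and inv: "\<exists>C. \<forall>g\<in>Z2. \<exists>v\<in>X2. ae_eq2 \<Omega> (M (ys, ws) v) g \<and> nX2 v \<le> C * nZ2 g \<and>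
      (\<forall>v'\<in>X2. ae_eq2 \<Omega> (M (ys, ws) v') g \<longrightarrow> ae_eq2 \<Omega> v' v)"
  shows "semismooth_newton X2 nX2 Z2 nZ2 M F (ys, ws)"
proof -
  interpret X: seminormed X2 nX2 by (rule seminormed_X2)
  interpret Z: seminormed Z2 nZ2 by (rule seminormed_Z2)
  have xs: "(ys, ws) \<in> X2" using ys ws by (simp add: X2_def)
  have near: "y \<in> XX \<and> w \<in> XX \<and> (\<lambda>t. y t - ys t) \<in> XX \<and> (\<lambda>t. w t - ws t) \<in> XX \<and>
      nX2 ((y, w) - (ys, ws)) = nX (\<lambda>t. y t - ys t) + nX (\<lambda>t. w t - ws t) \<and>
      (y, w) - (ys, ws) = (\<lambda>t. y t - ys t, \<lambda>t. w t - ws t)" if "(y, w) \<in> X2" for y w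
    using that ys ws XX_diff by (simp add: X2_def nX2_def fun_diff_def)
  show ?thesis
  proof
    show "\<exists>l\<in>Z2. (\<lambda>N. nZ2 (l - (\<Sum>i<N. h i))) \<longlonglongrightarrow> 0"
      if "\<And>n::nat. h n \<in> Z2" "\<And>n. nZ2 (h n) \<le> C * (1 / 2) ^ n" for h C
      using that by (rule Z2_complete)
    show "M x v \<in> Z2" if "x \<in> X2" "v \<in> X2" for x v using that by (rule M_in_Z2)
    show "F x \<in> Z2" if "x \<in> X2" for x using that by (rule F_in_Z2)
    show "(ys, ws) \<in> X2" by (rule xs)
    show "nZ2 (M x (v - w) - (M x v - M x w)) = 0" if "x \<in> X2" "v \<in> X2" "w \<in> X2" for x v w
    proof -
      obtain y w' a b a' b' where eq: "x = (y, w')" "v = (a, b)" "w = (a', b')" by (metis prod.collapse)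
      have X: "y \<in> XX" "w' \<in> XX" "a \<in> XX" "b \<in> XX" "a' \<in> XX" "b' \<in> XX" using that eq by (auto simp: X2_def)
      have "M x (v - w) - (M x v - M x w) \<in> Z2" using that by (intro Z.mem M_in_Z2 X.mem)
      moreover have "v - w = (\<lambda>t. a t - a' t, \<lambda>t. b t - b' t)" by (simp add: eq fun_diff_def)
      ultimately show ?thesis
        using M_diff_AE[OF X] by (simp add: nZ2_eq_0_iff ae_eq_def eq)
    qed
    show "\<exists>C. \<forall>v\<in>X2. nZ2 (M x v) \<le> C * nX2 v" if "x \<in> X2" for x
    proof -
      obtain y w where eq: "x = (y, w)" by (cases x)
      have X: "y \<in> XX" "w \<in> XX" using that eq by (auto simp: X2_def)
      show ?thesis
        by (rule exI[of _ "1 + CT * N (U y w) + CT * (Cq / \<gamma>) * m * (nX y + nX w)^2"])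
          (use M_Lp(3)[OF X] in \<open>auto simp: X2_def nZ2_def nX2_def eq\<close>)
    qed
    show "\<exists>v\<in>X2. nZ2 (M (ys, ws) v - g) = 0" if g: "g \<in> Z2" for g
    proof -
      obtain v where "v \<in> X2" "ae_eq2 \<Omega> (M (ys, ws) v) g" using inv g by blast
      then show ?thesis using ae_eq2_iff_nZ2[OF M_in_Z2[OF xs] g] by blast
    qed
    show "\<exists>C. \<forall>v\<in>X2. nX2 v \<le> C * nZ2 (M (ys, ws) v)"
    proof -
      obtain C where C: "\<forall>g\<in>Z2. \<exists>v\<in>X2. ae_eq2 \<Omega> (M (ys, ws) v) g \<and> nX2 v \<le> C * nZ2 g \<and>
        (\<forall>v'\<in>X2. ae_eq2 \<Omega> (M (ys, ws) v') g \<longrightarrow> ae_eq2 \<Omega> v' v)" using inv by blast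
      have "nX2 v \<le> C * nZ2 (M (ys, ws) v)" if v: "v \<in> X2" for v
      proof -
        have r: "ae_eq2 \<Omega> (M (ys, ws) v) (M (ys, ws) v)" by (simp add: ae_eq2_def ae_eq_refl)
        obtain v0 where v0: "v0 \<in> X2" "nX2 v0 \<le> C * nZ2 (M (ys, ws) v)" "ae_eq2 \<Omega> v v0"
          using C M_in_Z2[OF xs v] v r by meson
        then have "nX2 v = nX2 v0"
          using v nX_cong[of "fst v" "fst v0"] nX_cong[of "snd v" "snd v0"] by (auto simp: X2_def nX2_def ae_eq2_def)
        then show ?thesis using v0 by simp
      qed
      then show ?thesis by blast
    qed
    show "\<exists>\<epsilon>>0. \<forall>x\<in>X2. nX2 (x - (ys, ws)) < \<epsilon> \<longrightarrow> (\<forall>v\<in>X2. nZ2 (M x v - M (ys, ws) v) \<le> \<kappa> * nX2 v)"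
      if \<kappa>: "\<kappa> > 0" for \<kappa>
    proof -
      define A where "A = 2 * CT * ((d / \<gamma>) * P * m + Cq / \<gamma> * (m + \<rho>) * (\<rho> + 1) + Cq / \<gamma> * \<rho> * m)"
      have A: "A \<ge> 0" using CT \<gamma> Cq P_nonneg m_nonneg \<rho>_nonneg by (simp add: A_def)
      obtain \<epsilon> where \<epsilon>: "\<epsilon> > 0" "\<epsilon> \<le> 1" "\<And>E. 0 \<le> E \<Longrightarrow> E < \<epsilon> \<Longrightarrow> A * (E + \<mu> (P * E)) \<le> \<kappa>"
        using modulus_small[OF neg \<kappa> A] by blast
      have "nZ2 (M x v - M (ys, ws) v) \<le> \<kappa> * nX2 v" if x: "x \<in> X2" "nX2 (x - (ys, ws)) < \<epsilon>" and v: "v \<in> X2" for x v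
      proof -
        obtain y w a b where eq: "x = (y, w)" "v = (a, b)" by (metis prod.collapse)
        note n = near[of y w] 
        let ?E = "nX (\<lambda>t. y t - ys t) + nX (\<lambda>t. w t - ws t)"
        have yw: "y \<in> XX" "w \<in> XX" and ab: "a \<in> XX" "b \<in> XX" using x v eq by (auto simp: X2_def)
        have E: "?E < \<epsilon>" "?E \<ge> 0" using x n eq X.norm_nonneg[OF X.mem(3)[OF x(1) xs]] by auto
        have "nZ2 (M x v - M (ys, ws) v) \<le> A * (?E + \<mu> (P * ?E)) * (nX a + nX b)"
          unfolding A_def eq nZ2_def fst_diff snd_diff fun_diff_def
          by (rule M_increment[OF yw refl refl refl _ ab]) (use E \<epsilon> in simp)
        also have "\<dots> \<le> \<kappa> * (nX a + nX b)"
          using \<epsilon>(3)[OF E(2,1)] nX_nonneg[OF ab(1)] nX_nonneg[OF ab(2)] by (intro mult_right_mono) auto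
        finally show ?thesis by (simp add: nX2_def eq)
      qed
      then show ?thesis using \<epsilon>(1) by blast
    qed
    show "\<exists>\<epsilon>>0. \<forall>x\<in>X2. nX2 (x - (ys, ws)) < \<epsilon> \<longrightarrow>
        nZ2 (F x - M x (x - (ys, ws))) \<le> \<kappa> * nX2 (x - (ys, ws))"
      if \<kappa>: "\<kappa> > 0" for \<kappa>
    proof -
      define A where "A = 2 * CT * ((Cq / \<gamma> * m + (d + 1) / \<gamma> * P) * \<rho> + Cq / \<gamma> * (\<rho> + 1) * m)"
      have A: "A \<ge> 0" using CT \<gamma> Cq P_nonneg m_nonneg \<rho>_nonneg by (simp add: A_def)
      obtain \<epsilon> where \<epsilon>: "\<epsilon> > 0" "\<epsilon> \<le> 1" "\<And>E. 0 \<le> E \<Longrightarrow> E < \<epsilon> \<Longrightarrow> A * (E + \<mu> (P * E)) \<le> \<kappa>"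
        using modulus_small[OF neg \<kappa> A] by blast
      have "nZ2 (F x - M x (x - (ys, ws))) \<le> \<kappa> * nX2 (x - (ys, ws))" if x: "x \<in> X2" "nX2 (x - (ys, ws)) < \<epsilon>" for x
      proof -
        obtain y w where eq: "x = (y, w)" by (metis prod.collapse)
        note n = near[of y w] 
        let ?E = "nX (\<lambda>t. y t - ys t) + nX (\<lambda>t. w t - ws t)"
        have yw: "y \<in> XX" "w \<in> XX" using x eq by (auto simp: X2_def)
        have E: "?E < \<epsilon>" "?E \<ge> 0" using x n eq X.norm_nonneg[OF X.mem(3)[OF x(1) xs]] by auto
        have xe: "x - (ys, ws) = (\<lambda>t. y t - ys t, \<lambda>t. w t - ws t)" using n x eq by blast
        have "nZ2 (F x - M x (x - (ys, ws))) \<le> A * (?E + \<mu> (P * ?E)) * ?E"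
          unfolding A_def xe nZ2_def fst_diff snd_diff fun_diff_def unfolding eq
          by (rule F_remainder[OF yw refl refl refl _ sol]) (use E \<epsilon> in simp)
        also have "\<dots> \<le> \<kappa> * ?E"
          using \<epsilon>(3)[OF E(2,1)] E by (intro mult_right_mono) auto
        also have "?E = nX2 (x - (ys, ws))" unfolding xe by (simp add: nX2_def)
        finally show ?thesis .
      qed
      then show ?thesis using \<epsilon>(1) by blast
    qed
  qed
qed

end

section \<open>Convergence of the Newton iteration\<close>

text \<open>
  A bounded operator that is linear almost everywhere respects equality almost everywhere: it maps a
  function of norm zero to a function of norm zero.
\<close>

lemma bounded_linear_op_lincomb_AE:
  assumes \<Omega>: "open \<Omega>" and p: "p \<ge> 1"
    and T: "bounded_linear_op \<Omega> (W k \<Omega> p) (W_norm k \<Omega> p) (W l \<Omega> p) (W_norm l \<Omega> p) T"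
    and W: "v \<in> W k \<Omega> p" "w \<in> W k \<Omega> p" "z \<in> W k \<Omega> p"
    and eq: "ae_eq \<Omega> z (\<lambda>x. a * v x + c * w x)"
  shows "ae_eq \<Omega> (T z) (\<lambda>x. a * T v x + c * T w x)"
proof -
  have T_in: "\<And>v. v \<in> W k \<Omega> p \<Longrightarrow> T v \<in> W l \<Omega> p"
    and T_lin: "\<And>v w a c. v \<in> W k \<Omega> p \<Longrightarrow> w \<in> W k \<Omega> p \<Longrightarrow>
      ae_eq \<Omega> (T (\<lambda>x. a * v x + c * w x)) (\<lambda>x. a * T v x + c * T w x)"
    and T_bd: "\<exists>C. \<forall>v\<in>W k \<Omega> p. W_norm l \<Omega> p (T v) \<le> C * W_norm k \<Omega> p v"
    using T unfolding bounded_linear_op_def by blast+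
  have lin: "(\<lambda>x. a * v x + c * w x) \<in> W k \<Omega> p" if "v \<in> W k \<Omega> p" "w \<in> W k \<Omega> p" for v w a c
    using W_add[OF \<Omega> p] W_cmult[OF \<Omega> p] that by blast
  let ?s = "\<lambda>x. a * v x + c * w x"
  define e where "e = (\<lambda>x. 1 * z x + (-1) * ?s x)"
  have e: "e \<in> W k \<Omega> p" unfolding e_def by (rule lin[OF W(3) lin[OF W(1,2)]])
  have "ae_eq \<Omega> e (\<lambda>x. 0)" using eq unfolding ae_eq_def e_def by eventually_elim simp
  then have e0: "W_norm k \<Omega> p e = 0" using W_norm_eq_0_iff[OF \<Omega> p e] by simp
  obtain C where "\<forall>v\<in>W k \<Omega> p. W_norm l \<Omega> p (T v) \<le> C * W_norm k \<Omega> p v" using T_bd by blast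
  then have "W_norm l \<Omega> p (T e) \<le> 0" using e e0 by fastforce
  then have "W_norm l \<Omega> p (T e) = 0" using W_norm_nonneg[OF \<Omega> p, of l "T e"] by simp
  then have "ae_eq \<Omega> (T e) (\<lambda>x. 0)" using W_norm_eq_0_iff[OF \<Omega> p T_in[OF e]] by simp
  moreover have "ae_eq \<Omega> (T e) (\<lambda>x. 1 * T z x + (-1) * T ?s x)"
    unfolding e_def by (rule T_lin[OF W(3) lin[OF W(1,2)]])
  moreover have "ae_eq \<Omega> (T ?s) (\<lambda>x. a * T v x + c * T w x)" by (rule T_lin[OF W(1,2)])
  ultimately show ?thesis unfolding ae_eq_def by eventually_elim simp
qed

lemma bounded_linear_op_bound:
  assumes \<Omega>: "open \<Omega>" and p: "p \<ge> 1"
    and T: "bounded_linear_op \<Omega> (W k \<Omega> p) (W_norm k \<Omega> p) (W l \<Omega> p) (W_norm l \<Omega> p) T"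
  obtains C where "C \<ge> 0" "\<And>v. v \<in> W k \<Omega> p \<Longrightarrow> T v \<in> W l \<Omega> p"
    "\<And>v. v \<in> W k \<Omega> p \<Longrightarrow> W_norm l \<Omega> p (T v) \<le> C * W_norm k \<Omega> p v"
proof -
  obtain C where C: "\<forall>v\<in>W k \<Omega> p. W_norm l \<Omega> p (T v) \<le> C * W_norm k \<Omega> p v"
    using T unfolding bounded_linear_op_def by blast
  show thesis
  proof (rule that[of "max C 0"])
    show "T v \<in> W l \<Omega> p" if "v \<in> W k \<Omega> p" for v using T that unfolding bounded_linear_op_def by blast
    show "W_norm l \<Omega> p (T v) \<le> max C 0 * W_norm k \<Omega> p v" if "v \<in> W k \<Omega> p" for v
    proof -
      have "W_norm l \<Omega> p (T v) \<le> C * W_norm k \<Omega> p v" using C that by blast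
      also have "\<dots> \<le> max C 0 * W_norm k \<Omega> p v"
        by (rule mult_right_mono[OF max.cobounded1 W_norm_nonneg[OF \<Omega> p]])
      finally show ?thesis .
    qed
  qed simp
qed

text \<open>
  The bounds combine the algebra property of \<open>W\<^sup>1\<^sup>,\<^sup>s\<close> with the smoothing properties of \<open>G\<close> and of its adjoint \<open>Gs\<close>.
  Bilinearity holds almost everywhere because weak gradients and divergences are unique.
\<close>

lemma optimality_system_regularized:
  fixes \<Omega> :: "'a::euclidean_space set"
  assumes \<Omega>: "open \<Omega>" "bounded \<Omega>" and s: "s \<ge> 1" and emb: "compactly_embeds_C \<Omega> s"
    and par: "\<alpha> > 0" "\<gamma> > 0" "d \<ge> 2" "strict_mono_on {1..d} u"
    and G: "bounded_linear_op \<Omega> (Lp \<Omega> s) (Lp_norm \<Omega> s) (W 1 \<Omega> s) (W_norm 1 \<Omega> s) G"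
    and Gs: "bounded_linear_op \<Omega> (W 1 \<Omega> s) (W_norm 1 \<Omega> s) (W 1 \<Omega> s) (W_norm 1 \<Omega> s) Gs"
    and fz: "f \<in> Lp \<Omega> s" "z \<in> Lp \<Omega> s" and yw: "ys \<in> X_space \<Omega> s" "ws \<in> X_space \<Omega> s"
  obtains Cq CT where "regularized_system \<Omega> s \<alpha> \<gamma> d u (X_space \<Omega> s) (W_norm 2 \<Omega> s)
    (\<lambda>v w. Gs (\<lambda>x. wgrad \<Omega> v x \<bullet> wgrad \<Omega> w x)) (\<lambda>h v. div_coef \<Omega> (G h) v) Cq CT f z ys ws"
proof -
  have W0: "W 0 \<Omega> s = Lp \<Omega> s" "W_norm 0 \<Omega> s = Lp_norm \<Omega> s" by (auto simp: fun_eq_iff)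
  note G0 = G[folded W0]
  have XW: "v \<in> W 2 \<Omega> s" if "v \<in> X_space \<Omega> s" for v using that by (simp add: X_space_def del: W.simps)
  obtain CG where CG: "CG \<ge> 0" "\<And>v. v \<in> W 0 \<Omega> s \<Longrightarrow> G v \<in> W 1 \<Omega> s"
    "\<And>v. v \<in> W 0 \<Omega> s \<Longrightarrow> W_norm 1 \<Omega> s (G v) \<le> CG * W_norm 0 \<Omega> s v"
    by (rule bounded_linear_op_bound[OF \<Omega>(1) s G0]) (rule that)
  obtain CGs where CGs: "CGs \<ge> 0" "\<And>v. v \<in> W 1 \<Omega> s \<Longrightarrow> Gs v \<in> W 1 \<Omega> s"
    "\<And>v. v \<in> W 1 \<Omega> s \<Longrightarrow> W_norm 1 \<Omega> s (Gs v) \<le> CGs * W_norm 1 \<Omega> s v"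
    by (rule bounded_linear_op_bound[OF \<Omega>(1) s Gs]) (rule that)
  obtain Ce where Ce: "Ce \<ge> 0" "\<And>v. v \<in> W 1 \<Omega> s \<Longrightarrow> \<exists>c. continuous_on \<Omega> c \<and> ae_eq \<Omega> v c"
    "\<And>v. v \<in> W 1 \<Omega> s \<Longrightarrow> AE x in lebesgue_on \<Omega>. \<bar>v x\<bar> \<le> Ce * W_norm 1 \<Omega> s v"
    by (rule compactly_embeds_C_bound[OF emb \<Omega>(1) s]) (rule that)
  obtain Ci where Ci: "Ci \<ge> 0" "\<And>v w. v \<in> W 2 \<Omega> s \<Longrightarrow> w \<in> W 2 \<Omega> s \<Longrightarrow>
    (\<lambda>x. wgrad \<Omega> v x \<bullet> wgrad \<Omega> w x) \<in> W 1 \<Omega> s \<and>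
    W_norm 1 \<Omega> s (\<lambda>x. wgrad \<Omega> v x \<bullet> wgrad \<Omega> w x) \<le> Ci * W_norm 2 \<Omega> s v * W_norm 2 \<Omega> s w"
    by (rule inner_wgrad_W1[OF \<Omega>(1) s emb]) (rule that)
  obtain Cd where Cd: "Cd \<ge> 0"
    "\<And>a v. a \<in> W 1 \<Omega> s \<Longrightarrow> v \<in> W 2 \<Omega> s \<Longrightarrow> weak_div \<Omega> (\<lambda>x. a x *\<^sub>R wgrad \<Omega> v x) (div_coef \<Omega> a v)"
    "\<And>a v. a \<in> W 1 \<Omega> s \<Longrightarrow> v \<in> W 2 \<Omega> s \<Longrightarrow> div_coef \<Omega> a v \<in> Lp \<Omega> s"
    "\<And>a v. a \<in> W 1 \<Omega> s \<Longrightarrow> v \<in> W 2 \<Omega> s \<Longrightarrow>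
       Lp_norm \<Omega> s (div_coef \<Omega> a v) \<le> Cd * W_norm 1 \<Omega> s a * W_norm 2 \<Omega> s v"
    by (rule div_coef_Lp[OF \<Omega>(1) s emb]) (rule that)
  let ?B = "\<lambda>v w x. wgrad \<Omega> v x \<bullet> wgrad \<Omega> w x"
  let ?q = "\<lambda>v w. Gs (?B v w)" and ?T = "\<lambda>h v. div_coef \<Omega> (G h) v"
  have wg: "weak_grad \<Omega> v (wgrad \<Omega> v)" if "v \<in> X_space \<Omega> s" for v
    using W_SucD(1)[OF \<Omega>(1) s, of v 1] XW[OF that] by (simp only: numeral_2_eq_2 One_nat_def)
  note Wn = W_norm_nonneg[OF \<Omega>(1) s]
  show thesis
  proof (rule that[of "Ce * (CGs * Ci)" "Cd * CG"], unfold_locales)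
    show "open \<Omega>" "bounded \<Omega>" "1 \<le> s" "\<alpha> > 0" "\<gamma> > 0" "d \<ge> 2" "strict_mono_on {1..d} u"
      "f \<in> Lp \<Omega> s" "z \<in> Lp \<Omega> s" "ys \<in> X_space \<Omega> s" "ws \<in> X_space \<Omega> s"
      by (fact \<Omega> s par fz yw)+
    show "(\<lambda>t. a * v t + c * w t) \<in> X_space \<Omega> s" if "v \<in> X_space \<Omega> s" "w \<in> X_space \<Omega> s" for v w a c
      by (rule X_space_lincomb[OF \<Omega>(1) s that])
    show "W_norm 2 \<Omega> s (\<lambda>t. a * v t) = \<bar>a\<bar> * W_norm 2 \<Omega> s v" if "v \<in> X_space \<Omega> s" for v a
      using W_cmult[OF \<Omega>(1) s XW[OF that]] by blast
    show "W_norm 2 \<Omega> s (\<lambda>t. v t + w t) \<le> W_norm 2 \<Omega> s v + W_norm 2 \<Omega> s w"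
      if "v \<in> X_space \<Omega> s" "w \<in> X_space \<Omega> s" for v w
      using W_add[OF \<Omega>(1) s XW[OF that(1)] XW[OF that(2)]] by blast
    show "v \<in> Lp \<Omega> s" if "v \<in> X_space \<Omega> s" for v by (rule W_imp_Lp[OF \<Omega>(1) s XW[OF that]])
    show "Lp_norm \<Omega> s v \<le> W_norm 2 \<Omega> s v" for v by (rule Lp_norm_le_W_norm[OF \<Omega>(1) s])
    show "0 \<le> Ce * (CGs * Ci)" "0 \<le> Cd * CG" using Ce(1) CGs(1) Ci(1) Cd(1) CG(1) by simp_all
    show "?q v w \<in> borel_measurable (lebesgue_on \<Omega>)" if "v \<in> X_space \<Omega> s" "w \<in> X_space \<Omega> s" for v w
      by (rule Lp_measurable[OF W_imp_Lp[OF \<Omega>(1) s CGs(2)[OF conjunct1[OF Ci(2)[OF XW[OF that(1)] XW[OF that(2)]]]]]])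
    show "AE t in lebesgue_on \<Omega>. \<bar>?q v w t\<bar> \<le> Ce * (CGs * Ci) * W_norm 2 \<Omega> s v * W_norm 2 \<Omega> s w"
      if "v \<in> X_space \<Omega> s" "w \<in> X_space \<Omega> s" for v w
    proof -
      note i = Ci(2)[OF XW[OF that(1)] XW[OF that(2)]]
      have "Ce * W_norm 1 \<Omega> s (?q v w) \<le> Ce * (CGs * (Ci * W_norm 2 \<Omega> s v * W_norm 2 \<Omega> s w))"
        by (intro mult_left_mono Ce(1) order_trans[OF CGs(3)[OF conjunct1[OF i]]] CGs(1) conjunct2[OF i])
      then have le: "Ce * W_norm 1 \<Omega> s (?q v w) \<le> Ce * (CGs * Ci) * W_norm 2 \<Omega> s v * W_norm 2 \<Omega> s w"
        by (simp only: mult.assoc)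
      from Ce(3)[OF CGs(2)[OF conjunct1[OF i]]] show ?thesis
        by eventually_elim (rule order_trans[OF _ le])
    qed
    show "AE t in lebesgue_on \<Omega>. ?q (\<lambda>t. a * v1 t + c * v2 t) w t = a * ?q v1 w t + c * ?q v2 w t"
      if X: "v1 \<in> X_space \<Omega> s" "v2 \<in> X_space \<Omega> s" "w \<in> X_space \<Omega> s" for v1 v2 w a c
    proof -
      let ?v = "\<lambda>t. a * v1 t + c * v2 t"
      have v: "?v \<in> X_space \<Omega> s" by (rule X_space_lincomb[OF \<Omega>(1) s X(1,2)])
      have "ae_eq \<Omega> (?B ?v w) (\<lambda>x. a * ?B v1 w x + c * ?B v2 w x)"
        unfolding ae_eq_def using wgrad_lincomb_AE[OF \<Omega>(1) wg[OF X(1)] wg[OF X(2)] ae_eq_refl, of a c]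
        by eventually_elim (simp add: inner_add_left)
      from bounded_linear_op_lincomb_AE[OF \<Omega>(1) s Gs conjunct1[OF Ci(2)[OF XW[OF X(1)] XW[OF X(3)]]]
          conjunct1[OF Ci(2)[OF XW[OF X(2)] XW[OF X(3)]]] conjunct1[OF Ci(2)[OF XW[OF v] XW[OF X(3)]]] this]
      show ?thesis by (simp only: ae_eq_def)
    qed
    show "?q v w = ?q w v" for v w by (simp only: inner_commute)
    show "?T h v \<in> Lp \<Omega> s" if "h \<in> Lp \<Omega> s" "v \<in> X_space \<Omega> s" for h v
      using that by (intro Cd(3) CG(2) XW) (simp_all add: W0)
    show "Lp_norm \<Omega> s (?T h v) \<le> Cd * CG * Lp_norm \<Omega> s h * W_norm 2 \<Omega> s v"
      if "h \<in> Lp \<Omega> s" "v \<in> X_space \<Omega> s" for h v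
    proof -
      have h: "h \<in> W 0 \<Omega> s" using that by (simp add: W0)
      have "Lp_norm \<Omega> s (?T h v) \<le> Cd * W_norm 1 \<Omega> s (G h) * W_norm 2 \<Omega> s v" by (rule Cd(4)[OF CG(2)[OF h] XW[OF that(2)]])
      also have "\<dots> \<le> Cd * (CG * Lp_norm \<Omega> s h) * W_norm 2 \<Omega> s v"
        using CG(3)[OF h, unfolded W0] Cd(1) by (intro mult_right_mono mult_left_mono Wn)
      finally show ?thesis by (simp only: mult.assoc)
    qed
    show "AE t in lebesgue_on \<Omega>. ?T h v t = a * ?T h1 v t + c * ?T h2 v t"
      if h: "h1 \<in> Lp \<Omega> s" "h2 \<in> Lp \<Omega> s" "h \<in> Lp \<Omega> s" and v: "v \<in> X_space \<Omega> s"
        and eq: "AE t in lebesgue_on \<Omega>. h t = a * h1 t + c * h2 t" for h h1 h2 v a c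
    proof -
      note h' = h[folded W0]
      have "ae_eq \<Omega> (G h) (\<lambda>x. a * G h1 x + c * G h2 x)"
        using bounded_linear_op_lincomb_AE[OF \<Omega>(1) s G0 h'] eq by (simp only: ae_eq_def)
      then have "AE x in lebesgue_on \<Omega>. G h x *\<^sub>R wgrad \<Omega> v x = a *\<^sub>R (G h1 x *\<^sub>R wgrad \<Omega> v x) + c *\<^sub>R (G h2 x *\<^sub>R wgrad \<Omega> v x)"
        unfolding ae_eq_def by eventually_elim (simp add: scaleR_add_left)
      from weak_div_lincomb[OF \<Omega>(1) Cd(2)[OF CG(2)[OF h'(1)] XW[OF v]] Cd(2)[OF CG(2)[OF h'(2)] XW[OF v]] this]
      have "ae_eq \<Omega> (?T h v) (\<lambda>x. a * ?T h1 v x + c * ?T h2 v x)"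
        by (rule weak_div_unique[OF \<Omega>(1) Cd(2)[OF CG(2)[OF h'(3)] XW[OF v]]])
      then show ?thesis by (simp only: ae_eq_def)
    qed
    show "AE t in lebesgue_on \<Omega>. ?T h (\<lambda>t. a * v1 t + c * v2 t) t = a * ?T h v1 t + c * ?T h v2 t"
      if h: "h \<in> Lp \<Omega> s" and v: "v1 \<in> X_space \<Omega> s" "v2 \<in> X_space \<Omega> s" for h v1 v2 a c
    proof -
      let ?v = "\<lambda>t. a * v1 t + c * v2 t"
      have vX: "?v \<in> X_space \<Omega> s" by (rule X_space_lincomb[OF \<Omega>(1) s v])
      have Gh: "G h \<in> W 1 \<Omega> s" using CG(2)[unfolded W0, OF h] .
      have "AE x in lebesgue_on \<Omega>. G h x *\<^sub>R wgrad \<Omega> ?v x = a *\<^sub>R (G h x *\<^sub>R wgrad \<Omega> v1 x) + c *\<^sub>R (G h x *\<^sub>R wgrad \<Omega> v2 x)"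
        using wgrad_lincomb_AE[OF \<Omega>(1) wg[OF v(1)] wg[OF v(2)] ae_eq_refl, of a c]
        by eventually_elim (simp add: scaleR_add_right mult.commute)
      from weak_div_lincomb[OF \<Omega>(1) Cd(2)[OF Gh XW[OF v(1)]] Cd(2)[OF Gh XW[OF v(2)]] this]
      have "ae_eq \<Omega> (?T h ?v) (\<lambda>x. a * ?T h v1 x + c * ?T h v2 x)"
        by (rule weak_div_unique[OF \<Omega>(1) Cd(2)[OF Gh XW[OF vX]]])
      then show ?thesis by (simp only: ae_eq_def)
    qed
  qed
qed

theorem theorem4p6:
  fixes \<Omega> :: "'a::euclidean_space set"
    and s \<alpha> \<gamma> :: real and d :: nat and u :: "nat \<Rightarrow> real"
    and f z :: "'a \<Rightarrow> real"
    and G Gs :: "('a \<Rightarrow> real) \<Rightarrow> ('a \<Rightarrow> real)"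
    and y\<^sub>\<gamma> w\<^sub>\<gamma> :: "'a \<Rightarrow> real"
  assumes "DIM('a) \<le> 3" and "real DIM('a) < s" and "2 \<le> s"
    and "open \<Omega>" and "connected \<Omega>" and "\<Omega> \<noteq> {}" and "bounded \<Omega>"
    and "compactly_embeds_C \<Omega> s"
    and "f \<in> Lp \<Omega> s" and "z \<in> Lp \<Omega> s"
    and "\<alpha> > 0" and "d \<ge> 2" and "strict_mono_on {1..d} u"
    and "bounded_linear_op \<Omega> (Lp \<Omega> 2) (Lp_norm \<Omega> 2) (Lp \<Omega> 2) (Lp_norm \<Omega> 2) G"
    and "bounded_linear_op \<Omega> (Lp \<Omega> s) (Lp_norm \<Omega> s) (W 1 \<Omega> s) (W_norm 1 \<Omega> s) G"
    and "L2_adjoint \<Omega> G Gs"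
    and "bounded_linear_op \<Omega> (W 1 \<Omega> s) (W_norm 1 \<Omega> s) (W 1 \<Omega> s) (W_norm 1 \<Omega> s) Gs"
    and "\<And>M. M \<ge> u 1 \<Longrightarrow> G ` U_set \<Omega> u M \<subseteq> U_set \<Omega> u M"
    and "elliptic_regularity \<Omega> s G u"
    and "\<gamma> > 0"
    and "y\<^sub>\<gamma> \<in> X_space \<Omega> s" and "w\<^sub>\<gamma> \<in> X_space \<Omega> s"
    and "ae_eq \<Omega> (\<lambda>x. - div_coef \<Omega> (G (u_of \<Omega> Gs \<alpha> \<gamma> d u (y\<^sub>\<gamma>, w\<^sub>\<gamma>))) w\<^sub>\<gamma> x + y\<^sub>\<gamma> x) z"
    and "ae_eq \<Omega> (\<lambda>x. - div_coef \<Omega> (G (u_of \<Omega> Gs \<alpha> \<gamma> d u (y\<^sub>\<gamma>, w\<^sub>\<gamma>))) y\<^sub>\<gamma> x) f"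
    and "negligible (\<Union>i\<in>{1..<d}. {x \<in> \<Omega>. p_of \<Omega> Gs (y\<^sub>\<gamma>, w\<^sub>\<gamma>) x \<in> frontier (Q_pair \<alpha> \<gamma> u i)})"
    and "cont_invertible \<Omega> s (M_op \<Omega> G Gs \<alpha> \<gamma> d u (y\<^sub>\<gamma>, w\<^sub>\<gamma>))"
  shows "\<exists>\<epsilon>>0. \<forall>y0\<in>X_space \<Omega> s. \<forall>w0\<in>X_space \<Omega> s.
           X2_dist \<Omega> s (y0, w0) (y\<^sub>\<gamma>, w\<^sub>\<gamma>) < \<epsilon> \<longrightarrow>
             (\<exists>P. newton_iteration \<Omega> s G Gs \<alpha> \<gamma> d u f z (y0, w0) P) \<and>
             (\<forall>P. newton_iteration \<Omega> s G Gs \<alpha> \<gamma> d u f z (y0, w0) P \<longrightarrow>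
                (\<forall>k \<delta> \<delta>'. newton_step \<Omega> s G Gs \<alpha> \<gamma> d u f z (P k) \<delta> \<longrightarrow>
                   newton_step \<Omega> s G Gs \<alpha> \<gamma> d u f z (P k) \<delta>' \<longrightarrow> ae_eq2 \<Omega> \<delta> \<delta>') \<and>
                converges_superlinearly \<Omega> s P (y\<^sub>\<gamma>, w\<^sub>\<gamma>))"
proof -
  have s: "s \<ge> 1" using assms(3) by simp
  have \<Omega>: "open \<Omega>" "bounded \<Omega>" by (fact assms)+
  obtain Cq CT where rs: "regularized_system \<Omega> s \<alpha> \<gamma> d u (X_space \<Omega> s) (W_norm 2 \<Omega> s)
    (\<lambda>v w. Gs (\<lambda>x. wgrad \<Omega> v x \<bullet> wgrad \<Omega> w x)) (\<lambda>h v. div_coef \<Omega> (G h) v) Cq CT f z y\<^sub>\<gamma> w\<^sub>\<gamma>"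
    by (rule optimality_system_regularized[OF \<Omega> s assms(8,11,20,12,13,15,17,9,10,21,22)]) (rule that)
  interpret R: regularized_system \<Omega> s \<alpha> \<gamma> d u "X_space \<Omega> s" "W_norm 2 \<Omega> s"
    "\<lambda>v w. Gs (\<lambda>x. wgrad \<Omega> v x \<bullet> wgrad \<Omega> w x)" "\<lambda>h v. div_coef \<Omega> (G h) v" Cq CT f z y\<^sub>\<gamma> w\<^sub>\<gamma>
    by (rule rs)
  have U: "u_of \<Omega> Gs \<alpha> \<gamma> d u (y, w) = R.U y w" for y w
    by (simp add: u_of_def R.U_def p_of_def)
  have slope: "1 / \<gamma> * chi_reg \<alpha> \<gamma> d u (p_of \<Omega> Gs (y, w)) x = R.slope y w x" for y w x
    by (simp add: R.slope_def chi_reg_active p_of_def)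
  have A: "A_op \<Omega> G Gs \<alpha> \<gamma> d u (y, w) v1 v2 v3 =
      div_coef \<Omega> (G (\<lambda>x. R.slope y w x * Gs (\<lambda>x. wgrad \<Omega> v1 x \<bullet> wgrad \<Omega> v2 x) x)) v3" for y w v1 v2 v3
    unfolding A_op_def slope ..
  have M: "M_op \<Omega> G Gs \<alpha> \<gamma> d u = R.M"
    by (simp add: fun_eq_iff M_op_def R.M_def Let_def A U)
  have F: "residual \<Omega> G Gs \<alpha> \<gamma> d u f z = R.F"
    by (simp add: fun_eq_iff residual_def R.F_def Let_def U)
  have X2: "X_space \<Omega> s \<times> X_space \<Omega> s = R.X2" by (simp add: R.X2_def)
  have Z2: "Lp \<Omega> s \<times> Lp \<Omega> s = R.Z2" by (simp add: R.Z2_def)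
  have nX2: "X2_norm \<Omega> s = R.nX2" by (simp add: fun_eq_iff X2_norm_def R.nX2_def)
  have nZ2: "Ls2_norm \<Omega> s = R.nZ2" by (simp add: fun_eq_iff Ls2_norm_def R.nZ2_def)
  have dist: "X2_dist \<Omega> s v v' = R.nX2 (v - v')" for v v'
    by (simp add: X2_dist_def nX2 fun_diff_def minus_prod_def)
  interpret S: semismooth_newton R.X2 R.nX2 R.Z2 R.nZ2 R.M R.F "(y\<^sub>\<gamma>, w\<^sub>\<gamma>)"
  proof (rule R.semismooth_newton_axioms_hold)
    show "W_norm 2 \<Omega> s v = W_norm 2 \<Omega> s w" if "v \<in> X_space \<Omega> s" "w \<in> X_space \<Omega> s" "ae_eq \<Omega> v w" for v w
    proof -
      have "v \<in> W 2 \<Omega> s" using that by (simp add: X_space_def del: W.simps)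
      then show ?thesis using W_cong_AE(2)[OF \<Omega>(1) s _ that(3)] by metis
    qed
    show "AE t in lebesgue_on \<Omega>. fst (R.F (y\<^sub>\<gamma>, w\<^sub>\<gamma>)) t = 0"
      using assms(23) unfolding ae_eq_def U by eventually_elim (simp add: R.F_def)
    show "AE t in lebesgue_on \<Omega>. snd (R.F (y\<^sub>\<gamma>, w\<^sub>\<gamma>)) t = 0"
      using assms(24) unfolding ae_eq_def U by eventually_elim (simp add: R.F_def)
    have "(\<Union>i\<in>{1..<d}. {x \<in> \<Omega>. p_of \<Omega> Gs (y\<^sub>\<gamma>, w\<^sub>\<gamma>) x \<in> frontier (Q_pair \<alpha> \<gamma> u i)}) =
        {t \<in> \<Omega>. - Gs (\<lambda>x. wgrad \<Omega> y\<^sub>\<gamma> x \<bullet> wgrad \<Omega> w\<^sub>\<gamma> x) t \<in> kinks \<alpha> \<gamma> d u}"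
      by (auto simp: kinks_def p_of_def)
    then show "negligible {t \<in> \<Omega>. - Gs (\<lambda>x. wgrad \<Omega> y\<^sub>\<gamma> x \<bullet> wgrad \<Omega> w\<^sub>\<gamma> x) t \<in> kinks \<alpha> \<gamma> d u}"
      using assms(25) by simp
    show "\<exists>C. \<forall>g\<in>R.Z2. \<exists>v\<in>R.X2. ae_eq2 \<Omega> (R.M (y\<^sub>\<gamma>, w\<^sub>\<gamma>) v) g \<and> R.nX2 v \<le> C * R.nZ2 g \<and>
      (\<forall>v'\<in>R.X2. ae_eq2 \<Omega> (R.M (y\<^sub>\<gamma>, w\<^sub>\<gamma>) v') g \<longrightarrow> ae_eq2 \<Omega> v' v)"
      using assms(26) unfolding cont_invertible_def M X2 Z2 nX2 nZ2 by (rule conjunct2)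
  qed
  have step: "newton_step \<Omega> s G Gs \<alpha> \<gamma> d u f z x \<delta> \<longleftrightarrow> S.step x \<delta>" if x: "x \<in> R.X2" for x \<delta>
  proof -
    have "ae_eq2 \<Omega> (R.M x \<delta>) (- R.F x) \<longleftrightarrow> R.nZ2 (R.M x \<delta> + R.F x) = 0" if \<delta>: "\<delta> \<in> R.X2"
      using R.ae_eq2_iff_nZ2[OF R.M_in_Z2[OF x \<delta>] S.Z.mem(4)[OF R.F_in_Z2[OF x]]]
      by (simp only: diff_minus_eq_add)
    moreover have "(\<lambda>t. - fst (R.F x) t, \<lambda>t. - snd (R.F x) t) = - R.F x"
      by (simp only: uminus_prod_def fun_Compl_def)
    then have "newton_step \<Omega> s G Gs \<alpha> \<gamma> d u f z x \<delta> \<longleftrightarrow> \<delta> \<in> R.X2 \<and> ae_eq2 \<Omega> (R.M x \<delta>) (- R.F x)"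
      by (simp only: newton_step_def M F X2)
    ultimately show ?thesis unfolding S.step_def by blast
  qed
  have iter: "newton_iteration \<Omega> s G Gs \<alpha> \<gamma> d u f z x0 P \<longleftrightarrow>
      P 0 = x0 \<and> (\<forall>k. \<exists>\<delta>. S.step (P k) \<delta> \<and> P (Suc k) = P k + \<delta>)" if x0: "x0 \<in> R.X2" for x0 P
  proof -
    have eq: "newton_iteration \<Omega> s G Gs \<alpha> \<gamma> d u f z x0 P \<longleftrightarrow>
      P 0 = x0 \<and> (\<forall>k. \<exists>\<delta>. newton_step \<Omega> s G Gs \<alpha> \<gamma> d u f z (P k) \<delta> \<and> P (Suc k) = P k + \<delta>)"
      by (simp add: newton_iteration_def plus_prod_def plus_fun_def)
    have in1: "P k \<in> R.X2" if P0: "P 0 = x0" and st: "\<forall>k. \<exists>\<delta>. newton_step \<Omega> s G Gs \<alpha> \<gamma> d u f z (P k) \<delta> \<and> P (Suc k) = P k + \<delta>" for k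
    proof (induction k)
      case (Suc k)
      obtain \<delta> where "newton_step \<Omega> s G Gs \<alpha> \<gamma> d u f z (P k) \<delta>" "P (Suc k) = P k + \<delta>" using st by blast
      then show ?case using Suc S.X.mem(2) by (simp add: newton_step_def X2)
    qed (use P0 x0 in simp)
    have in2: "P k \<in> R.X2" if P0: "P 0 = x0" and st: "\<forall>k. \<exists>\<delta>. S.step (P k) \<delta> \<and> P (Suc k) = P k + \<delta>" for k
    proof (induction k)
      case (Suc k)
      obtain \<delta> where "S.step (P k) \<delta>" "P (Suc k) = P k + \<delta>" using st by blast
      then show ?case using Suc S.X.mem(2) by (simp add: S.step_def)
    qed (use P0 x0 in simp)
    show ?thesis
    proof
      assume "newton_iteration \<Omega> s G Gs \<alpha> \<gamma> d u f z x0 P"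
      note P = this[unfolded eq]
      show "P 0 = x0 \<and> (\<forall>k. \<exists>\<delta>. S.step (P k) \<delta> \<and> P (Suc k) = P k + \<delta>)"
        using P unfolding step[OF in1[OF conjunct1[OF P] conjunct2[OF P]]] .
    next
      assume P: "P 0 = x0 \<and> (\<forall>k. \<exists>\<delta>. S.step (P k) \<delta> \<and> P (Suc k) = P k + \<delta>)"
      then show "newton_iteration \<Omega> s G Gs \<alpha> \<gamma> d u f z x0 P"
        unfolding eq step[OF in2[OF conjunct1[OF P] conjunct2[OF P]]] .
    qed
  qed
  obtain \<epsilon> where conv: "\<epsilon> > 0 \<and> (\<forall>x0\<in>R.X2. R.nX2 (x0 - (y\<^sub>\<gamma>, w\<^sub>\<gamma>)) < \<epsilon> \<longrightarrow>
     (\<exists>P. P 0 = x0 \<and> (\<forall>k. \<exists>\<delta>. S.step (P k) \<delta> \<and> P (Suc k) = P k + \<delta>)) \<and>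
     (\<forall>P. P 0 = x0 \<longrightarrow> (\<forall>k. \<exists>\<delta>. S.step (P k) \<delta> \<and> P (Suc k) = P k + \<delta>) \<longrightarrow>
        (\<forall>k. P k \<in> R.X2) \<and>
        (\<forall>k \<delta> \<delta>'. S.step (P k) \<delta> \<longrightarrow> S.step (P k) \<delta>' \<longrightarrow> R.nX2 (\<delta> - \<delta>') = 0) \<and>
        (\<lambda>k. R.nX2 (P k - (y\<^sub>\<gamma>, w\<^sub>\<gamma>))) \<longlonglongrightarrow> 0 \<and>
        (\<lambda>k. R.nX2 (P (Suc k) - (y\<^sub>\<gamma>, w\<^sub>\<gamma>))) \<in> o(\<lambda>k. R.nX2 (P k - (y\<^sub>\<gamma>, w\<^sub>\<gamma>)))))"
    by (rule exE[OF S.superlinear_convergence]) (rule that)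
  show ?thesis
  proof (intro exI[of _ \<epsilon>] conjI ballI impI)
    show "\<epsilon> > 0" using conv by (rule conjunct1)
  next
    fix y0 w0 assume yw: "y0 \<in> X_space \<Omega> s" "w0 \<in> X_space \<Omega> s" "X2_dist \<Omega> s (y0, w0) (y\<^sub>\<gamma>, w\<^sub>\<gamma>) < \<epsilon>"
    have x0: "(y0, w0) \<in> R.X2" using yw by (simp add: R.X2_def)
    note c = mp[OF bspec[OF conjunct2[OF conv] x0] yw(3)[unfolded dist]]
    show "\<exists>P. newton_iteration \<Omega> s G Gs \<alpha> \<gamma> d u f z (y0, w0) P"
      unfolding iter[OF x0] using c by (rule conjunct1)
    show "\<forall>P. newton_iteration \<Omega> s G Gs \<alpha> \<gamma> d u f z (y0, w0) P \<longrightarrow>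
                (\<forall>k \<delta> \<delta>'. newton_step \<Omega> s G Gs \<alpha> \<gamma> d u f z (P k) \<delta> \<longrightarrow>
                   newton_step \<Omega> s G Gs \<alpha> \<gamma> d u f z (P k) \<delta>' \<longrightarrow> ae_eq2 \<Omega> \<delta> \<delta>') \<and>
                converges_superlinearly \<Omega> s P (y\<^sub>\<gamma>, w\<^sub>\<gamma>)"
    proof (intro allI impI)
      fix P assume "newton_iteration \<Omega> s G Gs \<alpha> \<gamma> d u f z (y0, w0) P"
      then have P: "P 0 = (y0, w0)" "\<forall>k. \<exists>\<delta>. S.step (P k) \<delta> \<and> P (Suc k) = P k + \<delta>"
        unfolding iter[OF x0] by blast+
      note c' = mp[OF mp[OF spec[OF conjunct2[OF c], of P] P(1)] P(2)]
      show "(\<forall>k \<delta> \<delta>'. newton_step \<Omega> s G Gs \<alpha> \<gamma> d u f z (P k) \<delta> \<longrightarrow>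
                   newton_step \<Omega> s G Gs \<alpha> \<gamma> d u f z (P k) \<delta>' \<longrightarrow> ae_eq2 \<Omega> \<delta> \<delta>') \<and>
                converges_superlinearly \<Omega> s P (y\<^sub>\<gamma>, w\<^sub>\<gamma>)"
      proof (intro conjI allI impI)
        fix k \<delta> \<delta>' assume "newton_step \<Omega> s G Gs \<alpha> \<gamma> d u f z (P k) \<delta>" "newton_step \<Omega> s G Gs \<alpha> \<gamma> d u f z (P k) \<delta>'"
        then have st: "S.step (P k) \<delta>" "S.step (P k) \<delta>'"
          unfolding step[OF spec[OF conjunct1[OF c']]] by this+
        then have "R.nX2 (\<delta> - \<delta>') = 0" using c' by blast
        then show "ae_eq2 \<Omega> \<delta> \<delta>'" using st by (intro R.ae_eq2_of_nX2) (simp_all add: S.step_def)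
      next
        show "converges_superlinearly \<Omega> s P (y\<^sub>\<gamma>, w\<^sub>\<gamma>)"
          unfolding converges_superlinearly_def dist using c' by blast
      qed
    qed
  qed
qed

end
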